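(* Let $l_0,l_1\in\mathbb{Z}_{\geq 1}$, $l_2,l_3\in\mathbb{Z}_{\geq 0}$. (i) Let $E_0$ satisfy $\Lambda(x+1,E_0)=\Lambda(x,E_0)$, and let $E_*$ satisfy $Q(E_* )\neq 0$ and $$\int_{E_0}^{E_*}\frac{Q_1(E)}{\sqrt{-Q(E)}}dE\in 2(l_0+l_1)\pi\sqrt{-1}+4\pi\sqrt{-1}\,\mathbb{Z}.$$ Then $\Lambda^{\mathrm{sym}}(x,E_* )\in\mathbf{D}$ and $\Lambda^{\mathrm{sym}}(x,E_* )\neq 0$. (ii) If $|p_*|<1$ and $E_*$ satisfies $Q_1(E_* )\neq 0$, $Q(E_* )\neq 0$, and there is a nonzero $f\in\mathbf{D}$ with $(H-E_* )f=0$ at $p=p_*$, then the eigenvalue $E_*$ continues analytically (as an eigenvalue of $H$ on $\mathbf{D}$) to a neighbourhood of $p=p_*$ and is holomorphic at $p=p_*$.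
   Context: $p=\exp(\pi\sqrt{-1}\tau)$, $\mathrm{Im}\,\tau>0$. $\wp$ is the Weierstrass $\wp$-function with periods $1,\tau$; $\omega_0=0,\omega_1=1/2,\omega_2=-(\tau+1)/2,\omega_3=\tau/2$; $u(x)=\sum_{i=0}^3 l_i(l_i+1)\wp(x+\omega_i)$, $H=-d^2/dx^2+u$. $\Xi(x,E)$ is the nonzero doubly periodic (periods $1,\tau$) solution of $h'''-4(u-E)h'-2u'h=0$ of the form $c_0(E)+\sum_i\sum_{j=0}^{l_i-1}b^{(i)}_j(E)\wp(x+\omega_i)^{l_i-j}$ with polynomial coefficients in $E$ without common divisor, $c_0$ monic of degree $g$, $\deg b^{(i)}_j<g$; $Q(E):=\Xi^2(E-u)+\frac12\Xi\partial_x^2\Xi-\frac14(\partial_x\Xi)^2$ (independent of $x$); $Q_1(E)=\int_{\varepsilon}^{1+\varepsilon}\Xi(x,E)dx$ with $\varepsilon$ chosen so the path avoids poles. $\Lambda(x,E)=\sqrt{\Xi(x,E)}\exp\int^x\frac{\sqrt{-Q(E)}}{\Xi(y,E)}dy$ solves $(H-E)\Lambda=0$; $\Lambda^{\mathrm{sym}}(x,E)=\Lambda(x,E)-(-1)^{l_0}\Lambda(-x,E)$. $\Phi(x)=(\sin\pi x)^{l_0+1}(\cos\pi x)^{l_1+1}$; $\mathbf{D}$ is the space of $f:\mathbb{R}\to\mathbb{C}$ with $f/\Phi$ holomorphic on $\mathbb{R}$, $f(x)=(-1)^{l_0+l_1}f(x+1)$, $f(x)=(-1)^{l_0+1}f(-x)$.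 *)

theory Defs
  imports "HOL-Complex_Analysis.Complex_Analysis" "HOL-Computational_Algebra.Polynomial"
begin

definition lattice :: "complex \<Rightarrow> complex set" where
  "lattice \<tau> = {of_int m + of_int n * \<tau> | m n. True}"

definition wp :: "complex \<Rightarrow> complex \<Rightarrow> complex" where
  "wp \<tau> z = 1 / z^2 + infsum (\<lambda>w. 1 / (z - w)^2 - 1 / w^2) (lattice \<tau> - {0})"

definition omega :: "complex \<Rightarrow> nat \<Rightarrow> complex" where
  "omega \<tau> i = (if i = 0 then 0 else if i = 1 then 1/2
                 else if i = 2 then - (\<tau> + 1) / 2 else \<tau> / 2)"

definition pot :: "complex \<Rightarrow> (nat \<Rightarrow> nat) \<Rightarrow> complex \<Rightarrow> complex" where
  "pot \<tau> l x = (\<Sum>i<4. of_nat (l i * (l i + 1)) * wp \<tau> (x + omega \<tau> i))"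

definition poles :: "complex \<Rightarrow> (nat \<Rightarrow> nat) \<Rightarrow> complex set" where
  "poles \<tau> l = {x. \<exists>i<4. l i > 0 \<and> x + omega \<tau> i \<in> lattice \<tau>}"

definition XiF :: "complex \<Rightarrow> (nat \<Rightarrow> nat) \<Rightarrow> complex poly \<Rightarrow> (nat \<Rightarrow> nat \<Rightarrow> complex poly)
                   \<Rightarrow> complex \<Rightarrow> complex \<Rightarrow> complex" where
  "XiF \<tau> l c0 b x E = poly c0 E +
     (\<Sum>i<4. \<Sum>j<l i. poly (b i j) E * wp \<tau> (x + omega \<tau> i) ^ (l i - j))"

definition Xi_ok :: "complex \<Rightarrow> (nat \<Rightarrow> nat) \<Rightarrow> complex poly \<Rightarrow> (nat \<Rightarrow> nat \<Rightarrow> complex poly) \<Rightarrow> bool" where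
  "Xi_ok \<tau> l c0 b \<longleftrightarrow>
     lead_coeff c0 = 1 \<and>
     (\<forall>i<4. \<forall>j<l i. b i j = 0 \<or> degree (b i j) < degree c0) \<and>
     (\<forall>d. d dvd c0 \<and> (\<forall>i<4. \<forall>j<l i. d dvd b i j) \<longrightarrow> degree d = 0) \<and>
     (\<forall>E x. x \<notin> poles \<tau> l \<longrightarrow>
        (let h = (\<lambda>y. XiF \<tau> l c0 b y E) in
          (deriv ^^ 3) h x - 4 * (pot \<tau> l x - E) * deriv h x - 2 * deriv (pot \<tau> l) x * h x = 0))"

text \<open>Xi(x,E): the (unique) normalized doubly periodic solution.\<close>
definition Xi :: "complex \<Rightarrow> (nat \<Rightarrow> nat) \<Rightarrow> complex \<Rightarrow> complex \<Rightarrow> complex" where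
  "Xi \<tau> l x E = (let cb = (SOME cb. Xi_ok \<tau> l (fst cb) (snd cb)) in XiF \<tau> l (fst cb) (snd cb) x E)"

text \<open>Q(E), evaluated at the base point x0 = 1/4 + tau/4 (not a pole; Q is independent of x).\<close>
definition Qf :: "complex \<Rightarrow> (nat \<Rightarrow> nat) \<Rightarrow> complex \<Rightarrow> complex" where
  "Qf \<tau> l E = (let h = (\<lambda>y. Xi \<tau> l y E); x0 = 1/4 + \<tau>/4 in
      (h x0)^2 * (E - pot \<tau> l x0) + 1/2 * h x0 * (deriv ^^ 2) h x0 - 1/4 * (deriv h x0)^2)"

definition Q1 :: "complex \<Rightarrow> (nat \<Rightarrow> nat) \<Rightarrow> complex \<Rightarrow> complex" where
  "Q1 \<tau> l E = contour_integral (linepath (\<tau>/4) (1 + \<tau>/4)) (\<lambda>y. Xi \<tau> l y E)"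

text \<open>Lam is a branch of Lambda(.,E) = sqrt(Xi) exp(int s/Xi) with s^2 = -Q(E):
  a nonzero holomorphic function off the poles of u with logarithmic derivative Xi'/(2Xi) + s/Xi.\<close>
definition Lam_spec :: "complex \<Rightarrow> (nat \<Rightarrow> nat) \<Rightarrow> complex \<Rightarrow> complex \<Rightarrow> (complex \<Rightarrow> complex) \<Rightarrow> bool" where
  "Lam_spec \<tau> l E s Lam \<longleftrightarrow>
     Lam holomorphic_on (- poles \<tau> l) \<and> (\<exists>x\<in>- poles \<tau> l. Lam x \<noteq> 0) \<and>
     (\<forall>x\<in>- poles \<tau> l. 2 * Xi \<tau> l x E * deriv Lam x = (deriv (\<lambda>y. Xi \<tau> l y E) x + 2 * s) * Lam x)"

definition Phi :: "(nat \<Rightarrow> nat) \<Rightarrow> real \<Rightarrow> complex" where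
  "Phi l x = complex_of_real (sin (pi * x) ^ (l 0 + 1) * cos (pi * x) ^ (l 1 + 1))"

definition Dsp :: "(nat \<Rightarrow> nat) \<Rightarrow> (real \<Rightarrow> complex) set" where
  "Dsp l = {f. (\<exists>S g. open S \<and> range complex_of_real \<subseteq> S \<and> g holomorphic_on S \<and>
                    (\<forall>x. f x = g (complex_of_real x) * Phi l x)) \<and>
              (\<forall>x. f x = (-1) ^ (l 0 + l 1) * f (x + 1)) \<and>
              (\<forall>x. f x = (-1) ^ (l 0 + 1) * f (- x))}"

definition eigen :: "complex \<Rightarrow> (nat \<Rightarrow> nat) \<Rightarrow> complex \<Rightarrow> (real \<Rightarrow> complex) \<Rightarrow> bool" where
  "eigen \<tau> l E f \<longleftrightarrow>
     (\<exists>f1 f2. (\<forall>x. (f has_vector_derivative f1 x) (at x) \<and> (f1 has_vector_derivative f2 x) (at x)) \<and>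
        (\<forall>x. complex_of_real x \<notin> poles \<tau> l \<longrightarrow>
              - f2 x + pot \<tau> l (complex_of_real x) * f x - E * f x = 0))"

end

theory Submission imports Defs begin

text \<open>
  Part (i): the operator \<open>y \<mapsto> \<Xi> y' - \<Xi>' y / 2\<close> acts on the solutions of \<open>(H - E) y = 0\<close> with square \<open>- Q(E)\<close>;
  its eigenvectors for the eigenvalue \<open>s\<close> are the branches of \<open>\<Lambda>\<close>, and translation by \<open>1\<close> multiplies them by a factor
  \<open>m(E, s)\<close>. Comparing the Wronskian of two such eigenvectors at nearby energies at the two ends of a period gives
  \<open>dm/dE = - m Q1(E) / (2 s)\<close>. Hence the quantization condition says \<open>\<Lambda>(x + 1, Es) = (-1)^(l0 + l1) \<Lambda>(x, Es)\<close>, and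
  the parity at the half periods cancels the growing exponent there, so that the symmetrization lies in \<open>\<D>\<close>.

  Part (ii): the solution of the larger exponent at \<open>0\<close> and the one at \<open>1/2\<close> depend analytically on \<open>(E, \<tau>)\<close> (Volterra series),
  and the eigenvalues are the zeros of their Wronskian. The \<open>E\<close>-derivative of the Wronskian at a zero is a nonzero
  multiple of the integral of \<open>f\<^sup>2\<close> over a period. Write \<open>2 s f\<close> as the difference of two eigenvectors
  for \<open>s\<close> and \<open>- s\<close>: their squares have mean zero since \<open>m\<^sup>2 = 1\<close>, and their product is a nonzero multiple of \<open>\<Xi>\<close>, so the
  integral is a nonzero multiple of \<open>Q1(E)\<close>. The implicit function theorem concludes.

  That \<open>\<Xi>\<close> exists at all (it is defined by a choice operator) follows from the Lenard recursion: its terms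
  lie in a finite-dimensional space of even elliptic functions, and a linear dependence gives a solution polynomial in \<open>E\<close>.
\<close>

subsection \<open>Integrals along rays and Volterra series\<close>

text \<open>Four points decide the form of the argument. (1) \<open>Lam\<close> may be singular at
  the half integers, so Floquet theory lives on \<open>upper\<close>, a convex pole-free strip above
  the real axis that real translations preserve; the real line is reached only at the end, by parity
  and analytic continuation. (2) The multiplier depends on the energy and on the branch s of the
  square root, and Q may vanish at the starting energy. Its derivative is therefore a limit of
  difference quotients along the given path, and at the starting point only continuity is used. (3)
  Analyticity in (E, tau) is expressed as joint continuity together with holomorphy along every
  holomorphic curve z -> (e z, t z). Volterra series suit this, since their bounds are locally
  uniform in all data. (4) The exponents l0 + 1 and -l0 at 0 have opposite parity, so the parity in
  \<open>Dsp\<close> selects the larger one. Finally, p = exp(pi i tau) has period 2 in tau: a shift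
  of tau by 2 preserves each half period modulo the lattice, whereas a shift by 1 exchanges omega_2
  and omega_3.\<close>

definition ray_integral :: "nat \<Rightarrow> (complex \<Rightarrow> complex) \<Rightarrow> complex \<Rightarrow> complex" where
  "ray_integral k G x = x * integral {0..1} (\<lambda>r. of_real r ^ k * G (of_real r * x))"

text \<open>With k = 2j and f = x^j g, the equation f'' = (j(j-1)/x^2 + q) f becomes (x^k g')' = x^k
  q g. Since x^k times \<open>ray_integral k G x\<close> is the integral of t^k G(t) from 0 to x,
  integrating twice from g(0) = 1 gives an integral equation for g, of which these are the Picard
  terms.\<close>

primrec volterra_term :: "nat \<Rightarrow> (complex \<Rightarrow> complex) \<Rightarrow> nat \<Rightarrow> complex \<Rightarrow> complex" where
  "volterra_term k q 0 = (\<lambda>x. 1)"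
| "volterra_term k q (Suc n) = ray_integral 0 (ray_integral k (\<lambda>y. q y * volterra_term k q n y))"

definition volterra_sum :: "nat \<Rightarrow> (complex \<Rightarrow> complex) \<Rightarrow> complex \<Rightarrow> complex" where
  "volterra_sum k q x = (\<Sum>n. volterra_term k q n x)"

text \<open>The parameter space is left abstract: later it holds an energy, or a pair of an energy
  and a modulus, and the admissible range of x may vary with it.\<close>

definition ray_closed :: "('p \<times> complex) set \<Rightarrow> bool" where
  "ray_closed D \<longleftrightarrow> (\<forall>p x r. (p, x) \<in> D \<and> r \<in> {0..1} \<longrightarrow> (p, of_real r * x) \<in> D)"

lemma continuous_on_linepath_compose [continuous_intros]:
  "continuous_on T f \<Longrightarrow> continuous_on T (\<lambda>x. linepath a b (f x))"
  by (auto simp: linepath_def intro!: continuous_intros)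

text \<open>Morera's theorem: exchanging the integrations turns the integral over a triangle into an
  integral over r of triangle integrals, each of which is zero by Cauchy's theorem.\<close>

lemma holomorphic_integral_param:
  fixes H :: "complex \<Rightarrow> real \<Rightarrow> complex"
  assumes S: "open S" and cont: "continuous_on (S \<times> {0..1}) (\<lambda>(z, r). H z r)"
    and hol: "\<And>r. r \<in> {0..1} \<Longrightarrow> (\<lambda>z. H z r) holomorphic_on S"
  shows "(\<lambda>z. integral {0..1} (H z)) holomorphic_on S"
proof -
  have contI: "continuous_on S (\<lambda>z. integral {0..1} (H z))"
    using integral_continuous_on_param[of S 0 1 H] cont by simp
  have swap: "contour_integral (linepath a b) (\<lambda>z. integral {0..1} (H z)) =
      integral {0..1} (\<lambda>r. contour_integral (linepath a b) (\<lambda>z. H z r))"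
    if ab: "closed_segment a b \<subseteq> S" for a b
  proof -
    have lp: "linepath a b t \<in> S" if "t \<in> {0..1}" for t
      using ab that linepath_in_path by blast
    have c: "continuous_on (cbox (0::real, 0::real) (1,1)) (\<lambda>(t, r). H (linepath a b t) r * (b - a))"
    proof -
      have "continuous_on ({0..1::real} \<times> {0..1::real}) (\<lambda>y. (\<lambda>(z, r). H z r) (linepath a b (fst y), snd y) * (b - a))"
        by (intro continuous_intros continuous_on_compose2[OF cont]) (auto simp: lp)
      then show ?thesis by (simp add: cbox_Pair_eq split_beta)
    qed
    have "contour_integral (linepath a b) (\<lambda>z. integral {0..1} (H z)) =
       integral {0..1} (\<lambda>t. integral {0..1} (\<lambda>r. H (linepath a b t) r * (b - a)))"
      by (simp add: contour_integral_integral)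
    also have "\<dots> = integral {0..1} (\<lambda>r. integral {0..1} (\<lambda>t. H (linepath a b t) r * (b - a)))"
      using integral_swap_continuous[OF c] by simp
    finally show ?thesis by (simp add: contour_integral_integral)
  qed
  have contr: "continuous_on {0..1} (\<lambda>r. contour_integral (linepath a b) (\<lambda>z. H z r))"
    if ab: "closed_segment a b \<subseteq> S" for a b
  proof -
    have lp: "linepath a b t \<in> S" if "t \<in> {0..1}" for t
      using ab that linepath_in_path by blast
    have "continuous_on ({0..1::real} \<times> {0..1::real}) (\<lambda>y. (\<lambda>(z, r). H z r) (linepath a b (snd y), fst y) * (b - a))"
      by (intro continuous_intros continuous_on_compose2[OF cont]) (auto simp: lp)
    then have "continuous_on {0..1} (\<lambda>r. integral (cbox 0 1) (\<lambda>t. H (linepath a b t) r * (b - a)))"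
      by (intro integral_continuous_on_param) (simp add: split_beta)
    then show ?thesis by (simp add: contour_integral_integral)
  qed
  have "(\<lambda>z. integral {0..1} (H z)) analytic_on S"
  proof (rule Morera_triangle[OF contI S], intro impI)
    fix a b c assume sub: "convex hull {a,b,c} \<subseteq> S"
    have segs: "closed_segment a b \<subseteq> S" "closed_segment b c \<subseteq> S" "closed_segment c a \<subseteq> S"
      using order_trans[OF segments_subset_convex_hull(1) sub] order_trans[OF segments_subset_convex_hull(3) sub]
        order_trans[OF segments_subset_convex_hull(5) sub] by auto
    let ?C = "\<lambda>a b r. contour_integral (linepath a b) (\<lambda>z. H z r)"
    have i: "?C a b integrable_on {0..1}" "?C b c integrable_on {0..1}" "?C c a integrable_on {0..1}"
      using contr segs by (auto intro!: integrable_continuous_real)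
    have "?C a b r + ?C b c r + ?C c a r = 0" if r: "r \<in> {0..1}" for r
    proof -
      have "((\<lambda>z. H z r) has_contour_integral 0) (linepath a b +++ linepath b c +++ linepath c a)"
        using Cauchy_theorem_triangle[of "\<lambda>z. H z r" a b c] hol[OF r] sub holomorphic_on_subset by blast
      moreover have "(\<lambda>z. H z r) contour_integrable_on (linepath a b)" "(\<lambda>z. H z r) contour_integrable_on (linepath b c)"
        "(\<lambda>z. H z r) contour_integrable_on (linepath c a)"
        using segs hol[OF r] by (meson contour_integrable_continuous_linepath continuous_on_subset holomorphic_on_imp_continuous_on)+
      ultimately show ?thesis
        by (metis (no_types, lifting) add.assoc contour_integral_unique has_chain_integral_chain_integral3)
    qed
    then have "integral {0..1} (\<lambda>r. ?C a b r + ?C b c r + ?C c a r) = 0"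
      by (intro integral_unique has_integral_is_0)
    moreover have "integral {0..1} (\<lambda>r. ?C a b r + ?C b c r + ?C c a r) =
       integral {0..1} (?C a b) + integral {0..1} (?C b c) + integral {0..1} (?C c a)"
      using i by (simp add: integral_add integrable_add)
    ultimately show "contour_integral (linepath a b) (\<lambda>z. integral {0..1} (H z)) +
        contour_integral (linepath b c) (\<lambda>z. integral {0..1} (H z)) +
        contour_integral (linepath c a) (\<lambda>z. integral {0..1} (H z)) = 0"
      using swap segs by simp
  qed
  then show ?thesis by (rule analytic_imp_holomorphic)
qed

lemma continuous_on_ray_integral:
  assumes D: "ray_closed D" and cont: "continuous_on D (\<lambda>(p, x). G p x)"
  shows "continuous_on D (\<lambda>(p, x). ray_integral k (G p) x)"
proof -
  have "continuous_on (D \<times> {0..1::real}) (\<lambda>y. of_real (snd y) ^ k * (\<lambda>(p, x). G p x) (fst (fst y), of_real (snd y) * snd (fst y)))"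
    by (intro continuous_intros continuous_on_compose2[OF cont])
      (use D in \<open>auto simp: ray_closed_def\<close>)
  then have "continuous_on D (\<lambda>px. integral (cbox 0 1) (\<lambda>r. of_real r ^ k * G (fst px) (of_real r * snd px)))"
    by (intro integral_continuous_on_param) (simp add: split_beta)
  then show ?thesis
    unfolding ray_integral_def split_beta by (intro continuous_intros) simp
qed

text \<open>Parameter and endpoint move together along a curve in z. Analyticity enters through
  \<open>hol\<close>, a statement about one complex variable; \<open>P\<close> contributes
  continuity and may take values in any topological space.\<close>

lemma holomorphic_ray_integral:
  fixes P :: "complex \<Rightarrow> 'p::topological_space"
  assumes S: "open S" and D: "ray_closed D" and cont: "continuous_on D (\<lambda>(p, x). G p x)"
    and P: "continuous_on S P" and X: "X holomorphic_on S" and PX: "\<And>z. z \<in> S \<Longrightarrow> (P z, X z) \<in> D"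
    and hol: "\<And>r. r \<in> {0..1} \<Longrightarrow> (\<lambda>z. G (P z) (of_real r * X z)) holomorphic_on S"
  shows "(\<lambda>z. ray_integral k (G (P z)) (X z)) holomorphic_on S"
  unfolding ray_integral_def
proof (intro holomorphic_intros X holomorphic_integral_param[OF S])
  have X': "continuous_on S X" using X by (rule holomorphic_on_imp_continuous_on)
  have "continuous_on (S \<times> {0..1::real}) (\<lambda>y. of_real (snd y) ^ k * (\<lambda>(p, x). G p x) (P (fst y), of_real (snd y) * X (fst y)))"
    by (intro continuous_intros continuous_on_compose2[OF cont] continuous_on_compose2[OF P] continuous_on_compose2[OF X'])
      (use D PX in \<open>auto simp: ray_closed_def\<close>)
  then show "continuous_on (S \<times> {0..1}) (\<lambda>(z, r). complex_of_real r ^ k * G (P z) (of_real r * X z))"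
    by (simp add: split_beta)
qed (auto intro: hol)

lemma ray_integral_bound:
  assumes cont: "continuous_on {0..1} (\<lambda>r. G (of_real r * x))"
    and bd: "\<And>r. r \<in> {0..1} \<Longrightarrow> norm (G (of_real r * x)) \<le> C * r ^ m"
  shows "norm (ray_integral k G x) \<le> norm x * (C / (m + 1))"
proof -
  have C: "C \<ge> 0" using bd[of 1] by (auto intro: order_trans[OF norm_ge_zero])
  have hi: "((\<lambda>r. C * r ^ m) has_integral C / (m + 1)) {0..1::real}"
  proof -
    have "((\<lambda>r. C * r ^ m) has_integral (C * 1 ^ (m+1) / (m + 1) - C * 0 ^ (m+1) / (m + 1))) {0..1::real}"
      by (rule fundamental_theorem_of_calculus)
        (auto intro!: derivative_eq_intros simp: has_real_derivative_iff_has_vector_derivative[symmetric] add_eq_0_iff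
           simp del: power_Suc)
    then show ?thesis by simp
  qed
  have "norm (integral {0..1} (\<lambda>r. of_real r ^ k * G (of_real r * x))) \<le> integral {0..1} (\<lambda>r. C * r ^ m)"
  proof (rule integral_norm_bound_integral)
    show "(\<lambda>r. complex_of_real r ^ k * G (of_real r * x)) integrable_on {0..1}"
      by (intro integrable_continuous_real continuous_intros cont)
    show "(\<lambda>r. C * r ^ m) integrable_on {0..1}" using hi by blast
    fix r :: real assume r: "r \<in> {0..1}"
    have "norm (complex_of_real r ^ k * G (of_real r * x)) = r ^ k * norm (G (of_real r * x))"
      using r by (simp add: norm_mult norm_power)
    also have "\<dots> \<le> 1 * (C * r ^ m)"
      using r bd[OF r] by (intro mult_mono) (auto simp: power_le_one)
    finally show "norm (complex_of_real r ^ k * G (of_real r * x)) \<le> C * r ^ m" by simp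
  qed
  also have "\<dots> = C / (m + 1)" using hi by (rule integral_unique)
  finally show ?thesis unfolding ray_integral_def norm_mult by (intro mult_left_mono) auto
qed

lemma continuous_on_volterra_term:
  fixes D :: "('p::topological_space \<times> complex) set"
  assumes D: "ray_closed D" and cont: "continuous_on D (\<lambda>(p, x). q p x)"
  shows "continuous_on D (\<lambda>(p, x). volterra_term k (q p) n x)"
proof (induction n)
  case (Suc n)
  have "continuous_on D (\<lambda>(p, x). q p x * volterra_term k (q p) n x)"
    using continuous_on_mult[OF cont Suc] by (simp add: split_beta)
  then show ?case
    using continuous_on_ray_integral[OF D continuous_on_ray_integral[OF D]] by simp
qed (simp add: split_beta)

lemma continuous_on_ray:
  assumes "ray_closed D" "continuous_on D (\<lambda>(p, x). f p x)" "(p, x) \<in> D"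
  shows "continuous_on {0..1} (\<lambda>r. f p (of_real r * x))"
proof -
  have "continuous_on {0..1} (\<lambda>r. (\<lambda>(p, x). f p x) (p, of_real r * x))"
    by (intro continuous_on_compose2[OF assms(2)] continuous_intros) (use assms in \<open>auto simp: ray_closed_def\<close>)
  then show ?thesis by simp
qed

text \<open>On the ray the n-th term is at most C r^(2n). The inner integral is estimated crudely
  and gains one power of r from the factor r x; the outer one then divides by 2n + 2, which suffices
  for the factorial. Because r^k <= 1, the bound is the same for every \<open>k\<close>.\<close>

lemma volterra_term_bound:
  fixes D :: "('p::topological_space \<times> complex) set"
  assumes D: "ray_closed D" and cont: "continuous_on D (\<lambda>(p, x). q p x)" and px: "(p, x) \<in> D"
    and B: "\<And>r. r \<in> {0..1} \<Longrightarrow> norm (q p (of_real r * x)) \<le> B"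
  shows "norm (volterra_term k (q p) n x) \<le> (B * (norm x)\<^sup>2) ^ n / fact n"
  using px B
proof (induction n arbitrary: x)
  case (Suc n)
  have B0: "B \<ge> 0" using Suc.prems(2)[of 1] by (auto intro: order_trans[OF norm_ge_zero])
  let ?h = "volterra_term k (q p) n"
  define C where "C = (B * (norm x)\<^sup>2) ^ n / fact n"
  have C0: "C \<ge> 0" using B0 by (simp add: C_def)
  have inD: "(p, of_real r * x) \<in> D" if "r \<in> {0..1}" for r
    using D Suc.prems(1) that by (auto simp: ray_closed_def)
  have contqh: "continuous_on D (\<lambda>(p, x). q p x * volterra_term k (q p) n x)"
    using continuous_on_mult[OF cont continuous_on_volterra_term[OF D cont]] by (simp add: split_beta)
  have h: "norm (?h (of_real r * x)) \<le> C * r ^ (2*n)" if r: "r \<in> {0..1}" for r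
  proof -
    have "norm (?h (of_real r * x)) \<le> (B * (norm (of_real r * x))\<^sup>2) ^ n / fact n"
    proof (rule Suc.IH[OF inD[OF r]])
      fix r' :: real assume r': "r' \<in> {0..1}"
      have "r' * r \<in> {0..1}" using r r' by (auto simp: mult_le_one)
      from Suc.prems(2)[OF this] show "norm (q p (of_real r' * (of_real r * x))) \<le> B" by (simp add: mult.assoc)
    qed
    also have "\<dots> = C * r ^ (2*n)"
      using r by (simp add: C_def norm_mult power_mult_distrib power_mult)
    finally show ?thesis .
  qed
  have qh: "norm (q p (of_real r * x) * ?h (of_real r * x)) \<le> B * C * r ^ (2*n)" if r: "r \<in> {0..1}" for r
    unfolding norm_mult mult.assoc by (intro mult_mono Suc.prems(2) h r B0) auto
  have 1: "norm (ray_integral k (\<lambda>y. q p y * ?h y) (of_real r * x)) \<le> norm x * B * C * r ^ (2*n+1)" if r: "r \<in> {0..1}" for r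
  proof -
    have "norm (ray_integral k (\<lambda>y. q p y * ?h y) (of_real r * x)) \<le> norm (of_real r * x) * (B * C * r ^ (2*n) / ((0::nat) + 1))"
    proof (rule ray_integral_bound)
      show "continuous_on {0..1} (\<lambda>ra. q p (complex_of_real ra * (complex_of_real r * x)) * ?h (complex_of_real ra * (complex_of_real r * x)))"
        using continuous_on_ray[OF D contqh inD[OF r]] .
      fix r' :: real assume r': "r' \<in> {0..1}"
      have rr: "r' * r \<in> {0..1}" using r r' by (auto simp: mult_le_one)
      have "norm (q p (of_real (r' * r) * x) * ?h (of_real (r' * r) * x)) \<le> B * C * (r' * r) ^ (2*n)"
        by (rule qh[OF rr])
      also have "\<dots> \<le> B * C * r ^ (2*n)"
        using r r' B0 C0 by (intro mult_left_mono power_mono) (auto simp: mult_left_le_one_le)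
      finally show "norm (q p (of_real r' * (of_real r * x)) * ?h (of_real r' * (of_real r * x))) \<le> B * C * r ^ (2*n) * r' ^ 0"
        by (simp add: mult.assoc)
    qed
    then show ?thesis using r by (simp add: norm_mult mult_ac)
  qed
  have "norm (ray_integral 0 (ray_integral k (\<lambda>y. q p y * ?h y)) x) \<le> norm x * (norm x * B * C / ((2*n+1) + 1))"
    using 1 by (intro ray_integral_bound continuous_on_ray[OF D continuous_on_ray_integral[OF D contqh] Suc.prems(1)]) auto
  also have "\<dots> = (B * (norm x)\<^sup>2) ^ Suc n / (fact n * real (2*n+2))"
    by (simp add: C_def power2_eq_square mult_ac)
  also have "\<dots> \<le> (B * (norm x)\<^sup>2) ^ Suc n / fact (Suc n)"
    using B0 by (intro divide_left_mono) (auto simp: mult_ac)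
  finally show ?case by simp
qed simp

text \<open>The value at x involves q on the whole segment from 0 to x. The union of these segments
  over a closed ball is compact and stays inside \<open>D\<close>, so q is bounded there.\<close>

lemma volterra_term_local_bound:
  fixes D :: "('p::heine_borel \<times> complex) set"
  assumes D: "ray_closed D" "open D" and cont: "continuous_on D (\<lambda>(p, x). q p x)" and d: "d \<in> D"
  obtains e M where "e > 0" "cball d e \<subseteq> D"
    "\<And>p x n k. (p, x) \<in> cball d e \<Longrightarrow> norm (volterra_term k (q p) n x) \<le> M ^ n / fact n"
proof -
  obtain e where e: "e > 0" "cball d e \<subseteq> D" using D(2) d open_contains_cball by blast
  define C where "C = (\<lambda>((p, x), r). (p, of_real r * x)) ` (cball d e \<times> {0..1::real})"
  have "compact C" unfolding C_def split_beta
    by (intro compact_continuous_image continuous_intros compact_Times compact_cball) auto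
  have CD: "C \<subseteq> D" using e D(1) by (auto simp: C_def ray_closed_def)
  have "bounded ((\<lambda>(p, x). q p x) ` C)"
    using \<open>compact C\<close> continuous_on_subset[OF cont CD] compact_continuous_image compact_imp_bounded by blast
  then obtain B where B: "\<And>p x. (p, x) \<in> C \<Longrightarrow> norm (q p x) \<le> B"
    unfolding bounded_iff by fastforce
  have "bounded (snd ` cball d e)"
    by (intro compact_imp_bounded compact_continuous_image continuous_intros compact_cball)
  then obtain R where R: "\<And>p x. (p, x) \<in> cball d e \<Longrightarrow> norm x \<le> R"
    by (metis bounded_iff image_eqI snd_conv)
  show ?thesis
  proof (rule that[OF e, of "\<bar>B\<bar> * R\<^sup>2"])
    fix p x n k assume px: "(p, x) \<in> cball d e"
    have "norm (volterra_term k (q p) n x) \<le> (\<bar>B\<bar> * (norm x)\<^sup>2) ^ n / fact n"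
    proof (rule volterra_term_bound[OF D(1) cont])
      show "(p, x) \<in> D" using px e by auto
      fix r :: real assume "r \<in> {0..1}"
      then have "(p, of_real r * x) \<in> C" using px by (force simp: C_def)
      from B[OF this] show "norm (q p (of_real r * x)) \<le> \<bar>B\<bar>" by linarith
    qed
    also have "\<dots> \<le> (\<bar>B\<bar> * R\<^sup>2) ^ n / fact n"
      using R[OF px] by (intro divide_right_mono power_mono mult_left_mono) auto
    finally show "norm (volterra_term k (q p) n x) \<le> (\<bar>B\<bar> * R\<^sup>2) ^ n / fact n" .
  qed
qed

lemma uniform_limit_volterra:
  fixes M :: real
  assumes "\<And>y n. y \<in> Y \<Longrightarrow> norm (volterra_term k (q y) n (X y)) \<le> M ^ n / fact n"
  shows "uniform_limit Y (\<lambda>N y. \<Sum>n<N. volterra_term k (q y) n (X y)) (\<lambda>y. volterra_sum k (q y) (X y)) sequentially"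
  unfolding volterra_sum_def
proof (rule Weierstrass_m_test[where M="\<lambda>n. M ^ n / fact n"])
  show "summable (\<lambda>n. M ^ n / fact n)"
    using summable_exp[of M] by (simp add: field_simps)
qed (use assms in auto)

lemma continuous_on_volterra_sum:
  fixes D :: "('p::heine_borel \<times> complex) set"
  assumes D: "ray_closed D" "open D" and cont: "continuous_on D (\<lambda>(p, x). q p x)"
  shows "continuous_on D (\<lambda>(p, x). volterra_sum k (q p) x)"
proof -
  have "\<exists>e>0. continuous_on (ball d e) (\<lambda>(p, x). volterra_sum k (q p) x)" if d: "d \<in> D" for d
  proof -
    obtain e M where e: "e > 0" "cball d e \<subseteq> D"
      "\<And>p x n k. (p, x) \<in> cball d e \<Longrightarrow> norm (volterra_term k (q p) n x) \<le> M ^ n / fact n"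
      using volterra_term_local_bound[OF D cont d] by metis
    have "uniform_limit (cball d e) (\<lambda>N y. \<Sum>n<N. volterra_term k (q (fst y)) n (snd y))
        (\<lambda>y. volterra_sum k (q (fst y)) (snd y)) sequentially"
      by (rule uniform_limit_volterra) (use e(3) in auto)
    moreover have "continuous_on (cball d e) (\<lambda>y. \<Sum>n<N. volterra_term k (q (fst y)) n (snd y))" for N
      using continuous_on_subset[OF continuous_on_volterra_term[OF D(1) cont] e(2)]
      by (intro continuous_intros) (simp add: split_beta)
    ultimately have "continuous_on (cball d e) (\<lambda>y. volterra_sum k (q (fst y)) (snd y))"
      by (intro uniform_limit_theorem[OF always_eventually]) auto
    then show ?thesis using e(1) by (auto simp: split_beta intro: continuous_on_subset[OF _ ball_subset_cball])
  qed
  then show ?thesis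
    by (metis centre_in_ball continuous_on_eq_continuous_at open_ball continuous_at_imp_continuous_on)
qed

text \<open>The induction runs over all contracted points r X(z) simultaneously, since the next term
  at X(z) evaluates the previous one along the entire ray.\<close>

lemma holomorphic_volterra_term:
  fixes P :: "complex \<Rightarrow> 'p::topological_space"
  assumes S: "open S" and D: "ray_closed D" and cont: "continuous_on D (\<lambda>(p, x). q p x)"
    and P: "continuous_on S P" and X: "X holomorphic_on S" and PX: "\<And>z. z \<in> S \<Longrightarrow> (P z, X z) \<in> D"
    and hol: "\<And>r. r \<in> {0..1} \<Longrightarrow> (\<lambda>z. q (P z) (of_real r * X z)) holomorphic_on S"
    and r: "r \<in> {0..1}"
  shows "(\<lambda>z. volterra_term k (q (P z)) n (of_real r * X z)) holomorphic_on S"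
  using r
proof (induction n arbitrary: r)
  case (Suc n)
  have contqh: "continuous_on D (\<lambda>(p, x). q p x * volterra_term k (q p) n x)"
    using continuous_on_mult[OF cont continuous_on_volterra_term[OF D cont]] by (simp add: split_beta)
  have PXr: "(P z, of_real r * X z) \<in> D" if "z \<in> S" "r \<in> {0..1}" for z r
    using PX D that by (auto simp: ray_closed_def)
  have rr: "r' * r \<in> {0..1}" if "r \<in> {0..1}" "r' \<in> {0..1}" for r r' :: real
    using that by (auto simp: mult_le_one)
  have 1: "(\<lambda>z. ray_integral k (\<lambda>y. q (P z) y * volterra_term k (q (P z)) n y) (of_real r * X z)) holomorphic_on S"
    if r: "r \<in> {0..1}" for r
  proof (rule holomorphic_ray_integral[OF S D contqh P])
    fix r' :: real assume r': "r' \<in> {0..1}"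
    from hol[OF rr[OF r r']] Suc.IH[OF rr[OF r r']]
    show "(\<lambda>z. q (P z) (of_real r' * (of_real r * X z)) * volterra_term k (q (P z)) n (of_real r' * (of_real r * X z))) holomorphic_on S"
      by (simp add: mult.assoc holomorphic_on_mult)
  qed (use r PXr in \<open>auto intro!: holomorphic_intros X\<close>)
  show ?case
    unfolding volterra_term.simps
  proof (rule holomorphic_ray_integral[OF S D continuous_on_ray_integral[OF D contqh] P])
    fix r' :: real assume r': "r' \<in> {0..1}"
    from 1[OF rr[OF Suc.prems r']]
    show "(\<lambda>z. ray_integral k (\<lambda>y. q (P z) y * volterra_term k (q (P z)) n y) (of_real r' * (of_real r * X z))) holomorphic_on S"
      by (simp add: mult.assoc)
  qed (use Suc.prems PXr in \<open>auto intro!: holomorphic_intros X\<close>)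
qed simp

lemma holomorphic_volterra_sum:
  fixes P :: "complex \<Rightarrow> 'p::heine_borel"
  assumes S: "open S" and D: "ray_closed D" "open D" and cont: "continuous_on D (\<lambda>(p, x). q p x)"
    and P: "continuous_on S P" and X: "X holomorphic_on S" and PX: "\<And>z. z \<in> S \<Longrightarrow> (P z, X z) \<in> D"
    and hol: "\<And>r. r \<in> {0..1} \<Longrightarrow> (\<lambda>z. q (P z) (of_real r * X z)) holomorphic_on S"
  shows "(\<lambda>z. volterra_sum k (q (P z)) (X z)) holomorphic_on S"
proof (rule holomorphic_uniform_sequence[OF S, where f="\<lambda>N z. \<Sum>n<N. volterra_term k (q (P z)) n (X z)"])
  fix N show "(\<lambda>z. \<Sum>n<N. volterra_term k (q (P z)) n (X z)) holomorphic_on S"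
    using holomorphic_volterra_term[OF S D(1) cont P X PX hol, of 1] by (intro holomorphic_intros) simp
next
  fix z assume z: "z \<in> S"
  obtain e M where e: "e > 0" "cball (P z, X z) e \<subseteq> D"
      "\<And>p x n k. (p, x) \<in> cball (P z, X z) e \<Longrightarrow> norm (volterra_term k (q p) n x) \<le> M ^ n / fact n"
    using volterra_term_local_bound[OF D cont PX[OF z]] by metis
  have "continuous_on S (\<lambda>z. (P z, X z))"
    using P X by (intro continuous_intros holomorphic_on_imp_continuous_on)
  then have "open (S \<inter> (\<lambda>z. (P z, X z)) -` ball (P z, X z) e)"
    using S by (intro continuous_open_preimage) auto
  moreover have "z \<in> S \<inter> (\<lambda>z. (P z, X z)) -` ball (P z, X z) e" using z e by auto
  ultimately obtain d where d: "d > 0" "cball z d \<subseteq> S \<inter> (\<lambda>z. (P z, X z)) -` ball (P z, X z) e"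
    using open_contains_cball by meson
  show "\<exists>d>0. cball z d \<subseteq> S \<and> uniform_limit (cball z d) (\<lambda>N z. \<Sum>n<N. volterra_term k (q (P z)) n (X z))
       (\<lambda>z. volterra_sum k (q (P z)) (X z)) sequentially"
    by (intro exI[of _ d] conjI uniform_limit_volterra[where M=M]) (use d e(3) in \<open>force+\<close>)
qed

definition star_zero :: "complex set \<Rightarrow> bool" where
  "star_zero S \<longleftrightarrow> open S \<and> 0 \<in> S \<and> (\<forall>x\<in>S. \<forall>r\<in>{0..1}. of_real r * x \<in> S)"

lemma ray_integral_uniform_limit:
  assumes Y: "\<And>y r. y \<in> Y \<Longrightarrow> r \<in> {0..1} \<Longrightarrow> of_real r * y \<in> Y" and bd: "\<And>y. y \<in> Y \<Longrightarrow> norm y \<le> R"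
    and cont: "\<And>N. continuous_on Y (S N)" and ul: "uniform_limit Y S T sequentially"
  shows "uniform_limit Y (\<lambda>N. ray_integral k (S N)) (ray_integral k T) sequentially"
proof (rule uniform_limitI)
  fix e :: real assume e: "e > 0"
  have contT: "continuous_on Y T"
    by (rule uniform_limit_theorem[OF always_eventually ul]) (use cont in auto)
  define d where "d = e / (\<bar>R\<bar> + 1)"
  have d: "d > 0" using e by (simp add: d_def add_nonneg_pos)
  from uniform_limitD[OF ul d] show "\<forall>\<^sub>F N in sequentially. \<forall>y\<in>Y. dist (ray_integral k (S N) y) (ray_integral k T y) < e"
  proof (rule eventually_mono, intro ballI)
    fix N y assume N: "\<forall>x\<in>Y. dist (S N x) (T x) < d" and y: "y \<in> Y"
    have cr: "continuous_on {0..1} (\<lambda>r. f (complex_of_real r * y))" if "continuous_on Y f" for f :: "complex \<Rightarrow> complex"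
      by (rule continuous_on_compose2[OF that]) (use Y y in \<open>auto intro!: continuous_intros\<close>)
    have "ray_integral k (S N) y - ray_integral k T y = ray_integral k (\<lambda>y. S N y - T y) y"
      unfolding ray_integral_def right_diff_distrib[symmetric]
      by (subst integral_diff[symmetric])
        (auto intro!: integrable_continuous_real continuous_intros cr cont contT simp: right_diff_distrib)
    also have "norm \<dots> \<le> norm y * (d / real (0 + 1))"
      by (rule ray_integral_bound)
        (use N Y y in \<open>auto intro!: continuous_intros cr cont contT less_imp_le simp: dist_norm\<close>)
    also have "\<dots> \<le> \<bar>R\<bar> * d"
      using d bd[OF y] by (simp add: mult_right_mono)
    also have "\<dots> < e" using e by (simp add: d_def field_simps add_nonneg_pos)
    finally show "dist (ray_integral k (S N) y) (ray_integral k T y) < e" by (simp add: dist_norm)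
  qed
qed

lemma ray_integral_sum:
  assumes "finite I" "\<And>i. i \<in> I \<Longrightarrow> continuous_on {0..1} (\<lambda>r. f i (complex_of_real r * y))"
  shows "ray_integral k (\<lambda>y. \<Sum>i\<in>I. f i y) y = (\<Sum>i\<in>I. ray_integral k (f i) y)"
  unfolding ray_integral_def sum_distrib_left[symmetric]
  by (subst integral_sum[symmetric])
    (auto intro!: integrable_continuous_real continuous_intros assms simp: sum_distrib_left)

lemma ray_integral_cong:
  assumes "\<And>r. r \<in> {0..1} \<Longrightarrow> f (complex_of_real r * y) = g (of_real r * y)"
  shows "ray_integral k f y = ray_integral k g y"
  unfolding ray_integral_def using assms by (auto intro!: arg_cong[of _ _ "\<lambda>z. y * z"] integral_cong)

context
  fixes \<Omega> :: "complex set" and q :: "complex \<Rightarrow> complex" and k :: nat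
  assumes star: "star_zero \<Omega>" and q: "q holomorphic_on \<Omega>"
begin

private lemma D: "ray_closed ((UNIV :: complex set) \<times> \<Omega>)" "open ((UNIV :: complex set) \<times> \<Omega>)"
  using star by (auto simp: star_zero_def ray_closed_def open_Times)

private lemma contq: "continuous_on ((UNIV :: complex set) \<times> \<Omega>) (\<lambda>(p, x). q x)"
  unfolding split_beta
  by (rule continuous_on_compose2[OF holomorphic_on_imp_continuous_on[OF q]]) (auto intro!: continuous_intros)

private lemma op: "open \<Omega>" and ray: "\<And>x r. x \<in> \<Omega> \<Longrightarrow> r \<in> {0..1} \<Longrightarrow> of_real r * x \<in> \<Omega>"
  using star by (auto simp: star_zero_def)

lemma volterra_sum_holomorphic: "volterra_sum k q holomorphic_on \<Omega>"
proof -
  have "(\<lambda>z. volterra_sum k ((\<lambda>_. q) z) z) holomorphic_on \<Omega>"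
  proof (rule holomorphic_volterra_sum[OF op D contq, of "\<lambda>z. 0" "\<lambda>z. z"])
    fix r :: real assume r: "r \<in> {0..1}"
    show "(\<lambda>z. q (of_real r * z)) holomorphic_on \<Omega>"
      using holomorphic_on_compose_gen[of "\<lambda>z. of_real r * z" \<Omega> q \<Omega>] q r ray
      by (auto simp: o_def intro!: holomorphic_intros)
  qed auto
  then show ?thesis by simp
qed

lemma ray_integral_holomorphic:
  assumes G: "G holomorphic_on \<Omega>"
  shows "ray_integral k G holomorphic_on \<Omega>"
proof -
  have "(\<lambda>z. ray_integral k ((\<lambda>_. G) z) z) holomorphic_on \<Omega>"
  proof (rule holomorphic_ray_integral[OF op D(1), of "\<lambda>_. G" "\<lambda>z. 0" "\<lambda>z. z"])
    show "continuous_on (UNIV \<times> \<Omega>) (\<lambda>(p::complex, x). G x)"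
      unfolding split_beta
      by (rule continuous_on_compose2[OF holomorphic_on_imp_continuous_on[OF G]]) (auto intro!: continuous_intros)
    fix r :: real assume r: "r \<in> {0..1}"
    show "(\<lambda>z. G (of_real r * z)) holomorphic_on \<Omega>"
      using holomorphic_on_compose_gen[of "\<lambda>z. of_real r * z" \<Omega> G \<Omega>] G r ray
      by (auto simp: o_def intro!: holomorphic_intros)
  qed auto
  then show ?thesis by simp
qed

text \<open>The substitution t = r x identifies x^m \<open>ray_integral m G x\<close> with the
  integral of t^m G(t) from 0 to x, hence with a primitive on the starlike domain.\<close>

lemma ray_integral_primitive:
  assumes G: "G holomorphic_on \<Omega>" and x: "x \<in> \<Omega>"
  shows "((\<lambda>x. x ^ m * ray_integral m G x) has_field_derivative x ^ m * G x) (at x)"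
proof -
  have st: "starlike \<Omega>"
    unfolding starlike_def
  proof (intro bexI[of _ 0] ballI subsetI)
    fix x y assume "x \<in> \<Omega>" "y \<in> closed_segment 0 x"
    then show "y \<in> \<Omega>" using ray by (auto simp: closed_segment_def scaleR_conv_of_real)
  qed (use star in \<open>simp add: star_zero_def\<close>)
  have hol: "(\<lambda>y. y ^ m * G y) holomorphic_on \<Omega>" by (intro holomorphic_intros G)
  then obtain F where F: "\<And>y. y \<in> \<Omega> \<Longrightarrow> (F has_field_derivative y ^ m * G y) (at y)"
    using holomorphic_starlike_primitive[OF holomorphic_on_imp_continuous_on[OF hol] st op finite.emptyI]
      holomorphic_on_imp_differentiable_at[OF hol op] by auto
  have eq: "F y - F 0 = y ^ m * ray_integral m G y" if y: "y \<in> \<Omega>" for y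
  proof -
    have seg: "closed_segment 0 y \<subseteq> \<Omega>"
      using ray[OF y] by (auto simp: closed_segment_def scaleR_conv_of_real)
    have "((\<lambda>y. y ^ m * G y) has_contour_integral (F y - F 0)) (linepath 0 y)"
      using contour_integral_primitive[of \<Omega> F "\<lambda>y. y ^ m * G y" "linepath 0 y"] F seg
      by (auto intro: has_field_derivative_at_within)
    then have "F y - F 0 = integral {0..1} (\<lambda>r. (of_real r * y) ^ m * G (of_real r * y) * y)"
      unfolding has_contour_integral_linepath
      by (intro integral_unique[symmetric]) (simp add: linepath_def scaleR_conv_of_real)
    also have "\<dots> = integral {0..1} (\<lambda>r. (y ^ m * y) * (of_real r ^ m * G (of_real r * y)))"
      by (simp add: power_mult_distrib mult_ac)
    finally show ?thesis by (simp add: ray_integral_def mult_ac)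
  qed
  have "((\<lambda>y. F y - F 0) has_field_derivative x ^ m * G x) (at x)"
    using F[OF x] by (auto intro!: derivative_eq_intros)
  then show ?thesis
    by (rule has_field_derivative_transform_within_open[OF _ op x eq])
qed

text \<open>The partial sums satisfy S(N+1) = 1 + K S(N), where K is the double ray integral; the
  equation for the sum follows by letting N tend to infinity, which needs uniform convergence on one
  segment.\<close>

lemma volterra_sum_fixpoint:
  assumes x: "x \<in> \<Omega>"
  shows "volterra_sum k q x = 1 + ray_integral 0 (ray_integral k (\<lambda>y. q y * volterra_sum k q y)) x"
proof -
  \<comment> \<open>The double ray integral at x sees only the segment from 0 to x, which is compact
    and closed under further contraction.\<close>
  define Y where "Y = (\<lambda>r. of_real r * x) ` {0..1}"
  have Y: "of_real r * y \<in> Y" if "y \<in> Y" "r \<in> {0..1}" for y r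
  proof -
    obtain s where s: "y = of_real s * x" "s \<in> {0..1}" using \<open>y \<in> Y\<close> unfolding Y_def by (elim imageE)
    have "r * s \<in> {0..1}" using s that by (auto simp: mult_le_one)
    then show ?thesis unfolding Y_def s(1) by (intro image_eqI[of _ _ "r * s"]) auto
  qed
  have bdY: "norm y \<le> norm x" if "y \<in> Y" for y
    using that by (auto simp: Y_def norm_mult mult_left_le_one_le)
  have Yo: "Y \<subseteq> \<Omega>" using ray[OF x] by (auto simp: Y_def)
  have xY: "x \<in> Y" unfolding Y_def by (rule image_eqI[of _ _ 1]) auto
  have cmpY: "compact Y" unfolding Y_def by (intro compact_continuous_image continuous_intros) auto
  have qY: "continuous_on Y q" using q Yo holomorphic_on_imp_continuous_on holomorphic_on_subset by blast
  then obtain B where B: "\<And>y. y \<in> Y \<Longrightarrow> norm (q y) \<le> B"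
    using compact_imp_bounded[OF compact_continuous_image[OF qY cmpY]] by (auto simp: bounded_iff)
  have contt: "continuous_on \<Omega> (volterra_term k q n)" for n
  proof -
    have "continuous_on \<Omega> (\<lambda>x. (\<lambda>(p::complex, x). volterra_term k q n x) (0, x))"
      by (rule continuous_on_compose2[OF continuous_on_volterra_term[OF D(1) contq]]) (auto intro!: continuous_intros)
    then show ?thesis by simp
  qed
  define S where "S = (\<lambda>N y. \<Sum>n<N. volterra_term k q n y)"
  have contS: "continuous_on Y (S N)" for N
    unfolding S_def using continuous_on_subset[OF contt Yo] by (intro continuous_intros)
  have ulS: "uniform_limit Y S (volterra_sum k q) sequentially"
    unfolding S_def
  proof (rule uniform_limit_volterra[where q = "\<lambda>_. q" and X = "\<lambda>y. y"])
    fix y n assume y: "y \<in> Y"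
    have "norm (volterra_term k q n y) \<le> (B * (norm y)\<^sup>2) ^ n / fact n"
      by (rule volterra_term_bound[OF D(1) contq, of 0]) (use y Y Yo B in auto)
    also have "\<dots> \<le> (\<bar>B\<bar> * (norm x)\<^sup>2) ^ n / fact n"
    proof -
      have "0 \<le> B" using B[OF y] norm_ge_zero order_trans by blast
      then show ?thesis using bdY[OF y] by (intro divide_right_mono power_mono mult_mono) auto
    qed
    finally show "norm (volterra_term k q n y) \<le> (\<bar>B\<bar> * (norm x)\<^sup>2) ^ n / fact n" .
  qed
  have ul1: "uniform_limit Y (\<lambda>N y. q y * S N y) (\<lambda>y. q y * volterra_sum k q y) sequentially"
  proof (rule uniform_limitI)
    fix e :: real assume e: "e > 0"
    have e': "e / (\<bar>B\<bar> + 1) > 0" using e by (simp add: add_nonneg_pos)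
    from uniform_limitD[OF ulS this]
    show "\<forall>\<^sub>F N in sequentially. \<forall>y\<in>Y. dist (q y * S N y) (q y * volterra_sum k q y) < e"
    proof (rule eventually_mono, intro ballI)
      fix N y assume N: "\<forall>y\<in>Y. dist (S N y) (volterra_sum k q y) < e / (\<bar>B\<bar> + 1)" and y: "y \<in> Y"
      have "dist (q y * S N y) (q y * volterra_sum k q y) = norm (q y) * dist (S N y) (volterra_sum k q y)"
        by (simp add: dist_norm norm_mult flip: right_diff_distrib)
      also have "\<dots> \<le> \<bar>B\<bar> * (e / (\<bar>B\<bar> + 1))"
        using N y B[OF y] by (intro mult_mono) auto
      also have "\<dots> < e" using e by (simp add: field_simps add_nonneg_pos)
      finally show "dist (q y * S N y) (q y * volterra_sum k q y) < e" .
    qed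
  qed
  have contYray: "continuous_on Y (ray_integral m f)" if f: "continuous_on Y f" for m f
  proof -
    have "continuous_on ((UNIV :: complex set) \<times> Y) (\<lambda>(p, x). ray_integral m f x)"
      by (rule continuous_on_ray_integral)
        (use Y f in \<open>auto simp: ray_closed_def split_beta intro!: continuous_on_compose2[OF f] continuous_intros\<close>)
    then have "continuous_on Y (\<lambda>x. (\<lambda>(p, x). ray_integral m f x) (0::complex, x))"
      by (rule continuous_on_compose2) (auto intro!: continuous_intros)
    then show ?thesis by simp
  qed
  have contY': "continuous_on {0..1} (\<lambda>r. f (complex_of_real r * y))" if "continuous_on Y f" "y \<in> Y" for f :: "complex \<Rightarrow> complex" and y
    by (rule continuous_on_compose2[OF that(1)]) (use Y that in \<open>auto intro!: continuous_intros\<close>)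
  have "uniform_limit Y (\<lambda>N. ray_integral 0 (ray_integral k (\<lambda>y. q y * S N y)))
      (ray_integral 0 (ray_integral k (\<lambda>y. q y * volterra_sum k q y))) sequentially"
    by (intro ray_integral_uniform_limit[OF Y bdY] ul1 contYray continuous_intros qY contS)
  from tendsto_uniform_limitI[OF this xY]
  have "(\<lambda>N. 1 + ray_integral 0 (ray_integral k (\<lambda>y. q y * S N y)) x) \<longlonglongrightarrow>
      1 + ray_integral 0 (ray_integral k (\<lambda>y. q y * volterra_sum k q y)) x"
    by (intro tendsto_intros)
  moreover have "1 + ray_integral 0 (ray_integral k (\<lambda>y. q y * S N y)) x = S (Suc N) x" for N
  proof -
    have t: "continuous_on Y (volterra_term k q n)" for n using continuous_on_subset[OF contt Yo] .
    have 1: "ray_integral k (\<lambda>y. q y * S N y) y = (\<Sum>n<N. ray_integral k (\<lambda>y. q y * volterra_term k q n y) y)" if y: "y \<in> Y" for y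
      unfolding S_def sum_distrib_left
      by (rule ray_integral_sum) (auto intro!: contY'[OF _ y] continuous_intros qY t)
    have "ray_integral 0 (ray_integral k (\<lambda>y. q y * S N y)) x
       = ray_integral 0 (\<lambda>y. \<Sum>n<N. ray_integral k (\<lambda>y. q y * volterra_term k q n y) y) x"
      by (rule ray_integral_cong) (use 1 Y xY in auto)
    also have "\<dots> = (\<Sum>n<N. volterra_term k q (Suc n) x)"
      unfolding volterra_term.simps
      by (rule ray_integral_sum) (auto intro!: contY'[OF _ xY] contYray continuous_intros qY t)
    finally show ?thesis unfolding S_def sum.lessThan_Suc_shift by simp
  qed
  ultimately have "(\<lambda>N. S (Suc N) x) \<longlonglongrightarrow> 1 + ray_integral 0 (ray_integral k (\<lambda>y. q y * volterra_sum k q y)) x"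
    by simp
  then show ?thesis
    using LIMSEQ_unique LIMSEQ_Suc[OF tendsto_uniform_limitI[OF ulS xY]] by blast
qed

lemma volterra_sum_even:
  assumes "\<And>x. x \<in> \<Omega> \<Longrightarrow> q (- x) = q x" and "x \<in> \<Omega>"
  shows "volterra_sum k q (- x) = volterra_sum k q x"
proof -
  have "volterra_term k q n (- x) = volterra_term k q n x" if "x \<in> \<Omega>" for n x
    using that
  proof (induction n arbitrary: x)
    case (Suc n)
    have 1: "ray_integral k (\<lambda>y. q y * volterra_term k q n y) (- y) = - ray_integral k (\<lambda>y. q y * volterra_term k q n y) y"
      if "y \<in> \<Omega>" for y
      using Suc.IH[OF ray[OF that]] assms(1)[OF ray[OF that]]
      by (auto simp: ray_integral_def intro!: arg_cong[of _ _ "\<lambda>z. y * z"] integral_cong)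
    have "integral {0..1} (\<lambda>r. ray_integral k (\<lambda>y. q y * volterra_term k q n y) (- (of_real r * x))) =
      integral {0..1} (\<lambda>r. - ray_integral k (\<lambda>y. q y * volterra_term k q n y) (of_real r * x))"
      by (rule integral_cong) (use 1 ray[OF Suc.prems] in auto)
    then show ?case by (simp add: ray_integral_def[of 0])
  qed simp
  then show ?thesis unfolding volterra_sum_def using assms(2) by simp
qed

end

text \<open>The exponent \<open>k = 2 * j\<close> turns the Volterra series into the solution \<open>x ^ j * (1 + \<dots>)\<close> of
  \<open>f'' = (j * (j - 1) / x\<^sup>2 + q) f\<close>.\<close>

definition frob :: "nat \<Rightarrow> (complex \<Rightarrow> complex) \<Rightarrow> complex \<Rightarrow> complex" where
  "frob j q x = x ^ j * volterra_sum (2 * j) q x"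

definition frob' :: "nat \<Rightarrow> (complex \<Rightarrow> complex) \<Rightarrow> complex \<Rightarrow> complex" where
  "frob' j q x = of_nat j * x ^ (j - 1) * volterra_sum (2 * j) q x
     + x ^ j * ray_integral (2 * j) (\<lambda>y. q y * volterra_sum (2 * j) q y) x"

lemma volterra_sum_0: "volterra_sum k q 0 = 1"
proof -
  have "volterra_term k q n 0 = (if n = 0 then 1 else 0)" for n
    by (cases n) (auto simp: ray_integral_def)
  then have "(\<lambda>n. volterra_term k q n 0) = (\<lambda>n. if n = 0 then 1 else 0)" by (rule ext)
  then have "(\<lambda>n. volterra_term k q n 0) sums 1"
    using sums_single[of 0 "\<lambda>_. 1 :: complex"] by simp
  then show ?thesis unfolding volterra_sum_def by (rule sums_unique[symmetric])
qed

lemma frob_deriv: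
  assumes star: "star_zero \<Omega>" and q: "q holomorphic_on \<Omega>" and x: "x \<in> \<Omega>"
  shows "(frob j q has_field_derivative frob' j q x) (at x)"
proof -
  define G where "G = (\<lambda>y. q y * volterra_sum (2 * j) q y)"
  have op: "open \<Omega>" using star by (simp add: star_zero_def)
  have G: "G holomorphic_on \<Omega>"
    unfolding G_def by (intro holomorphic_intros q volterra_sum_holomorphic[OF star q])
  have "((\<lambda>x. 1 + x ^ 0 * ray_integral 0 (ray_integral (2 * j) G) x) has_field_derivative x ^ 0 * ray_integral (2 * j) G x) (at x)"
    using ray_integral_primitive[OF star q ray_integral_holomorphic[OF star q G] x, of 0]
    by (auto intro!: derivative_eq_intros)
  then have "(volterra_sum (2 * j) q has_field_derivative x ^ 0 * ray_integral (2 * j) G x) (at x)"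
    by (rule has_field_derivative_transform_within_open[OF _ op x])
      (use volterra_sum_fixpoint[OF star q] in \<open>simp add: G_def\<close>)
  then have "((\<lambda>x. x ^ j * volterra_sum (2 * j) q x) has_field_derivative frob' j q x) (at x)"
    unfolding frob'_def G_def by (auto intro!: derivative_eq_intros simp: mult_ac)
  then show ?thesis by (simp add: frob_def[abs_def])
qed

text \<open>For j <= 1 the singular term is 0 / x^2, which is 0 also at x = 0 by the convention for
  division by zero. The equation is then available at the centre itself, as the fundamental
  solutions at a regular point require.\<close>

lemma frob'_deriv:
  assumes star: "star_zero \<Omega>" and q: "q holomorphic_on \<Omega>" and x: "x \<in> \<Omega>" and x0: "x \<noteq> 0 \<or> j \<le> 1"
  shows "(frob' j q has_field_derivative (of_nat (j * (j - 1)) / x\<^sup>2 + q x) * frob j q x) (at x)"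
proof -
  define g where "g = volterra_sum (2 * j) q"
  define G where "G = (\<lambda>y. q y * g y)"
  define v where "v = ray_integral (2 * j) G"
  have op: "open \<Omega>" using star by (simp add: star_zero_def)
  have G: "G holomorphic_on \<Omega>"
    unfolding G_def g_def by (intro holomorphic_intros q volterra_sum_holomorphic[OF star q])
  have v: "v holomorphic_on \<Omega>" unfolding v_def by (rule ray_integral_holomorphic[OF star q G])
  obtain v' where v': "(v has_field_derivative v') (at x)"
    using holomorphic_on_imp_differentiable_at[OF v op x] by (auto simp: field_differentiable_def)
  have g': "(g has_field_derivative v x) (at x)"
  proof -
    have "((\<lambda>x. 1 + x ^ 0 * ray_integral 0 v x) has_field_derivative x ^ 0 * v x) (at x)"
      using ray_integral_primitive[OF star q v x, of 0] by (auto intro!: derivative_eq_intros)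
    then have "(g has_field_derivative x ^ 0 * v x) (at x)"
      by (rule has_field_derivative_transform_within_open[OF _ op x])
        (use volterra_sum_fixpoint[OF star q] in \<open>simp add: G_def g_def v_def\<close>)
    then show ?thesis by simp
  qed
  \<comment> \<open>Here v is g'. Computing the derivative of x^(2j) v once as a primitive and once
    by the product rule yields the equation for v multiplied by a power of x, which the case
    distinction below cancels.\<close>
  have "((\<lambda>x. x ^ (2*j) * v x) has_field_derivative x ^ (2*j) * G x) (at x)"
    unfolding v_def by (rule ray_integral_primitive[OF star q G x])
  moreover have "((\<lambda>x. x ^ (2*j) * v x) has_field_derivative of_nat (2*j) * x ^ (2*j-1) * v x + x ^ (2*j) * v') (at x)"
    by (rule derivative_eq_intros v' refl)+ simp
  ultimately have e: "x ^ (2*j) * G x = of_nat (2*j) * x ^ (2*j-1) * v x + x ^ (2*j) * v'"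
    using DERIV_unique by blast
  have d: "((\<lambda>x. of_nat j * x ^ (j - 1) * g x + x ^ j * v x) has_field_derivative
      of_nat j * (of_nat (j - 1) * x ^ (j - 1 - 1)) * g x + of_nat j * x ^ (j - 1) * v x + of_nat j * x ^ (j - 1) * v x + x ^ j * v') (at x)"
    by (rule derivative_eq_intros v' g' refl)+ (simp add: algebra_simps)
  have "of_nat j * (of_nat (j - 1) * x ^ (j - 1 - 1)) * g x + of_nat j * x ^ (j - 1) * v x + of_nat j * x ^ (j - 1) * v x + x ^ j * v'
     = (of_nat (j * (j - 1)) / x\<^sup>2 + q x) * (x ^ j * g x)"
  proof (cases "x = 0")
    case True
    moreover have "v 0 = 0" by (simp add: v_def ray_integral_def)
    ultimately show ?thesis using x0 e by (cases "j = 0") (auto simp: G_def)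
  next
    case False
    consider "j = 0" | "j = 1" | i where "j = Suc (Suc i)" by (cases j; cases "j - 1") auto
    then show ?thesis
    proof cases
      case 1 then show ?thesis using e by (simp add: G_def)
    next
      case 2
      have "2 * x * v x + x ^ 2 * v' = x^2 * G x" using e 2 by simp
      then have "x * (2 * v x + x * v') = x * (x * G x)" by (simp add: power2_eq_square algebra_simps)
      then have "2 * v x + x * v' = x * G x" using False by simp
      then show ?thesis using 2 by (simp add: G_def algebra_simps)
    next
      case (3 i)
      have "x ^ (2*j) = x^(2*j-1) * x" using 3 by (simp add: power_Suc2[symmetric] del: power_Suc)
      then have "x^(2*j-1) * (x * G x) = x^(2*j-1) * (of_nat (2*j) * v x + x * v')" using e by (simp add: algebra_simps)
      then have e': "x * G x = of_nat (2*j) * v x + x * v'" using False by simp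
      have "of_nat j * x ^ (j - 1) * v x + of_nat j * x ^ (j - 1) * v x + x ^ j * v' = x ^ (j - 1) * (of_nat (2*j) * v x + x * v')"
        using 3 by (simp add: algebra_simps)
      also have "\<dots> = x ^ (j - 1) * (x * G x)" by (simp only: e')
      also have "\<dots> = x ^ j * G x" using 3 by simp
      finally have E1: "of_nat j * x ^ (j - 1) * v x + (of_nat j * x ^ (j - 1) * v x + x ^ j * v') = q x * (x ^ j * g x)"
        by (simp add: G_def algebra_simps)
      have E2: "of_nat j * (of_nat (j - 1) * x ^ (j - 1 - 1)) * g x = of_nat (j * (j - 1)) / x\<^sup>2 * (x ^ j * g x)"
        using 3 False by (simp add: field_simps power2_eq_square)
      show ?thesis by (simp only: E1 E2 add.assoc distrib_right)
    qed
  qed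
  then show ?thesis using d unfolding frob'_def[abs_def] frob_def g_def[symmetric] v_def G_def by (simp add: g_def)
qed

subsection \<open>The Weierstrass function\<close>

definition lattice_pt :: "complex \<Rightarrow> int \<times> int \<Rightarrow> complex" where
  "lattice_pt \<tau> mn = of_int (fst mn) + of_int (snd mn) * \<tau>"

definition wp_term :: "complex \<Rightarrow> int \<times> int \<Rightarrow> complex \<Rightarrow> complex" where
  "wp_term \<tau> mn z = 1 / (z - lattice_pt \<tau> mn)\<^sup>2 - 1 / (lattice_pt \<tau> mn)\<^sup>2"

definition wp_reg :: "complex \<Rightarrow> complex \<Rightarrow> complex" where
  "wp_reg \<tau> z = infsum (\<lambda>w. 1 / (z - w)^2 - 1 / w^2) (lattice \<tau> - {0})"

definition l1_norm :: "int \<times> int \<Rightarrow> real" where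
  "l1_norm mn = of_int (\<bar>fst mn\<bar> + \<bar>snd mn\<bar>)"

lemma wp_eq: "wp \<tau> z = 1 / z\<^sup>2 + wp_reg \<tau> z"
  by (simp add: wp_def wp_reg_def)

lemma lattice_eq_range: "lattice \<tau> = range (lattice_pt \<tau>)"
proof -
  have "of_int m + of_int n * \<tau> \<in> range (lattice_pt \<tau>)" for m n
    by (rule range_eqI[of _ _ "(m, n)"]) (simp add: lattice_pt_def)
  then show ?thesis by (auto simp: lattice_def lattice_pt_def)
qed

lemma Im_lattice_pt: "Im (lattice_pt \<tau> mn) = of_int (snd mn) * Im \<tau>"
  by (simp add: lattice_pt_def)

lemma inj_lattice_pt:
  assumes "Im \<tau> > 0" shows "inj (lattice_pt \<tau>)"
proof (rule injI)
  fix p q assume eq: "lattice_pt \<tau> p = lattice_pt \<tau> q"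
  then have "Im (lattice_pt \<tau> p) = Im (lattice_pt \<tau> q)" by simp
  then have "snd p = snd q" using assms by (simp add: Im_lattice_pt)
  with eq show "p = q" by (simp add: lattice_pt_def prod_eq_iff)
qed

lemma lattice_pt_eq_0_iff:
  assumes "Im \<tau> > 0" shows "lattice_pt \<tau> mn = 0 \<longleftrightarrow> mn = (0, 0)"
  using injD[OF inj_lattice_pt[OF assms], of mn "(0,0)"] by (auto simp: lattice_pt_def)

lemma lattice_minus_0:
  assumes "Im \<tau> > 0" shows "lattice \<tau> - {0} = lattice_pt \<tau> ` (UNIV - {(0,0)})"
  using lattice_pt_eq_0_iff[OF assms] by (auto simp: lattice_eq_range)

lemma wp_reg_alt:
  assumes "Im \<tau> > 0"
  shows "wp_reg \<tau> z = infsum (\<lambda>mn. wp_term \<tau> mn z) (UNIV - {(0,0)})"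
  unfolding wp_reg_def lattice_minus_0[OF assms] wp_term_def
  by (subst infsum_reindex) (auto intro: inj_on_subset[OF inj_lattice_pt[OF assms]] simp: o_def)

text \<open>The imaginary part of w = m + n tau is n Im tau, so |n| <= |w| / a; then |m| <= |w| +
  |n| b. The constant depends only on a and b, so it is uniform over a region of moduli.\<close>

lemma l1_norm_le:
  assumes "a > 0" "Im \<tau> \<ge> a" "norm \<tau> \<le> b"
  shows "l1_norm mn \<le> (1 + (1 + b) / a) * norm (lattice_pt \<tau> mn)"
proof -
  let ?w = "lattice_pt \<tau> mn"
  have b: "b \<ge> 0" using assms(3) norm_ge_zero order_trans by blast
  have "real_of_int \<bar>snd mn\<bar> * a \<le> \<bar>real_of_int (snd mn)\<bar> * Im \<tau>"
    using assms by (simp add: mult_left_mono)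
  also have "\<dots> = \<bar>Im ?w\<bar>" using assms by (simp add: Im_lattice_pt abs_mult)
  also have "\<dots> \<le> norm ?w" by (rule abs_Im_le_cmod)
  finally have n: "real_of_int \<bar>snd mn\<bar> \<le> norm ?w / a" using assms by (simp add: field_simps)
  have "real_of_int \<bar>fst mn\<bar> = norm (?w - of_int (snd mn) * \<tau>)"
    by (simp add: lattice_pt_def)
  also have "\<dots> \<le> norm ?w + real_of_int \<bar>snd mn\<bar> * norm \<tau>"
    using norm_triangle_ineq4[of ?w "of_int (snd mn) * \<tau>"] by (simp add: norm_mult)
  also have "\<dots> \<le> norm ?w + norm ?w / a * b"
    using n assms b by (intro add_left_mono mult_mono) auto
  finally show ?thesis using n assms by (simp add: l1_norm_def field_simps)
qed

lemma finite_l1_ball: "finite {mn. l1_norm mn \<le> K}"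
proof (rule finite_subset)
  show "{mn. l1_norm mn \<le> K} \<subseteq> {-\<lceil>K\<rceil>..\<lceil>K\<rceil>} \<times> {-\<lceil>K\<rceil>..\<lceil>K\<rceil>}"
  proof
    fix mn assume "mn \<in> {mn. l1_norm mn \<le> K}"
    then have "\<bar>fst mn\<bar> + \<bar>snd mn\<bar> \<le> \<lceil>K\<rceil>" unfolding l1_norm_def by (simp add: le_ceiling_iff)
    then show "mn \<in> {-\<lceil>K\<rceil>..\<lceil>K\<rceil>} \<times> {-\<lceil>K\<rceil>..\<lceil>K\<rceil>}" by (cases mn) auto
  qed
qed auto

section \<open>A summable majorant for sums over the lattice\<close>

definition int_weight :: "int \<Rightarrow> real" where
  "int_weight n = (1 + real_of_int \<bar>n\<bar>) powr (-3/2)"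

lemma summable_int_weight: "int_weight summable_on UNIV"
proof -
  have s: "summable (\<lambda>n. real n powr (-3/2))" by (simp add: summable_real_powr_iff)
  have 1: "summable (\<lambda>n. int_weight (int n))"
    using summable_ignore_initial_segment[OF s, of 1] by (simp add: int_weight_def add.commute)
  have 2: "summable (\<lambda>n. int_weight (- int n - 1))"
  proof -
    have "int_weight (- int n - 1) = real (n + 2) powr (-3/2)" for n
      unfolding int_weight_def by (rule arg_cong[of _ _ "\<lambda>x. x powr (-3/2)"]) simp
    then show ?thesis using summable_ignore_initial_segment[OF s, of 2] by simp
  qed
  have "int_weight summable_on range int"
    using 1 by (subst summable_on_reindex) (auto simp: o_def int_weight_def intro!: summable_on_UNIV_nonneg_real_iff[THEN iffD2])
  moreover have "int_weight summable_on range (\<lambda>n. - int n - 1)"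
    using 2 by (subst summable_on_reindex) (auto simp: o_def int_weight_def inj_def intro!: summable_on_UNIV_nonneg_real_iff[THEN iffD2])
  moreover have "range int \<inter> range (\<lambda>n. - int n - 1) = {}" by auto
  ultimately have "int_weight summable_on (range int \<union> range (\<lambda>n. - int n - 1))"
    by (rule summable_on_Un_disjoint)
  moreover have "range int \<union> range (\<lambda>n. - int n - 1) = UNIV"
  proof -
    have "x \<in> range int \<union> range (\<lambda>n. - int n - 1)" for x
    proof (cases "x \<ge> 0")
      case True then have "x = int (nat x)" by simp
      then show ?thesis by blast
    next
      case False then have "x = - int (nat (- x - 1)) - 1" by simp
      then show ?thesis by blast
    qed
    then show ?thesis by blast
  qed
  ultimately show ?thesis by simp
qed

text \<open>With s = |m| + |n| >= 1 one has (1 + |m|)(1 + |n|) <= (2s)^2. Raising this to the power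
  -3/2 bounds 1/s^3 by 8 times a product of two one-dimensional weights, so the double sum
  factors.\<close>

lemma summable_l1_cube: "(\<lambda>mn. 1 / l1_norm mn ^ 3) summable_on (UNIV - {(0,0)})"
proof -
  have nonneg: "int_weight n \<ge> 0" for n by (simp add: int_weight_def)
  have "(\<lambda>(m, n). int_weight m * int_weight n) summable_on UNIV \<times> UNIV"
  proof (rule summable_on_SigmaI)
    show "((\<lambda>n. (case (m, n) of (m, n) \<Rightarrow> int_weight m * int_weight n)) has_sum int_weight m * infsum int_weight UNIV) UNIV" for m
      using has_sum_cmult_right[OF has_sum_infsum[OF summable_int_weight]] by simp
    show "(\<lambda>m. int_weight m * infsum int_weight UNIV) summable_on UNIV"
      by (intro summable_on_cmult_left summable_int_weight)
  qed (auto simp: nonneg)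
  then have "(\<lambda>mn. 8 * (int_weight (fst mn) * int_weight (snd mn))) summable_on UNIV"
    by (intro summable_on_cmult_right) (simp add: case_prod_unfold)
  then have sm: "(\<lambda>mn. 8 * (int_weight (fst mn) * int_weight (snd mn))) summable_on (UNIV - {(0,0)})"
    by (rule summable_on_cofin_subset) simp
  have "(\<lambda>mn. norm (1 / l1_norm mn ^ 3)) summable_on (UNIV - {(0,0)})"
  proof (rule Infinite_Sum.abs_summable_on_comparison_test'[OF sm])
    fix mn :: "int \<times> int" assume mn: "mn \<in> UNIV - {(0,0)}"
    define s where "s = l1_norm mn"
    have "\<bar>fst mn\<bar> + \<bar>snd mn\<bar> \<ge> 1" using mn by (cases mn) auto
    then have s1: "s \<ge> 1" unfolding s_def l1_norm_def by linarith
    have "(1 + real_of_int \<bar>fst mn\<bar>) * (1 + real_of_int \<bar>snd mn\<bar>) \<le> (2 * s) * (2 * s)"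
      using s1 by (intro mult_mono) (auto simp: s_def l1_norm_def)
    then have "((2 * s) * (2 * s)) powr (-3/2) \<le> ((1 + real_of_int \<bar>fst mn\<bar>) * (1 + real_of_int \<bar>snd mn\<bar>)) powr (-3/2)"
      by (intro powr_mono2') (auto intro!: mult_pos_pos add_pos_nonneg)
    also have "\<dots> = int_weight (fst mn) * int_weight (snd mn)"
      by (simp add: int_weight_def powr_mult)
    also have "((2 * s) * (2 * s)) powr (-3/2) = 1 / (8 * s ^ 3)"
    proof -
      have "((2 * s) * (2 * s)) powr (-3/2) = ((2 * s) powr 2) powr (-3/2)"
        using s1 by (simp add: power2_eq_square[symmetric])
      also have "\<dots> = (2 * s) powr (-3)" by (simp add: powr_powr)
      also have "\<dots> = 1 / (2 * s) ^ 3"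
        using s1 by (simp add: powr_minus_divide powr_numeral)
      finally show ?thesis by (simp add: power3_eq_cube mult_ac)
    qed
    finally show "norm (1 / l1_norm mn ^ 3) \<le> 8 * (int_weight (fst mn) * int_weight (snd mn))"
      using s1 by (simp add: s_def[symmetric] field_simps)
  qed
  then show ?thesis by (rule summable_on_iff_abs_summable_on_real[THEN iffD2])
qed

text \<open>The term equals z (2w - z) / ((z - w)^2 w^2). From |z| <= |w| / 2 follow |2w - z| <= 5/2
  |w| and |z - w| >= |w| / 2, so the constant is 10 = 5/2 times 4.\<close>

lemma wp_term_bound:
  assumes R: "R > 0" "norm z \<le> R" and w: "norm (lattice_pt \<tau> mn) \<ge> 2 * R"
  shows "norm (wp_term \<tau> mn z) \<le> 10 * R / norm (lattice_pt \<tau> mn) ^ 3"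
proof -
  let ?w = "lattice_pt \<tau> mn"
  have w0: "norm ?w > 0" using R w by linarith
  have zw: "norm (z - ?w) \<ge> norm ?w / 2"
    using norm_triangle_ineq2[of ?w z] R w by (simp add: norm_minus_commute)
  have zw0: "z - ?w \<noteq> 0" using zw w0 by auto
  have "wp_term \<tau> mn z = z * (2 * ?w - z) / ((z - ?w)\<^sup>2 * ?w\<^sup>2)"
  proof -
    have "1 / (z - ?w)\<^sup>2 - 1 / ?w\<^sup>2 = (?w\<^sup>2 - (z - ?w)\<^sup>2) / ((z - ?w)\<^sup>2 * ?w\<^sup>2)"
      using w0 zw0 by (simp add: diff_frac_eq)
    also have "?w\<^sup>2 - (z - ?w)\<^sup>2 = z * (2 * ?w - z)" by (simp add: power2_eq_square algebra_simps)
    finally show ?thesis by (simp add: wp_term_def)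
  qed
  then have "norm (wp_term \<tau> mn z) = norm z * norm (2 * ?w - z) / ((norm (z - ?w))\<^sup>2 * (norm ?w)\<^sup>2)"
    by (simp add: norm_mult norm_divide norm_power)
  also have "\<dots> \<le> R * (5 / 2 * norm ?w) / ((norm ?w / 2)\<^sup>2 * (norm ?w)\<^sup>2)"
  proof (intro frac_le mult_mono power_mono)
    show "norm (2 * ?w - z) \<le> 5 / 2 * norm ?w"
      using norm_triangle_ineq4[of "2 * ?w" z] R w by (simp add: norm_mult)
  qed (use R zw w0 in auto)
  also have "\<dots> = 10 * R / norm ?w ^ 3"
    using w0 by (simp add: field_simps power2_eq_square power3_eq_cube)
  finally show ?thesis .
qed

context
  fixes a b R :: real and N :: "(int \<times> int) set"
  assumes a: "a > 0" and R: "R > 0" and b: "b \<ge> 0"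
  defines "N \<equiv> {mn. l1_norm mn \<le> (1 + (1 + b) / a) * (2 * R)}"
begin

private lemma far:
  assumes "Im \<tau> \<ge> a" "norm \<tau> \<le> b" "mn \<notin> N"
  shows "norm (lattice_pt \<tau> mn) > 2 * R"
proof -
  have C: "1 + (1 + b) / a > 0" using a b by (simp add: add_pos_nonneg)
  have "(1 + (1 + b) / a) * (2 * R) < (1 + (1 + b) / a) * norm (lattice_pt \<tau> mn)"
    using l1_norm_le[OF a assms(1,2), of mn] assms(3) unfolding N_def by simp
  then show ?thesis using C by (simp add: mult_less_cancel_left_pos)
qed

text \<open>\<open>N\<close> is finite and independent of z and tau: outside it every lattice point
  has modulus above 2R for all moduli in the region. This gives one majorant for arguments and
  moduli at once.\<close>

lemma wp_tail_bound:
  assumes "Im \<tau> \<ge> a" "norm \<tau> \<le> b" "norm z \<le> R" "mn \<notin> N"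
  shows "norm (wp_term \<tau> mn z) \<le> 10 * R * (1 + (1 + b) / a) ^ 3 * (1 / l1_norm mn ^ 3)"
proof -
  let ?w = "lattice_pt \<tau> mn" and ?C = "1 + (1 + b) / a"
  have C: "?C > 0" using a b by (simp add: add_pos_nonneg)
  have w: "norm ?w > 2 * R" by (rule far[OF assms(1,2,4)])
  have l: "l1_norm mn > 0"
  proof -
    have "0 < ?C * (2 * R)" using C R by simp
    also have "\<dots> < l1_norm mn" using assms(4) by (simp add: N_def)
    finally show ?thesis .
  qed
  have "norm (wp_term \<tau> mn z) \<le> 10 * R / norm ?w ^ 3"
    using wp_term_bound[OF R assms(3), of \<tau> mn] w by simp
  also have "\<dots> \<le> 10 * R / (l1_norm mn / ?C) ^ 3"
    using l C R l1_norm_le[OF a assms(1,2), of mn]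
    by (intro divide_left_mono power_mono mult_pos_pos zero_less_power) (auto simp: field_simps)
  finally show ?thesis by (simp add: power_divide)
qed

lemma uniform_limit_wp_tail:
  assumes Y: "\<And>y. y \<in> Y \<Longrightarrow> Im (\<theta> y) \<ge> a \<and> norm (\<theta> y) \<le> b \<and> norm (\<zeta> y) \<le> R"
  shows "uniform_limit Y (\<lambda>X y. \<Sum>mn\<in>X. wp_term (\<theta> y) mn (\<zeta> y))
    (\<lambda>y. infsum (\<lambda>mn. wp_term (\<theta> y) mn (\<zeta> y)) (UNIV - insert (0,0) N)) (finite_subsets_at_top (UNIV - insert (0,0) N))"
proof (rule Weierstrass_m_test_general)
  show "(\<lambda>mn. 10 * R * (1 + (1 + b) / a) ^ 3 * (1 / l1_norm mn ^ 3)) summable_on (UNIV - insert (0,0) N)"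
    by (intro summable_on_cmult_right summable_on_subset_banach[OF summable_l1_cube]) auto
qed (use Y wp_tail_bound in auto)

lemma wp_term_summable_tail:
  assumes "Im \<tau> \<ge> a" "norm \<tau> \<le> b" "norm z \<le> R"
  shows "(\<lambda>mn. wp_term \<tau> mn z) summable_on (UNIV - insert (0,0) N)"
proof (rule abs_summable_summable, rule Infinite_Sum.abs_summable_on_comparison_test')
  show "(\<lambda>mn. 10 * R * (1 + (1 + b) / a) ^ 3 * (1 / l1_norm mn ^ 3)) summable_on (UNIV - insert (0,0) N)"
    by (intro summable_on_cmult_right summable_on_subset_banach[OF summable_l1_cube]) auto
qed (use assms wp_tail_bound in auto)

lemma wp_reg_split:
  assumes "Im \<tau> \<ge> a" "norm \<tau> \<le> b" "norm z \<le> R"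
  shows "wp_reg \<tau> z = (\<Sum>mn\<in>N - {(0,0)}. wp_term \<tau> mn z) + infsum (\<lambda>mn. wp_term \<tau> mn z) (UNIV - insert (0,0) N)"
    and "(\<lambda>mn. wp_term \<tau> mn z) summable_on UNIV - {(0,0)}"
proof -
  have fin: "finite N" unfolding N_def using finite_l1_ball by simp
  have U: "UNIV - {(0,0)} = (N - {(0,0)}) \<union> (UNIV - insert (0,0) N)" by auto
  have "Im \<tau> > 0" using a assms by linarith
  then show "wp_reg \<tau> z = (\<Sum>mn\<in>N - {(0,0)}. wp_term \<tau> mn z) + infsum (\<lambda>mn. wp_term \<tau> mn z) (UNIV - insert (0,0) N)"
    unfolding wp_reg_alt[OF \<open>Im \<tau> > 0\<close>] U
    by (subst infsum_Un_disjoint) (auto simp: fin intro!: wp_term_summable_tail assms)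
  show "(\<lambda>mn. wp_term \<tau> mn z) summable_on UNIV - {(0,0)}"
    unfolding U by (rule summable_on_Un_disjoint) (auto simp: fin intro!: wp_term_summable_tail assms)
qed

end

lemma lattice_avoid:
  assumes "z \<notin> lattice \<tau> - {0}" "Im \<tau> > 0" "mn \<noteq> (0,0)"
  shows "z \<noteq> lattice_pt \<tau> mn" "lattice_pt \<tau> mn \<noteq> 0"
  using assms lattice_pt_eq_0_iff[OF assms(2), of mn] by (auto simp: lattice_eq_range)

lemma wp_term_summable:
  assumes "Im \<tau> > 0"
  shows "(\<lambda>mn. wp_term \<tau> mn z) summable_on UNIV - {(0,0)}"
  by (rule wp_reg_split(2)[of "Im \<tau>" "norm z + 1" "norm \<tau>"]) (use assms in \<open>auto intro: add_nonneg_pos\<close>)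

section \<open>Joint analyticity of the Weierstrass function in argument and modulus\<close>

lemma holomorphic_wp_reg_curve:
  assumes S: "open S" and \<zeta>: "\<zeta> holomorphic_on S" and \<theta>: "\<theta> holomorphic_on S"
    and \<tau>: "\<And>\<sigma>. \<sigma> \<in> S \<Longrightarrow> Im (\<theta> \<sigma>) > 0 \<and> \<zeta> \<sigma> \<notin> lattice (\<theta> \<sigma>) - {0}"
  shows "(\<lambda>\<sigma>. wp_reg (\<theta> \<sigma>) (\<zeta> \<sigma>)) holomorphic_on S"
proof -
  have "\<exists>d>0. (\<lambda>\<sigma>. wp_reg (\<theta> \<sigma>) (\<zeta> \<sigma>)) holomorphic_on ball \<sigma>0 d" if \<sigma>0: "\<sigma>0 \<in> S" for \<sigma>0
  proof -
    define a where "a = Im (\<theta> \<sigma>0) / 2"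
    define b where "b = norm (\<theta> \<sigma>0) + 1"
    define R where "R = norm (\<zeta> \<sigma>0) + 1"
    define N where "N = {mn. l1_norm mn \<le> (1 + (1 + b) / a) * (2 * R)}"
    have abR: "a > 0" "b \<ge> 0" "R > 0" using \<tau>[OF \<sigma>0] by (auto simp: a_def b_def R_def add_nonneg_pos)
    have "open (S \<inter> (\<lambda>\<sigma>. (\<theta> \<sigma>, \<zeta> \<sigma>)) -` (({t. Im t > a} \<inter> ball 0 b) \<times> ball 0 R))"
      using S \<zeta> \<theta> open_halfspace_Im_gt[of a]
      by (intro continuous_open_preimage continuous_intros holomorphic_on_imp_continuous_on open_Times open_Int) auto
    moreover have "\<sigma>0 \<in> S \<inter> (\<lambda>\<sigma>. (\<theta> \<sigma>, \<zeta> \<sigma>)) -` (({t. Im t > a} \<inter> ball 0 b) \<times> ball 0 R)"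
      using \<sigma>0 \<tau>[OF \<sigma>0] by (auto simp: a_def b_def R_def)
    ultimately obtain d where d: "d > 0" "cball \<sigma>0 d \<subseteq> S \<inter> (\<lambda>\<sigma>. (\<theta> \<sigma>, \<zeta> \<sigma>)) -` (({t. Im t > a} \<inter> ball 0 b) \<times> ball 0 R)"
      by (meson open_contains_cball)
    have dS: "cball \<sigma>0 d \<subseteq> S" "ball \<sigma>0 d \<subseteq> S" using d by auto
    have bd: "Im (\<theta> y) \<ge> a \<and> norm (\<theta> y) \<le> b \<and> norm (\<zeta> y) \<le> R" if "y \<in> cball \<sigma>0 d" for y
    proof -
      have "y \<in> (\<lambda>\<sigma>. (\<theta> \<sigma>, \<zeta> \<sigma>)) -` (({t. Im t > a} \<inter> ball 0 b) \<times> ball 0 R)" using d that by blast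
      then show ?thesis by (auto simp: less_imp_le)
    qed
    have term_hol: "(\<lambda>y. wp_term (\<theta> y) mn (\<zeta> y)) holomorphic_on S" if "mn \<noteq> (0,0)" for mn
      unfolding wp_term_def
    proof (intro holomorphic_intros \<zeta> \<theta>)
      have av: "\<zeta> z \<noteq> lattice_pt (\<theta> z) mn" "lattice_pt (\<theta> z) mn \<noteq> 0" if "z \<in> S" for z
        using lattice_avoid[OF _ _ \<open>mn \<noteq> (0,0)\<close>] \<tau>[OF that] by blast+
      show "(\<lambda>y. lattice_pt (\<theta> y) mn) holomorphic_on S" unfolding lattice_pt_def by (intro holomorphic_intros \<theta>)
      then show "(\<lambda>y. lattice_pt (\<theta> y) mn) holomorphic_on S" .
      show "\<And>z. z \<in> S \<Longrightarrow> (\<zeta> z - lattice_pt (\<theta> z) mn)\<^sup>2 \<noteq> 0" "\<And>z. z \<in> S \<Longrightarrow> (lattice_pt (\<theta> z) mn)\<^sup>2 \<noteq> 0"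
        using av by auto
    qed
    \<comment> \<open>Off the finite set \<open>N\<close> the series converges uniformly on the
      closed ball, so its sum is holomorphic inside; the finitely many remaining terms are
      holomorphic on their own.\<close>
    have tail: "(\<lambda>y. infsum (\<lambda>mn. wp_term (\<theta> y) mn (\<zeta> y)) (UNIV - insert (0,0) N)) holomorphic_on ball \<sigma>0 d"
    proof -
      have ul: "uniform_limit (cball \<sigma>0 d) (\<lambda>X y. \<Sum>mn\<in>X. wp_term (\<theta> y) mn (\<zeta> y))
        (\<lambda>y. infsum (\<lambda>mn. wp_term (\<theta> y) mn (\<zeta> y)) (UNIV - insert (0,0) N)) (finite_subsets_at_top (UNIV - insert (0,0) N))"
        unfolding N_def by (rule uniform_limit_wp_tail[OF abR(1,3,2)]) (use bd in auto)
      have ev: "\<forall>\<^sub>F X in finite_subsets_at_top (UNIV - insert (0,0) N).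
         continuous_on (cball \<sigma>0 d) (\<lambda>y. \<Sum>mn\<in>X. wp_term (\<theta> y) mn (\<zeta> y)) \<and>
         (\<lambda>y. \<Sum>mn\<in>X. wp_term (\<theta> y) mn (\<zeta> y)) holomorphic_on ball \<sigma>0 d"
      proof (rule eventually_finite_subsets_at_top_weakI)
        fix X assume X: "finite X" "X \<subseteq> UNIV - insert (0,0) N"
        have "(\<lambda>y. \<Sum>mn\<in>X. wp_term (\<theta> y) mn (\<zeta> y)) holomorphic_on S"
          using X by (intro holomorphic_on_sum term_hol) auto
        then show "continuous_on (cball \<sigma>0 d) (\<lambda>y. \<Sum>mn\<in>X. wp_term (\<theta> y) mn (\<zeta> y)) \<and>
         (\<lambda>y. \<Sum>mn\<in>X. wp_term (\<theta> y) mn (\<zeta> y)) holomorphic_on ball \<sigma>0 d"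
          using dS holomorphic_on_subset holomorphic_on_imp_continuous_on by blast
      qed
      show ?thesis by (rule holomorphic_uniform_limit[OF ev ul]) auto
    qed
    have "(\<lambda>y. (\<Sum>mn\<in>N - {(0,0)}. wp_term (\<theta> y) mn (\<zeta> y)) + infsum (\<lambda>mn. wp_term (\<theta> y) mn (\<zeta> y)) (UNIV - insert (0,0) N))
      holomorphic_on ball \<sigma>0 d"
      using dS by (intro holomorphic_on_add tail holomorphic_on_sum holomorphic_on_subset[OF term_hol]) auto
    moreover have "wp_reg (\<theta> y) (\<zeta> y) = (\<Sum>mn\<in>N - {(0,0)}. wp_term (\<theta> y) mn (\<zeta> y)) + infsum (\<lambda>mn. wp_term (\<theta> y) mn (\<zeta> y)) (UNIV - insert (0,0) N)"
      if "y \<in> ball \<sigma>0 d" for y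
      unfolding N_def by (rule wp_reg_split(1)[OF abR(1,3,2)]) (use bd that in auto)
    ultimately have "(\<lambda>\<sigma>. wp_reg (\<theta> \<sigma>) (\<zeta> \<sigma>)) holomorphic_on ball \<sigma>0 d"
      by (intro holomorphic_transform[of _ "ball \<sigma>0 d" "\<lambda>\<sigma>. wp_reg (\<theta> \<sigma>) (\<zeta> \<sigma>)"]) auto
    then show ?thesis using d(1) by blast
  qed
  then have "(\<lambda>\<sigma>. wp_reg (\<theta> \<sigma>) (\<zeta> \<sigma>)) field_differentiable (at \<sigma>)" if "\<sigma> \<in> S" for \<sigma>
    using that holomorphic_on_imp_differentiable_at[OF _ open_ball] centre_in_ball by blast
  then show ?thesis by (auto intro: holomorphic_onI field_differentiable_at_within)
qed

lemma continuous_on_wp_reg: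
  "continuous_on {(z, \<tau>). Im \<tau> > 0 \<and> z \<notin> lattice \<tau> - {0}} (\<lambda>(z, \<tau>). wp_reg \<tau> z)" (is "continuous_on ?U _")
proof -
  have "continuous (at p within ?U) (\<lambda>(z, \<tau>). wp_reg \<tau> z)" if p: "p \<in> ?U" for p
  proof -
    define a where "a = Im (snd p) / 2"
    define b where "b = norm (snd p) + 1"
    define R where "R = norm (fst p) + 1"
    define N where "N = {mn. l1_norm mn \<le> (1 + (1 + b) / a) * (2 * R)}"
    have abR: "a > 0" "b \<ge> 0" "R > 0" using p by (auto simp: a_def b_def R_def add_nonneg_pos split_beta)
    define B where "B = ball (0::complex) R \<times> ({t. Im t > a} \<inter> ball 0 b)"
    have opB: "open B" unfolding B_def by (intro open_Times open_Int open_halfspace_Im_gt) auto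
    have pB: "p \<in> B" using p by (cases p) (auto simp: B_def a_def b_def R_def)
    have bd: "Im (snd y) \<ge> a \<and> norm (snd y) \<le> b \<and> norm (fst y) \<le> R" if "y \<in> ?U \<inter> B" for y
      using that by (auto simp: B_def)
    have termc: "continuous_on (?U \<inter> B) (\<lambda>y. wp_term (snd y) mn (fst y))" if "mn \<noteq> (0,0)" for mn
      unfolding wp_term_def
    proof (intro continuous_intros)
      have av: "fst y \<noteq> lattice_pt (snd y) mn" "lattice_pt (snd y) mn \<noteq> 0" if "y \<in> ?U \<inter> B" for y
        using lattice_avoid[OF _ _ \<open>mn \<noteq> (0,0)\<close>, of "fst y" "snd y"] that by auto
      show "continuous_on (?U \<inter> B) (\<lambda>y. lattice_pt (snd y) mn)" unfolding lattice_pt_def by (intro continuous_intros)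
      then show "continuous_on (?U \<inter> B) (\<lambda>y. lattice_pt (snd y) mn)" .
      show "\<forall>y\<in>?U \<inter> B. (fst y - lattice_pt (snd y) mn)\<^sup>2 \<noteq> 0" "\<forall>y\<in>?U \<inter> B. (lattice_pt (snd y) mn)\<^sup>2 \<noteq> 0"
        using av by auto
    qed
    have tail: "continuous_on (?U \<inter> B) (\<lambda>y. infsum (\<lambda>mn. wp_term (snd y) mn (fst y)) (UNIV - insert (0,0) N))"
    proof (rule uniform_limit_theorem)
      show "uniform_limit (?U \<inter> B) (\<lambda>X y. \<Sum>mn\<in>X. wp_term (snd y) mn (fst y))
        (\<lambda>y. infsum (\<lambda>mn. wp_term (snd y) mn (fst y)) (UNIV - insert (0,0) N)) (finite_subsets_at_top (UNIV - insert (0,0) N))"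
        unfolding N_def by (rule uniform_limit_wp_tail[OF abR(1,3,2)]) (use bd in auto)
      show "\<forall>\<^sub>F X in finite_subsets_at_top (UNIV - insert (0,0) N).
         continuous_on (?U \<inter> B) (\<lambda>y. \<Sum>mn\<in>X. wp_term (snd y) mn (fst y))"
        by (rule eventually_finite_subsets_at_top_weakI, intro continuous_on_sum termc) auto
    qed auto
    have "continuous_on (?U \<inter> B) (\<lambda>y. (\<Sum>mn\<in>N - {(0,0)}. wp_term (snd y) mn (fst y)) + infsum (\<lambda>mn. wp_term (snd y) mn (fst y)) (UNIV - insert (0,0) N))"
      by (intro continuous_on_add tail continuous_on_sum termc) auto
    moreover have "wp_reg (snd y) (fst y) = (\<Sum>mn\<in>N - {(0,0)}. wp_term (snd y) mn (fst y)) + infsum (\<lambda>mn. wp_term (snd y) mn (fst y)) (UNIV - insert (0,0) N)"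
      if "y \<in> ?U \<inter> B" for y
      unfolding N_def by (rule wp_reg_split(1)[OF abR(1,3,2)]) (use bd[OF that] in auto)
    ultimately have "continuous_on (?U \<inter> B) (\<lambda>y. wp_reg (snd y) (fst y))"
      by (metis (no_types, lifting) continuous_on_eq)
    then have "continuous (at p within (?U \<inter> B)) (\<lambda>y. wp_reg (snd y) (fst y))"
      using p pB continuous_on_eq_continuous_within by blast
    moreover have "at p within (?U \<inter> B) = at p within ?U"
      using at_within_nhd[OF pB opB, of "?U \<inter> B" ?U] by blast
    ultimately show ?thesis by (simp add: split_beta')
  qed
  then show ?thesis by (simp add: continuous_on_eq_continuous_within)
qed

section \<open>Arithmetic of the lattice, parity and periodicity of the Weierstrass function\<close>

lemma lattice_uminus: "- w \<in> lattice \<tau> \<longleftrightarrow> w \<in> lattice \<tau>"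
proof -
  have "- w \<in> lattice \<tau>" if w: "w \<in> lattice \<tau>" for w
  proof -
    obtain m n where "w = of_int m + of_int n * \<tau>" using w by (auto simp: lattice_def)
    then have "- w = of_int (- m) + of_int (- n) * \<tau>" by simp
    then show ?thesis unfolding lattice_def by blast
  qed
  from this[of w] this[of "- w"] show ?thesis by auto
qed

lemma lattice_add:
  assumes "v \<in> lattice \<tau>" "w \<in> lattice \<tau>" shows "v + w \<in> lattice \<tau>"
proof -
  obtain m n m' n' where "v = of_int m + of_int n * \<tau>" "w = of_int m' + of_int n' * \<tau>"
    using assms by (auto simp: lattice_def)
  then have "v + w = of_int (m + m') + of_int (n + n') * \<tau>" by (simp add: algebra_simps)
  then show ?thesis unfolding lattice_def by blast
qed

lemma lattice_add_iff: "w \<in> lattice \<tau> \<Longrightarrow> v + w \<in> lattice \<tau> \<longleftrightarrow> v \<in> lattice \<tau>"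
  using lattice_add[of v \<tau> w] lattice_add[of "v + w" \<tau> "- w"] lattice_uminus[of w \<tau>] by auto

lemma lattice_of_int [simp]: "of_int m \<in> lattice \<tau>" "of_int n * \<tau> \<in> lattice \<tau>"
  unfolding lattice_def mem_Collect_eq
  by (rule exI[of _ m], rule exI[of _ 0], simp) (rule exI[of _ 0], rule exI[of _ n], simp)

lemma lattice_basic [simp]: "0 \<in> lattice \<tau>" "1 \<in> lattice \<tau>" "\<tau> \<in> lattice \<tau>"
  using lattice_of_int[of 0] lattice_of_int[of 1] by auto

lemma wp_uminus: "wp \<tau> (- z) = wp \<tau> z"
proof -
  have "infsum (\<lambda>w. 1 / (z - - w)^2 - 1 / (- w)^2) (lattice \<tau> - {0}) = infsum (\<lambda>w. 1 / (z - w)^2 - 1 / w^2) (lattice \<tau> - {0})"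
    by (rule infsum_reindex_bij_witness[of _ uminus uminus]) (auto simp: lattice_uminus)
  moreover have "(- z - w)^2 = (z - - w)^2" for w by (simp add: power2_eq_square algebra_simps)
  ultimately show ?thesis by (simp add: wp_def)
qed

text \<open>As c / omega keeps a distance delta from the closed set of integers, 1 + |n| is at most
  K |c - n omega|. The decay is of order 2; it is weakened to 3/2 in order to reuse
  \<open>int_weight\<close>.\<close>

lemma summable_inverse_square_progression:
  fixes c \<omega> :: complex
  assumes \<omega>: "\<omega> \<noteq> 0" and c: "c / \<omega> \<notin> \<int>"
  shows "(\<lambda>n::int. 1 / (c - of_int n * \<omega>)\<^sup>2) summable_on UNIV"
proof -
  obtain \<delta> where \<delta>: "\<delta> > 0" "\<And>x. x \<in> \<int> \<Longrightarrow> \<delta> \<le> dist (c / \<omega>) x"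
    using separate_point_closed[OF closed_Ints c] by blast
  define K where "K = (1 + (1 + norm (c / \<omega>)) / \<delta>) / norm \<omega>"
  have K: "(1 + \<bar>real_of_int n\<bar>) \<le> K * norm (c - of_int n * \<omega>)" for n
  proof -
    have d: "\<delta> \<le> norm (c / \<omega> - of_int n)" using \<delta>(2)[of "of_int n"] by (simp add: dist_norm)
    have "\<bar>real_of_int n\<bar> = norm (c / \<omega> - (c / \<omega> - of_int n))" by simp
    also have "\<dots> \<le> norm (c / \<omega>) + norm (c / \<omega> - of_int n)" by (rule norm_triangle_ineq4)
    finally have "1 + \<bar>real_of_int n\<bar> \<le> (1 + norm (c / \<omega>)) * 1 + norm (c / \<omega> - of_int n)" by simp
    also have "\<dots> \<le> (1 + norm (c / \<omega>)) * (norm (c / \<omega> - of_int n) / \<delta>) + norm (c / \<omega> - of_int n)"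
      using d \<delta>(1) by (intro add_right_mono mult_left_mono) (auto simp: field_simps)
    also have "\<dots> = K * (norm \<omega> * norm (c / \<omega> - of_int n))"
      using \<omega> by (simp add: K_def field_simps)
    also have "norm \<omega> * norm (c / \<omega> - of_int n) = norm (c - of_int n * \<omega>)"
    proof -
      have "\<omega> * (c / \<omega> - of_int n) = c - of_int n * \<omega>" using \<omega> by (simp add: right_diff_distrib)
      then show ?thesis by (metis norm_mult)
    qed
    finally show ?thesis .
  qed
  have "(\<lambda>n. norm (1 / (c - of_int n * \<omega>)\<^sup>2)) summable_on UNIV"
  proof (rule Infinite_Sum.abs_summable_on_comparison_test'[OF summable_on_cmult_right[OF summable_int_weight]])
    fix n :: int
    let ?t = "1 + \<bar>real_of_int n\<bar>" and ?v = "norm (c - of_int n * \<omega>)"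
    have v: "?v > 0" using K[of n] by (cases "?v = 0") auto
    have "1 / ?v\<^sup>2 \<le> K\<^sup>2 * (1 / ?t\<^sup>2)"
      using power_mono[OF K[of n], of 2] v by (simp add: field_simps power_mult_distrib)
    also have "1 / ?t\<^sup>2 = ?t powr (-2)" by (simp add: powr_minus_divide)
    also have "\<dots> \<le> ?t powr (-3/2)" by (intro powr_mono) auto
    finally show "norm (1 / (c - of_int n * \<omega>)\<^sup>2) \<le> K\<^sup>2 * int_weight n"
      by (simp add: norm_divide norm_power int_weight_def mult_left_mono)
  qed
  then show ?thesis by (rule abs_summable_summable)
qed

lemma infsum_telescope_progression:
  fixes c \<omega> :: complex
  assumes \<omega>: "\<omega> \<noteq> 0" and c: "c / \<omega> \<notin> \<int>"
  shows "infsum (\<lambda>n::int. 1 / (c + \<omega> - of_int n * \<omega>)\<^sup>2 - 1 / (c - of_int n * \<omega>)\<^sup>2) UNIV = 0"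
proof -
  let ?f = "\<lambda>n::int. 1 / (c - of_int n * \<omega>)\<^sup>2"
  have hs: "(?f has_sum infsum ?f UNIV) UNIV"
    by (rule has_sum_infsum[OF summable_inverse_square_progression[OF assms]])
  have "((\<lambda>n. ?f (n - 1)) has_sum infsum ?f UNIV) UNIV"
    using hs by (subst has_sum_reindex_bij_witness[of UNIV "\<lambda>n. n + 1" "\<lambda>n. n - 1" UNIV ?f]) auto
  from has_sum_add[OF this has_sum_uminusI[OF hs]]
  have "((\<lambda>n. ?f (n - 1) + - ?f n) has_sum 0) UNIV" by simp
  moreover have "?f (n - 1) + - ?f n = 1 / (c + \<omega> - of_int n * \<omega>)\<^sup>2 - 1 / (c - of_int n * \<omega>)\<^sup>2" for n
    by (simp add: algebra_simps)
  ultimately show ?thesis by (simp add: infsumI)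
qed

text \<open>Putting the index (0,0) back gives a sum over all pairs, on which translations of the
  index act.\<close>

lemma wp_full:
  assumes "Im \<tau> > 0" and z: "z \<noteq> 0"
  shows "((\<lambda>mn. if mn = (0,0) then 1 / z\<^sup>2 else wp_term \<tau> mn z) has_sum wp \<tau> z) UNIV"
proof -
  have "((\<lambda>mn. wp_term \<tau> mn z) has_sum wp_reg \<tau> z) (UNIV - {(0,0)})"
    unfolding wp_reg_alt[OF assms(1)] by (rule has_sum_infsum[OF wp_term_summable[OF assms(1)]])
  then have "((\<lambda>mn. if mn = (0,0) then 1 / z\<^sup>2 else wp_term \<tau> mn z) has_sum wp_reg \<tau> z) (UNIV - {(0,0)})"
    by (subst has_sum_cong[where g = "\<lambda>mn. wp_term \<tau> mn z"]) auto
  from has_sum_insert[OF _ this, of "(0,0)"] show ?thesis by (simp add: wp_eq insert_UNIV)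
qed

text \<open>In the difference of the two series the counterterms 1/w^2 cancel. The remaining double
  series is unconditionally summable, so it may be summed first in the direction of the period,
  where it telescopes to zero. This proves periodicity without passing to the derivative of
  \<open>wp\<close>.\<close>

lemma wp_shift_aux:
  assumes \<tau>: "Im \<tau> > 0" and z: "z \<notin> lattice \<tau>" and \<omega>: "\<omega> = 1 \<or> \<omega> = \<tau>"
  shows "wp \<tau> (z + \<omega>) = wp \<tau> z"
proof -
  have z\<omega>: "z + \<omega> \<notin> lattice \<tau>" using z \<omega> lattice_add_iff[of \<omega> \<tau> z] by auto
  have nz: "z \<noteq> 0" "z + \<omega> \<noteq> 0" using z z\<omega> by auto
  define g where "g = (\<lambda>mn. 1 / (z + \<omega> - lattice_pt \<tau> mn)\<^sup>2 - 1 / (z - lattice_pt \<tau> mn)\<^sup>2)"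
  have "((\<lambda>mn. (if mn = (0,0) then 1 / (z + \<omega>)\<^sup>2 else wp_term \<tau> mn (z + \<omega>)) + - (if mn = (0,0) then 1 / z\<^sup>2 else wp_term \<tau> mn z))
     has_sum (wp \<tau> (z + \<omega>) + - wp \<tau> z)) UNIV"
    by (intro has_sum_add has_sum_uminusI wp_full \<tau> nz)
  moreover have "(if mn = (0,0) then 1 / (z + \<omega>)\<^sup>2 else wp_term \<tau> mn (z + \<omega>)) + - (if mn = (0,0) then 1 / z\<^sup>2 else wp_term \<tau> mn z) = g mn" for mn
    by (simp add: g_def wp_term_def lattice_pt_def)
  ultimately have hs: "(g has_sum (wp \<tau> (z + \<omega>) - wp \<tau> z)) UNIV" by simp
  have smb: "(\<lambda>(m, n). g (m, n)) summable_on UNIV \<times> UNIV"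
    using hs by (auto simp: summable_on_def)
  have "infsum g UNIV = infsum (\<lambda>m. infsum (\<lambda>n. g (m, n)) UNIV) UNIV"
    using infsum_Sigma'_banach[OF smb] by simp
  moreover have "\<dots> = infsum (\<lambda>n. infsum (\<lambda>m. g (m, n)) UNIV) UNIV"
    by (rule infsum_swap_banach[OF smb])
  moreover have "infsum (\<lambda>m. g (m, n)) UNIV = 0" if "\<omega> = 1" for n
  proof -
    have "(z - of_int n * \<tau>) / 1 \<notin> \<int>"
    proof
      assume "(z - of_int n * \<tau>) / 1 \<in> \<int>"
      then obtain m where "z - of_int n * \<tau> = of_int m" by (auto elim: Ints_cases)
      then have "z = of_int m + of_int n * \<tau>" by (simp add: algebra_simps)
      then show False using z unfolding lattice_def by blast
    qed
    from infsum_telescope_progression[OF _ this] show ?thesis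
      by (simp add: g_def lattice_pt_def that algebra_simps)
  qed
  moreover have "infsum (\<lambda>n. g (m, n)) UNIV = 0" if "\<omega> = \<tau>" for m
  proof -
    have t0: "\<tau> \<noteq> 0" using \<tau> by auto
    have "(z - of_int m) / \<tau> \<notin> \<int>"
    proof
      assume "(z - of_int m) / \<tau> \<in> \<int>"
      then obtain n where "(z - of_int m) / \<tau> = of_int n" by (auto elim: Ints_cases)
      then have "z = of_int m + of_int n * \<tau>" using t0 by (simp add: field_simps)
      then show False using z unfolding lattice_def by blast
    qed
    from infsum_telescope_progression[OF t0 this] show ?thesis
      by (simp add: g_def lattice_pt_def that algebra_simps)
  qed
  ultimately have "infsum g UNIV = 0" using \<omega> by auto
  then show ?thesis using infsumI[OF hs] by simp
qed

lemma wp_lattice_shift: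
  assumes \<tau>: "Im \<tau> > 0" and z: "z \<notin> lattice \<tau>" and w: "w \<in> lattice \<tau>"
  shows "wp \<tau> (z + w) = wp \<tau> z"
proof -
  have shift: "wp \<tau> (z + of_int n * \<omega>) = wp \<tau> z" if \<omega>: "\<omega> = 1 \<or> \<omega> = \<tau>" and z: "z \<notin> lattice \<tau>" for n \<omega> z
  proof (induction n rule: int_induct[of _ 0])
    case (step1 i)
    have "z + of_int i * \<omega> \<notin> lattice \<tau>"
      using z \<omega> lattice_add_iff[of "of_int i * \<omega>" \<tau> z] lattice_of_int[of i \<tau>] by auto
    from wp_shift_aux[OF \<tau> this \<omega>] step1 show ?case by (simp add: algebra_simps)
  next
    case (step2 i)
    have "z + of_int (i - 1) * \<omega> \<notin> lattice \<tau>"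
      using z \<omega> lattice_add_iff[of "of_int (i - 1) * \<omega>" \<tau> z] lattice_of_int[of "i - 1" \<tau>] by auto
    from wp_shift_aux[OF \<tau> this \<omega>] step2 show ?case by (simp add: algebra_simps)
  qed simp
  obtain m n where "w = of_int m + of_int n * \<tau>" using w by (auto simp: lattice_def)
  moreover have "z + of_int m \<notin> lattice \<tau>" using z lattice_add_iff[of "of_int m" \<tau> z] by simp
  ultimately show ?thesis using shift[of \<tau> "z + of_int m" n] shift[of 1 z m] z by (simp add: add.assoc)
qed

lemma lattice_shift_tau: "lattice (\<tau> + of_int k) = lattice \<tau>"
proof -
  have sub: "lattice (\<tau> + of_int k) \<subseteq> lattice \<tau>" for \<tau> k
  proof
    fix w assume "w \<in> lattice (\<tau> + of_int k)"
    then obtain m n where "w = of_int m + of_int n * (\<tau> + of_int k)" by (auto simp: lattice_def)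
    then have "w = of_int (m + n * k) + of_int n * \<tau>" by (simp add: algebra_simps)
    then show "w \<in> lattice \<tau>" unfolding lattice_def by blast
  qed
  from sub[of \<tau> k] sub[of "\<tau> + of_int k" "- k"] show ?thesis by auto
qed

text \<open>A nonzero lattice point has \<open>l1_norm\<close> at least 1, so its modulus is bounded
  below by the reciprocal of the constant in \<open>l1_norm_le\<close>.\<close>

lemma lattice_separated:
  assumes "Im \<tau> > 0"
  obtains \<epsilon> where "\<epsilon> > 0" "\<And>x y. x \<in> lattice \<tau> \<Longrightarrow> y \<in> lattice \<tau> \<Longrightarrow> dist y x < \<epsilon> \<Longrightarrow> y = x"
proof -
  let ?C = "1 + (1 + norm \<tau>) / Im \<tau>"
  have C: "?C > 0" using assms by (simp add: add_pos_nonneg)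
  have 1: "norm w \<ge> 1 / ?C" if "w \<in> lattice \<tau>" "w \<noteq> 0" for w
  proof -
    obtain mn where w: "w = lattice_pt \<tau> mn" "mn \<noteq> (0,0)"
      using \<open>w \<in> lattice \<tau>\<close> \<open>w \<noteq> 0\<close> lattice_pt_eq_0_iff[OF assms] by (auto simp: lattice_eq_range)
    have "\<bar>fst mn\<bar> + \<bar>snd mn\<bar> \<ge> 1" using w(2) by (cases mn) auto
    then have "l1_norm mn \<ge> 1" unfolding l1_norm_def by linarith
    with l1_norm_le[OF assms order_refl order_refl, of mn] have "1 \<le> ?C * norm w" by (simp add: w)
    then show ?thesis using C by (simp add: divide_le_eq mult.commute)
  qed
  have 2: "y - x \<in> lattice \<tau>" if "x \<in> lattice \<tau>" "y \<in> lattice \<tau>" for x y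
    using lattice_add[of y \<tau> "- x"] that lattice_uminus by auto
  show ?thesis
  proof (rule that[of "1 / ?C"])
    show "1 / ?C > 0" using C by simp
    fix x y assume "x \<in> lattice \<tau>" "y \<in> lattice \<tau>" "dist y x < 1 / ?C"
    then show "y = x" using 1[OF 2, of x y] by (force simp: dist_norm)
  qed
qed

lemma closed_subset_lattice:
  assumes "Im \<tau> > 0" "S \<subseteq> lattice \<tau>" shows "closed S"
proof -
  obtain \<epsilon> where "\<epsilon> > 0" "\<And>x y. x \<in> lattice \<tau> \<Longrightarrow> y \<in> lattice \<tau> \<Longrightarrow> dist y x < \<epsilon> \<Longrightarrow> y = x"
    using lattice_separated[OF assms(1)] by metis
  then show ?thesis using assms(2) by (intro discrete_imp_closed[of \<epsilon>]) blast+
qed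

lemma closed_lattice: "Im \<tau> > 0 \<Longrightarrow> closed (lattice \<tau>)"
  by (rule closed_subset_lattice) auto

lemma countable_lattice: "countable (lattice \<tau>)"
  by (simp add: lattice_eq_range)

section \<open>Poles of the potential, its parity and its periods\<close>

lemma poles_eq: "poles \<tau> l = (\<Union>i\<in>{i. i < 4 \<and> l i > 0}. (\<lambda>w. w - omega \<tau> i) ` lattice \<tau>)"
  by (force simp: poles_def image_iff)

lemma closed_poles: "Im \<tau> > 0 \<Longrightarrow> closed (poles \<tau> l)"
  unfolding poles_eq
proof (intro closed_UN ballI)
  fix i assume "Im \<tau> > 0"
  then have "closed ((+) (- omega \<tau> i) ` lattice \<tau>)" by (intro closed_translation closed_lattice)
  then show "closed ((\<lambda>w. w - omega \<tau> i) ` lattice \<tau>)" by simp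
qed simp

lemma open_not_poles: "Im \<tau> > 0 \<Longrightarrow> open (- poles \<tau> l)"
  using closed_poles by (simp add: open_Compl)

lemma countable_poles: "countable (poles \<tau> l)"
  unfolding poles_eq by (intro countable_UN countable_image countable_lattice) (auto intro: countable_finite)

lemma connected_diff_countable:
  fixes S :: "complex set"
  assumes "open S" "connected S" "countable C"
  shows "connected (S - C)"
  using connected_open_diff_countable[OF _ assms] by simp

lemma connected_not_poles: "connected (- poles \<tau> l)"
  using connected_diff_countable[OF open_UNIV connected_UNIV countable_poles, of \<tau> l] by (simp add: Compl_eq_Diff_UNIV)

lemma two_omega: "2 * omega \<tau> i \<in> lattice \<tau>"
proof -
  have "- (\<tau> + 1) \<in> lattice \<tau>" unfolding lattice_uminus by (rule lattice_add) auto
  moreover have "2 * omega \<tau> i = 0 \<or> 2 * omega \<tau> i = 1 \<or> 2 * omega \<tau> i = - (\<tau> + 1) \<or> 2 * omega \<tau> i = \<tau>"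
    by (simp add: omega_def)
  ultimately show ?thesis by auto
qed

lemma poles_uminus: "- x \<in> poles \<tau> l \<longleftrightarrow> x \<in> poles \<tau> l"
proof -
  have "- x + omega \<tau> i \<in> lattice \<tau> \<longleftrightarrow> x + omega \<tau> i \<in> lattice \<tau>" for i
    using lattice_uminus[of "- x + omega \<tau> i" \<tau>] lattice_add_iff[OF two_omega, of "x - omega \<tau> i" \<tau> i] by (simp add: algebra_simps)
  then show ?thesis by (simp add: poles_def)
qed

lemma poles_shift: "w \<in> lattice \<tau> \<Longrightarrow> x + w \<in> poles \<tau> l \<longleftrightarrow> x \<in> poles \<tau> l"
  using lattice_add_iff[of w \<tau> "x + omega \<tau> i" for i] by (simp add: poles_def add.assoc add.left_commute add.commute)

lemma not_poles_lattice: "x \<notin> poles \<tau> l \<Longrightarrow> i < 4 \<Longrightarrow> l i > 0 \<Longrightarrow> x + omega \<tau> i \<notin> lattice \<tau>"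
  by (auto simp: poles_def)

lemma wp_omega_uminus:
  assumes "Im \<tau> > 0" "x + omega \<tau> i \<notin> lattice \<tau>"
  shows "wp \<tau> (- x + omega \<tau> i) = wp \<tau> (x + omega \<tau> i)"
proof -
  have "x - omega \<tau> i \<notin> lattice \<tau>"
    using assms(2) lattice_add_iff[OF two_omega, of "x - omega \<tau> i" \<tau> i] by (simp add: algebra_simps)
  from wp_lattice_shift[OF assms(1) this two_omega[of \<tau> i]] have "wp \<tau> (x + omega \<tau> i) = wp \<tau> (x - omega \<tau> i)"
    by (simp add: algebra_simps)
  also have "\<dots> = wp \<tau> (- x + omega \<tau> i)" using wp_uminus[of \<tau> "x - omega \<tau> i"] by simp
  finally show ?thesis by simp
qed

lemma wp_omega_shift:
  assumes "Im \<tau> > 0" "x + omega \<tau> i \<notin> lattice \<tau>" "w \<in> lattice \<tau>"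
  shows "wp \<tau> (x + w + omega \<tau> i) = wp \<tau> (x + omega \<tau> i)"
  using wp_lattice_shift[OF assms] by (simp add: algebra_simps)

lemma pot_cong:
  assumes "\<And>i. i < 4 \<Longrightarrow> l i > 0 \<Longrightarrow> wp \<tau> (x + omega \<tau> i) = wp \<tau>' (x' + omega \<tau>' i)"
  shows "pot \<tau> l x = pot \<tau>' l x'"
  unfolding pot_def by (intro sum.cong refl) (use assms in force)

lemma pot_uminus: "Im \<tau> > 0 \<Longrightarrow> x \<notin> poles \<tau> l \<Longrightarrow> pot \<tau> l (- x) = pot \<tau> l x"
  by (intro pot_cong wp_omega_uminus) (auto simp: not_poles_lattice)

lemma pot_shift: "Im \<tau> > 0 \<Longrightarrow> x \<notin> poles \<tau> l \<Longrightarrow> w \<in> lattice \<tau> \<Longrightarrow> pot \<tau> l (x + w) = pot \<tau> l x"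
  by (intro pot_cong wp_omega_shift) (auto simp: not_poles_lattice)

lemma open_not_lattice_0: "Im \<tau> > 0 \<Longrightarrow> open (- (lattice \<tau> - {0}))"
  by (intro open_Compl closed_subset_lattice[of \<tau>]) auto

lemma holomorphic_wp_reg: "Im \<tau> > 0 \<Longrightarrow> wp_reg \<tau> holomorphic_on (- (lattice \<tau> - {0}))"
  using holomorphic_wp_reg_curve[OF open_not_lattice_0, of \<tau> "\<lambda>z. z" "\<lambda>_. \<tau>"] by auto

lemma holomorphic_wp_curve:
  assumes "open S" "\<zeta> holomorphic_on S" "\<theta> holomorphic_on S"
    and "\<And>\<sigma>. \<sigma> \<in> S \<Longrightarrow> Im (\<theta> \<sigma>) > 0 \<and> \<zeta> \<sigma> \<notin> lattice (\<theta> \<sigma>)"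
  shows "(\<lambda>\<sigma>. wp (\<theta> \<sigma>) (\<zeta> \<sigma>)) holomorphic_on S"
proof -
  have "\<zeta> \<sigma> \<noteq> 0" if "\<sigma> \<in> S" for \<sigma> using assms(4)[OF that] by auto
  then show ?thesis
    unfolding wp_eq using assms by (intro holomorphic_intros holomorphic_wp_reg_curve) auto
qed

lemma holomorphic_wp_compose:
  assumes "Im \<tau> > 0" "open S" "\<zeta> holomorphic_on S" "\<And>\<sigma>. \<sigma> \<in> S \<Longrightarrow> \<zeta> \<sigma> \<notin> lattice \<tau>"
  shows "(\<lambda>\<sigma>. wp \<tau> (\<zeta> \<sigma>)) holomorphic_on S"
  using holomorphic_wp_curve[of S \<zeta> "\<lambda>_. \<tau>"] assms by auto

lemma holomorphic_wp_omega:
  assumes "Im \<tau> > 0" "i < 4" "l i > 0"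
  shows "(\<lambda>x. wp \<tau> (x + omega \<tau> i)) holomorphic_on (- poles \<tau> l)"
  by (rule holomorphic_wp_compose)
    (use assms not_poles_lattice in \<open>auto intro!: open_not_poles holomorphic_intros\<close>)

lemma holomorphic_pot: "Im \<tau> > 0 \<Longrightarrow> pot \<tau> l holomorphic_on (- poles \<tau> l)"
  unfolding pot_def[abs_def]
proof (intro holomorphic_on_sum)
  fix i :: nat assume "Im \<tau> > 0" "i \<in> {..<4}"
  then show "(\<lambda>x. of_nat (l i * (l i + 1)) * wp \<tau> (x + omega \<tau> i)) holomorphic_on - poles \<tau> l"
    by (cases "l i = 0") (auto intro!: holomorphic_intros holomorphic_wp_omega)
qed

section \<open>Translation by the half period 1/2\<close>

definition swap_half :: "nat \<Rightarrow> nat" where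
  "swap_half i = (if i = 0 then 1 else if i = 1 then 0 else if i = 2 then 3 else if i = 3 then 2 else i)"

lemma nat_less_4: "i < (4::nat) \<Longrightarrow> i = 0 \<or> i = 1 \<or> i = 2 \<or> i = 3" by auto

lemma swap_half_lt: "swap_half i < 4 \<longleftrightarrow> i < 4" by (auto simp: swap_half_def)

lemma swap_half_swap_half [simp]: "swap_half (swap_half i) = i" by (auto simp: swap_half_def)

text \<open>Modulo the lattice, adding 1/2 exchanges omega_0 with omega_1 and omega_2 with omega_3.
  Hence the potential seen from 1/2 is again of the same form, with parameters
  \<open>l \<circ> swap_half\<close>, and every result at 0 transfers to 1/2.\<close>

lemma omega_swap_half: "i < 4 \<Longrightarrow> 1 / 2 + omega \<tau> i - omega \<tau> (swap_half i) \<in> lattice \<tau>"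
proof -
  assume "i < 4"
  then have "1 / 2 + omega \<tau> i - omega \<tau> (swap_half i) = (if i = 0 then 0 else if i = 1 then 1 else if i = 2 then - \<tau> else 1 + \<tau>)"
    by (auto simp: omega_def swap_half_def field_simps dest!: nat_less_4)
  then show ?thesis using lattice_uminus[of \<tau> \<tau>] lattice_add[of 1 \<tau> \<tau>] by auto
qed

lemma poles_swap_half: "x \<in> poles \<tau> (l \<circ> swap_half) \<longleftrightarrow> x + 1/2 \<in> poles \<tau> l"
proof -
  have *: "x + 1/2 + omega \<tau> (swap_half i) \<in> lattice \<tau> \<longleftrightarrow> x + omega \<tau> i \<in> lattice \<tau>" if "i < 4" for i
    using lattice_add_iff[OF omega_swap_half[of "swap_half i" \<tau>], of "x + omega \<tau> i"] that by (simp add: swap_half_lt algebra_simps)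
  show ?thesis
  proof
    assume "x \<in> poles \<tau> (l \<circ> swap_half)"
    then obtain i where "i < 4" "l (swap_half i) > 0" "x + omega \<tau> i \<in> lattice \<tau>" by (auto simp: poles_def)
    with * show "x + 1/2 \<in> poles \<tau> l" unfolding poles_def by (auto intro!: exI[of _ "swap_half i"] simp: swap_half_lt)
  next
    assume "x + 1/2 \<in> poles \<tau> l"
    then obtain i where "i < 4" "l i > 0" "x + 1/2 + omega \<tau> i \<in> lattice \<tau>" by (auto simp: poles_def)
    with *[of "swap_half i"] show "x \<in> poles \<tau> (l \<circ> swap_half)"
      unfolding poles_def by (auto intro!: exI[of _ "swap_half i"] simp: swap_half_lt)
  qed
qed

lemma pot_swap_half:
  assumes "Im \<tau> > 0" "x + 1/2 \<notin> poles \<tau> l"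
  shows "pot \<tau> (l \<circ> swap_half) x = pot \<tau> l (x + 1/2)"
proof -
  have "pot \<tau> l (x + 1/2) = (\<Sum>i<4. of_nat (l (swap_half i) * (l (swap_half i) + 1)) * wp \<tau> (x + 1/2 + omega \<tau> (swap_half i)))"
    unfolding pot_def by (rule sum.reindex_bij_witness[of _ swap_half swap_half]) (auto simp: swap_half_lt)
  also have "\<dots> = pot \<tau> (l \<circ> swap_half) x"
    unfolding pot_def
  proof (intro sum.cong refl)
    fix i :: nat assume i: "i \<in> {..<4}"
    show "of_nat (l (swap_half i) * (l (swap_half i) + 1)) * wp \<tau> (x + 1/2 + omega \<tau> (swap_half i))
       = of_nat ((l \<circ> swap_half) i * ((l \<circ> swap_half) i + 1)) * wp \<tau> (x + omega \<tau> i)"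
    proof (cases "l (swap_half i) = 0")
      case False
      have "x + 1/2 + omega \<tau> (swap_half i) \<notin> lattice \<tau>"
        using assms(2) False i by (intro not_poles_lattice) (auto simp: swap_half_lt)
      from wp_lattice_shift[OF assms(1) this, of "- (1/2 + omega \<tau> (swap_half i) - omega \<tau> i)"]
      have "wp \<tau> (x + omega \<tau> i) = wp \<tau> (x + 1/2 + omega \<tau> (swap_half i))"
        using omega_swap_half[of "swap_half i" \<tau>] i unfolding lattice_uminus by (simp add: swap_half_lt algebra_simps)
      then show ?thesis by simp
    qed simp
  qed
  finally show ?thesis by simp
qed

section \<open>Translation of the modulus by even integers\<close>

lemma wp_shift_tau: "wp (\<tau> + of_int k) = wp \<tau>"
  unfolding wp_def[abs_def] lattice_shift_tau ..

text \<open>An even shift 2k moves tau/2 by the lattice vector k. An odd shift would exchange the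
  classes of omega_2 and omega_3 and so change the potential.\<close>

lemma omega_shift_tau: "omega (\<tau> + of_int (2 * k)) i - omega \<tau> i \<in> lattice \<tau>"
  using lattice_of_int[of k \<tau>] lattice_of_int[of "- k" \<tau>] by (auto simp: omega_def field_simps)

lemma poles_shift_tau: "poles (\<tau> + of_int (2 * k)) l = poles \<tau> l"
proof -
  have "x + omega (\<tau> + of_int (2 * k)) i \<in> lattice \<tau> \<longleftrightarrow> x + omega \<tau> i \<in> lattice \<tau>" for x i
    using lattice_add_iff[OF omega_shift_tau[of \<tau> k], of "x + omega \<tau> i" i] by (simp add: algebra_simps)
  then show ?thesis by (simp only: poles_def lattice_shift_tau)
qed

lemma pot_shift_tau:
  assumes "Im \<tau> > 0" "x \<notin> poles \<tau> l"
  shows "pot (\<tau> + of_int (2 * k)) l x = pot \<tau> l x"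
proof (rule pot_cong)
  fix i :: nat assume "i < 4" "l i > 0"
  then have "x + omega \<tau> i \<notin> lattice \<tau>" using assms by (auto simp: poles_def)
  from wp_lattice_shift[OF assms(1) this omega_shift_tau[of \<tau> k i]]
  show "wp (\<tau> + of_int (2 * k)) (x + omega (\<tau> + of_int (2 * k)) i) = wp \<tau> (x + omega \<tau> i)"
    unfolding wp_shift_tau by (simp add: algebra_simps)
qed

section \<open>Regular part of the potential on a cell around the origin\<close>

definition pot_reg :: "complex \<Rightarrow> (nat \<Rightarrow> nat) \<Rightarrow> complex \<Rightarrow> complex" where
  "pot_reg \<tau> l x = of_nat (l 0 * (l 0 + 1)) * wp_reg \<tau> x +
     (\<Sum>i\<in>{1,2,3}. of_nat (l i * (l i + 1)) * wp \<tau> (x + omega \<tau> i))"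

lemma pot_eq_pot_reg: "pot \<tau> l x = of_nat (l 0 * (l 0 + 1)) / x\<^sup>2 + pot_reg \<tau> l x"
proof -
  have "{..<4::nat} = {0,1,2,3}" by auto
  then show ?thesis by (simp add: pot_def pot_reg_def wp_eq[of \<tau> x] omega_def[of \<tau> 0] algebra_simps add_divide_distrib)
qed

text \<open>The open rectangle is small enough that all other points congruent to a half period lie
  outside it, so the origin is the only possible pole inside; it is also convex and
  symmetric.\<close>

definition cell :: "complex \<Rightarrow> complex set" where
  "cell \<tau> = {x. \<bar>Re x\<bar> < 1/2 \<and> \<bar>Im x\<bar> < Im \<tau> / 2}"

lemma lattice_small:
  assumes "Im \<tau> > 0" "w \<in> lattice \<tau>" "\<bar>Im w\<bar> < Im \<tau>"
  obtains m where "w = of_int m"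
proof -
  obtain m n where w: "w = of_int m + of_int n * \<tau>" using assms(2) by (auto simp: lattice_def)
  then have "\<bar>of_int n * Im \<tau>\<bar> < Im \<tau>" using assms(3) by simp
  then have "\<bar>real_of_int n\<bar> < 1" using assms(1) by (simp add: abs_mult)
  then have "n = 0" by linarith
  with w that show ?thesis by simp
qed

lemma strip_omega_not_lattice:
  assumes "Im \<tau> > 0" "\<bar>Im x\<bar> < Im \<tau> / 2" "i \<in> {2,3}"
  shows "x + omega \<tau> i \<notin> lattice \<tau>"
proof
  assume "x + omega \<tau> i \<in> lattice \<tau>"
  moreover have im: "\<bar>Im (x + omega \<tau> i)\<bar> < Im \<tau>" "Im (x + omega \<tau> i) \<noteq> 0"
    using assms by (auto simp: omega_def)
  ultimately obtain m where "x + omega \<tau> i = of_int m" using lattice_small[OF assms(1)] by metis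
  with im(2) show False by simp
qed

lemma cell_not_lattice:
  assumes \<tau>: "Im \<tau> > 0" and x: "x \<in> cell \<tau>"
  shows "x \<notin> lattice \<tau> - {0}" and "i \<in> {1,2,3} \<Longrightarrow> x + omega \<tau> i \<notin> lattice \<tau>"
proof -
  have x': "\<bar>Re x\<bar> < 1/2" "\<bar>Im x\<bar> < Im \<tau> / 2" using x by (auto simp: cell_def)
  show "x \<notin> lattice \<tau> - {0}"
  proof
    assume "x \<in> lattice \<tau> - {0}"
    then have x0: "x \<in> lattice \<tau>" "x \<noteq> 0" by auto
    obtain m where m: "x = of_int m" by (rule lattice_small[OF \<tau> x0(1)]) (use x' \<tau> in auto)
    have "\<bar>real_of_int m\<bar> < 1/2" using x'(1) m by simp
    then have "m = 0" by linarith
    with m x0 show False by simp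
  qed
  have "x + omega \<tau> 1 \<notin> lattice \<tau>"
  proof
    assume "x + omega \<tau> 1 \<in> lattice \<tau>"
    then have x1: "x + 1/2 \<in> lattice \<tau>" by (simp add: omega_def)
    obtain m where m: "x + 1/2 = of_int m" by (rule lattice_small[OF \<tau> x1]) (use x' \<tau> in auto)
    from arg_cong[OF m, of Re] have "Re x + 1/2 = real_of_int m" by simp
    with x'(1) have "0 < real_of_int m" "real_of_int m < 1" by linarith+
    then have "0 < m" "m < 1" by simp_all
    then show False by linarith
  qed
  then show "i \<in> {1,2,3} \<Longrightarrow> x + omega \<tau> i \<notin> lattice \<tau>"
    using strip_omega_not_lattice[OF \<tau> x'(2)] by auto
qed

lemma cell_not_poles: "Im \<tau> > 0 \<Longrightarrow> x \<in> cell \<tau> \<Longrightarrow> x \<noteq> 0 \<Longrightarrow> x \<notin> poles \<tau> l"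
  using cell_not_lattice[of \<tau> x] by (auto simp: poles_def omega_def[of \<tau> 0] dest!: nat_less_4)

lemma star_zero_cell: "Im \<tau> > 0 \<Longrightarrow> star_zero (cell \<tau>)"
  unfolding star_zero_def
proof (intro conjI ballI)
  have "cell \<tau> = {x. Re x < 1/2} \<inter> {x. Re x > -1/2} \<inter> {x. Im x < Im \<tau> / 2} \<inter> {x. Im x > - Im \<tau> / 2}"
    by (auto simp: cell_def)
  then show "open (cell \<tau>)"
    by (simp only: open_Int open_halfspace_Re_lt open_halfspace_Re_gt open_halfspace_Im_lt open_halfspace_Im_gt)
  fix x and r :: real assume x: "x \<in> cell \<tau>" and r: "r \<in> {0..1}"
  have "\<bar>r * Re x\<bar> \<le> \<bar>Re x\<bar>" "\<bar>r * Im x\<bar> \<le> \<bar>Im x\<bar>"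
    using r by (auto simp: abs_mult mult_left_le_one_le)
  then show "of_real r * x \<in> cell \<tau>" using x by (auto simp: cell_def)
qed (auto simp: cell_def)

lemma open_cell: "Im \<tau> > 0 \<Longrightarrow> open (cell \<tau>)"
  using star_zero_cell star_zero_def by blast

lemma uminus_cell [simp]: "- x \<in> cell \<tau> \<longleftrightarrow> x \<in> cell \<tau>"
  by (simp add: cell_def)

lemma holomorphic_pot_reg: "Im \<tau> > 0 \<Longrightarrow> pot_reg \<tau> l holomorphic_on cell \<tau>"
  unfolding pot_reg_def[abs_def]
  by (intro holomorphic_intros holomorphic_wp_compose holomorphic_on_subset[OF holomorphic_wp_reg] open_cell)
    (use cell_not_lattice in auto)

lemma pot_reg_uminus:
  assumes "Im \<tau> > 0" "x \<in> cell \<tau>"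
  shows "pot_reg \<tau> l (- x) = pot_reg \<tau> l x"
proof (cases "x = 0")
  case False
  then show ?thesis
    using pot_uminus[OF assms(1) cell_not_poles[OF assms(1,2) False], of l] by (simp add: pot_eq_pot_reg)
qed simp

lemma continuous_on_pot_reg:
  "continuous_on {(\<tau>, x). Im \<tau> > 0 \<and> x \<in> cell \<tau>} (\<lambda>(\<tau>, x). pot_reg \<tau> l x)" (is "continuous_on ?D _")
proof -
  have reg: "continuous_on ?D (\<lambda>y. wp_reg (fst y) (f y))"
    if f: "continuous_on ?D f" "\<And>y. y \<in> ?D \<Longrightarrow> f y \<notin> lattice (fst y) - {0}" for f
  proof -
    have "continuous_on ?D (\<lambda>y. (\<lambda>(z, \<tau>). wp_reg \<tau> z) (f y, fst y))"
      by (rule continuous_on_compose2[OF continuous_on_wp_reg])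
        (use f(2) in \<open>auto intro!: continuous_intros f(1)\<close>)
    then show ?thesis by simp
  qed
  have om: "continuous_on ?D (\<lambda>y. omega (fst y) i)" for i
    by (cases "i = 0"; cases "i = 1"; cases "i = 2") (auto simp: omega_def intro!: continuous_intros)
  have "continuous_on ?D (\<lambda>y. wp (fst y) (snd y + omega (fst y) i))" if i: "i \<in> {1,2,3}" for i
  proof -
    have av: "snd y + omega (fst y) i \<notin> lattice (fst y)" if "y \<in> ?D" for y
    proof -
      have "Im (fst y) > 0" "snd y \<in> cell (fst y)" using that by (auto simp: split_beta)
      from cell_not_lattice(2)[OF this i] show ?thesis .
    qed
    have "snd y + omega (fst y) i \<noteq> 0" if "y \<in> ?D" for y
      using av[OF that] by (metis lattice_basic(1))
    then show ?thesis unfolding wp_eq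
      by (intro continuous_intros reg om) (use av in auto)
  qed
  moreover have "continuous_on ?D (\<lambda>y. wp_reg (fst y) (snd y))"
    by (intro reg continuous_intros) (use cell_not_lattice(1) in auto)
  ultimately show ?thesis unfolding pot_reg_def split_beta by (intro continuous_intros) auto
qed

lemma holomorphic_pot_reg_curve:
  assumes S: "open S" and t: "t holomorphic_on S" and x: "x holomorphic_on S"
    and tx: "\<And>\<sigma>. \<sigma> \<in> S \<Longrightarrow> Im (t \<sigma>) > 0 \<and> x \<sigma> \<in> cell (t \<sigma>)"
  shows "(\<lambda>\<sigma>. pot_reg (t \<sigma>) l (x \<sigma>)) holomorphic_on S"
proof -
  have om: "(\<lambda>\<sigma>. omega (t \<sigma>) i) holomorphic_on S" for i
    using t by (cases "i = 0"; cases "i = 1"; cases "i = 2") (auto simp: omega_def intro!: holomorphic_intros)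
  show ?thesis unfolding pot_reg_def
    by (intro holomorphic_intros holomorphic_wp_curve holomorphic_wp_reg_curve om assms)
      (use tx cell_not_lattice in auto)
qed

subsection \<open>Linear equations of second order in the complex domain\<close>

definition ode_sol :: "(complex \<Rightarrow> complex) \<Rightarrow> complex set \<Rightarrow> (complex \<Rightarrow> complex) \<Rightarrow> bool" where
  "ode_sol v S y \<longleftrightarrow> y holomorphic_on S \<and> (\<forall>x\<in>S. deriv (deriv y) x = v x * y x)"

definition wronskian :: "(complex \<Rightarrow> complex) \<Rightarrow> (complex \<Rightarrow> complex) \<Rightarrow> complex \<Rightarrow> complex" where
  "wronskian y z x = y x * deriv z x - deriv y x * z x"

lemma ode_sol_subset: "ode_sol v S y \<Longrightarrow> T \<subseteq> S \<Longrightarrow> ode_sol v T y"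
  by (auto simp: ode_sol_def intro: holomorphic_on_subset)

lemma holomorphic_has_deriv: "f holomorphic_on S \<Longrightarrow> open S \<Longrightarrow> x \<in> S \<Longrightarrow> (f has_field_derivative deriv f x) (at x)"
  by (rule holomorphic_derivI)

lemma ode_solI:
  assumes "open S" and "\<And>x. x \<in> S \<Longrightarrow> (y has_field_derivative y' x) (at x)"
    and "\<And>x. x \<in> S \<Longrightarrow> (y' has_field_derivative v x * y x) (at x)"
  shows "ode_sol v S y"
proof -
  have y: "deriv y x = y' x" if "x \<in> S" for x using assms(2)[OF that] by (rule DERIV_imp_deriv)
  have "(deriv y has_field_derivative v x * y x) (at x)" if "x \<in> S" for x
    by (rule has_field_derivative_transform_within_open[OF assms(3)[OF that] assms(1) that]) (use y in auto)
  then show ?thesis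
    using assms by (auto simp: ode_sol_def holomorphic_on_open DERIV_imp_deriv)
qed

lemma ode_solD:
  assumes "ode_sol v S y" "open S" "x \<in> S"
  shows "(y has_field_derivative deriv y x) (at x)" "(deriv y has_field_derivative v x * y x) (at x)"
  using assms holomorphic_has_deriv[of y S x] holomorphic_has_deriv[OF holomorphic_deriv[of y S], of x]
  by (auto simp: ode_sol_def)

lemma ode_sol_lincomb:
  assumes "ode_sol v S y" "ode_sol v S z" "open S"
  shows "ode_sol v S (\<lambda>x. a * y x + b * z x)"
  by (rule ode_solI[where y' = "\<lambda>x. a * deriv y x + b * deriv z x"])
    (use assms ode_solD in \<open>auto intro!: derivative_eq_intros simp: algebra_simps\<close>)

lemma ode_sol_cong:
  assumes "ode_sol v S y" "open S" "\<And>x. x \<in> S \<Longrightarrow> y x = z x" "\<And>x. x \<in> S \<Longrightarrow> v x = w x"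
  shows "ode_sol w S z"
proof (rule ode_solI[OF assms(2), of _ "deriv y"])
  fix x assume x: "x \<in> S"
  show "(z has_field_derivative deriv y x) (at x)"
    by (rule has_field_derivative_transform_within_open[OF ode_solD(1)[OF assms(1,2) x] assms(2) x assms(3)])
  show "(deriv y has_field_derivative w x * z x) (at x)"
    using ode_solD(2)[OF assms(1,2) x] assms(3,4) x by simp
qed

lemma wronskian_deriv:
  assumes "ode_sol v S y" "ode_sol w S z" "open S" "x \<in> S"
  shows "(wronskian y z has_field_derivative (w x - v x) * y x * z x) (at x)"
  unfolding wronskian_def[abs_def]
  using ode_solD[OF assms(1,3,4)] ode_solD[OF assms(2,3,4)]
  by (auto intro!: derivative_eq_intros simp: algebra_simps)

lemma deriv_zero_constant:
  assumes "open S" "connected S" "\<And>x. x \<in> S \<Longrightarrow> (f has_field_derivative 0) (at x)" "x \<in> S" "y \<in> S"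
  shows "f x = (f y :: complex)"
  using DERIV_zero_connected_constant[of S "{}" f] assms
  by (metis Diff_empty continuous_at_imp_continuous_on DERIV_isCont finite.emptyI)

lemma wronskian_const:
  assumes "ode_sol v S y" "ode_sol v S z" "open S" "connected S" "x \<in> S" "x' \<in> S"
  shows "wronskian y z x = wronskian y z x'"
proof (rule deriv_zero_constant[OF assms(3,4) _ assms(5,6)])
  show "(wronskian y z has_field_derivative 0) (at t)" if "t \<in> S" for t
    using wronskian_deriv[OF assms(1,2,3) that] by simp
qed

lemma identity_open:
  fixes f g :: "complex \<Rightarrow> complex"
  assumes "f holomorphic_on S" "g holomorphic_on S" "open S" "connected S" "open T" "T \<noteq> {}" "T \<subseteq> S"
    "\<And>z. z \<in> T \<Longrightarrow> f z = g z" "z \<in> S"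
  shows "f z = g z"
  using analytic_continuation_open[OF assms(5,3,6,4,7,1,2)] assms(8,9) by blast

text \<open>Near a point where y does not vanish the quotient z / y has derivative zero; the
  identity theorem carries the resulting relation past the zeros of y.\<close>

lemma proportional_if_wronskian_0:
  assumes y: "y holomorphic_on S" and z: "z holomorphic_on S" and S: "open S" "connected S"
    and W: "\<And>x. x \<in> S \<Longrightarrow> wronskian y z x = 0" and a: "a \<in> S" "y a \<noteq> 0"
  shows "\<exists>k. \<forall>x\<in>S. z x = k * y x"
proof -
  have cont: "continuous_on S y" using y by (rule holomorphic_on_imp_continuous_on)
  have "open (S \<inter> y -` (- {0}))" using cont S by (intro continuous_open_preimage) auto
  then obtain e where e: "e > 0" "ball a e \<subseteq> S \<inter> y -` (- {0})"
    using a open_contains_ball by (metis Int_iff Compl_iff singletonD vimageI)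
  define k where "k = z a / y a"
  have "z x / y x = k" if x: "x \<in> ball a e" for x
    unfolding k_def
  proof (rule deriv_zero_constant[of "ball a e" "\<lambda>x. z x / y x"])
    fix t assume t: "t \<in> ball a e"
    then have tS: "t \<in> S" "y t \<noteq> 0" using e by auto
    have "((\<lambda>x. z x / y x) has_field_derivative (deriv z t * y t - z t * deriv y t) / (y t * y t)) (at t)"
      by (intro DERIV_divide holomorphic_has_deriv[OF _ S(1)] y z tS)
    moreover have "deriv z t * y t - z t * deriv y t = 0" using W[OF tS(1)] by (simp add: wronskian_def mult.commute)
    ultimately show "((\<lambda>x. z x / y x) has_field_derivative 0) (at t)" by simp
  qed (use x e in auto)
  then have eq: "z x = k * y x" if "x \<in> ball a e" for x
    using that e by (metis Compl_iff Int_iff nonzero_eq_divide_eq singletonI subset_iff vimage_eq)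
  have "z x = k * y x" if "x \<in> S" for x
    by (rule identity_open[OF z _ S, of "\<lambda>x. k * y x" "ball a e"])
      (use e eq that in \<open>auto intro!: holomorphic_intros y\<close>)
  then show ?thesis by blast
qed

lemma deriv_parity:
  assumes "f holomorphic_on S" "open S" "\<And>x. x \<in> S \<Longrightarrow> - x \<in> S" "\<And>x. x \<in> S \<Longrightarrow> f (- x) = c * f x" "x \<in> S"
  shows "deriv f (- x) = - c * deriv f x"
proof -
  have "((\<lambda>x. f (- x)) has_field_derivative deriv f (- x) * (-1)) (at x)"
    using holomorphic_has_deriv[OF assms(1,2) assms(3)[OF assms(5)]]
    by (intro DERIV_chain2[of f]) (auto intro!: derivative_eq_intros)
  moreover have "((\<lambda>x. f (- x)) has_field_derivative c * deriv f x) (at x)"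
    by (rule has_field_derivative_transform_within_open[OF DERIV_cmult[OF holomorphic_has_deriv[OF assms(1,2,5)]] assms(2,5)])
      (use assms(4) in auto)
  ultimately have "deriv f (- x) * (-1) = c * deriv f x" by (rule DERIV_unique)
  then show ?thesis by (simp add: minus_equation_iff) (metis add.inverse_inverse)
qed

subsection \<open>The solution with the larger exponent at the origin\<close>

definition regsol :: "complex \<Rightarrow> (nat \<Rightarrow> nat) \<Rightarrow> complex \<Rightarrow> complex \<Rightarrow> complex" where
  "regsol \<tau> l E = frob (l 0 + 1) (\<lambda>x. pot_reg \<tau> l x - E)"

definition regsol' :: "complex \<Rightarrow> (nat \<Rightarrow> nat) \<Rightarrow> complex \<Rightarrow> complex \<Rightarrow> complex" where
  "regsol' \<tau> l E = frob' (l 0 + 1) (\<lambda>x. pot_reg \<tau> l x - E)"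

context
  fixes \<tau> :: complex and l :: "nat \<Rightarrow> nat" and E :: complex
  assumes \<tau>: "Im \<tau> > 0"
begin

private lemma qhol: "(\<lambda>x. pot_reg \<tau> l x - E) holomorphic_on cell \<tau>"
  by (intro holomorphic_intros holomorphic_pot_reg \<tau>)

lemma regsol_deriv: "x \<in> cell \<tau> \<Longrightarrow> (regsol \<tau> l E has_field_derivative regsol' \<tau> l E x) (at x)"
  unfolding regsol_def regsol'_def by (rule frob_deriv[OF star_zero_cell[OF \<tau>] qhol])

lemma deriv_regsol: "x \<in> cell \<tau> \<Longrightarrow> deriv (regsol \<tau> l E) x = regsol' \<tau> l E x"
  by (rule DERIV_imp_deriv) (rule regsol_deriv)

lemma regsol_holomorphic: "regsol \<tau> l E holomorphic_on cell \<tau>"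
  using regsol_deriv open_cell[OF \<tau>] by (auto simp: holomorphic_on_open)

lemma regsol_ode: "ode_sol (\<lambda>x. pot \<tau> l x - E) (cell \<tau> - {0}) (regsol \<tau> l E)"
proof (rule ode_solI[where y' = "regsol' \<tau> l E"])
  show "open (cell \<tau> - {0})" using open_cell[OF \<tau>] by (simp add: open_delete)
  fix x assume x: "x \<in> cell \<tau> - {0}"
  show "(regsol' \<tau> l E has_field_derivative (pot \<tau> l x - E) * regsol \<tau> l E x) (at x)"
    using frob'_deriv[OF star_zero_cell[OF \<tau>] qhol, of x "l 0 + 1"] x
    by (simp add: regsol'_def regsol_def pot_eq_pot_reg mult.commute add_diff_eq)
qed (use regsol_deriv in auto)

lemma regsol_uminus: "x \<in> cell \<tau> \<Longrightarrow> regsol \<tau> l E (- x) = (-1) ^ (l 0 + 1) * regsol \<tau> l E x"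
  using volterra_sum_even[OF star_zero_cell[OF \<tau>] qhol, of x "2 * (l 0 + 1)"]
  by (simp add: regsol_def frob_def pot_reg_uminus[OF \<tau>] power_minus[of x] mult_ac)

lemma regsol_0: "regsol \<tau> l E 0 = 0"
  by (simp add: regsol_def frob_def)

text \<open>Apart from the power of x, the solution is a continuous function with value 1 at
  0.\<close>

lemma regsol_nonzero:
  assumes "open S" "0 \<in> S"
  obtains x where "x \<in> S - {0}" "regsol \<tau> l E x \<noteq> 0" "x \<in> cell \<tau>"
proof -
  let ?g = "volterra_sum (2 * (l 0 + 1)) (\<lambda>x. pot_reg \<tau> l x - E)"
  have cont: "continuous_on (cell \<tau>) ?g"
    by (rule holomorphic_on_imp_continuous_on[OF volterra_sum_holomorphic[OF star_zero_cell[OF \<tau>] qhol]])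
  have "open (cell \<tau> \<inter> ?g -` (- {0}))" using cont open_cell[OF \<tau>] by (intro continuous_open_preimage) auto
  then have "open (S \<inter> (cell \<tau> \<inter> ?g -` (- {0})))" using assms(1) by blast
  moreover have "0 \<in> S \<inter> (cell \<tau> \<inter> ?g -` (- {0}))"
    using assms(2) \<tau> by (simp add: volterra_sum_0 cell_def)
  ultimately have "\<not> (S \<inter> (cell \<tau> \<inter> ?g -` (- {0})) \<subseteq> {0})"
    by (metis (no_types, lifting) empty_iff insert_iff not_open_singleton subset_singletonD)
  then obtain x where "x \<in> S" "x \<in> cell \<tau>" "?g x \<noteq> 0" "x \<noteq> 0" by blast
  then show ?thesis by (intro that[of x]) (auto simp: regsol_def frob_def)
qed

text \<open>The Wronskian with \<open>regsol\<close> of a solution of the same parity is odd and constant, hence zero: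
  no growth condition at the origin is needed.\<close>

lemma parity_imp_regsol:
  assumes S: "open S" "connected S" "S \<subseteq> cell \<tau> - {0}" "\<And>x. x \<in> S \<Longrightarrow> - x \<in> S" "open (insert 0 S)"
    and F: "ode_sol (\<lambda>x. pot \<tau> l x - E) S F" and par: "\<And>x. x \<in> S \<Longrightarrow> F (- x) = (-1) ^ (l 0 + 1) * F x"
  shows "\<exists>k. \<forall>x\<in>S. F x = k * regsol \<tau> l E x"
proof -
  have R: "ode_sol (\<lambda>x. pot \<tau> l x - E) S (regsol \<tau> l E)" by (rule ode_sol_subset[OF regsol_ode S(3)])
  have Fh: "F holomorphic_on S" and Rh: "regsol \<tau> l E holomorphic_on S" using F R by (auto simp: ode_sol_def)
  have pR: "regsol \<tau> l E (- x) = (-1) ^ (l 0 + 1) * regsol \<tau> l E x" if "x \<in> S" for x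
    using regsol_uminus S(3) that by blast
  have W: "wronskian (regsol \<tau> l E) F x = 0" if x: "x \<in> S" for x
  proof -
    define p :: complex where "p = (-1) ^ (l 0 + 1)"
    have sq: "p * p = 1" by (simp add: p_def power_add[symmetric])
    have dF: "deriv F (- x) = - p * deriv F x" unfolding p_def by (rule deriv_parity[OF Fh S(1) S(4) par x])
    have dR: "deriv (regsol \<tau> l E) (- x) = - p * deriv (regsol \<tau> l E) x"
      unfolding p_def by (rule deriv_parity[OF Rh S(1) S(4) pR x])
    have "wronskian (regsol \<tau> l E) F (- x) = - (p * p) * wronskian (regsol \<tau> l E) F x"
      unfolding wronskian_def dF dR par[OF x, folded p_def] pR[OF x, folded p_def] by (simp add: algebra_simps)
    also have "\<dots> = - wronskian (regsol \<tau> l E) F x" unfolding sq by simp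
    finally show ?thesis
      using wronskian_const[OF R F S(1,2) S(4)[OF x] x] by simp
  qed
  obtain a where "a \<in> insert 0 S - {0}" "regsol \<tau> l E a \<noteq> 0" using regsol_nonzero[OF S(5)] by blast
  then show ?thesis using proportional_if_wronskian_0[OF Rh Fh S(1,2) W, of a] by blast
qed

end

subsection \<open>From solutions on a strip to eigenfunctions and back\<close>

definition half_ints :: "complex set" where "half_ints = {x. 2 * x \<in> \<int>}"

definition strip :: "complex \<Rightarrow> complex set" where "strip \<tau> = {x. \<bar>Im x\<bar> < Im \<tau> / 2}"

definition PhiC :: "(nat \<Rightarrow> nat) \<Rightarrow> complex \<Rightarrow> complex" where
  "PhiC l z = sin (of_real pi * z) ^ (l 0 + 1) * cos (of_real pi * z) ^ (l 1 + 1)"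

lemma PhiC_of_real: "PhiC l (of_real x) = Phi l x"
  by (simp add: PhiC_def Phi_def flip: sin_of_real cos_of_real)

lemma half_ints_cases:
  assumes "x \<in> half_ints" obtains n :: int where "x = of_int n" | n :: int where "x = of_int n + 1/2"
proof -
  obtain m where m: "2 * x = of_int m" using assms by (auto simp: half_ints_def elim: Ints_cases)
  show ?thesis
  proof (cases "even m")
    case True
    then obtain k where "m = 2 * k" by (rule evenE)
    with m have "x = of_int k" by simp
    then show ?thesis by (rule that)
  next
    case False
    then obtain k where "m = 2 * k + 1" by (rule oddE)
    with m have "2 * x = 2 * (of_int k + 1/2)" by (simp add: algebra_simps)
    then have "2 * (x - (of_int k + 1/2)) = 0" by (simp only: right_diff_distrib diff_self)
    then have "x - (of_int k + 1/2) = 0" by (metis mult_eq_0_iff zero_neq_numeral)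
    then have "x = of_int k + 1/2" by (simp only: right_minus_eq)
    then show ?thesis by (rule that)
  qed
qed

lemma half_intsI: "of_int n \<in> half_ints" "of_int n + 1/2 \<in> half_ints"
proof -
  have "2 * complex_of_int n = of_int (2 * n)" "2 * (complex_of_int n + 1/2) = of_int (2 * n + 1)" by (simp_all add: algebra_simps)
  then show "of_int n \<in> half_ints" "of_int n + 1/2 \<in> half_ints" unfolding half_ints_def by (metis Ints_of_int mem_Collect_eq)+
qed

lemma half_ints_shift: "x + of_int n \<in> half_ints \<longleftrightarrow> x \<in> half_ints"
proof -
  have "x + of_int n \<in> half_ints" if "x \<in> half_ints" for x n
    using that Ints_add[of "2 * x" "2 * of_int n"] by (simp add: half_ints_def algebra_simps)
  from this[of x n] this[of "x + of_int n" "- n"] show ?thesis by auto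
qed

lemma half_ints_add_half: "x + 1/2 \<in> half_ints \<longleftrightarrow> x \<in> half_ints"
proof -
  have "2 * x + 1 \<in> \<int> \<longleftrightarrow> 2 * x \<in> \<int>" using Ints_add[of "2*x" 1] Ints_diff[of "2*x+1" 1] by auto
  then show ?thesis by (simp add: half_ints_def algebra_simps)
qed

lemma half_ints_uminus: "- x \<in> half_ints \<longleftrightarrow> x \<in> half_ints"
  by (simp add: half_ints_def minus_in_Ints_iff)

lemma closed_half_ints: "closed half_ints"
proof -
  have "half_ints = (\<lambda>x. 2 * x) -` \<int>" by (auto simp: half_ints_def)
  moreover have "closed ((\<lambda>x::complex. 2 * x) -` \<int>)"
    by (intro continuous_closed_vimage closed_Ints) auto
  ultimately show ?thesis by simp
qed

lemma countable_half_ints: "countable half_ints"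
proof (rule countable_subset)
  show "half_ints \<subseteq> range of_int \<union> range (\<lambda>n::int. of_int n + 1/2)"
    by (auto elim: half_ints_cases)
qed auto

lemma open_strip: "open (strip \<tau>)"
proof -
  have "strip \<tau> = {x. Im x < Im \<tau> / 2} \<inter> {x. Im x > - Im \<tau> / 2}" by (auto simp: strip_def)
  then show ?thesis by (simp only: open_Int open_halfspace_Im_lt open_halfspace_Im_gt)
qed

lemma convex_strip: "convex (strip \<tau>)"
proof -
  have "strip \<tau> = {x. Im x < Im \<tau> / 2} \<inter> {x. Im x > - Im \<tau> / 2}" by (auto simp: strip_def)
  then show ?thesis by (simp only: convex_Int convex_halfspace_Im_lt convex_halfspace_Im_gt)
qed

lemma strip_shift [simp]: "x + of_int n \<in> strip \<tau> \<longleftrightarrow> x \<in> strip \<tau>" "x + 1 \<in> strip \<tau> \<longleftrightarrow> x \<in> strip \<tau>"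
    "x + 1/2 \<in> strip \<tau> \<longleftrightarrow> x \<in> strip \<tau>" "- x \<in> strip \<tau> \<longleftrightarrow> x \<in> strip \<tau>"
  by (auto simp: strip_def)

lemma open_strip_half: "open (strip \<tau> - half_ints)"
  by (intro open_Diff open_strip closed_half_ints)

lemma connected_strip_half: "connected (strip \<tau> - half_ints)"
  by (intro connected_diff_countable open_strip convex_connected convex_strip countable_half_ints)

lemma strip_poles:
  assumes "Im \<tau> > 0" "x \<in> strip \<tau>" "x \<in> poles \<tau> l" shows "x \<in> half_ints"
proof -
  have x: "\<bar>Im x\<bar> < Im \<tau> / 2" using assms by (simp add: strip_def)
  obtain i where i: "i < 4" "x + omega \<tau> i \<in> lattice \<tau>" using assms(3) by (auto simp: poles_def)
  have "i \<noteq> 2" "i \<noteq> 3" using strip_omega_not_lattice[OF assms(1) x] i(2) by auto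
  then have "i = 0 \<or> i = 1" using i(1) by linarith
  then have xi: "x \<in> lattice \<tau> \<or> x + 1/2 \<in> lattice \<tau>" using i(2) by (auto simp: omega_def)
  have "\<bar>Im x\<bar> < Im \<tau>" "\<bar>Im (x + 1/2)\<bar> < Im \<tau>" using x assms(1) by auto
  with xi obtain m where "x = of_int m \<or> x + 1/2 = of_int m" using lattice_small[OF assms(1)] by metis
  then have "x \<in> half_ints \<or> x + 1/2 \<in> half_ints" using half_intsI(1)[of m] by metis
  then show ?thesis using half_ints_add_half by blast
qed

lemma cell_half_ints: "x \<in> cell \<tau> \<Longrightarrow> x \<in> half_ints \<Longrightarrow> x = 0"
proof (erule half_ints_cases)
  fix n assume "x \<in> cell \<tau>" "x = of_int n"
  then have "\<bar>real_of_int n\<bar> < 1/2" by (simp add: cell_def)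
  then have "n = 0" by linarith
  with \<open>x = of_int n\<close> show ?thesis by simp
next
  fix n assume "x \<in> cell \<tau>" "x = of_int n + 1/2"
  then have "\<bar>real_of_int n + 1/2\<bar> < 1/2" by (simp add: cell_def)
  then have "real_of_int n < 0" "real_of_int n > - 1" by linarith+
  then have "n < 0" "n > - 1" by simp_all
  then show ?thesis by linarith
qed

lemma cell_strip: "x \<in> cell \<tau> \<Longrightarrow> x \<in> strip \<tau>"
  by (simp add: cell_def strip_def)

lemma half_ints_poles:
  assumes "l 0 \<ge> 1" "l 1 \<ge> 1" "x \<in> half_ints" shows "x \<in> poles \<tau> l"
  using assms(3)
proof (cases rule: half_ints_cases)
  case (1 n)
  then show ?thesis using assms(1) by (auto simp: poles_def omega_def intro!: exI[of _ 0])
next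
  case (2 n)
  then have "x + omega \<tau> 1 = of_int (n + 1)" by (simp add: omega_def)
  then have "x + omega \<tau> 1 \<in> lattice \<tau>" using lattice_of_int(1)[of "n + 1" \<tau>] by simp
  then show ?thesis using assms(2) by (auto simp: poles_def intro!: exI[of _ 1])
qed

lemma PhiC_eq_0_iff: "PhiC l z = 0 \<longleftrightarrow> z \<in> half_ints"
proof -
  have s: "sin (of_real pi * z) = 0 \<longleftrightarrow> (\<exists>n::int. z = of_int n)"
    unfolding sin_eq_0 by (auto simp: mult.commute)
  have c: "cos (of_real pi * z) = 0 \<longleftrightarrow> (\<exists>n::int. z = of_int n + 1/2)"
  proof -
    have "of_real pi * z = complex_of_real (real_of_int n * pi) + of_real pi / 2 \<longleftrightarrow> z = of_int n + 1/2" for n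
    proof -
      have "complex_of_real (real_of_int n * pi) + of_real pi / 2 = of_real pi * (of_int n + 1/2)" by (simp add: algebra_simps)
      then show ?thesis by simp
    qed
    then show ?thesis unfolding cos_eq_0 by simp
  qed
  show ?thesis
    unfolding PhiC_def by (auto simp: s c half_intsI elim: half_ints_cases)
qed

lemma PhiC_shift: "PhiC l (z + 1) = (-1) ^ (l 0 + l 1) * PhiC l z"
proof -
  have "sin (of_real pi * (z + 1)) = - sin (of_real pi * z)" "cos (of_real pi * (z + 1)) = - cos (of_real pi * z)"
    by (simp_all add: algebra_simps sin_add cos_add sin_of_real cos_of_real)
  then show ?thesis by (simp add: PhiC_def power_minus[of "sin _"] power_minus[of "cos _"] power_add)
qed

lemma PhiC_half: "PhiC l (y + 1/2) = (-1) ^ (l 1 + 1) * (sin (of_real pi * y) ^ (l 1 + 1) * cos (of_real pi * y) ^ (l 0 + 1))"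
proof -
  have h: "sin (complex_of_real pi / 2) = 1" "cos (complex_of_real pi / 2) = 0"
    using sin_of_real[of "pi/2"] cos_of_real[of "pi/2"] by simp_all
  have "of_real pi * (y + 1/2) = of_real pi * y + of_real pi / 2" by (simp add: algebra_simps)
  then have "sin (of_real pi * (y + 1/2)) = cos (of_real pi * y)" "cos (of_real pi * (y + 1/2)) = - sin (of_real pi * y)"
    by (simp_all only: sin_add cos_add h) simp_all
  then show ?thesis by (simp add: PhiC_def power_minus[of "sin _"])
qed

lemma holomorphic_PhiC: "PhiC l holomorphic_on S"
  unfolding PhiC_def[abs_def] by (intro holomorphic_intros)

text \<open>At a point of \<open>A\<close> the extension takes the value of the local extension
  centred there; it coincides with it on the whole ball because the punctured ball misses
  \<open>A\<close>.\<close>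

lemma removable_extension:
  fixes P :: "complex \<Rightarrow> complex"
  assumes U: "open U" and A: "closed A" and P: "P holomorphic_on U - A"
    and loc: "\<And>a. a \<in> A \<inter> U \<Longrightarrow> \<exists>r>0. \<exists>h. ball a r \<subseteq> U \<and> h holomorphic_on ball a r \<and> (\<forall>z\<in>ball a r - {a}. z \<notin> A \<and> P z = h z)"
  obtains G where "G holomorphic_on U" "\<And>z. z \<in> U - A \<Longrightarrow> G z = P z"
proof -
  obtain r h where rh: "\<And>a. a \<in> A \<inter> U \<Longrightarrow> r a > (0::real) \<and> ball a (r a) \<subseteq> U \<and> h a holomorphic_on ball a (r a) \<and>
      (\<forall>z\<in>ball a (r a) - {a}. z \<notin> A \<and> P z = h a z)"
    using loc by metis
  define G where "G = (\<lambda>z. if z \<in> A then h z z else P z)"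
  have "G field_differentiable (at z)" if z: "z \<in> U" for z
  proof (cases "z \<in> A")
    case True
    then have *: "r z > 0" "h z holomorphic_on ball z (r z)" "\<And>w. w \<in> ball z (r z) \<Longrightarrow> w \<noteq> z \<Longrightarrow> w \<notin> A \<and> P w = h z w"
      using rh[of z] z by auto
    have eq: "h z w = G w" if "w \<in> ball z (r z)" for w
      using *(3)[OF that] True by (cases "w = z") (auto simp: G_def)
    have "(h z has_field_derivative deriv (h z) z) (at z)" using *(1,2) by (intro holomorphic_has_deriv) auto
    from has_field_derivative_transform_within_open[OF this open_ball[of z "r z"] _ eq]
    have "(G has_field_derivative deriv (h z) z) (at z)" using *(1) by simp
    then show ?thesis unfolding field_differentiable_def by blast
  next
    case False
    have op: "open (U - A)" using U A by (rule open_Diff)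
    have zin: "z \<in> U - A" using z False by simp
    have "(P has_field_derivative deriv P z) (at z)" by (rule holomorphic_has_deriv[OF P op zin])
    then have "(G has_field_derivative deriv P z) (at z)"
      by (rule has_field_derivative_transform_within_open[OF _ op zin]) (simp add: G_def)
    then show ?thesis unfolding field_differentiable_def by blast
  qed
  then have "G holomorphic_on U" by (auto intro: holomorphic_onI field_differentiable_at_within)
  then show ?thesis by (rule that) (simp add: G_def)
qed

lemma sinc_cell:
  obtains S where "S holomorphic_on UNIV" "\<And>y. y \<noteq> 0 \<Longrightarrow> S y = sin (of_real pi * y) / y" "\<And>y. y \<in> cell \<tau> \<Longrightarrow> S y \<noteq> 0"
proof -
  let ?f = "\<lambda>z. sin (complex_of_real pi * z)"
  let ?S = "\<lambda>z. if z = 0 then deriv ?f 0 else (?f z - ?f 0) / (z - 0)"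
  have d: "deriv ?f 0 = of_real pi" by (rule DERIV_imp_deriv) (auto intro!: derivative_eq_intros)
  have "?S holomorphic_on UNIV" by (rule pole_lemma_open) (auto intro!: holomorphic_intros)
  moreover have "?S y \<noteq> 0" if y: "y \<in> cell \<tau>" for y
  proof (cases "y = 0")
    case False
    then have "y \<notin> half_ints" using cell_half_ints[OF y] by blast
    then have "PhiC (\<lambda>_. 0) y \<noteq> 0" by (simp add: PhiC_eq_0_iff)
    then show ?thesis using False by (simp add: PhiC_def)
  qed (simp add: d)
  ultimately show ?thesis by (intro that[of ?S]) auto
qed

lemma cos_cell: "y \<in> cell \<tau> \<Longrightarrow> cos (of_real pi * y) \<noteq> 0"
proof
  assume y: "y \<in> cell \<tau>" and c: "cos (of_real pi * y) = 0"
  then have "PhiC (\<lambda>_. 0) y = 0" by (simp add: PhiC_def)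
  then have "y = 0" using cell_half_ints[OF y] by (simp add: PhiC_eq_0_iff)
  with c show False by simp
qed

text \<open>Inside the cell sin(pi y) / y and cos(pi y) have no zeros, so the factor y^j cancels the
  zero of sin^j exactly.\<close>

lemma frob_quotient:
  assumes g: "g holomorphic_on cell \<tau>"
  obtains h where "h holomorphic_on cell \<tau>"
    "\<And>y. y \<in> cell \<tau> - {0} \<Longrightarrow> k * (y ^ j * g y) / (sin (of_real pi * y) ^ j * cos (of_real pi * y) ^ m) = h y"
proof -
  obtain S where S: "S holomorphic_on UNIV" "\<And>y. y \<noteq> 0 \<Longrightarrow> S y = sin (of_real pi * y) / y" "\<And>y. y \<in> cell \<tau> \<Longrightarrow> S y \<noteq> 0"
    using sinc_cell by blast
  have S': "S holomorphic_on cell \<tau>" using S(1) by (rule holomorphic_on_subset) simp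
  show ?thesis
  proof (rule that[of "\<lambda>y. k * g y / (S y ^ j * cos (of_real pi * y) ^ m)"])
    show "(\<lambda>y. k * g y / (S y ^ j * cos (of_real pi * y) ^ m)) holomorphic_on cell \<tau>"
      by (intro holomorphic_intros g S') (use S(3) cos_cell in auto)
    fix y assume y: "y \<in> cell \<tau> - {0}"
    then have "sin (of_real pi * y) = S y * y" using S(2) by auto
    then show "k * (y ^ j * g y) / (sin (of_real pi * y) ^ j * cos (of_real pi * y) ^ m) = k * g y / (S y ^ j * cos (of_real pi * y) ^ m)"
      using y by (simp add: power_mult_distrib)
  qed
qed

lemma ode_sol_translate:
  assumes "ode_sol v S y" "open S"
  shows "ode_sol (\<lambda>x. v (x + a)) {x. x + a \<in> S} (\<lambda>x. y (x + a))"
proof (rule ode_solI[where y' = "\<lambda>x. deriv y (x + a)"])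
  have "open ((\<lambda>x. x + a) -` S)" by (intro continuous_open_vimage assms(2)) (auto intro!: continuous_intros)
  then show "open {x. x + a \<in> S}" by (simp add: vimage_def)
  fix x assume "x \<in> {x. x + a \<in> S}"
  then have x: "x + a \<in> S" by simp
  show "((\<lambda>x. y (x + a)) has_field_derivative deriv y (x + a)) (at x)"
    using ode_solD(1)[OF assms x] by (simp add: DERIV_shift)
  show "((\<lambda>x. deriv y (x + a)) has_field_derivative v (x + a) * y (x + a)) (at x)"
    using ode_solD(2)[OF assms x] by (simp add: DERIV_shift)
qed

lemma convex_cell: "convex (cell \<tau>)"
proof -
  have "cell \<tau> = {x. Re x < 1/2} \<inter> {x. Re x > -1/2} \<inter> {x. Im x < Im \<tau> / 2} \<inter> {x. Im x > - Im \<tau> / 2}"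
    by (auto simp: cell_def)
  then show ?thesis
    by (simp only: convex_Int convex_halfspace_Re_lt convex_halfspace_Re_gt convex_halfspace_Im_lt convex_halfspace_Im_gt)
qed

lemma open_connected_punctured_cell:
  assumes "Im \<tau> > 0"
  shows "open (cell \<tau> - {0})" "connected (cell \<tau> - {0})" "open (insert 0 (cell \<tau> - {0}))"
proof -
  show "open (cell \<tau> - {0})" using open_cell[OF assms] by (simp add: open_delete)
  show "connected (cell \<tau> - {0})"
    by (intro connected_diff_countable open_cell assms convex_connected convex_cell) simp
  have "insert 0 (cell \<tau> - {0}) = cell \<tau>" using assms by (auto simp: cell_def)
  then show "open (insert 0 (cell \<tau> - {0}))" using open_cell[OF assms] by simp
qed

text \<open>Parity about 0 forces F to be a multiple of the regular solution there. Parity about 1/2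
  follows from parity about 0 combined with the quasi-period, and gives the same conclusion at 1/2
  with swapped parameters. Thus F vanishes to at least the order of \<open>PhiC\<close> at every
  half integer.\<close>

lemma strip_solution_extends:
  assumes \<tau>: "Im \<tau> > 0" and F: "ode_sol (\<lambda>x. pot \<tau> l x - E) (strip \<tau> - half_ints) F"
    and per: "\<And>x. x \<in> strip \<tau> - half_ints \<Longrightarrow> F (x + 1) = (-1) ^ (l 0 + l 1) * F x"
    and par: "\<And>x. x \<in> strip \<tau> - half_ints \<Longrightarrow> F (- x) = (-1) ^ (l 0 + 1) * F x"
  obtains G where "G holomorphic_on strip \<tau>" "\<And>z. z \<in> strip \<tau> - half_ints \<Longrightarrow> F z = G z * PhiC l z"
proof -
  let ?U = "strip \<tau> - half_ints"
  have sub0: "cell \<tau> - {0} \<subseteq> ?U" using cell_half_ints cell_strip by blast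
  have F0: "ode_sol (\<lambda>x. pot \<tau> l x - E) (cell \<tau> - {0}) F" by (rule ode_sol_subset[OF F sub0])
  have "\<exists>k. \<forall>x\<in>cell \<tau> - {0}. F x = k * regsol \<tau> l E x"
    by (rule parity_imp_regsol[OF \<tau> open_connected_punctured_cell(1,2)[OF \<tau>] _ _ open_connected_punctured_cell(3)[OF \<tau>] F0])
      (use par sub0 in auto)
  then obtain k0 where k0: "\<And>x. x \<in> cell \<tau> - {0} \<Longrightarrow> F x = k0 * regsol \<tau> l E x" by blast
  let ?l = "l \<circ> swap_half"
  have sub1: "x + 1/2 \<in> ?U" if "x \<in> cell \<tau> - {0}" for x
    using that cell_half_ints[of x] cell_strip[of x] by (auto simp: half_ints_add_half)
  have F1: "ode_sol (\<lambda>x. pot \<tau> ?l x - E) (cell \<tau> - {0}) (\<lambda>x. F (x + 1/2))"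
  proof (rule ode_sol_cong[OF ode_sol_subset[OF ode_sol_translate[OF F open_strip_half, of "1/2"]] open_connected_punctured_cell(1)[OF \<tau>]])
    fix x assume x: "x \<in> cell \<tau> - {0}"
    then have "x + 1/2 \<notin> poles \<tau> l" using strip_poles[OF \<tau>] sub1 by blast
    then show "pot \<tau> l (x + 1/2) - E = pot \<tau> ?l x - E" by (simp add: pot_swap_half[OF \<tau>])
  qed (use sub1 in auto)
  have "\<exists>k. \<forall>x\<in>cell \<tau> - {0}. F (x + 1/2) = k * regsol \<tau> ?l E x"
  proof (rule parity_imp_regsol[OF \<tau> open_connected_punctured_cell(1,2)[OF \<tau>] _ _ open_connected_punctured_cell(3)[OF \<tau>] F1])
    fix x assume x: "x \<in> cell \<tau> - {0}"
    have x2: "x - 1/2 \<in> ?U" using sub1[OF x] half_ints_shift[of "x - 1/2" 1] strip_shift(2)[of "x - 1/2" \<tau>]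
      by (simp add: algebra_simps)
    have "F (- x + 1/2) = (-1) ^ (l 0 + 1) * F (x - 1/2)" using par[OF x2] by (simp add: algebra_simps)
    moreover have "F (x + 1/2) = (-1) ^ (l 0 + l 1) * F (x - 1/2)" using per[OF x2] by (simp add: algebra_simps)
    \<comment> \<open>The sign required about 1/2, which is (-1)^(l1 + 1), times the quasi-period
      sign equals the parity sign about 0.\<close>
    moreover have "(-1) ^ (?l 0 + 1) * (-1) ^ (l 0 + l 1) = ((-1) ^ (l 0 + 1) :: complex)"
    proof -
      have "(-1) ^ (l 1 + 1) * (-1) ^ (l 0 + l 1) = ((-1) ^ (2 * l 1 + (l 0 + 1)) :: complex)"
        unfolding power_add[symmetric] by (simp add: algebra_simps mult_2)
      then show ?thesis by (simp add: swap_half_def power_add power_mult)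
    qed
    ultimately show "F (- x + 1/2) = (-1) ^ (?l 0 + 1) * F (x + 1/2)"
      by (metis (no_types, lifting) mult.assoc)
  qed auto
  then obtain k1 where k1: "\<And>x. x \<in> cell \<tau> - {0} \<Longrightarrow> F (x + 1/2) = k1 * regsol \<tau> ?l E x" by blast
  have qh: "(\<lambda>x. pot_reg \<tau> l x - E) holomorphic_on cell \<tau>" for l by (intro holomorphic_intros holomorphic_pot_reg \<tau>)
  obtain h0 where h0: "h0 holomorphic_on cell \<tau>" "\<And>y. y \<in> cell \<tau> - {0} \<Longrightarrow> F y / PhiC l y = h0 y"
  proof -
    obtain h where h: "h holomorphic_on cell \<tau>"
      "\<And>y. y \<in> cell \<tau> - {0} \<Longrightarrow> k0 * (y ^ (l 0 + 1) * volterra_sum (2 * (l 0 + 1)) (\<lambda>x. pot_reg \<tau> l x - E) y)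
          / (sin (of_real pi * y) ^ (l 0 + 1) * cos (of_real pi * y) ^ (l 1 + 1)) = h y"
      using frob_quotient[OF volterra_sum_holomorphic[OF star_zero_cell[OF \<tau>] qh]] by blast
    show ?thesis by (rule that[OF h(1)]) (simp add: k0 regsol_def frob_def PhiC_def h(2)[symmetric])
  qed
  obtain h1 where h1: "h1 holomorphic_on cell \<tau>" "\<And>y. y \<in> cell \<tau> - {0} \<Longrightarrow> F (y + 1/2) / PhiC l (y + 1/2) = h1 y"
  proof -
    obtain h where h: "h holomorphic_on cell \<tau>"
      "\<And>y. y \<in> cell \<tau> - {0} \<Longrightarrow> (k1 / (-1) ^ (l 1 + 1)) * (y ^ (l 1 + 1) * volterra_sum (2 * (l 1 + 1)) (\<lambda>x. pot_reg \<tau> ?l x - E) y)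
          / (sin (of_real pi * y) ^ (l 1 + 1) * cos (of_real pi * y) ^ (l 0 + 1)) = h y"
      using frob_quotient[OF volterra_sum_holomorphic[OF star_zero_cell[OF \<tau>] qh]] by blast
    have l1: "?l 0 = l 1" by (simp add: swap_half_def)
    show ?thesis
    proof (rule that[OF h(1)])
      fix y assume y: "y \<in> cell \<tau> - {0}"
      show "F (y + 1/2) / PhiC l (y + 1/2) = h y"
        unfolding h(2)[OF y, symmetric] k1[OF y] PhiC_half regsol_def frob_def l1 by simp
    qed
  qed
  \<comment> \<open>The signs of F and of \<open>PhiC\<close> under x -> x + 1 agree, so the
    quotient has period 1 and local models at 0 and at 1/2 serve all half integers.\<close>
  define P where "P = (\<lambda>z. F z / PhiC l z)"
  have Pper1: "P (z + 1) = P z" if "z \<in> ?U" for z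
    using per[OF that] PhiC_shift[of l z] by (simp add: P_def)
  have Pper: "P (z + of_int n) = P z" if z: "z \<in> ?U" for z n
  proof (induction n rule: int_induct[of _ 0])
    case (step1 i)
    have "z + of_int i \<in> ?U" using z by (simp add: half_ints_shift)
    from Pper1[OF this] step1 show ?case by (simp add: algebra_simps)
  next
    case (step2 i)
    have "z + of_int (i - 1) \<in> ?U" using z half_ints_shift[of z "i - 1"] strip_shift(1)[of z "i - 1" \<tau>] by simp
    from Pper1[OF this] step2 show ?case by (simp add: algebra_simps)
  qed simp
  obtain r where r: "r > 0" "ball 0 r \<subseteq> cell \<tau>"
  proof -
    have "0 \<in> cell \<tau>" using \<tau> by (simp add: cell_def)
    then show ?thesis using that open_cell[OF \<tau>] open_contains_ball by blast
  qed
  have Ph: "P holomorphic_on ?U"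
    unfolding P_def by (intro holomorphic_intros holomorphic_PhiC) (use F in \<open>auto simp: ode_sol_def PhiC_eq_0_iff\<close>)
  have local: "\<exists>r>0. \<exists>h. ball (of_int n + c) r \<subseteq> strip \<tau> \<and> h holomorphic_on ball (of_int n + c) r \<and>
       (\<forall>z\<in>ball (of_int n + c) r - {of_int n + c}. z \<notin> half_ints \<and> P z = h z)"
    if h: "h holomorphic_on cell \<tau>" "\<And>y. y \<in> cell \<tau> - {0} \<Longrightarrow> P (y + c) = h y"
      and c: "\<And>y. y \<in> cell \<tau> - {0} \<Longrightarrow> y + c \<in> ?U" "c \<in> strip \<tau>" for h c and n :: int
  proof (intro exI[of _ r] exI[of _ "\<lambda>z. h (z - of_int n - c)"] conjI ballI)
    have inb: "z - of_int n - c \<in> cell \<tau>" if "z \<in> ball (of_int n + c) r" for z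
    proof -
      have "z - of_int n - c \<in> ball 0 r" using that by (simp add: dist_norm norm_minus_commute algebra_simps)
      then show ?thesis using r by blast
    qed
    have inU: "z \<in> ?U" if "z \<in> ball (of_int n + c) r" "z \<noteq> of_int n + c" for z
    proof -
      have "z - of_int n - c \<noteq> 0" using that(2) by (auto simp: algebra_simps)
      then have "(z - of_int n - c) + c \<in> ?U" using c(1)[of "z - of_int n - c"] inb[OF that(1)] by blast
      then have "z + of_int (- n) \<in> ?U" by simp
      then show ?thesis by (simp only: Diff_iff half_ints_shift strip_shift) simp
    qed
    show "r > 0" by fact
    show "ball (of_int n + c) r \<subseteq> strip \<tau>"
    proof
      fix z assume z: "z \<in> ball (of_int n + c) r"
      show "z \<in> strip \<tau>"
      proof (cases "z = of_int n + c")
        case True then show ?thesis using c(2) strip_shift(1)[of c n \<tau>] by (simp add: add.commute)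
      qed (use inU z in auto)
    qed
    have "(h \<circ> (\<lambda>z. z - of_int n - c)) holomorphic_on ball (of_int n + c) r"
      by (rule holomorphic_on_compose_gen[OF _ h(1)]) (use inb in \<open>auto intro!: holomorphic_intros\<close>)
    then show "(\<lambda>z. h (z - of_int n - c)) holomorphic_on ball (of_int n + c) r" by (simp add: o_def)
    fix z assume z: "z \<in> ball (of_int n + c) r - {of_int n + c}"
    have zU: "z \<in> ?U" using inU z by blast
    then show "z \<notin> half_ints" by simp
    have "z + of_int (- n) \<in> ?U" using zU by (simp only: Diff_iff half_ints_shift strip_shift) simp
    have y: "z - of_int n - c \<in> cell \<tau> - {0}" using inb z by (auto simp: algebra_simps)
    have "P z = P (z + of_int (- n))" by (rule Pper[OF zU, symmetric])
    also have "\<dots> = P ((z - of_int n - c) + c)" by simp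
    also have "\<dots> = h (z - of_int n - c)" by (rule h(2)[OF y])
    finally show "P z = h (z - of_int n - c)" .
  qed
  obtain G where G: "G holomorphic_on strip \<tau>" "\<And>z. z \<in> strip \<tau> - half_ints \<Longrightarrow> G z = P z"
  proof (rule removable_extension[OF open_strip closed_half_ints Ph])
    fix a assume "a \<in> half_ints \<inter> strip \<tau>"
    then have "a \<in> half_ints" by simp
    then show "\<exists>r>0. \<exists>h. ball a r \<subseteq> strip \<tau> \<and> h holomorphic_on ball a r \<and> (\<forall>z\<in>ball a r - {a}. z \<notin> half_ints \<and> P z = h z)"
    proof (cases rule: half_ints_cases)
      case (1 n)
      show ?thesis using local[OF h0(1), of 0 n] h0(2) sub0 \<tau> 1 by (auto simp: P_def strip_def)
    next
      case (2 n)
      show ?thesis unfolding 2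
        by (rule local[OF h1(1)]) (use h1(2) sub1 \<tau> in \<open>auto simp: P_def strip_def\<close>)
    qed
  qed blast
  show ?thesis
    by (rule that[OF G(1)]) (use G(2) PhiC_eq_0_iff in \<open>auto simp: P_def\<close>)
qed

lemma has_vector_derivative_of_real:
  assumes "(F has_field_derivative F') (at (of_real x))"
  shows "((\<lambda>x. F (complex_of_real x)) has_vector_derivative F') (at x)"
  using has_vector_derivative_real_field[OF assms] by (simp add: o_def)

text \<open>Since l0 and l1 are at least 1, every half integer is a pole of the potential, where
  \<open>eigen\<close> asks only for differentiability. The equation for F away from
  \<open>half_ints\<close> is therefore enough, and the holomorphic extension supplies the
  derivatives.\<close>

lemma strip_solution_eigenfunction:
  assumes \<tau>: "Im \<tau> > 0" and l: "l 0 \<ge> 1" "l 1 \<ge> 1" and F: "ode_sol (\<lambda>x. pot \<tau> l x - E) (strip \<tau> - half_ints) F"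
    and per: "\<And>x. x \<in> strip \<tau> - half_ints \<Longrightarrow> F (x + 1) = (-1) ^ (l 0 + l 1) * F x"
    and par: "\<And>x. x \<in> strip \<tau> - half_ints \<Longrightarrow> F (- x) = (-1) ^ (l 0 + 1) * F x"
    and nz: "z0 \<in> strip \<tau> - half_ints" "F z0 \<noteq> 0"
  obtains H where "H holomorphic_on strip \<tau>" "\<And>z. z \<in> strip \<tau> - half_ints \<Longrightarrow> H z = F z"
    "(\<lambda>x. H (complex_of_real x)) \<in> Dsp l" "(\<lambda>x. H (complex_of_real x)) \<noteq> (\<lambda>_. 0)" "eigen \<tau> l E (\<lambda>x. H (complex_of_real x))"
proof -
  obtain G where G: "G holomorphic_on strip \<tau>" "\<And>z. z \<in> strip \<tau> - half_ints \<Longrightarrow> F z = G z * PhiC l z"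
    using strip_solution_extends[OF \<tau> F per par] by blast
  define H where "H = (\<lambda>z. G z * PhiC l z)"
  have H: "H holomorphic_on strip \<tau>" unfolding H_def by (intro holomorphic_intros G holomorphic_PhiC)
  have HF: "H z = F z" if "z \<in> strip \<tau> - half_ints" for z using G(2)[OF that] by (simp add: H_def)
  have real: "complex_of_real x \<in> strip \<tau>" for x using \<tau> by (simp add: strip_def)
  have H0: "H z = 0" if "z \<in> half_ints" for z using that by (simp add: H_def PhiC_eq_0_iff)
  have sq: "(-1) ^ n * ((-1) ^ n * a) = (a::complex)" for n a by (simp add: mult.assoc[symmetric] power_add[symmetric])
  have inD: "(\<lambda>x. H (complex_of_real x)) \<in> Dsp l"
    unfolding Dsp_def mem_Collect_eq
  proof (intro conjI allI)
    show "\<exists>S g. open S \<and> range complex_of_real \<subseteq> S \<and> g holomorphic_on S \<and> (\<forall>x. H (complex_of_real x) = g (complex_of_real x) * Phi l x)"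
      using G(1) real open_strip by (intro exI[of _ "strip \<tau>"] exI[of _ G]) (auto simp: H_def PhiC_of_real)
    fix x :: real
    show "H (complex_of_real x) = (-1) ^ (l 0 + l 1) * H (complex_of_real (x + 1))"
    proof (cases "complex_of_real x \<in> half_ints")
      case True
      then show ?thesis using H0[OF True] H0[of "of_real (x + 1)"] half_ints_shift[of "of_real x" 1] by simp
    next
      case False
      then have x: "complex_of_real x \<in> strip \<tau> - half_ints" "complex_of_real x + 1 \<in> strip \<tau> - half_ints"
        using real half_ints_shift[of "of_real x" 1] by auto
      show ?thesis using HF[OF x(1)] HF[OF x(2)] per[OF x(1)] by (simp add: sq)
    qed
    show "H (complex_of_real x) = (-1) ^ (l 0 + 1) * H (complex_of_real (- x))"
    proof (cases "complex_of_real x \<in> half_ints")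
      case True
      then show ?thesis using H0[OF True] H0[of "of_real (- x)"] half_ints_uminus[of "of_real x"] by simp
    next
      case False
      then have x: "complex_of_real x \<in> strip \<tau> - half_ints" "- complex_of_real x \<in> strip \<tau> - half_ints"
        using real half_ints_uminus[of "of_real x"] by auto
      show ?thesis using HF[OF x(1)] HF[OF x(2)] par[OF x(1)] sq[of "l 0 + 1"] by simp
    qed
  qed
  have nz': "(\<lambda>x. H (complex_of_real x)) \<noteq> (\<lambda>_. 0)"
  proof
    assume "(\<lambda>x. H (complex_of_real x)) = (\<lambda>_. 0)"
    then have z: "H w = 0" if "w \<in> \<real>" for w using that by (auto simp: fun_eq_iff elim: Reals_cases)
    have lim: "(0::complex) islimpt \<real>"
      unfolding islimpt_approachable
    proof (intro allI impI)
      fix e :: real assume "e > 0"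
      then show "\<exists>x'\<in>\<real>. x' \<noteq> 0 \<and> dist x' (0::complex) < e" by (intro bexI[of _ "of_real (e/2)"]) auto
    qed
    have "H z0 = 0"
      by (rule analytic_continuation[OF H open_strip convex_connected[OF convex_strip], of \<real> 0])
        (use real[of 0] lim z nz in \<open>auto intro: real elim!: Reals_cases\<close>)
    then show False using HF nz by simp
  qed
  have eig: "eigen \<tau> l E (\<lambda>x. H (complex_of_real x))"
    unfolding eigen_def
  proof (rule exI[of _ "\<lambda>x. deriv H (complex_of_real x)"], rule exI[of _ "\<lambda>x. deriv (deriv H) (complex_of_real x)"], intro conjI allI impI)
    fix x :: real
    show "((\<lambda>x. H (complex_of_real x)) has_vector_derivative deriv H (complex_of_real x)) (at x)"
      by (intro has_vector_derivative_of_real holomorphic_has_deriv[OF H open_strip real])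
    show "((\<lambda>x. deriv H (complex_of_real x)) has_vector_derivative deriv (deriv H) (complex_of_real x)) (at x)"
      by (intro has_vector_derivative_of_real holomorphic_has_deriv[OF holomorphic_deriv[OF H open_strip] open_strip real])
    assume "complex_of_real x \<notin> poles \<tau> l"
    then have x: "complex_of_real x \<in> strip \<tau> - half_ints" using half_ints_poles[OF l] real by blast
    have "ode_sol (\<lambda>x. pot \<tau> l x - E) (strip \<tau> - half_ints) H"
      by (rule ode_sol_cong[OF F open_strip_half]) (use HF in auto)
    then show "- deriv (deriv H) (complex_of_real x) + pot \<tau> l (complex_of_real x) * H (complex_of_real x) - E * H (complex_of_real x) = 0"
      using x by (auto simp: ode_sol_def algebra_simps)
  qed
  show ?thesis by (rule that[OF H HF inD nz' eig])
qed

section \<open>From eigenfunctions on the real line back to regular solutions\<close>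

lemma real_identity:
  fixes f g :: "complex \<Rightarrow> complex"
  assumes f: "f holomorphic_on S" and g: "g holomorphic_on S" and S: "open S" "connected S"
    and a: "complex_of_real a \<in> S" and eq: "\<And>x. complex_of_real x \<in> S \<Longrightarrow> f (of_real x) = g (of_real x)" and z: "z \<in> S"
  shows "f z = g z"
proof -
  have lim: "complex_of_real a islimpt (complex_of_real ` {x. complex_of_real x \<in> S})"
    unfolding islimpt_approachable
  proof (intro allI impI)
    fix e :: real assume e: "e > 0"
    obtain d where d: "d > 0" "ball (complex_of_real a) d \<subseteq> S" using S(1) a open_contains_ball by blast
    define h where "h = min d e / 2"
    have h: "0 < h" "h < d" "h < e" using d e by (auto simp: h_def)
    have "dist (complex_of_real (a + h)) (of_real a) = h"
      unfolding dist_of_real using h by (simp add: dist_real_def)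
    then have "complex_of_real (a + h) \<in> S" "dist (complex_of_real (a + h)) (of_real a) < e"
      using h d by (auto simp: dist_commute subset_iff)
    then show "\<exists>x'\<in>complex_of_real ` {x. complex_of_real x \<in> S}. x' \<noteq> of_real a \<and> dist x' (of_real a) < e"
      using h by (intro bexI[of _ "of_real (a + h)"] imageI) auto
  qed
  have "(\<lambda>z. f z - g z) z = 0"
    by (rule analytic_continuation[of _ S "complex_of_real ` {x. complex_of_real x \<in> S}" "of_real a"])
      (use lim eq a S z in \<open>auto intro!: holomorphic_intros f g\<close>)
  then show ?thesis by simp
qed

text \<open>Membership in \<open>Dsp\<close> provides a holomorphic extension of f; the identity
  theorem transfers both the equation and the parity from the real line to it, after which
  \<open>parity_imp_regsol\<close> applies.\<close>

lemma Dsp_eigen_regsol: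
  assumes \<tau>: "Im \<tau> > 0" and f: "f \<in> Dsp l" and eig: "eigen \<tau> l E f"
  shows "\<exists>k. \<forall>x::real. \<bar>x\<bar> < 1/2 \<longrightarrow> f x = k * regsol \<tau> l E (of_real x)"
proof -
  obtain S g where S: "open S" "range complex_of_real \<subseteq> S" "g holomorphic_on S"
    and fg: "\<And>x. f x = g (complex_of_real x) * Phi l x" and par: "\<And>x. f x = (-1) ^ (l 0 + 1) * f (- x)"
    using f unfolding Dsp_def by blast
  define F where "F = (\<lambda>z. g z * PhiC l z)"
  have Ff: "F (of_real x) = f x" for x by (simp add: F_def fg PhiC_of_real)
  have FS: "F holomorphic_on S" unfolding F_def by (intro holomorphic_intros S holomorphic_PhiC)
  \<comment> \<open>\<open>S\<close> may be disconnected or thin. The component of the origin still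
    contains the whole real segment (-1/2, 1/2), because that segment is connected.\<close>
  define T where "T = connected_component_set (S \<inter> cell \<tau>) 0"
  have opT: "open T" unfolding T_def by (intro open_connected_component open_Int S open_cell \<tau>)
  have conT: "connected T" unfolding T_def by (rule connected_connected_component)
  have Tsub: "T \<subseteq> S" "T \<subseteq> cell \<tau>" using connected_component_subset unfolding T_def by blast+
  have realT: "complex_of_real x \<in> T" if "\<bar>x\<bar> < 1/2" for x
  proof -
    have "complex_of_real ` {-1/2<..<1/2} \<subseteq> T"
      unfolding T_def
    proof (rule connected_component_maximal)
      show "connected (complex_of_real ` {-1/2<..<1/2})"
        by (intro connected_continuous_image continuous_intros connected_Ioo)
      show "complex_of_real ` {- 1 / 2<..<1 / 2} \<subseteq> S \<inter> cell \<tau>" using S \<tau> by (auto simp: cell_def)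
      show "0 \<in> complex_of_real ` {-1/2<..<1/2}" by (intro image_eqI[of _ _ 0]) auto
    qed
    moreover have "complex_of_real x \<in> complex_of_real ` {-1/2<..<1/2}"
      by (intro imageI) (use that in \<open>auto simp: abs_less_iff\<close>)
    ultimately show ?thesis by (rule subsetD)
  qed
  define T0 where "T0 = T - {0}"
  have T0: "open T0" "connected T0"
    unfolding T0_def by (simp_all add: opT open_delete connected_diff_countable conT)
  have T0c: "T0 \<subseteq> cell \<tau> - {0}" using Tsub by (auto simp: T0_def)
  have quarter: "complex_of_real (1/4) \<in> T0" using realT[of "1/4"] by (simp add: T0_def)
  have FT: "F holomorphic_on T" "F holomorphic_on T0"
    using FS Tsub holomorphic_on_subset by (auto simp: T0_def)
  obtain f1 f2 where f12: "\<And>x. (f has_vector_derivative f1 x) (at x)" "\<And>x. (f1 has_vector_derivative f2 x) (at x)"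
    "\<And>x. complex_of_real x \<notin> poles \<tau> l \<Longrightarrow> - f2 x + pot \<tau> l (complex_of_real x) * f x - E * f x = 0"
    using eig unfolding eigen_def by blast
  have fF: "f = (\<lambda>x. F (of_real x))" by (simp add: Ff)
  have "f1 x = deriv F (of_real x)" for x
    using vector_derivative_unique_at[OF f12(1)[of x, unfolded fF] has_vector_derivative_of_real[OF holomorphic_has_deriv[OF FS S(1)]]] S(2) by auto
  then have f1: "f1 = (\<lambda>x. deriv F (of_real x))" by auto
  have f2: "f2 x = deriv (deriv F) (of_real x)" for x
    using vector_derivative_unique_at[OF f12(2)[of x, unfolded f1]
       has_vector_derivative_of_real[OF holomorphic_has_deriv[OF holomorphic_deriv[OF FS S(1)] S(1)]]] S(2) by auto
  have np: "z \<notin> poles \<tau> l" if "z \<in> T0" for z using cell_not_poles[OF \<tau>] T0c that by blast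
  have "deriv (deriv F) z = (pot \<tau> l z - E) * F z" if z: "z \<in> T0" for z
  proof (rule real_identity[OF _ _ T0 quarter _ z])
    show "deriv (deriv F) holomorphic_on T0" by (intro holomorphic_deriv FT T0)
    show "(\<lambda>z. (pot \<tau> l z - E) * F z) holomorphic_on T0"
      by (intro holomorphic_intros FT holomorphic_on_subset[OF holomorphic_pot[OF \<tau>]]) (use np in auto)
    fix x assume "complex_of_real x \<in> T0"
    from f12(3)[OF np[OF this]] show "deriv (deriv F) (of_real x) = (pot \<tau> l (of_real x) - E) * F (of_real x)"
      by (simp add: Ff f2 algebra_simps)
  qed
  then have ode: "ode_sol (\<lambda>x. pot \<tau> l x - E) T0 F" using FT by (simp add: ode_sol_def)
  \<comment> \<open>\<open>T\<close> may fail to be symmetric, so parity is exploited on a small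
    ball, and the resulting proportionality is continued over \<open>T0\<close>.\<close>
  obtain r where r: "r > 0" "ball 0 r \<subseteq> T" 
  proof -
    have "0 \<in> T" using realT[of 0] by simp
    then show ?thesis using that opT open_contains_ball by blast
  qed
  have parF: "F (- z) = (-1) ^ (l 0 + 1) * F z" if z: "z \<in> ball 0 r" for z
  proof (rule real_identity[where f = "\<lambda>z. F (- z)" and g = "\<lambda>z. (-1) ^ (l 0 + 1) * F z" and S = "ball 0 r" and a = 0])
    have "(F \<circ> uminus) holomorphic_on ball 0 r"
      by (rule holomorphic_on_compose_gen[OF _ holomorphic_on_subset[OF FT(1) r(2)]]) (auto intro!: holomorphic_intros)
    then show "(\<lambda>z. F (- z)) holomorphic_on ball 0 r" by (simp add: o_def)
    show "(\<lambda>z. (-1) ^ (l 0 + 1) * F z) holomorphic_on ball 0 r"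
      by (intro holomorphic_intros holomorphic_on_subset[OF FT(1) r(2)])
    fix x :: real
    have "F (- of_real x) = f (- x)" using Ff[of "- x"] by simp
    moreover have "(-1) ^ (l 0 + 1) * ((-1) ^ (l 0 + 1) * f (- x)) = f (- x)"
      unfolding mult.assoc[symmetric] power_add[symmetric] by simp
    ultimately show "F (- of_real x) = (-1) ^ (l 0 + 1) * F (of_real x)" unfolding Ff using par[of x] by simp
  qed (use r z in auto)
  let ?B = "ball 0 r - {0::complex}"
  have Bsub: "?B \<subseteq> T0" using r by (auto simp: T0_def)
  have "\<exists>k. \<forall>x\<in>?B. F x = k * regsol \<tau> l E x"
  proof (rule parity_imp_regsol[OF \<tau> _ _ _ _ _ ode_sol_subset[OF ode Bsub]])
    show "open ?B" by (simp add: open_delete)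
    show "connected ?B" by (intro connected_diff_countable) auto
    have "insert 0 ?B = ball 0 r" using r by auto
    then show "open (insert 0 ?B)" by simp
    show "?B \<subseteq> cell \<tau> - {0}" using Bsub T0c by blast
  qed (use parF in auto)
  then obtain k where k: "\<And>x. x \<in> ?B \<Longrightarrow> F x = k * regsol \<tau> l E x" by blast
  have kT: "F x = k * regsol \<tau> l E x" if "x \<in> T0" for x
  proof (rule identity_open[OF FT(2) _ T0 _ _ Bsub k that])
    show "(\<lambda>x. k * regsol \<tau> l E x) holomorphic_on T0"
      by (intro holomorphic_intros holomorphic_on_subset[OF regsol_holomorphic[OF \<tau>]]) (use T0c in auto)
    show "open ?B" by (simp add: open_delete)
    have "complex_of_real (r/2) \<in> ?B" using r by simp
    then show "?B \<noteq> {}" by blast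
  qed
  show ?thesis
  proof (intro exI[of _ k] allI impI)
    fix x :: real assume x: "\<bar>x\<bar> < 1/2"
    show "f x = k * regsol \<tau> l E (of_real x)"
    proof (cases "x = 0")
      case True
      then show ?thesis by (simp add: fg Phi_def regsol_0[OF \<tau>])
    next
      case False
      then have "complex_of_real x \<in> T0" using realT[OF x] by (simp add: T0_def)
      from kT[OF this] show ?thesis by (simp add: Ff)
    qed
  qed
qed

section \<open>Gluing the regular solutions at 0 and at 1/2\<close>

lemma ode_sol_local:
  assumes "open S" and loc: "\<And>z. z \<in> S \<Longrightarrow> \<exists>N y. z \<in> N \<and> open N \<and> ode_sol v N y \<and> (\<forall>w\<in>N. F w = y w)"
  shows "ode_sol v S F"
proof (rule ode_solI[OF assms(1), where y' = "deriv F"])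
  fix z assume z: "z \<in> S"
  obtain N y where N: "z \<in> N" "open N" "ode_sol v N y" "\<And>w. w \<in> N \<Longrightarrow> F w = y w" using loc[OF z] by blast
  have F: "ode_sol v N F" by (rule ode_sol_cong[OF N(3,2)]) (use N(4) in auto)
  show "(F has_field_derivative deriv F z) (at z)" "(deriv F has_field_derivative v z * F z) (at z)"
    using ode_solD[OF F N(2,1)] by blast+
qed

text \<open>The value at \<open>1/4\<close> of the Wronskian of the regular solutions at \<open>0\<close> and at \<open>1/2\<close>; its zeros are the
  eigenvalues on the space \<open>Dsp l\<close>.\<close>

definition half_shift :: "complex \<Rightarrow> (nat \<Rightarrow> nat) \<Rightarrow> complex \<Rightarrow> complex \<Rightarrow> complex" where
  "half_shift \<tau> l E z = regsol \<tau> (l \<circ> swap_half) E (z - 1/2)"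

definition evans :: "complex \<Rightarrow> (nat \<Rightarrow> nat) \<Rightarrow> complex \<Rightarrow> complex" where
  "evans \<tau> l E = regsol \<tau> l E (1/4) * regsol' \<tau> (l \<circ> swap_half) E (- 1/4)
     - regsol' \<tau> l E (1/4) * regsol \<tau> (l \<circ> swap_half) E (- 1/4)"

text \<open>The right half of the cell about 0, which is also the left half of the cell about 1/2:
  both regular solutions are defined and solve the equation here.\<close>

definition overlap :: "complex \<Rightarrow> complex set" where
  "overlap \<tau> = {z. 0 < Re z \<and> Re z < 1/2 \<and> \<bar>Im z\<bar> < Im \<tau> / 2}"

lemma overlap_facts:
  assumes \<tau>: "Im \<tau> > 0"
  shows "open (overlap \<tau>)" "connected (overlap \<tau>)" "z \<in> overlap \<tau> \<Longrightarrow> z \<in> cell \<tau> - {0}"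
    "z \<in> overlap \<tau> \<Longrightarrow> z - 1/2 \<in> cell \<tau> - {0}" "1/4 \<in> overlap \<tau>"
proof -
  have eq: "overlap \<tau> = {x. Re x < 1/2} \<inter> {x. Re x > 0} \<inter> {x. Im x < Im \<tau> / 2} \<inter> {x. Im x > - Im \<tau> / 2}"
    by (auto simp: overlap_def)
  show "open (overlap \<tau>)" unfolding eq
    by (intro open_Int open_halfspace_Re_lt open_halfspace_Re_gt open_halfspace_Im_lt open_halfspace_Im_gt)
  show "connected (overlap \<tau>)" unfolding eq
    by (intro convex_connected convex_Int convex_halfspace_Re_lt convex_halfspace_Re_gt convex_halfspace_Im_lt convex_halfspace_Im_gt)
  show "z \<in> overlap \<tau> \<Longrightarrow> z \<in> cell \<tau> - {0}" by (auto simp: overlap_def cell_def)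
  show "z \<in> overlap \<tau> \<Longrightarrow> z - 1/2 \<in> cell \<tau> - {0}" by (auto simp: overlap_def cell_def complex_eq_iff)
  show "1/4 \<in> overlap \<tau>" using \<tau> by (simp add: overlap_def)
qed

lemma half_shift_ode:
  assumes \<tau>: "Im \<tau> > 0"
  shows "ode_sol (\<lambda>x. pot \<tau> l x - E) {z. z - 1/2 \<in> cell \<tau> - {0}} (half_shift \<tau> l E)"
proof -
  have op: "open {z. z - 1/2 \<in> cell \<tau> - {0}}"
  proof -
    have "open ((\<lambda>z. z - 1/2) -` (cell \<tau> - {0}))"
      by (intro continuous_open_vimage open_connected_punctured_cell(1)[OF \<tau>]) (auto intro!: continuous_intros)
    then show ?thesis by (simp add: vimage_def)
  qed
  have t: "ode_sol (\<lambda>x. pot \<tau> (l \<circ> swap_half) (x + - (1/2)) - E) {z. z - 1/2 \<in> cell \<tau> - {0}} (\<lambda>x. regsol \<tau> (l \<circ> swap_half) E (x + - (1/2)))"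
    using ode_sol_translate[OF regsol_ode[OF \<tau>, of "l \<circ> swap_half" E] open_connected_punctured_cell(1)[OF \<tau>], of "- (1/2)"] by simp
  show ?thesis
  proof (rule ode_sol_cong[OF t op])
    fix x assume "x \<in> {z. z - 1/2 \<in> cell \<tau> - {0}}"
    then have "x - 1/2 \<notin> poles \<tau> (l \<circ> swap_half)" using cell_not_poles[OF \<tau>] by blast
    then have "x - 1/2 + 1/2 \<notin> poles \<tau> l" by (simp only: poles_swap_half) simp
    from pot_swap_half[OF \<tau> this]
    show "pot \<tau> (l \<circ> swap_half) (x + - (1/2)) - E = pot \<tau> l x - E" by simp
  qed (simp add: half_shift_def)
qed

lemma evans_eq_wronskian:
  assumes \<tau>: "Im \<tau> > 0"
  shows "evans \<tau> l E = wronskian (regsol \<tau> l E) (half_shift \<tau> l E) (1/4)"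
proof -
  have c: "1/4 \<in> cell \<tau>" "- 1/4 \<in> cell \<tau>" using \<tau> by (auto simp: cell_def)
  have "((\<lambda>z. regsol \<tau> (l \<circ> swap_half) E (z + - (1/2))) has_field_derivative regsol' \<tau> (l \<circ> swap_half) E (- 1/4)) (at (1/4))"
    using regsol_deriv[OF \<tau> c(2), of "l \<circ> swap_half" E]
      DERIV_shift[of "regsol \<tau> (l \<circ> swap_half) E" _ "1/4" "- (1/2)"] by simp
  then have "deriv (half_shift \<tau> l E) (1/4) = regsol' \<tau> (l \<circ> swap_half) E (- 1/4)"
    unfolding half_shift_def[abs_def] by (intro DERIV_imp_deriv) simp
  then show ?thesis by (simp add: evans_def wronskian_def half_shift_def deriv_regsol[OF \<tau> c(1)])
qed

lemma regsol_nonzero_open: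
  assumes \<tau>: "Im \<tau> > 0" and T: "open T" "T \<noteq> {}" "T \<subseteq> cell \<tau>"
  obtains a where "a \<in> T" "regsol \<tau> l E a \<noteq> 0"
proof (rule ccontr)
  assume "\<not> thesis"
  then have 0: "regsol \<tau> l E z = 0" if "z \<in> T" for z using that \<open>\<And>a. a \<in> T \<Longrightarrow> regsol \<tau> l E a \<noteq> 0 \<Longrightarrow> thesis\<close> by blast
  have 0: "0 \<in> cell \<tau>" using \<tau> by (simp add: cell_def)
  obtain a where a: "regsol \<tau> l E a \<noteq> 0" "a \<in> cell \<tau>"
    using regsol_nonzero[OF \<tau> open_cell[OF \<tau>] 0] by blast
  have "regsol \<tau> l E a = 0"
    by (rule identity_open[OF regsol_holomorphic[OF \<tau>] _ open_cell[OF \<tau>] _ T _ a(2)])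
      (use \<open>\<And>z. z \<in> T \<Longrightarrow> regsol \<tau> l E z = 0\<close> convex_connected[OF convex_cell] in auto)
  with a show False by simp
qed

lemma evans_zero_proportional:
  assumes \<tau>: "Im \<tau> > 0" and W: "evans \<tau> l E = 0"
  obtains k where "k \<noteq> 0" "\<And>z. z \<in> overlap \<tau> \<Longrightarrow> regsol \<tau> l E z = k * half_shift \<tau> l E z"
proof -
  let ?O = "overlap \<tau>" and ?f = "regsol \<tau> l E" and ?g = "half_shift \<tau> l E"
  have f: "ode_sol (\<lambda>x. pot \<tau> l x - E) ?O ?f" by (rule ode_sol_subset[OF regsol_ode[OF \<tau>]]) (use overlap_facts[OF \<tau>] in auto)
  have g: "ode_sol (\<lambda>x. pot \<tau> l x - E) ?O ?g" by (rule ode_sol_subset[OF half_shift_ode[OF \<tau>]]) (use overlap_facts[OF \<tau>] in auto)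
  have hol: "?f holomorphic_on ?O" "?g holomorphic_on ?O" using f g by (auto simp: ode_sol_def)
  have W0: "wronskian ?g ?f z = 0" if "z \<in> ?O" for z
  proof -
    have "wronskian ?f ?g z = 0"
      using wronskian_const[OF f g overlap_facts(1,2)[OF \<tau>] that overlap_facts(5)[OF \<tau>]] W evans_eq_wronskian[OF \<tau>] by simp
    then show ?thesis by (simp add: wronskian_def algebra_simps)
  qed
  have ne: "?O \<noteq> {}" using overlap_facts(5)[OF \<tau>] by blast
  obtain a where a: "a \<in> ?O" "?f a \<noteq> 0"
    using regsol_nonzero_open[OF \<tau> overlap_facts(1)[OF \<tau>] ne] overlap_facts(3)[OF \<tau>] by blast
  have "open ((\<lambda>z. z + 1/2) -` ?O)"
    by (intro continuous_open_vimage overlap_facts(1) \<tau>) (auto intro!: continuous_intros)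
  moreover have "- 1/4 \<in> (\<lambda>z. z + 1/2) -` ?O" using overlap_facts(5)[OF \<tau>] by simp
  moreover have "(\<lambda>z. z + 1/2) -` ?O \<subseteq> cell \<tau>" using overlap_facts(4)[OF \<tau>] by force
  ultimately obtain b where b: "b + 1/2 \<in> ?O" "regsol \<tau> (l \<circ> swap_half) E b \<noteq> 0"
    using regsol_nonzero_open[OF \<tau>, of "(\<lambda>z. z + 1/2) -` ?O"] by blast
  have "?g (b + 1/2) \<noteq> 0" using b(2) by (simp add: half_shift_def)
  from proportional_if_wronskian_0[OF hol(2,1) overlap_facts(1,2)[OF \<tau>] W0 b(1) this]
  obtain k where k: "\<And>z. z \<in> ?O \<Longrightarrow> ?f z = k * ?g z" by blast
  have "k \<noteq> 0" using k[OF a(1)] a(2) by auto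
  then show ?thesis using that k by blast
qed

text \<open>Proportional regular solutions patch to a function around 0 and 1/2, which is spread
  over the strip by the sign of the quasi-period. \<open>FA\<close> and \<open>FB\<close> show that
  on each translated cell the result is given by one analytic formula.\<close>

lemma evans_zero_strip_solution:
  assumes \<tau>: "Im \<tau> > 0" and W: "evans \<tau> l E = 0"
  obtains F k where "ode_sol (\<lambda>x. pot \<tau> l x - E) (strip \<tau> - half_ints) F"
    "\<And>x. x \<in> strip \<tau> - half_ints \<Longrightarrow> F (x + 1) = (-1) ^ (l 0 + l 1) * F x"
    "\<And>x. x \<in> strip \<tau> - half_ints \<Longrightarrow> F (- x) = (-1) ^ (l 0 + 1) * F x"
    "\<And>x. x \<in> cell \<tau> - {0} \<Longrightarrow> F x = regsol \<tau> l E x"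
    "\<And>x. x \<in> cell \<tau> - {0} \<Longrightarrow> F (x + 1/2) = k * regsol \<tau> (l \<circ> swap_half) E x" "k \<noteq> 0"
proof -
  obtain k where k0: "k \<noteq> 0" and k: "\<And>z. z \<in> overlap \<tau> \<Longrightarrow> regsol \<tau> l E z = k * half_shift \<tau> l E z"
    using evans_zero_proportional[OF assms] by blast
  define \<epsilon> :: complex where "\<epsilon> = (-1) ^ (l 0 + l 1)"
  have \<epsilon>2: "\<epsilon> * \<epsilon> = 1" by (simp add: \<epsilon>_def power_add[symmetric])
  have \<epsilon>0: "\<epsilon> \<noteq> 0" by (simp add: \<epsilon>_def)
  define F0 where "F0 = (\<lambda>z. if Re z < 1/2 then regsol \<tau> l E z else k * half_shift \<tau> l E z)"
  \<comment> \<open>The fundamental period is -1/4 <= Re z < 3/4. Its seam lies inside the cells of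
    the integers, and the switch at Re z = 1/2 inside those of the half-odd points, so both are
    crossed by a single formula.\<close>
  define F where "F = (\<lambda>z. \<epsilon> powi \<lfloor>Re z + 1/4\<rfloor> * F0 (z - of_int \<lfloor>Re z + 1/4\<rfloor>))"
  \<comment> \<open>Reflection about 0 followed by reflection about 1/2 is translation by 1, so the
    two parity signs multiply to the quasi-period sign \<epsilon>.\<close>
  have jump: "k * half_shift \<tau> l E (w + 1) = \<epsilon> * regsol \<tau> l E w" if w: "- w \<in> overlap \<tau>" for w
  proof -
    have c: "w \<in> cell \<tau>" "- w - 1/2 \<in> cell \<tau>"
      using w by (auto simp: overlap_def cell_def)
    have "k * half_shift \<tau> l E (w + 1) = k * regsol \<tau> (l \<circ> swap_half) E (- (- w - 1/2))"
      by (simp add: half_shift_def)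
    also have "\<dots> = (-1) ^ (l 1 + 1) * (k * half_shift \<tau> l E (- w))"
      unfolding regsol_uminus[OF \<tau> c(2), of "l \<circ> swap_half" E] by (simp add: half_shift_def swap_half_def)
    also have "k * half_shift \<tau> l E (- w) = regsol \<tau> l E (- w)" using k[OF w] by simp
    also have "\<dots> = (-1) ^ (l 0 + 1) * regsol \<tau> l E w" by (rule regsol_uminus[OF \<tau> c(1)])
    finally show ?thesis by (simp add: \<epsilon>_def power_add mult_ac)
  qed
  have FA: "F z = \<epsilon> powi n * regsol \<tau> l E (z - of_int n)" if z: "z - of_int n \<in> cell \<tau>" for z n
  proof -
    have re: "\<bar>Re z - real_of_int n\<bar> < 1/2" "\<bar>Im z\<bar> < Im \<tau> / 2" using z by (auto simp: cell_def)
    show ?thesis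
    proof (cases "Re z - real_of_int n < - 1/4")
      case True
      then have fl: "\<lfloor>Re z + 1/4\<rfloor> = n - 1" using re by (intro floor_unique) linarith+
      have "- (z - of_int n) \<in> overlap \<tau>" using re True by (auto simp: overlap_def)
      from jump[OF this] have "k * half_shift \<tau> l E (z - of_int (n - 1)) = \<epsilon> * regsol \<tau> l E (z - of_int n)" by (simp add: algebra_simps)
      moreover have "\<epsilon> powi (n - 1) * \<epsilon> = \<epsilon> powi n" using \<epsilon>0 power_int_add_1[of \<epsilon> "n - 1"] by simp
      ultimately show ?thesis using True re unfolding F_def fl F0_def
        by (auto simp: mult.assoc[symmetric])
    next
      case False
      then have "\<lfloor>Re z + 1/4\<rfloor> = n" using re by (intro floor_unique) linarith+
      then show ?thesis using re by (auto simp: F_def F0_def)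
    qed
  qed
  have FB: "F z = \<epsilon> powi n * (k * half_shift \<tau> l E (z - of_int n))" if z: "z - of_int n - 1/2 \<in> cell \<tau>" for z n
  proof -
    have re: "\<bar>Re z - real_of_int n - 1/2\<bar> < 1/2" "\<bar>Im z\<bar> < Im \<tau> / 2" using z by (auto simp: cell_def)
    consider "Re z - real_of_int n < 1/2" | "1/2 \<le> Re z - real_of_int n" "Re z - real_of_int n < 3/4" | "3/4 \<le> Re z - real_of_int n" by linarith
    then show ?thesis
    proof cases
      case 1
      have "z - of_int n \<in> overlap \<tau>" using re 1 by (auto simp: overlap_def)
      from k[OF this] FA[of z n] overlap_facts(3)[OF \<tau> this] show ?thesis by auto
    next
      case 2
      then have "\<lfloor>Re z + 1/4\<rfloor> = n" using re by (intro floor_unique) linarith+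
      then show ?thesis using 2 by (auto simp: F_def F0_def)
    next
      case 3
      have "- (z - of_int (n + 1)) \<in> overlap \<tau>" using re 3 by (auto simp: overlap_def)
      from jump[OF this] overlap_facts(3)[OF \<tau> this]
      have j: "k * half_shift \<tau> l E (z - of_int n) = \<epsilon> * regsol \<tau> l E (z - of_int (n + 1))"
        and c: "z - of_int (n + 1) \<in> cell \<tau>"
        using uminus_cell[of "z - of_int (n + 1)" \<tau>] by (auto simp: algebra_simps simp del: uminus_cell)
      have "\<epsilon> powi (n + 1) = \<epsilon> powi n * \<epsilon>" using \<epsilon>0 by (simp add: power_int_add_1)
      with FA[OF c] j show ?thesis by simp
    qed
  qed
  have cover: "(\<exists>n. z - of_int n \<in> cell \<tau> - {0}) \<or> (\<exists>n. z - of_int n - 1/2 \<in> cell \<tau> - {0})" if z: "z \<in> strip \<tau> - half_ints" for z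
  proof -
    define n where "n = \<lfloor>Re z\<rfloor>"
    have n: "real_of_int n \<le> Re z" "Re z < real_of_int n + 1" by (auto simp: n_def)
    have im: "\<bar>Im z\<bar> < Im \<tau> / 2" using z by (simp add: strip_def)
    have nz: "z \<noteq> of_int m" "z \<noteq> of_int m + 1/2" for m using z half_intsI by auto
    show ?thesis
    proof (cases "Re z = real_of_int n")
      case True
      then have "z - of_int n \<in> cell \<tau> - {0}" using im nz(1)[of n] by (auto simp: cell_def)
      then show ?thesis by blast
    next
      case False
      then have "real_of_int n < Re z" using n(1) by simp
      then have "\<bar>Re (z - of_int n - 1/2)\<bar> < 1/2" using n(2) by (simp only: abs_less_iff) simp
      moreover have "z - of_int n - 1/2 \<noteq> 0"
        using nz(2)[of n] by (simp only: diff_diff_eq right_minus_eq not_False_eq_True)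
      ultimately have "z - of_int n - 1/2 \<in> cell \<tau> - {0}" using im by (simp add: cell_def)
      then show ?thesis by blast
    qed
  qed
  have ode: "ode_sol (\<lambda>x. pot \<tau> l x - E) (strip \<tau> - half_ints) F"
  proof (rule ode_sol_local[OF open_strip_half])
    have shift: "ode_sol (\<lambda>x. pot \<tau> l x - E) {z. z - of_int n \<in> S} (\<lambda>z. \<epsilon> powi n * y (z - of_int n)) \<and> open {z. z - of_int n \<in> S}"
      if y: "ode_sol (\<lambda>x. pot \<tau> l x - E) S y" and S: "open S" "S \<inter> poles \<tau> l = {}" for n y S
    proof
      have "open ((\<lambda>z. z - of_int n) -` S)" by (intro continuous_open_vimage S) (auto intro!: continuous_intros)
      then show op: "open {z. z - of_int n \<in> S}" by (simp add: vimage_def)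
      have t: "ode_sol (\<lambda>x. pot \<tau> l (x + - of_int n) - E) {z. z - of_int n \<in> S} (\<lambda>x. \<epsilon> powi n * y (x + - of_int n) + 0 * y (x + - of_int n))"
        using ode_sol_translate[OF y S(1), of "- of_int n"] op by (intro ode_sol_lincomb) simp_all
      show "ode_sol (\<lambda>x. pot \<tau> l x - E) {z. z - of_int n \<in> S} (\<lambda>z. \<epsilon> powi n * y (z - of_int n))"
      proof (rule ode_sol_cong[OF t op])
        fix x assume "x \<in> {z. z - of_int n \<in> S}"
        then have "x - of_int n \<notin> poles \<tau> l" using S by blast
        from pot_shift[OF \<tau> this lattice_of_int(1)[of n]] show "pot \<tau> l (x + - of_int n) - E = pot \<tau> l x - E" by simp
      qed simp
    qed
    fix z assume "z \<in> strip \<tau> - half_ints"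
    from cover[OF this] show "\<exists>N y. z \<in> N \<and> open N \<and> ode_sol (\<lambda>x. pot \<tau> l x - E) N y \<and> (\<forall>w\<in>N. F w = y w)"
    proof (elim disjE exE)
      fix n assume zn: "z - of_int n \<in> cell \<tau> - {0}"
      have "(cell \<tau> - {0}) \<inter> poles \<tau> l = {}" using cell_not_poles[OF \<tau>] by blast
      from shift[OF regsol_ode[OF \<tau>] open_connected_punctured_cell(1)[OF \<tau>] this, of n] show ?thesis
        by (intro exI[of _ "{z. z - of_int n \<in> cell \<tau> - {0}}"] exI[of _ "\<lambda>z. \<epsilon> powi n * regsol \<tau> l E (z - of_int n)"])
          (use zn FA in auto)
    next
      fix n assume zn: "z - of_int n - 1/2 \<in> cell \<tau> - {0}"
      let ?S = "{z. z - 1/2 \<in> cell \<tau> - {0}}"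
      have op: "open ?S"
      proof -
        have "open ((\<lambda>z. z - 1/2) -` (cell \<tau> - {0}))"
          by (intro continuous_open_vimage open_connected_punctured_cell(1)[OF \<tau>]) (auto intro!: continuous_intros)
        then show ?thesis by (simp add: vimage_def)
      qed
      have np: "?S \<inter> poles \<tau> l = {}"
      proof -
        have "x \<notin> poles \<tau> l" if "x - 1/2 \<in> cell \<tau> - {0}" for x
        proof -
          have "x - 1/2 \<notin> poles \<tau> (l \<circ> swap_half)" using cell_not_poles[OF \<tau>] that by blast
          then have "x - 1/2 + 1/2 \<notin> poles \<tau> l" by (simp only: poles_swap_half) simp
          then show ?thesis by simp
        qed
        then show ?thesis by blast
      qed
      have "ode_sol (\<lambda>x. pot \<tau> l x - E) ?S (\<lambda>x. k * half_shift \<tau> l E x + 0 * half_shift \<tau> l E x)"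
        by (intro ode_sol_lincomb half_shift_ode \<tau> op)
      then have "ode_sol (\<lambda>x. pot \<tau> l x - E) ?S (\<lambda>x. k * half_shift \<tau> l E x)"
        by (simp only: mult_zero_left add_0_right)
      note sh = shift[OF this op np, of n]
      show ?thesis
      proof (intro exI conjI ballI)
        show "z \<in> {z. z - of_int n \<in> ?S}" unfolding mem_Collect_eq by (rule zn)
        show "open {z. z - of_int n \<in> ?S}" by (rule sh[THEN conjunct2])
        show "ode_sol (\<lambda>x. pot \<tau> l x - E) {z. z - of_int n \<in> ?S} (\<lambda>z. \<epsilon> powi n * (k * half_shift \<tau> l E (z - of_int n)))"
          by (rule sh[THEN conjunct1])
        show "F w = \<epsilon> powi n * (k * half_shift \<tau> l E (w - of_int n))" if "w \<in> {z. z - of_int n \<in> ?S}" for w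
          by (rule FB) (use that in blast)
      qed
    qed
  qed
  have F0: "F x = regsol \<tau> l E x" if "x \<in> cell \<tau> - {0}" for x using FA[of x 0] that by simp
  have per: "F (x + 1) = \<epsilon> * F x" for x
  proof -
    have "\<lfloor>Re (x + 1) + 1/4\<rfloor> = \<lfloor>(Re x + 1/4) + 1\<rfloor>" by (intro arg_cong[of _ _ floor]) simp
    also have "\<dots> = \<lfloor>Re x + 1/4\<rfloor> + 1" by (rule one_add_floor[symmetric])
    finally have "\<lfloor>Re (x + 1) + 1/4\<rfloor> = \<lfloor>Re x + 1/4\<rfloor> + 1" .
    then show ?thesis using \<epsilon>0 by (simp add: F_def power_int_add_1 mult_ac)
  qed
  have parity: "F (- x) = (-1) ^ (l 0 + 1) * F x" if x: "x \<in> strip \<tau> - half_ints" for x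
  proof (rule identity_open[where f = "\<lambda>x. F (- x)" and g = "\<lambda>x. (-1) ^ (l 0 + 1) * F x",
      OF _ _ open_strip_half connected_strip_half open_connected_punctured_cell(1)[OF \<tau>] _ _ _ x])
    have Fh: "F holomorphic_on strip \<tau> - half_ints" using ode by (simp add: ode_sol_def)
    show "(\<lambda>x. (-1) ^ (l 0 + 1) * F x) holomorphic_on strip \<tau> - half_ints" by (intro holomorphic_intros Fh)
    have "(F \<circ> uminus) holomorphic_on strip \<tau> - half_ints"
      by (rule holomorphic_on_compose_gen[OF _ Fh]) (auto intro!: holomorphic_intros simp: half_ints_uminus)
    then show "(\<lambda>x. F (- x)) holomorphic_on strip \<tau> - half_ints" by (simp add: o_def)
    have "1/4 \<in> cell \<tau> - {0}" using \<tau> by (simp add: cell_def)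
    then show "cell \<tau> - {0} \<noteq> {}" by blast
    show "cell \<tau> - {0} \<subseteq> strip \<tau> - half_ints" using cell_half_ints cell_strip by blast
    fix z assume "z \<in> cell \<tau> - {0}"
    then show "F (- z) = (-1) ^ (l 0 + 1) * F z" using F0[of z] F0[of "- z"] regsol_uminus[OF \<tau>] by simp
  qed
  show ?thesis
    by (rule that[OF ode _ parity F0 _ k0]) (use per FB[of _ 0] in \<open>auto simp: \<epsilon>_def half_shift_def\<close>)
qed

subsection \<open>The Lenard recursion\<close>

text \<open>The coefficients of the formal solution \<open>h = 1 + h\<^sub>1 / E + \<dots>\<close> of
  \<open>2 h h'' - h'\<^sup>2 - 4 (u - E) h\<^sup>2 = 4 E\<close>, whose \<open>x\<close>-derivative is \<open>2 h\<close> times the third-order equation.\<close>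

fun lenard :: "(complex \<Rightarrow> complex) \<Rightarrow> nat \<Rightarrow> complex \<Rightarrow> complex" where
  "lenard u 0 = (\<lambda>x. 1)"
| "lenard u (Suc n) = (\<lambda>x. - (1/2) * (\<Sum>j<n. lenard u (Suc j) x * lenard u (n - j) x)
     - (1/8) * (\<Sum>j\<le>n. 2 * lenard u j x * deriv (deriv (lenard u (n - j))) x
          - deriv (lenard u j) x * deriv (lenard u (n - j)) x
          - 4 * u x * lenard u j x * lenard u (n - j) x))"

declare lenard.simps(2) [simp del]

definition third_op :: "(complex \<Rightarrow> complex) \<Rightarrow> (complex \<Rightarrow> complex) \<Rightarrow> complex \<Rightarrow> complex" where
  "third_op u h x = deriv (deriv (deriv h)) x - 4 * u x * deriv h x - 2 * deriv u x * h x"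

lemma sum_square_split:
  fixes h :: "nat \<Rightarrow> complex"
  shows "(\<Sum>j\<le>Suc n. h j * h (Suc n - j)) = 2 * (h 0 * h (Suc n)) + (\<Sum>j<n. h (Suc j) * h (n - j))"
proof -
  have "(\<Sum>j\<le>Suc n. h j * h (Suc n - j)) = h 0 * h (Suc n) + (\<Sum>j\<le>n. h (Suc j) * h (n - j))"
    by (subst sum.atMost_Suc_shift) simp
  also have "(\<Sum>j\<le>n. h (Suc j) * h (n - j)) = (\<Sum>j<n. h (Suc j) * h (n - j)) + h (Suc n) * h 0"
    by (subst lessThan_Suc_atMost[symmetric], subst sum.lessThan_Suc) simp
  finally show ?thesis by (simp add: mult.commute)
qed

text \<open>This is the coefficient of E^(-n) in the quadratic identity. The newest term h_(n+1)
  enters only through 2 h_0 h_(n+1) with h_0 = 1, and the definition of \<open>lenard\<close> solves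
  for it.\<close>

lemma lenard_quadratic:
  "(\<Sum>j\<le>n. 2 * lenard u j x * deriv (deriv (lenard u (n - j))) x - deriv (lenard u j) x * deriv (lenard u (n - j)) x
      - 4 * u x * lenard u j x * lenard u (n - j) x)
    + 4 * (\<Sum>j\<le>Suc n. lenard u j x * lenard u (Suc n - j) x) = 0" (is "?S + _ = 0")
proof -
  have "- (1/2) * b - (1/8) * a = h \<Longrightarrow> a + 4 * (2 * (1 * h) + b) = 0" for a b h :: complex
  proof -
    assume "- (1/2) * b - (1/8) * a = h"
    from this[symmetric] show ?thesis by (simp only:) (simp add: algebra_simps)
  qed
  from this[OF fun_cong[OF lenard.simps(2)[of u n], of x, symmetric]]
  show ?thesis unfolding sum_square_split[of "\<lambda>j. lenard u j x"] lenard.simps(1) .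
qed

lemma holomorphic_lenard:
  assumes "open S" "u holomorphic_on S" shows "lenard u n holomorphic_on S"
proof (induction n rule: less_induct)
  case (less n)
  show ?case
  proof (cases n)
    case (Suc m)
    have hj: "lenard u j holomorphic_on S" if "j \<le> m" for j
    proof -
      have "j < n" using that Suc by simp
      then show ?thesis by (rule less)
    qed
    have d: "deriv (lenard u j) holomorphic_on S" "deriv (deriv (lenard u j)) holomorphic_on S" if "j \<le> m" for j
      using holomorphic_deriv[OF hj[OF that] assms(1)] holomorphic_deriv[OF holomorphic_deriv[OF hj[OF that] assms(1)] assms(1)] by auto
    have t1: "(\<lambda>x. \<Sum>j<m. lenard u (Suc j) x * lenard u (m - j) x) holomorphic_on S"
      by (rule holomorphic_on_sum, rule holomorphic_on_mult[OF hj hj]) auto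
    have t2: "(\<lambda>x. \<Sum>j\<le>m. 2 * lenard u j x * deriv (deriv (lenard u (m - j))) x
          - deriv (lenard u j) x * deriv (lenard u (m - j)) x - 4 * u x * lenard u j x * lenard u (m - j) x) holomorphic_on S"
    proof (rule holomorphic_on_sum)
      fix j assume "j \<in> {..m}"
      then have j: "j \<le> m" "m - j \<le> m" by auto
      show "(\<lambda>x. 2 * lenard u j x * deriv (deriv (lenard u (m - j))) x
          - deriv (lenard u j) x * deriv (lenard u (m - j)) x - 4 * u x * lenard u j x * lenard u (m - j) x) holomorphic_on S"
        by (intro holomorphic_on_diff holomorphic_on_mult holomorphic_on_const hj[OF j(1)] hj[OF j(2)] d[OF j(1)] d[OF j(2)] assms(2))
    qed
    show ?thesis unfolding Suc lenard.simps(2)[of u m]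
      by (intro holomorphic_on_diff holomorphic_on_mult holomorphic_on_const t1 t2)
  qed simp
qed

text \<open>The derivative of the quadratic identity, read as a formal power series in 1/E, factors
  as 2h times the third-order equation. Power series over a field form an integral domain and h
  begins with 1, so the factor can be cancelled.\<close>

lemma lenard_recursion:
  assumes S: "open S" and u: "u holomorphic_on S" and x: "x \<in> S"
  shows "4 * deriv (lenard u (Suc n)) x = - third_op u (lenard u n) x"
proof -
  let ?h = "lenard u"
  have hol: "?h n holomorphic_on S" for n by (rule holomorphic_lenard[OF S u])
  have d0: "(?h n has_field_derivative deriv (?h n) x) (at x)"
    and d1: "(deriv (?h n) has_field_derivative deriv (deriv (?h n)) x) (at x)"
    and d2: "(deriv (deriv (?h n)) has_field_derivative deriv (deriv (deriv (?h n))) x) (at x)" for n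
    by (rule holomorphic_has_deriv[OF hol S x], rule holomorphic_has_deriv[OF holomorphic_deriv[OF hol S] S x],
      rule holomorphic_has_deriv[OF holomorphic_deriv[OF holomorphic_deriv[OF hol S] S] S x])
  have du: "(u has_field_derivative deriv u x) (at x)" by (rule holomorphic_has_deriv[OF u S x])
  \<comment> \<open>With x fixed, A, B, C, D are the generating series of the values of h, h', h'',
    h''', and \<open>fps_X\<close> stands for 1/E.\<close>
  define A where "A = Abs_fps (\<lambda>n. ?h n x)"
  define B where "B = Abs_fps (\<lambda>n. deriv (?h n) x)"
  define C where "C = Abs_fps (\<lambda>n. deriv (deriv (?h n)) x)"
  define D where "D = Abs_fps (\<lambda>n. deriv (deriv (deriv (?h n))) x)"
  define U where "U = fps_const (u x)"
  define U' where "U' = fps_const (deriv u x)"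
  have diff: "(\<Sum>j\<le>n. 2 * (deriv (?h j) x * deriv (deriv (?h (n - j))) x + ?h j x * deriv (deriv (deriv (?h (n - j)))) x)
        - (deriv (deriv (?h j)) x * deriv (?h (n - j)) x + deriv (?h j) x * deriv (deriv (?h (n - j))) x)
        - 4 * (deriv u x * ?h j x * ?h (n - j) x + u x * (deriv (?h j) x * ?h (n - j) x + ?h j x * deriv (?h (n - j)) x)))
      + 4 * (\<Sum>j\<le>Suc n. deriv (?h j) x * ?h (Suc n - j) x + ?h j x * deriv (?h (Suc n - j)) x) = 0" for n
  proof -
    have "((\<lambda>x. (\<Sum>j\<le>n. 2 * ?h j x * deriv (deriv (?h (n - j))) x - deriv (?h j) x * deriv (?h (n - j)) x
       - 4 * u x * ?h j x * ?h (n - j) x) + 4 * (\<Sum>j\<le>Suc n. ?h j x * ?h (Suc n - j) x)) has_field_derivative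
       (\<Sum>j\<le>n. 2 * (deriv (?h j) x * deriv (deriv (?h (n - j))) x + ?h j x * deriv (deriv (deriv (?h (n - j)))) x)
        - (deriv (deriv (?h j)) x * deriv (?h (n - j)) x + deriv (?h j) x * deriv (deriv (?h (n - j))) x)
        - 4 * (deriv u x * ?h j x * ?h (n - j) x + u x * (deriv (?h j) x * ?h (n - j) x + ?h j x * deriv (?h (n - j)) x)))
      + 4 * (\<Sum>j\<le>Suc n. deriv (?h j) x * ?h (Suc n - j) x + ?h j x * deriv (?h (Suc n - j)) x)) (at x)"
      by (rule derivative_eq_intros d0 d1 d2 du refl | (simp only: ring_distribs mult.assoc mult.commute mult.left_commute; fail))+
        (simp add: algebra_simps)
    then show ?thesis unfolding lenard_quadratic by (rule DERIV_unique[OF _ DERIV_const])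
  qed
  have "fps_X * (2 * (B * C + A * D) - (C * B + B * C) - 4 * (U' * A * A + U * (B * A + A * B))) + 4 * (B * A + A * B) = 0"
  proof (rule fps_ext)
    fix m
    show "(fps_X * (2 * (B * C + A * D) - (C * B + B * C) - 4 * (U' * A * A + U * (B * A + A * B))) + 4 * (B * A + A * B)) $ m = 0 $ m"
    proof (cases m)
      case 0 then show ?thesis by (simp add: A_def B_def fps_mult_nth)
    next
      case (Suc n)
      have num: "(2 * F) $ k = 2 * F $ k" "(4 * F) $ k = 4 * F $ k" for F :: "complex fps" and k
        by (simp_all add: numeral_fps_const)
      have U: "(U * F) $ k = u x * F $ k" "(U' * F) $ k = deriv u x * F $ k" for F k
        by (simp_all add: U_def U'_def)
      have prod: "(F * G) $ k = (\<Sum>j\<le>k. F $ j * G $ (k - j))" for F G :: "complex fps" and k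
        by (simp add: fps_mult_nth atLeast0AtMost)
      have X: "(fps_X * F) $ Suc n = F $ n" for F :: "complex fps" by simp
      have nth: "A $ k = ?h k x" "B $ k = deriv (?h k) x" "C $ k = deriv (deriv (?h k)) x" "D $ k = deriv (deriv (deriv (?h k))) x" for k
        by (simp_all add: A_def B_def C_def D_def)
      have E: "(fps_X * (2 * (B * C + A * D) - (C * B + B * C) - 4 * (U' * (A * A) + U * (B * A + A * B))) + 4 * (B * A + A * B)) $ Suc n = 0"
        unfolding fps_add_nth fps_sub_nth X num U unfolding prod nth
        using diff[of n] by (simp only: sum.distrib sum_subtractf sum_distrib_left[symmetric] mult.assoc)
      then show ?thesis unfolding Suc by (simp add: mult.assoc)
    qed
  qed
  also have "fps_X * (2 * (B * C + A * D) - (C * B + B * C) - 4 * (U' * A * A + U * (B * A + A * B))) + 4 * (B * A + A * B)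
      = (2 * A) * (fps_X * (D - 2 * U' * A - 4 * U * B) + 4 * B)" by (simp add: algebra_simps)
  finally have "(2 * A) * (fps_X * (D - 2 * U' * A - 4 * U * B) + 4 * B) = 0" .
  moreover have "2 * A \<noteq> 0"
  proof
    assume "2 * A = 0"
    then have "(2 * A) $ 0 = 0" by simp
    then show False by (simp add: A_def numeral_fps_const)
  qed
  ultimately have Z: "fps_X * (D - 2 * U' * A - 4 * U * B) + 4 * B = 0" by simp
  have "(fps_X * (D - 2 * U' * A - 4 * U * B) + 4 * B) $ Suc n = 0" unfolding Z by simp
  then have "third_op u (?h n) x + 4 * deriv (?h (Suc n)) x = 0"
    unfolding mult.assoc by (simp add: A_def B_def D_def U_def U'_def numeral_fps_const third_op_def algebra_simps)
  then show ?thesis by (simp add: add_eq_0_iff)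
qed

lemma deriv_shift:
  assumes "f holomorphic_on S" "open S" "\<And>x. x \<in> S \<Longrightarrow> x + w \<in> S" "\<And>x. x \<in> S \<Longrightarrow> f (x + w) = f x" "x \<in> S"
  shows "deriv f (x + w) = deriv f x"
proof -
  have "((\<lambda>x. f (x + w)) has_field_derivative deriv f (x + w)) (at x)"
    using holomorphic_has_deriv[OF assms(1,2) assms(3)[OF assms(5)]] by (simp add: DERIV_shift)
  moreover have "((\<lambda>x. f (x + w)) has_field_derivative deriv f x) (at x)"
    by (rule has_field_derivative_transform_within_open[OF holomorphic_has_deriv[OF assms(1,2,5)] assms(2,5)])
      (use assms(4) in auto)
  ultimately show ?thesis by (rule DERIV_unique)
qed

lemma lenard_shift:
  assumes S: "open S" and u: "u holomorphic_on S" and w: "\<And>x. x \<in> S \<Longrightarrow> x + w \<in> S" "\<And>x. x \<in> S \<Longrightarrow> u (x + w) = u x" and x: "x \<in> S"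
  shows "lenard u n (x + w) = lenard u n x"
  using x
proof (induction n arbitrary: x rule: less_induct)
  case (less n)
  show ?case
  proof (cases n)
    case (Suc m)
    have hol: "lenard u j holomorphic_on S" for j by (rule holomorphic_lenard[OF S u])
    have h0: "lenard u j (x + w) = lenard u j x" if "j \<le> m" "x \<in> S" for j x using less.IH that Suc by simp
    have h1: "deriv (lenard u j) (x + w) = deriv (lenard u j) x" if "j \<le> m" "x \<in> S" for j x
      by (rule deriv_shift[OF hol S w(1) h0]) (use that in auto)
    have h2: "deriv (deriv (lenard u j)) (x + w) = deriv (deriv (lenard u j)) x" if "j \<le> m" "x \<in> S" for j x
      by (rule deriv_shift[OF holomorphic_deriv[OF hol S] S w(1) h1]) (use that in auto)
    show ?thesis unfolding Suc lenard.simps(2)[of u m]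
      using less.prems by (intro arg_cong2[of _ _ _ _ "(-)"] arg_cong2[of _ _ _ _ "(*)"] sum.cong refl) (simp_all add: h0 h1 h2 w(2))
  qed simp
qed

lemma lenard_uminus:
  assumes S: "open S" and u: "u holomorphic_on S" and w: "\<And>x. x \<in> S \<Longrightarrow> - x \<in> S" "\<And>x. x \<in> S \<Longrightarrow> u (- x) = u x" and x: "x \<in> S"
  shows "lenard u n (- x) = lenard u n x"
  using x
proof (induction n arbitrary: x rule: less_induct)
  case (less n)
  show ?case
  proof (cases n)
    case (Suc m)
    have hol: "lenard u j holomorphic_on S" for j by (rule holomorphic_lenard[OF S u])
    have h0: "lenard u j (- x) = lenard u j x" if "j \<le> m" "x \<in> S" for j x using less.IH that Suc by simp
    have h1: "deriv (lenard u j) (- x) = - deriv (lenard u j) x" if "j \<le> m" "x \<in> S" for j x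
      using deriv_parity[OF hol S w(1), of j 1 x] h0 that by auto
    have h2: "deriv (deriv (lenard u j)) (- x) = deriv (deriv (lenard u j)) x" if "j \<le> m" "x \<in> S" for j x
      using deriv_parity[OF holomorphic_deriv[OF hol S] S w(1), of j "-1" x] h1 that by auto
    show ?thesis unfolding Suc lenard.simps(2)[of u m]
      using less.prems by (simp add: h0 h1 h2 w(2))
  qed simp
qed

subsection \<open>Leading coefficients at a pole\<close>

text \<open>The coefficient \<open>a\<close> may be zero, so this bounds the pole order by m and
  records the coefficient of y^(-m). It is thereby stable under sums, products and derivatives, with
  explicit coefficients.\<close>

definition polar :: "complex \<Rightarrow> nat \<Rightarrow> complex \<Rightarrow> (complex \<Rightarrow> complex) \<Rightarrow> bool" where
  "polar c m a f \<longleftrightarrow> (\<exists>\<epsilon>>0. \<exists>\<phi>. \<phi> holomorphic_on ball 0 \<epsilon> \<and> \<phi> 0 = a \<and> (\<forall>y\<in>ball 0 \<epsilon> - {0}. f (c + y) = \<phi> y / y ^ m))"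

lemma polarI: "\<epsilon> > 0 \<Longrightarrow> \<phi> holomorphic_on ball 0 \<epsilon> \<Longrightarrow> \<phi> 0 = a \<Longrightarrow> (\<And>y. y \<in> ball 0 \<epsilon> \<Longrightarrow> y \<noteq> 0 \<Longrightarrow> f (c + y) = \<phi> y / y ^ m) \<Longrightarrow> polar c m a f"
  unfolding polar_def by blast

lemma polarE:
  assumes "polar c m a f"
  obtains \<epsilon> \<phi> where "\<epsilon> > 0" "\<phi> holomorphic_on ball 0 \<epsilon>" "\<phi> 0 = a" "\<And>y. y \<in> ball 0 \<epsilon> \<Longrightarrow> y \<noteq> 0 \<Longrightarrow> f (c + y) = \<phi> y / y ^ m"
  using assms unfolding polar_def by blast

lemma polar_tendsto: "polar c m a f \<Longrightarrow> ((\<lambda>y. y ^ m * f (c + y)) \<longlongrightarrow> a) (at 0)"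
proof (elim polarE)
  fix \<epsilon> \<phi> assume *: "\<epsilon> > 0" "\<phi> holomorphic_on ball 0 \<epsilon>" "\<phi> 0 = a" "\<And>y. y \<in> ball 0 \<epsilon> \<Longrightarrow> y \<noteq> 0 \<Longrightarrow> f (c + y) = \<phi> y / y ^ m"
  have "isCont \<phi> 0" using *(1,2) by (meson centre_in_ball holomorphic_on_imp_continuous_on continuous_on_eq_continuous_at open_ball)
  then have "(\<phi> \<longlongrightarrow> a) (at 0)" using *(3) by (simp add: isCont_def)
  then show ?thesis
  proof (rule Lim_transform_within_open[OF _ open_ball[of 0 \<epsilon>]])
    fix y :: complex assume "y \<in> ball 0 \<epsilon>" "y \<noteq> 0"
    then show "\<phi> y = y ^ m * f (c + y)" using *(4)[of y] by simp
  qed (use * in auto)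
qed

lemma polar_unique: "polar c m a f \<Longrightarrow> polar c m b f \<Longrightarrow> a = b"
  using polar_tendsto tendsto_unique[of "at (0::complex)"] by (metis at_neq_bot)

lemma polar_mult:
  assumes "polar c m a f" "polar c n b g" shows "polar c (m + n) (a * b) (\<lambda>x. f x * g x)"
proof -
  obtain e \<phi> where 1: "e > 0" "\<phi> holomorphic_on ball 0 e" "\<phi> 0 = a" "\<And>y. y \<in> ball 0 e \<Longrightarrow> y \<noteq> 0 \<Longrightarrow> f (c + y) = \<phi> y / y ^ m"
    using assms(1) by (elim polarE) metis
  obtain d \<psi> where 2: "d > 0" "\<psi> holomorphic_on ball 0 d" "\<psi> 0 = b" "\<And>y. y \<in> ball 0 d \<Longrightarrow> y \<noteq> 0 \<Longrightarrow> g (c + y) = \<psi> y / y ^ n"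
    using assms(2) by (elim polarE) metis
  show ?thesis
    by (rule polarI[of "min d e" "\<lambda>y. \<phi> y * \<psi> y"])
      (use 1 2 in \<open>auto intro!: holomorphic_intros intro: holomorphic_on_subset simp: power_add\<close>)
qed

lemma polar_add:
  assumes "polar c m a f" "polar c m b g" shows "polar c m (a + b) (\<lambda>x. f x + g x)"
proof -
  obtain e \<phi> where 1: "e > 0" "\<phi> holomorphic_on ball 0 e" "\<phi> 0 = a" "\<And>y. y \<in> ball 0 e \<Longrightarrow> y \<noteq> 0 \<Longrightarrow> f (c + y) = \<phi> y / y ^ m"
    using assms(1) by (elim polarE) metis
  obtain d \<psi> where 2: "d > 0" "\<psi> holomorphic_on ball 0 d" "\<psi> 0 = b" "\<And>y. y \<in> ball 0 d \<Longrightarrow> y \<noteq> 0 \<Longrightarrow> g (c + y) = \<psi> y / y ^ m"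
    using assms(2) by (elim polarE) metis
  show ?thesis
    by (rule polarI[of "min d e" "\<lambda>y. \<phi> y + \<psi> y"])
      (use 1 2 in \<open>auto intro!: holomorphic_intros intro: holomorphic_on_subset simp: add_divide_distrib\<close>)
qed

lemma polar_const: "polar c 0 k (\<lambda>x. k)"
  by (rule polarI[of 1 "\<lambda>_. k"]) auto

lemma polar_cmult: "polar c m a f \<Longrightarrow> polar c m (k * a) (\<lambda>x. k * f x)"
  using polar_mult[OF polar_const[of c k], of m a f] by simp

lemma polar_diff: "polar c m a f \<Longrightarrow> polar c m b g \<Longrightarrow> polar c m (a - b) (\<lambda>x. f x - g x)"
  using polar_add[of c m a f "- b" "\<lambda>x. - 1 * g x"] polar_cmult[of c m b g "-1"] by simp

lemma polar_raise: "polar c m a f \<Longrightarrow> polar c (m + k) (if k = 0 then a else 0) f"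
proof (elim polarE)
  fix \<epsilon> \<phi> assume *: "\<epsilon> > 0" "\<phi> holomorphic_on ball 0 \<epsilon>" "\<phi> 0 = a" "\<And>y. y \<in> ball 0 \<epsilon> \<Longrightarrow> y \<noteq> 0 \<Longrightarrow> f (c + y) = \<phi> y / y ^ m"
  show ?thesis
    by (rule polarI[OF *(1), of "\<lambda>y. \<phi> y * y ^ k"]) (use * in \<open>auto intro!: holomorphic_intros simp: power_add\<close>)
qed

lemma polar_sum: "finite I \<Longrightarrow> (\<And>i. i \<in> I \<Longrightarrow> polar c m (a i) (f i)) \<Longrightarrow> polar c m (\<Sum>i\<in>I. a i) (\<lambda>x. \<Sum>i\<in>I. f i x)"
proof (induction rule: finite_induct)
  case empty
  show ?case using polar_cmult[OF polar_raise[OF polar_const[of c 0], of m], of 0] by simp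
next
  case (insert i I)
  then show ?case using polar_add[of c m "a i" "f i" "\<Sum>i\<in>I. a i" "\<lambda>x. \<Sum>i\<in>I. f i x"] by simp
qed

lemma polar_power: "polar c m a f \<Longrightarrow> polar c (n * m) (a ^ n) (\<lambda>x. f x ^ n)"
proof (induction n)
  case 0 then show ?case using polar_const[of c 1] by simp
next
  case (Suc n)
  from polar_mult[OF Suc.prems Suc.IH[OF Suc.prems]] show ?case by (simp add: add.commute)
qed

lemma polar_lower:
  assumes "polar c (Suc m) 0 f" obtains a where "polar c m a f"
proof -
  obtain e \<phi> where 1: "e > 0" "\<phi> holomorphic_on ball 0 e" "\<phi> 0 = 0" "\<And>y. y \<in> ball 0 e \<Longrightarrow> y \<noteq> 0 \<Longrightarrow> f (c + y) = \<phi> y / y ^ Suc m"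
    using assms by (elim polarE) metis
  let ?\<psi> = "\<lambda>z. if z = 0 then deriv \<phi> 0 else (\<phi> z - \<phi> 0) / (z - 0)"
  have "?\<psi> holomorphic_on ball 0 e" using 1(2) by (rule pole_lemma_open) simp
  then have "polar c m (deriv \<phi> 0) f"
    by (rule polarI[OF 1(1)]) (use 1 in auto)
  then show ?thesis by (rule that)
qed

lemma polar_deriv:
  assumes "polar c m a f" shows "polar c (Suc m) (- of_nat m * a) (deriv f)"
proof -
  obtain e \<phi> where 1: "e > 0" "\<phi> holomorphic_on ball 0 e" "\<phi> 0 = a" "\<And>y. y \<in> ball 0 e \<Longrightarrow> y \<noteq> 0 \<Longrightarrow> f (c + y) = \<phi> y / y ^ m"
    using assms by (elim polarE) metis
  show ?thesis
  proof (rule polarI[OF 1(1), of "\<lambda>y. y * deriv \<phi> y - of_nat m * \<phi> y"])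
    show "(\<lambda>y. y * deriv \<phi> y - of_nat m * \<phi> y) holomorphic_on ball 0 e"
      by (intro holomorphic_intros holomorphic_deriv 1) auto
    fix y :: complex assume y: "y \<in> ball 0 e" "y \<noteq> 0"
    have op: "open (ball 0 e - {0::complex})" by (simp add: open_delete)
    have d\<phi>: "(\<phi> has_field_derivative deriv \<phi> y) (at y)" by (rule holomorphic_has_deriv[OF 1(2) open_ball y(1)])
    have "((\<lambda>y. \<phi> y / y ^ m) has_field_derivative (deriv \<phi> y * y ^ m - \<phi> y * (of_nat m * y ^ (m - 1))) / (y ^ m * y ^ m)) (at y)"
      using y by (auto intro!: derivative_eq_intros d\<phi>)
    then have "((\<lambda>y. f (c + y)) has_field_derivative (deriv \<phi> y * y ^ m - \<phi> y * (of_nat m * y ^ (m - 1))) / (y ^ m * y ^ m)) (at y)"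
      by (rule has_field_derivative_transform_within_open[OF _ op]) (use y 1(4) in auto)
    then have "(f has_field_derivative (deriv \<phi> y * y ^ m - \<phi> y * (of_nat m * y ^ (m - 1))) / (y ^ m * y ^ m)) (at (y + c))"
      unfolding DERIV_shift by (simp add: add.commute)
    then have "deriv f (c + y) = (deriv \<phi> y * y ^ m - \<phi> y * (of_nat m * y ^ (m - 1))) / (y ^ m * y ^ m)"
      by (simp add: DERIV_imp_deriv add.commute)
    also have "\<dots> = (y * deriv \<phi> y - of_nat m * \<phi> y) / y ^ Suc m"
      using y(2) by (cases m) (auto simp: field_simps)
    finally show "deriv f (c + y) = (y * deriv \<phi> y - of_nat m * \<phi> y) / y ^ Suc m" .
  qed (use 1 in auto)
qed

lemma polar_even_odd:
  assumes "polar c m a f" "odd m" and ev: "\<epsilon> > 0" "\<And>y. y \<in> ball 0 \<epsilon> \<Longrightarrow> y \<noteq> 0 \<Longrightarrow> f (c - y) = f (c + y)"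
  shows "a = 0"
proof -
  have t: "((\<lambda>y. y ^ m * f (c + y)) \<longlongrightarrow> a) (at 0)" by (rule polar_tendsto[OF assms(1)])
  have "filterlim uminus (at 0) (at (0::complex))"
    by (auto simp: filterlim_at eventually_at_filter intro!: tendsto_eq_intros)
  from filterlim_compose[OF t this] have "((\<lambda>y. (- y) ^ m * f (c + - y)) \<longlongrightarrow> a) (at 0)" .
  then have "((\<lambda>y. - (y ^ m * f (c + y))) \<longlongrightarrow> a) (at 0)"
    by (rule Lim_transform_within_open[OF _ open_ball[of 0 \<epsilon>]]) (use ev assms(2) in auto)
  then have "a = - a" using tendsto_minus[OF t] tendsto_unique[of "at (0::complex)"] by (metis at_neq_bot)
  then show ?thesis by simp
qed

subsection \<open>Even elliptic functions with poles at the half periods\<close>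

lemma omega_diff_not_lattice:
  assumes \<tau>: "Im \<tau> > 0" and ik: "i < 4" "k < 4" "i \<noteq> k"
  shows "omega \<tau> k - omega \<tau> i \<notin> lattice \<tau>"
proof
  assume "omega \<tau> k - omega \<tau> i \<in> lattice \<tau>"
  then obtain m n where mn: "omega \<tau> k - omega \<tau> i = of_int m + of_int n * \<tau>" by (auto simp: lattice_def)
  define a :: "nat \<Rightarrow> int" where "a = (\<lambda>i. if i = 1 then 1 else if i = 2 then -1 else 0)"
  define b :: "nat \<Rightarrow> int" where "b = (\<lambda>i. if i = 2 then -1 else if i = 3 then 1 else 0)"
  have ab: "omega \<tau> i = (of_int (a i) + of_int (b i) * \<tau>) / 2" if "i < 4" for i
    using nat_less_4[OF that] by (auto simp: a_def b_def omega_def field_simps)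
  let ?X = "\<lambda>i. of_int (a i) + of_int (b i) * \<tau>"
  have half: "x - y = 2 * (x / 2 - y / 2)" for x y :: complex by (simp add: field_simps)
  have "?X k - ?X i = 2 * (?X k / 2 - ?X i / 2)" by (rule half)
  also have "\<dots> = 2 * (of_int m + of_int n * \<tau>)" using mn unfolding ab[OF ik(1)] ab[OF ik(2)] by simp
  finally have eq: "of_int (a k - a i) + of_int (b k - b i) * \<tau> = of_int (2 * m) + of_int (2 * n) * \<tau>"
    by (simp add: algebra_simps)
  have "lattice_pt \<tau> (a k - a i, b k - b i) = lattice_pt \<tau> (2 * m, 2 * n)" using eq by (simp add: lattice_pt_def)
  then have "a k - a i = 2 * m" "b k - b i = 2 * n" using injD[OF inj_lattice_pt[OF \<tau>]] by blast+
  then show False using nat_less_4[OF ik(1)] nat_less_4[OF ik(2)] ik(3)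
    by (elim disjE) (simp_all add: a_def b_def, presburger+)
qed

lemma poles_separated:
  assumes "Im \<tau> > 0"
  obtains \<delta> where "\<delta> > 0" "\<And>c y. c \<in> poles \<tau> l \<Longrightarrow> y \<in> ball 0 \<delta> \<Longrightarrow> y \<noteq> 0 \<Longrightarrow> c + y \<notin> poles \<tau> l"
proof -
  obtain \<epsilon> where \<epsilon>: "\<epsilon> > 0" "\<And>x y. x \<in> lattice \<tau> \<Longrightarrow> y \<in> lattice \<tau> \<Longrightarrow> dist y x < \<epsilon> \<Longrightarrow> y = x"
    using lattice_separated[OF assms] by metis
  have two: "2 * c \<in> lattice \<tau>" if c: "c \<in> poles \<tau> l" for c
  proof -
    obtain i where i: "c + omega \<tau> i \<in> lattice \<tau>" using c by (auto simp: poles_def)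
    have "(c + omega \<tau> i) + (c + omega \<tau> i) \<in> lattice \<tau>" by (rule lattice_add[OF i i])
    then have "2 * c + 2 * omega \<tau> i \<in> lattice \<tau>" by (simp add: algebra_simps mult_2)
    then show ?thesis using lattice_add_iff[OF two_omega] by blast
  qed
  show ?thesis
  proof (rule that[of "\<epsilon> / 2"])
    show "\<epsilon> / 2 > 0" using \<epsilon>(1) by simp
    fix c y :: complex assume c: "c \<in> poles \<tau> l" and y: "y \<in> ball 0 (\<epsilon> / 2)" "y \<noteq> 0"
    show "c + y \<notin> poles \<tau> l"
    proof
      assume "c + y \<in> poles \<tau> l"
      then have "dist (2 * (c + y)) (2 * c) < \<epsilon> \<Longrightarrow> 2 * (c + y) = 2 * c" using \<epsilon>(2) two c by blast
      moreover have "dist (2 * (c + y)) (2 * c) < \<epsilon>" using y by (simp add: dist_norm algebra_simps norm_mult)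
      ultimately show False using y by simp
    qed
  qed
qed

lemma omega_poles: "i < 4 \<Longrightarrow> l i > 0 \<Longrightarrow> - omega \<tau> i \<in> poles \<tau> l"
  by (auto simp: poles_def intro!: exI[of _ i])

lemma polar_cong:
  assumes "polar c m a f" "\<delta> > 0" "\<And>y. y \<in> ball 0 \<delta> \<Longrightarrow> y \<noteq> 0 \<Longrightarrow> f (c + y) = g (c + y)"
  shows "polar c m a g"
proof -
  obtain e \<phi> where 1: "e > 0" "\<phi> holomorphic_on ball 0 e" "\<phi> 0 = a" "\<And>y. y \<in> ball 0 e \<Longrightarrow> y \<noteq> 0 \<Longrightarrow> f (c + y) = \<phi> y / y ^ m"
    using assms(1) by (elim polarE) metis
  show ?thesis
  proof (rule polarI[of "min \<delta> e" \<phi>])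
    fix y :: complex assume "y \<in> ball 0 (min \<delta> e)" "y \<noteq> 0"
    then show "g (c + y) = \<phi> y / y ^ m" using assms(3)[of y] 1(4)[of y] by simp
  qed (use 1 assms(2) in \<open>auto intro: holomorphic_on_subset\<close>)
qed

lemma polar_wp_same:
  assumes \<tau>: "Im \<tau> > 0" shows "polar (- omega \<tau> i) 2 1 (\<lambda>x. wp \<tau> (x + omega \<tau> i))"
proof -
  have "0 \<in> - (lattice \<tau> - {0})" by simp
  then obtain r where r: "r > 0" "ball 0 r \<subseteq> - (lattice \<tau> - {0})"
    using open_not_lattice_0[OF \<tau>] open_contains_ball by blast
  show ?thesis
  proof (rule polarI[OF r(1), of "\<lambda>y. 1 + y\<^sup>2 * wp_reg \<tau> y"])
    show "(\<lambda>y. 1 + y\<^sup>2 * wp_reg \<tau> y) holomorphic_on ball 0 r"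
      by (intro holomorphic_intros holomorphic_on_subset[OF holomorphic_wp_reg[OF \<tau>] r(2)])
    fix y :: complex assume "y \<noteq> 0"
    then show "wp \<tau> (- omega \<tau> i + y + omega \<tau> i) = (1 + y\<^sup>2 * wp_reg \<tau> y) / y\<^sup>2"
      by (simp add: wp_eq field_simps)
  qed simp
qed

lemma polar_wp_other:
  assumes \<tau>: "Im \<tau> > 0" and ik: "i < 4" "k < 4" "i \<noteq> k"
  shows "polar (- omega \<tau> i) 0 (wp \<tau> (omega \<tau> k - omega \<tau> i)) (\<lambda>x. wp \<tau> (x + omega \<tau> k))"
proof -
  have "omega \<tau> k - omega \<tau> i \<in> - lattice \<tau>" using omega_diff_not_lattice[OF assms] by simp
  then obtain r where r: "r > 0" "ball (omega \<tau> k - omega \<tau> i) r \<subseteq> - lattice \<tau>"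
    using closed_lattice[OF \<tau>] open_contains_ball by (meson open_Compl)
  have av: "y + (omega \<tau> k - omega \<tau> i) \<notin> lattice \<tau>" if "y \<in> ball 0 r" for y
  proof -
    have "y + (omega \<tau> k - omega \<tau> i) \<in> ball (omega \<tau> k - omega \<tau> i) r" using that by (simp add: dist_norm)
    then show ?thesis using r by blast
  qed
  show ?thesis
    by (rule polarI[OF r(1), of "\<lambda>y. wp \<tau> (y + (omega \<tau> k - omega \<tau> i))"])
      (use av in \<open>auto intro!: holomorphic_wp_compose \<tau> holomorphic_intros simp: algebra_simps\<close>)
qed

lemma polar_pot:
  assumes \<tau>: "Im \<tau> > 0" and i: "i < 4"
  shows "polar (- omega \<tau> i) 2 (of_nat (l i * (l i + 1))) (pot \<tau> l)"
proof -
  have "polar (- omega \<tau> i) 2 (\<Sum>k<4. if k = i then of_nat (l i * (l i + 1)) else 0)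
    (\<lambda>x. \<Sum>k<4. of_nat (l k * (l k + 1)) * wp \<tau> (x + omega \<tau> k))"
  proof (rule polar_sum)
    fix k :: nat assume k: "k \<in> {..<4}"
    show "polar (- omega \<tau> i) 2 (if k = i then of_nat (l i * (l i + 1)) else 0) (\<lambda>x. of_nat (l k * (l k + 1)) * wp \<tau> (x + omega \<tau> k))"
    proof (cases "k = i")
      case True
      then show ?thesis using polar_cmult[OF polar_wp_same[OF \<tau>, of i], of "of_nat (l i * (l i + 1))"] by simp
    next
      case False
      then show ?thesis
        using polar_raise[OF polar_cmult[OF polar_wp_other[OF \<tau> i, of k], of "of_nat (l k * (l k + 1))"], of 2] k by (simp add: numeral_2_eq_2)
    qed
  qed simp
  then show ?thesis using i by (simp add: pot_def[abs_def])
qed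

definition elliptic :: "complex \<Rightarrow> (nat \<Rightarrow> nat) \<Rightarrow> (complex \<Rightarrow> complex) \<Rightarrow> bool" where
  "elliptic \<tau> l f \<longleftrightarrow> f holomorphic_on (- poles \<tau> l) \<and> (\<forall>x. x \<notin> poles \<tau> l \<longrightarrow> (\<forall>w\<in>lattice \<tau>. f (x + w) = f x) \<and> f (- x) = f x)"

lemma elliptic_even_center:
  assumes "elliptic \<tau> l f" "- omega \<tau> i + y \<notin> poles \<tau> l"
  shows "f (- omega \<tau> i - y) = f (- omega \<tau> i + y)"
proof -
  have "- (2 * omega \<tau> i) \<in> lattice \<tau>" unfolding lattice_uminus by (rule two_omega)
  moreover have "- (- omega \<tau> i + y) \<notin> poles \<tau> l" using assms(2) poles_uminus by blast
  ultimately have "f (- (- omega \<tau> i + y) + - (2 * omega \<tau> i)) = f (- (- omega \<tau> i + y))"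
    using assms(1) unfolding elliptic_def by blast
  also have "\<dots> = f (- omega \<tau> i + y)" using assms unfolding elliptic_def by blast
  also have "- (- omega \<tau> i + y) + - (2 * omega \<tau> i) = - omega \<tau> i - y" by (simp add: algebra_simps)
  finally show ?thesis .
qed

text \<open>An even elliptic function is even about each half period, so its odd-order coefficients
  vanish there. Once the coefficient of an even order is gone, the order drops by two.\<close>

lemma elliptic_polar_even:
  assumes \<tau>: "Im \<tau> > 0" and f: "elliptic \<tau> l f" and i: "i < 4" "l i > 0" and p: "polar (- omega \<tau> i) (Suc m) 0 f" "odd m"
  obtains m' a where "m = Suc m'" "polar (- omega \<tau> i) m' a f"
proof -
  obtain a where a: "polar (- omega \<tau> i) m a f" using polar_lower[OF p(1)] by blast
  obtain \<delta> where \<delta>: "\<delta> > 0" "\<And>y. y \<in> ball 0 \<delta> \<Longrightarrow> y \<noteq> 0 \<Longrightarrow> - omega \<tau> i + y \<notin> poles \<tau> l"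
    using poles_separated[OF \<tau>, of l] omega_poles[of i l \<tau>, OF i] by metis
  have "a = 0" by (rule polar_even_odd[OF a p(2) \<delta>(1) elliptic_even_center[OF f \<delta>(2)]])
  obtain m' where m': "m = Suc m'" using p(2) by (cases m) auto
  then show ?thesis using that a \<open>a = 0\<close> polar_lower by metis
qed

lemma elliptic_lenard: "Im \<tau> > 0 \<Longrightarrow> elliptic \<tau> l (lenard (pot \<tau> l) n)"
  unfolding elliptic_def
  by (auto intro!: holomorphic_lenard lenard_shift[where S = "- poles \<tau> l"] lenard_uminus[where S = "- poles \<tau> l"]
      open_not_poles holomorphic_pot pot_shift pot_uminus simp: poles_shift poles_uminus)

text \<open>The exponent -2k solves the indicial equation of the third-order operator: it belongs to
  the product of two solutions of type y^(-k). The three contributions to the coefficient of order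
  2k + 3 add up to 4k(k+1) b (-(2k+1) + 2k + 1) = 0.\<close>

lemma polar_third_op:
  assumes h: "polar c (2 * k) b h" and u: "polar c 2 (of_nat (k * (k + 1))) u"
  shows "polar c (2 * k + 3) 0 (third_op u h)"
proof -
  have h1: "polar c (2*k+1) (- of_nat (2*k) * b) (deriv h)" using polar_deriv[OF h] by simp
  have h2: "polar c (2*k+2) (- of_nat (2*k+1) * (- of_nat (2*k) * b)) (deriv (deriv h))" using polar_deriv[OF h1] by simp
  have h3: "polar c (2*k+3) (- of_nat (2*k+2) * (- of_nat (2*k+1) * (- of_nat (2*k) * b))) (deriv (deriv (deriv h)))"
    using polar_deriv[OF h2] by (simp add: numeral_3_eq_3)
  have u1: "polar c 3 (- of_nat 2 * of_nat (k * (k + 1))) (deriv u)" using polar_deriv[OF u] by (simp add: numeral_3_eq_3 numeral_2_eq_2)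
  have t1: "polar c (2*k+3) (4 * of_nat (k * (k + 1)) * (- of_nat (2*k) * b)) (\<lambda>x. 4 * u x * deriv h x)"
    using polar_mult[OF polar_cmult[OF u, of 4] h1] by (simp add: numeral_3_eq_3)
  have t2: "polar c (2*k+3) (2 * (- of_nat 2 * of_nat (k * (k + 1))) * b) (\<lambda>x. 2 * deriv u x * h x)"
    using polar_mult[OF polar_cmult[OF u1, of 2] h] by (simp add: add.commute)
  have "polar c (2*k+3) ((- of_nat (2*k+2) * (- of_nat (2*k+1) * (- of_nat (2*k) * b))) - (4 * of_nat (k * (k + 1)) * (- of_nat (2*k) * b))
     - (2 * (- of_nat 2 * of_nat (k * (k + 1))) * b)) (third_op u h)"
    unfolding third_op_def[abs_def] by (intro polar_diff h3 t1 t2)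
  moreover have "(- of_nat (2*k+2) * (- of_nat (2*k+1) * (- of_nat (2*k) * b))) - (4 * of_nat (k * (k + 1)) * (- of_nat (2*k) * b))
     - (2 * (- of_nat 2 * of_nat (k * (k + 1))) * b) = 0" by (simp add: algebra_simps)
  ultimately show ?thesis by simp
qed

text \<open>Homogeneity: u has weight 2, each derivative weight 1, and every term of the recursion
  for h_n has weight 2n. The bound grows with n and only starts the descent in
  \<open>polar_lenard\<close>.\<close>

lemma polar_lenard_apriori:
  assumes "polar c 2 a u" shows "\<exists>a. polar c (2 * n) a (lenard u n)"
proof (induction n rule: less_induct)
  case (less n)
  show ?case
  proof (cases n)
    case 0 then show ?thesis using polar_const[of c 1] by auto
  next
    case (Suc m)
    have "\<exists>a. \<forall>j\<le>m. polar c (2 * j) (a j) (lenard u j)" using less Suc by (metis less_Suc_eq_le)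
    then obtain b where b: "\<And>j. j \<le> m \<Longrightarrow> polar c (2 * j) (b j) (lenard u j)" by blast
    have b1: "polar c (2 * j + 1) (- of_nat (2 * j) * b j) (deriv (lenard u j))" if "j \<le> m" for j using polar_deriv[OF b[OF that]] by simp
    have b2: "polar c (2 * j + 2) (- of_nat (2 * j + 1) * (- of_nat (2 * j) * b j)) (deriv (deriv (lenard u j)))" if "j \<le> m" for j
      using polar_deriv[OF b1[OF that]] by simp
    have t1: "polar c (2 * n) (b (Suc j) * b (m - j)) (\<lambda>x. lenard u (Suc j) x * lenard u (m - j) x)" if "j < m" for j
    proof -
      have "2 * Suc j + 2 * (m - j) = 2 * n" using that Suc by simp
      with polar_mult[OF b[of "Suc j"] b[of "m - j"]] that show ?thesis by simp
    qed
    have t2: "\<exists>a. polar c (2 * n) a (\<lambda>x. 2 * lenard u j x * deriv (deriv (lenard u (m - j))) x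
          - deriv (lenard u j) x * deriv (lenard u (m - j)) x - 4 * u x * lenard u j x * lenard u (m - j) x)" if j: "j \<le> m" for j
    proof -
      have e: "2 * j + (2 * (m - j) + 2) = 2 * n" "(2 * j + 1) + (2 * (m - j) + 1) = 2 * n" "2 + 2 * j + 2 * (m - j) = 2 * n"
        using j Suc by auto
      have mj: "m - j \<le> m" by simp
      note p1 = polar_mult[OF polar_cmult[OF b[OF j], of 2] b2[OF mj], unfolded e(1)]
      note p2 = polar_mult[OF b1[OF j] b1[OF mj], unfolded e(2)]
      note p3 = polar_mult[OF polar_mult[OF polar_cmult[OF assms, of 4] b[OF j]] b[OF mj], unfolded e(3)]
      show ?thesis using polar_diff[OF polar_diff[OF p1 p2] p3] by blast
    qed
    then have "\<forall>j. \<exists>a. j \<le> m \<longrightarrow> polar c (2 * n) a (\<lambda>x. 2 * lenard u j x * deriv (deriv (lenard u (m - j))) x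
          - deriv (lenard u j) x * deriv (lenard u (m - j)) x - 4 * u x * lenard u j x * lenard u (m - j) x)" by blast
    from choice[OF this] obtain d where d: "\<And>j. j \<le> m \<Longrightarrow> polar c (2 * n) (d j) (\<lambda>x. 2 * lenard u j x * deriv (deriv (lenard u (m - j))) x
          - deriv (lenard u j) x * deriv (lenard u (m - j)) x - 4 * u x * lenard u j x * lenard u (m - j) x)" by blast
    show ?thesis unfolding Suc lenard.simps(2)[of u m]
      unfolding Suc[symmetric]
      by (rule exI, rule polar_diff[OF polar_cmult[OF polar_sum] polar_cmult[OF polar_sum]]) (use t1 d in auto)
  qed
qed

text \<open>By \<open>polar_third_op\<close> the derivative of h_(n+1) has a pole of order at most
  2k + 2, hence h_(n+1) one of order at most 2k + 1, and evenness excludes 2k + 1. This uniform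
  bound puts all h_n into one finite-dimensional space.\<close>

lemma polar_lenard:
  assumes \<tau>: "Im \<tau> > 0" and i: "i < 4" "l i > 0"
  shows "\<exists>a. polar (- omega \<tau> i) (2 * l i) a (lenard (pot \<tau> l) n)"
proof (induction n)
  case 0
  show ?case using polar_raise[OF polar_const[of "- omega \<tau> i" 1], of "2 * l i"] by auto
next
  case (Suc n)
  let ?c = "- omega \<tau> i" and ?u = "pot \<tau> l" and ?k = "l i"
  let ?h = "lenard ?u (Suc n)"
  obtain b where b: "polar ?c (2 * ?k) b (lenard ?u n)" using Suc by blast
  have u: "polar ?c 2 (of_nat (?k * (?k + 1))) ?u" by (rule polar_pot[OF \<tau> i(1)])
  obtain \<delta> where \<delta>: "\<delta> > 0" "\<And>y. y \<in> ball 0 \<delta> \<Longrightarrow> y \<noteq> 0 \<Longrightarrow> ?c + y \<notin> poles \<tau> l"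
    using poles_separated[OF \<tau>, of l] omega_poles[of i l \<tau>, OF i] by metis
  have M: "polar ?c (2 * ?k + 3) 0 (deriv ?h)"
  proof (rule polar_cong[OF _ \<delta>(1)])
    show "polar ?c (2 * ?k + 3) 0 (\<lambda>x. (- 1/4) * third_op ?u (lenard ?u n) x)"
      using polar_cmult[OF polar_third_op[OF b u], of "- 1/4"] by simp
    fix y :: complex assume "y \<in> ball 0 \<delta>" "y \<noteq> 0"
    then have "?c + y \<in> - poles \<tau> l" using \<delta>(2) by simp
    from lenard_recursion[OF open_not_poles[OF \<tau>] holomorphic_pot[OF \<tau>] this, of n]
    show "- 1/4 * third_op ?u (lenard ?u n) (?c + y) = deriv ?h (?c + y)" by (simp add: field_simps)
  qed
  \<comment> \<open>Descent from the a priori order. For orders above 2k + 1 differentiation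
    multiplies the coefficient by a nonzero integer and the bound on the derivative kills it; the
    last order 2k + 1 is odd and falls to evenness.\<close>
  have "\<exists>a. polar ?c (2 * ?k + j) a ?h \<Longrightarrow> \<exists>a. polar ?c (2 * ?k) a ?h" for j
  proof (induction j)
    case (Suc j)
    then obtain a where a: "polar ?c (2 * ?k + Suc j) a ?h" by blast
    have d: "polar ?c (2 * ?k + j + 2) (- of_nat (2 * ?k + Suc j) * a) (deriv ?h)" using polar_deriv[OF a] by simp
    have "a = 0"
    proof (cases j)
      case 0
      show ?thesis
        by (rule polar_even_odd[OF a _ \<delta>(1) elliptic_even_center[OF elliptic_lenard[OF \<tau>] \<delta>(2)]]) (simp_all add: 0)
    next
      case (Suc j')
      have "polar ?c (2 * ?k + j + 2) 0 (deriv ?h)" using polar_raise[OF M, of j'] Suc by (simp add: numeral_3_eq_3 split: if_splits)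
      from polar_unique[OF d this] have "of_nat (2 * ?k + Suc j) * a = 0"
        by (metis mult_minus_left neg_equal_0_iff_equal)
      moreover have "of_nat (2 * ?k + Suc j) \<noteq> (0 :: complex)" by (simp only: of_nat_eq_0_iff)
      ultimately show ?thesis by simp
    qed
    then obtain a' where "polar ?c (2 * ?k + j) a' ?h" using polar_lower[of ?c "2 * ?k + j" ?h] a by auto
    then show ?case using Suc.IH by blast
  qed simp
  moreover obtain a where "polar ?c (2 * Suc n) a ?h" using polar_lenard_apriori[OF u] by blast
  then have "\<exists>a. polar ?c (2 * ?k + 2 * Suc n) a ?h" using polar_raise[of ?c "2 * Suc n" a ?h "2 * ?k"] by (auto simp: add.commute)
  ultimately show ?case by blast
qed

lemma doubly_periodic_entire_constant:
  assumes \<tau>: "Im \<tau> > 0" and f: "f holomorphic_on UNIV" and per: "\<And>x w. w \<in> lattice \<tau> \<Longrightarrow> f (x + w) = f x"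
  shows "f x = (f y :: complex)"
proof -
  let ?K = "(\<lambda>(s, t). complex_of_real s + complex_of_real t * \<tau>) ` ({0..1} \<times> {0..1::real})"
  have "compact ?K"
    unfolding split_beta by (intro compact_continuous_image continuous_intros compact_Times) auto
  then have "bounded (f ` ?K)"
    using holomorphic_on_imp_continuous_on[OF f]
    by (intro compact_imp_bounded compact_continuous_image[of ?K f]) (auto intro: continuous_on_subset)
  moreover have "range f \<subseteq> f ` ?K"
  proof
    fix v assume "v \<in> range f"
    then obtain z where z: "v = f z" by blast
    define t where "t = Im z / Im \<tau>"
    define s where "s = Re z - t * Re \<tau>"
    have zst: "z = of_real s + of_real t * \<tau>" using \<tau> by (simp add: complex_eq_iff s_def t_def)
    have "of_int (- \<lfloor>s\<rfloor>) + of_int (- \<lfloor>t\<rfloor>) * \<tau> \<in> lattice \<tau>" unfolding lattice_def by blast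
    from per[OF this, of z] have "v = f (z + (of_int (- \<lfloor>s\<rfloor>) + of_int (- \<lfloor>t\<rfloor>) * \<tau>))" using z by simp
    also have "z + (of_int (- \<lfloor>s\<rfloor>) + of_int (- \<lfloor>t\<rfloor>) * \<tau>) = of_real (frac s) + of_real (frac t) * \<tau>"
      by (subst zst) (simp add: frac_def algebra_simps)
    finally have v: "v = f (of_real (frac s) + of_real (frac t) * \<tau>)" .
    have "of_real (frac s) + of_real (frac t) * \<tau> \<in> ?K"
      by (intro image_eqI[of _ _ "(frac s, frac t)"]) (auto simp: frac_lt_1 less_imp_le)
    then show "v \<in> f ` ?K" unfolding v by (rule imageI)
  qed
  ultimately have "bounded (range f)" using bounded_subset by blast
  then have "f constant_on UNIV" by (rule Liouville_theorem[OF f])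
  then show ?thesis by (auto simp: constant_on_def)
qed

text \<open>The numbers 0 to 3 label half periods, so 4 is free to label the constant
  function.\<close>

definition basis_set :: "(nat \<Rightarrow> nat) \<Rightarrow> (nat \<times> nat) set" where
  "basis_set l = insert (4, 0) (SIGMA i:{..<4}. {..<l i})"

definition basis_fun :: "complex \<Rightarrow> (nat \<Rightarrow> nat) \<Rightarrow> nat \<times> nat \<Rightarrow> complex \<Rightarrow> complex" where
  "basis_fun \<tau> l k x = (if fst k = 4 then 1 else wp \<tau> (x + omega \<tau> (fst k)) ^ (l (fst k) - snd k))"

lemma finite_basis_set [simp]: "finite (basis_set l)"
  by (simp add: basis_set_def)

lemma sum_basis_set: "(\<Sum>k\<in>basis_set l. f k) = f (4, 0) + (\<Sum>i<4. \<Sum>j<l i. f (i, j))"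
  unfolding basis_set_def by (subst sum.insert) (auto simp: sum.Sigma)

lemma elliptic_wp_power:
  assumes "Im \<tau> > 0" "i < 4" "l i > 0"
  shows "elliptic \<tau> l (\<lambda>x. wp \<tau> (x + omega \<tau> i) ^ n)"
  unfolding elliptic_def
proof (intro conjI allI impI ballI)
  show "(\<lambda>x. wp \<tau> (x + omega \<tau> i) ^ n) holomorphic_on - poles \<tau> l"
    using assms by (intro holomorphic_intros holomorphic_wp_omega)
  fix x assume "x \<notin> poles \<tau> l"
  then have x: "x + omega \<tau> i \<notin> lattice \<tau>" using assms by (auto simp: poles_def)
  show "wp \<tau> (- x + omega \<tau> i) ^ n = wp \<tau> (x + omega \<tau> i) ^ n" unfolding wp_omega_uminus[OF assms(1) x] ..
  show "wp \<tau> (x + w + omega \<tau> i) ^ n = wp \<tau> (x + omega \<tau> i) ^ n" if "w \<in> lattice \<tau>" for w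
    unfolding wp_omega_shift[OF assms(1) x that] ..
qed

lemma elliptic_basis_fun: "Im \<tau> > 0 \<Longrightarrow> k \<in> basis_set l \<Longrightarrow> elliptic \<tau> l (basis_fun \<tau> l k)"
  using elliptic_wp_power[of \<tau> "fst k" l "l (fst k) - snd k"]
  by (auto simp: basis_set_def basis_fun_def[abs_def] elliptic_def)

lemma elliptic_lincomb:
  assumes "finite I" "\<And>i. i \<in> I \<Longrightarrow> elliptic \<tau> l (f i)"
  shows "elliptic \<tau> l (\<lambda>x. \<Sum>i\<in>I. c i * f i x)"
  using assms unfolding elliptic_def by (auto intro!: holomorphic_intros sum.cong)

lemma elliptic_diff_cmult:
  assumes "elliptic \<tau> l f" "elliptic \<tau> l g"
  shows "elliptic \<tau> l (\<lambda>x. f x - c * g x)"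
  using assms unfolding elliptic_def by (auto intro!: holomorphic_intros)

text \<open>Induction on the total pole order. Subtracting a multiple of a power of
  \<open>wp\<close> removes the leading term at one half period, evenness lowers the order there by
  two, and the orders at the other half periods are unaffected. Without poles, Liouville's theorem
  leaves a constant.\<close>

lemma elliptic_span:
  assumes \<tau>: "Im \<tau> > 0" and f: "elliptic \<tau> l f" and nl: "\<And>i. i < 4 \<Longrightarrow> n i \<le> l i"
    and p: "\<And>i. i < 4 \<Longrightarrow> l i > 0 \<Longrightarrow> \<exists>a. polar (- omega \<tau> i) (2 * n i) a f"
  shows "\<exists>a. \<forall>x. x \<notin> poles \<tau> l \<longrightarrow> f x = (\<Sum>k\<in>basis_set l. a k * basis_fun \<tau> l k x)"
  using f nl p
proof (induction "\<Sum>i<4. n i" arbitrary: n f rule: less_induct)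
  case less
  show ?case
  proof (cases "\<exists>i<4. n i > 0")
    case False
    have loc: "\<exists>r>0. \<exists>h. ball a r \<subseteq> UNIV \<and> h holomorphic_on ball a r \<and> (\<forall>z\<in>ball a r - {a}. z \<notin> poles \<tau> l \<and> f z = h z)"
      if "a \<in> poles \<tau> l \<inter> UNIV" for a
    proof -
      obtain i where i: "i < 4" "l i > 0" "a + omega \<tau> i \<in> lattice \<tau>" using \<open>a \<in> poles \<tau> l \<inter> UNIV\<close> by (auto simp: poles_def)
      have "n i = 0" using False i by auto
      then obtain b where "polar (- omega \<tau> i) 0 b f" using less.prems(3)[OF i(1,2)] by auto
      then obtain e \<phi> where e: "e > 0" "\<phi> holomorphic_on ball 0 e" "\<And>y. y \<in> ball 0 e \<Longrightarrow> y \<noteq> 0 \<Longrightarrow> f (- omega \<tau> i + y) = \<phi> y"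
        by (elim polarE) (metis div_by_1 power_0)
      obtain \<delta> where \<delta>: "\<delta> > 0" "\<And>c y. c \<in> poles \<tau> l \<Longrightarrow> y \<in> ball 0 \<delta> \<Longrightarrow> y \<noteq> 0 \<Longrightarrow> c + y \<notin> poles \<tau> l"
        using poles_separated[OF \<tau>] by metis
      show ?thesis
      proof (intro exI[of _ "min e \<delta>"] exI[of _ "\<lambda>z. \<phi> (z - a)"] conjI ballI)
        have "(\<phi> \<circ> (\<lambda>z. z - a)) holomorphic_on ball a (min e \<delta>)"
          by (rule holomorphic_on_compose_gen[OF _ e(2)]) (auto intro!: holomorphic_intros simp: dist_norm norm_minus_commute)
        then show "(\<lambda>z. \<phi> (z - a)) holomorphic_on ball a (min e \<delta>)" by (simp add: o_def)
        fix z assume z: "z \<in> ball a (min e \<delta>) - {a}"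
        then have y: "z - a \<in> ball 0 e" "z - a \<in> ball 0 \<delta>" "z - a \<noteq> 0" by (auto simp: dist_norm norm_minus_commute)
        have "a + (z - a) \<notin> poles \<tau> l" using \<delta>(2) y \<open>a \<in> poles \<tau> l \<inter> UNIV\<close> by blast
        then show "z \<notin> poles \<tau> l" by simp
        have "- omega \<tau> i + (z - a) \<notin> poles \<tau> l" using \<delta>(2)[OF omega_poles] i y by blast
        then have "f (- omega \<tau> i + (z - a) + (a + omega \<tau> i)) = f (- omega \<tau> i + (z - a))"
          using less.prems(1) i(3) unfolding elliptic_def by blast
        then show "f z = \<phi> (z - a)" using e(3)[OF y(1,3)] by simp
      qed (use e(1) \<delta>(1) in auto)
    qed
    have fh: "f holomorphic_on UNIV - poles \<tau> l" using less.prems(1) by (simp add: elliptic_def Compl_eq_Diff_UNIV)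
    obtain G where G: "G holomorphic_on UNIV" "\<And>z. z \<in> UNIV - poles \<tau> l \<Longrightarrow> G z = f z"
      using removable_extension[OF open_UNIV closed_poles[OF \<tau>] fh loc] by blast
    have per: "G (x + w) = G x" if w: "w \<in> lattice \<tau>" for x w
    proof (rule identity_open[of "\<lambda>x. G (x + w)" UNIV G "- poles \<tau> l"])
      have "(G \<circ> (\<lambda>x. x + w)) holomorphic_on UNIV" by (intro holomorphic_on_compose holomorphic_intros holomorphic_on_subset[OF G(1)]) auto
      then show "(\<lambda>x. G (x + w)) holomorphic_on UNIV" by (simp add: o_def)
      show "- poles \<tau> l \<noteq> {}"
        using countable_poles[of \<tau> l] uncountable_UNIV_complex by (metis Compl_empty_eq Compl_UNIV_eq double_complement)
      fix z assume "z \<in> - poles \<tau> l"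
      then show "G (z + w) = G z"
        using G(2)[of z] G(2)[of "z + w"] less.prems(1) w poles_shift[OF w] by (auto simp: elliptic_def)
    qed (auto simp: G open_not_poles \<tau>)
    have c: "G x = G 0" for x by (rule doubly_periodic_entire_constant[OF \<tau> G(1) per])
    have "f x = (\<Sum>k\<in>basis_set l. (if k = (4, 0) then G 0 else 0) * basis_fun \<tau> l k x)" if "x \<notin> poles \<tau> l" for x
    proof -
      have "(\<Sum>k\<in>basis_set l. (if k = (4, 0) then G 0 else 0) * basis_fun \<tau> l k x)
          = (\<Sum>k\<in>basis_set l. if k = (4, 0) then G 0 * basis_fun \<tau> l k x else 0)" by (rule sum.cong) auto
      also have "\<dots> = G 0 * basis_fun \<tau> l (4, 0) x" by (subst sum.delta) (auto simp: basis_set_def)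
      finally show ?thesis using G(2)[of x] c[of x] that by (simp add: basis_fun_def)
    qed
    then show ?thesis by (intro exI[of _ "\<lambda>k. if k = (4, 0) then G 0 else 0"] allI impI)
  next
    case True
    then obtain i where i: "i < 4" "n i > 0" by blast
    then have li: "l i > 0" "n i \<le> l i" using less.prems(2) by (auto intro: order.strict_trans2)
    obtain a where a: "polar (- omega \<tau> i) (2 * n i) a f" using less.prems(3) i li by blast
    let ?g = "\<lambda>x. f x - a * wp \<tau> (x + omega \<tau> i) ^ n i"
    have ge: "elliptic \<tau> l ?g" by (intro elliptic_diff_cmult less.prems(1) elliptic_wp_power \<tau> i li)
    have pw: "polar (- omega \<tau> i) (2 * n i) 1 (\<lambda>x. wp \<tau> (x + omega \<tau> i) ^ n i)"
      using polar_power[OF polar_wp_same[OF \<tau>, of i], of "n i"] by (simp add: mult.commute)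
    have "polar (- omega \<tau> i) (2 * n i) 0 ?g" using polar_diff[OF a polar_cmult[OF pw, of a]] by simp
    then have "polar (- omega \<tau> i) (Suc (2 * n i - 1)) 0 ?g" using i by simp
    then obtain m' b where m': "2 * n i - 1 = Suc m'" "polar (- omega \<tau> i) m' b ?g"
      using elliptic_polar_even[OF \<tau> ge i(1) li(1), of "2 * n i - 1"] i(2) by auto
    define n' where "n' = n(i := n i - 1)"
    have "m' = 2 * n' i" using m'(1) i(2) by (simp add: n'_def)
    have pg: "\<exists>a. polar (- omega \<tau> k) (2 * n' k) a ?g" if k: "k < 4" "l k > 0" for k
    proof (cases "k = i")
      case True
      then show ?thesis using m'(2) \<open>m' = 2 * n' i\<close> by blast
    next
      case False
      obtain b where b: "polar (- omega \<tau> k) (2 * n k) b f" using less.prems(3)[OF k] by blast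
      have "polar (- omega \<tau> k) 0 (wp \<tau> (omega \<tau> i - omega \<tau> k) ^ n i) (\<lambda>x. wp \<tau> (x + omega \<tau> i) ^ n i)"
        using polar_power[OF polar_wp_other[OF \<tau> k(1) i(1) False], of "n i"] by simp
      from polar_raise[OF polar_cmult[OF this, of a], of "2 * n k"] polar_diff[OF b]
      show ?thesis using False by (auto simp: n'_def)
    qed
    have "(\<Sum>k<4. n' k) < (\<Sum>k<4. n k)"
    proof (rule sum_strict_mono_ex1)
      show "\<forall>k\<in>{..<4}. n' k \<le> n k" by (simp add: n'_def)
      show "\<exists>k\<in>{..<4}. n' k < n k" using i by (intro bexI[of _ i]) (auto simp: n'_def)
    qed simp
    moreover have "n' k \<le> l k" if "k < 4" for k using less.prems(2)[OF that] by (auto simp: n'_def)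
    ultimately obtain c where c: "\<And>x. x \<notin> poles \<tau> l \<Longrightarrow> ?g x = (\<Sum>k\<in>basis_set l. c k * basis_fun \<tau> l k x)"
      using less.hyps[OF _ ge _ pg] by blast
    \<comment> \<open>\<open>basis_fun\<close> counts powers downwards from l i, so the power n i
      has second index l i - n i.\<close>
    define k0 where "k0 = (i, l i - n i)"
    have k0: "k0 \<in> basis_set l" "basis_fun \<tau> l k0 x = wp \<tau> (x + omega \<tau> i) ^ n i" for x
      using i li by (auto simp: k0_def basis_set_def basis_fun_def)
    have "f x = (\<Sum>k\<in>basis_set l. (c k + (if k = k0 then a else 0)) * basis_fun \<tau> l k x)" if x: "x \<notin> poles \<tau> l" for x
    proof -
      have "(\<Sum>k\<in>basis_set l. (c k + (if k = k0 then a else 0)) * basis_fun \<tau> l k x)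
         = (\<Sum>k\<in>basis_set l. c k * basis_fun \<tau> l k x) + (\<Sum>k\<in>basis_set l. if k = k0 then a * basis_fun \<tau> l k x else 0)"
        unfolding sum.distrib[symmetric] by (rule sum.cong) (auto simp: distrib_right)
      also have "(\<Sum>k\<in>basis_set l. if k = k0 then a * basis_fun \<tau> l k x else 0) = a * wp \<tau> (x + omega \<tau> i) ^ n i"
        using k0 by (simp add: sum.delta)
      finally show ?thesis using c[OF x] by (simp add: diff_eq_eq)
    qed
    then show ?thesis by (intro exI[of _ "\<lambda>k. c k + (if k = k0 then a else 0)"] allI impI)
  qed
qed

text \<open>One step of Gaussian elimination: a row p with a nonzero entry in column
  \<open>k0\<close> clears that column in the remaining rows, which \<sigma> enumerates by skipping
  p.\<close>

lemma linear_dependence: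
  fixes a :: "nat \<Rightarrow> 'k \<Rightarrow> complex"
  assumes "finite K"
  shows "\<exists>c. (\<exists>n\<le>card K. c n \<noteq> 0) \<and> (\<forall>k\<in>K. (\<Sum>n\<le>card K. c n * a n k) = 0)"
  using assms
proof (induction K arbitrary: a rule: finite_induct)
  case empty
  show ?case by (intro exI[of _ "\<lambda>_. 1"]) auto
next
  case (insert k0 K)
  have cK: "card (insert k0 K) = Suc (card K)" using insert by simp
  show ?case
  proof (cases "\<forall>n\<le>Suc (card K). a n k0 = 0")
    case True
    obtain c where c: "\<exists>n\<le>card K. c n \<noteq> 0" "\<forall>k\<in>K. (\<Sum>n\<le>card K. c n * a n k) = 0" using insert.IH by blast
    show ?thesis unfolding cK
      by (intro exI[of _ "\<lambda>n. if n \<le> card K then c n else 0"]) (use c True in \<open>auto cong: sum.cong_simp intro: le_SucI\<close>)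
  next
    case False
    then obtain p where p: "p \<le> Suc (card K)" "a p k0 \<noteq> 0" by blast
    define \<sigma> where "\<sigma> = (\<lambda>n. if n < p then n else Suc n)"
    have inj: "inj_on \<sigma> {..card K}" by (auto simp: \<sigma>_def inj_on_def split: if_splits)
    have im: "\<sigma> ` {..card K} = {..Suc (card K)} - {p}"
    proof (intro equalityI subsetI)
      fix m assume m: "m \<in> {..Suc (card K)} - {p}"
      show "m \<in> \<sigma> ` {..card K}"
      proof (cases "m < p")
        case True then show ?thesis using p(1) by (intro image_eqI[of _ _ m]) (auto simp: \<sigma>_def)
      next
        case False then show ?thesis using m by (intro image_eqI[of _ _ "m - 1"]) (auto simp: \<sigma>_def)
      qed
    qed (auto simp: \<sigma>_def split: if_splits)
    obtain c where c: "\<exists>n\<le>card K. c n \<noteq> 0"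
      "\<forall>k\<in>K. (\<Sum>n\<le>card K. c n * (a (\<sigma> n) k - a (\<sigma> n) k0 / a p k0 * a p k)) = 0"
      using insert.IH[of "\<lambda>n k. a (\<sigma> n) k - a (\<sigma> n) k0 / a p k0 * a p k"] by blast
    define s where "s = (\<Sum>n\<le>card K. c n * (a (\<sigma> n) k0 / a p k0))"
    define d where "d = (\<lambda>m. if m = p then - s else c (inv_into {..card K} \<sigma> m))"
    have d\<sigma>: "d (\<sigma> n) = c n" if "n \<le> card K" for n
      using inv_into_f_f[OF inj, of n] that by (auto simp: d_def \<sigma>_def)
    have sum: "(\<Sum>m\<le>Suc (card K). d m * a m k) = (\<Sum>n\<le>card K. c n * a (\<sigma> n) k) - s * a p k" for k
    proof -
      have "(\<Sum>m\<le>Suc (card K). d m * a m k) = d p * a p k + (\<Sum>m\<in>{..Suc (card K)} - {p}. d m * a m k)"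
        using p(1) by (intro sum.remove) auto
      also have "(\<Sum>m\<in>{..Suc (card K)} - {p}. d m * a m k) = (\<Sum>n\<le>card K. d (\<sigma> n) * a (\<sigma> n) k)"
        unfolding im[symmetric] by (simp add: sum.reindex[OF inj])
      finally show ?thesis using d\<sigma> by (simp add: d_def cong: sum.cong_simp)
    qed
    have "(\<Sum>m\<le>Suc (card K). d m * a m k) = 0" if k: "k \<in> insert k0 K" for k
    proof (cases "k = k0")
      case True
      have "s * a p k0 = (\<Sum>n\<le>card K. c n * a (\<sigma> n) k0)" using p(2) by (simp add: s_def sum_distrib_right)
      then show ?thesis unfolding sum True by simp
    next
      case False
      then have "(\<Sum>n\<le>card K. c n * (a (\<sigma> n) k - a (\<sigma> n) k0 / a p k0 * a p k)) = 0" using c(2) k by blast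
      then show ?thesis unfolding sum s_def by (simp add: sum_distrib_right sum_subtractf right_diff_distrib mult.assoc)
    qed
    moreover have "\<exists>n\<le>Suc (card K). d n \<noteq> 0"
    proof -
      obtain n where n: "n \<le> card K" "c n \<noteq> 0" using c(1) by blast
      have "\<sigma> n \<le> Suc (card K)" using n by (auto simp: \<sigma>_def)
      then show ?thesis using d\<sigma>[OF n(1)] n(2) by auto
    qed
    ultimately show ?thesis unfolding cK by blast
  qed
qed

subsection \<open>Existence of the doubly periodic solution of the third-order equation\<close>

lemma deriv_eq_on_open:
  assumes "open S" "\<And>x. x \<in> S \<Longrightarrow> f x = g x" "x \<in> S" shows "deriv f x = deriv g (x :: complex)"
  by (rule deriv_cong_ev) (use assms in \<open>auto simp: eventually_nhds\<close>)

lemma deriv_lincomb: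
  assumes "open S" "finite I" "\<And>i. i \<in> I \<Longrightarrow> f i holomorphic_on S" "x \<in> S"
  shows "deriv (\<lambda>x. \<Sum>i\<in>I. c i * f i x) x = (\<Sum>i\<in>I. c i * deriv (f i) x)"
proof (rule DERIV_imp_deriv)
  show "((\<lambda>x. \<Sum>i\<in>I. c i * f i x) has_field_derivative (\<Sum>i\<in>I. c i * deriv (f i) x)) (at x)"
    by (intro DERIV_sum DERIV_cmult holomorphic_has_deriv[OF assms(3) assms(1,4)])
qed

lemma third_op_lincomb:
  assumes "open S" "finite I" "\<And>i. i \<in> I \<Longrightarrow> f i holomorphic_on S" "x \<in> S"
  shows "third_op u (\<lambda>x. \<Sum>i\<in>I. c i * f i x) x = (\<Sum>i\<in>I. c i * third_op u (f i) x)"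
proof -
  let ?F = "\<lambda>x. \<Sum>i\<in>I. c i * f i x"
  have hol: "deriv (f i) holomorphic_on S" "deriv (deriv (f i)) holomorphic_on S" if "i \<in> I" for i
    using holomorphic_deriv[OF assms(3)[OF that] assms(1)] holomorphic_deriv[OF holomorphic_deriv[OF assms(3)[OF that] assms(1)] assms(1)] by auto
  have d1: "deriv ?F y = (\<Sum>i\<in>I. c i * deriv (f i) y)" if "y \<in> S" for y
    by (rule deriv_lincomb[OF assms(1,2,3) that])
  have d2: "deriv (deriv ?F) y = (\<Sum>i\<in>I. c i * deriv (deriv (f i)) y)" if "y \<in> S" for y
    using deriv_eq_on_open[OF assms(1) d1 that] deriv_lincomb[OF assms(1,2) hol(1) that, where c = c] by simp
  have d3: "deriv (deriv (deriv ?F)) x = (\<Sum>i\<in>I. c i * deriv (deriv (deriv (f i))) x)"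
    using deriv_eq_on_open[OF assms(1) d2 assms(4)] deriv_lincomb[OF assms(1,2) hol(2) assms(4), where c = c] by simp
  show ?thesis
    unfolding third_op_def d1[OF assms(4)] d3
    by (simp add: sum_distrib_left sum_subtractf[symmetric] algebra_simps)
qed

lemma third_op_cong:
  assumes "open S" "\<And>x. x \<in> S \<Longrightarrow> f x = g x" "x \<in> S" shows "third_op u f x = third_op u g x"
proof -
  have d1: "deriv f y = deriv g y" if "y \<in> S" for y by (rule deriv_eq_on_open[OF assms(1,2) that])
  have d2: "deriv (deriv f) y = deriv (deriv g) y" if "y \<in> S" for y by (rule deriv_eq_on_open[OF assms(1) d1 that])
  have d3: "deriv (deriv (deriv f)) x = deriv (deriv (deriv g)) x" by (rule deriv_eq_on_open[OF assms(1) d2 assms(3)])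
  show ?thesis using assms(2,3) d1 d3 by (simp add: third_op_def)
qed

definition xi_lin :: "complex \<Rightarrow> (nat \<Rightarrow> nat) \<Rightarrow> (nat \<times> nat \<Rightarrow> complex poly) \<Rightarrow> complex \<Rightarrow> complex \<Rightarrow> complex" where
  "xi_lin \<tau> l p x E = (\<Sum>k\<in>basis_set l. poly (p k) E * basis_fun \<tau> l k x)"

text \<open>The third-order equation expanded over the basis: for fixed x the left side is a
  polynomial in E, so polynomial algebra can be applied to it.\<close>

definition xi_sol :: "complex \<Rightarrow> (nat \<Rightarrow> nat) \<Rightarrow> (nat \<times> nat \<Rightarrow> complex poly) \<Rightarrow> bool" where
  "xi_sol \<tau> l p \<longleftrightarrow> (\<forall>E x. x \<notin> poles \<tau> l \<longrightarrow>
     (\<Sum>k\<in>basis_set l. poly (p k) E * (third_op (pot \<tau> l) (basis_fun \<tau> l k) x + 4 * E * deriv (basis_fun \<tau> l k) x)) = 0)"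

definition coeffs_of :: "complex poly \<Rightarrow> (nat \<Rightarrow> nat \<Rightarrow> complex poly) \<Rightarrow> nat \<times> nat \<Rightarrow> complex poly" where
  "coeffs_of c0 b k = (if fst k = 4 then c0 else b (fst k) (snd k))"

lemma XiF_eq_xi_lin: "XiF \<tau> l c0 b x E = xi_lin \<tau> l (coeffs_of c0 b) x E"
  unfolding XiF_def xi_lin_def sum_basis_set by (simp add: coeffs_of_def basis_fun_def)

lemma holomorphic_basis_fun: "Im \<tau> > 0 \<Longrightarrow> k \<in> basis_set l \<Longrightarrow> basis_fun \<tau> l k holomorphic_on - poles \<tau> l"
  using elliptic_basis_fun unfolding elliptic_def by blast

lemma xi_lin_third:
  assumes \<tau>: "Im \<tau> > 0" and x: "x \<notin> poles \<tau> l"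
  shows "third_op (pot \<tau> l) (\<lambda>y. xi_lin \<tau> l p y E) x + 4 * E * deriv (\<lambda>y. xi_lin \<tau> l p y E) x
    = (\<Sum>k\<in>basis_set l. poly (p k) E * (third_op (pot \<tau> l) (basis_fun \<tau> l k) x + 4 * E * deriv (basis_fun \<tau> l k) x))"
  unfolding xi_lin_def
  using third_op_lincomb[OF open_not_poles[OF \<tau>] finite_basis_set holomorphic_basis_fun[OF \<tau>], where c = "\<lambda>k. poly (p k) E"] x
    deriv_lincomb[OF open_not_poles[OF \<tau>] finite_basis_set holomorphic_basis_fun[OF \<tau>], where c = "\<lambda>k. poly (p k) E"]
  by (simp add: distrib_left sum.distrib sum_distrib_left mult_ac)

lemma Xi_ok_iff:
  assumes \<tau>: "Im \<tau> > 0"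
  shows "Xi_ok \<tau> l c0 b \<longleftrightarrow> lead_coeff c0 = 1 \<and> (\<forall>i<4. \<forall>j<l i. b i j = 0 \<or> degree (b i j) < degree c0) \<and>
     (\<forall>d. d dvd c0 \<and> (\<forall>i<4. \<forall>j<l i. d dvd b i j) \<longrightarrow> degree d = 0) \<and> xi_sol \<tau> l (coeffs_of c0 b)"
proof -
  have e: "(deriv ^^ 3) h x - 4 * (pot \<tau> l x - E) * deriv h x - 2 * deriv (pot \<tau> l) x * h x
      = third_op (pot \<tau> l) h x + 4 * E * deriv h x" for h x E
    by (simp add: third_op_def numeral_3_eq_3 algebra_simps)
  then show ?thesis
    unfolding Xi_ok_def xi_sol_def Let_def XiF_eq_xi_lin e by (simp add: xi_lin_third[OF \<tau>])
qed

text \<open>For fixed x the expression is d times a polynomial R in E and vanishes for all E.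
  Cancelling d in the polynomial ring gives R = 0, also at the roots of d.\<close>

lemma xi_sol_cancel:
  assumes d: "d \<noteq> 0" and p: "xi_sol \<tau> l p" "\<And>k. k \<in> basis_set l \<Longrightarrow> p k = d * p' k"
  shows "xi_sol \<tau> l p'"
  unfolding xi_sol_def
proof (intro allI impI)
  fix E x assume x: "x \<notin> poles \<tau> l"
  let ?M = "\<lambda>k. third_op (pot \<tau> l) (basis_fun \<tau> l k) x" and ?D = "\<lambda>k. deriv (basis_fun \<tau> l k) x"
  define R where "R = (\<Sum>k\<in>basis_set l. p' k * [:?M k, 4 * ?D k:])"
  have R: "poly R E = (\<Sum>k\<in>basis_set l. poly (p' k) E * (?M k + 4 * E * ?D k))" for E
    by (simp add: R_def poly_sum algebra_simps)
  have "poly (d * R) E = 0" for E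
  proof -
    have "poly (d * R) E = (\<Sum>k\<in>basis_set l. poly (p k) E * (?M k + 4 * E * ?D k))"
      unfolding poly_mult R sum_distrib_left by (rule sum.cong) (auto simp: p(2))
    also have "\<dots> = 0" using p(1) x unfolding xi_sol_def by blast
    finally show ?thesis .
  qed
  then have "d * R = 0" using poly_all_0_iff_0 by blast
  then have "R = 0" using d by simp
  then show "(\<Sum>k\<in>basis_set l. poly (p' k) E * (?M k + 4 * E * ?D k)) = 0" using R[of E] by simp
qed

text \<open>Take a relation c_0 h_0 + ... + c_N h_N = 0 with c_N = 1. The solution is the sum over m
  < N of E^(N-1-m) times c_(N-m) h_0 + ... + c_N h_m. The Lenard recursion makes the equation
  telescope, leaving the derivative of h_0 = 1 and the derivative of the relation, both
  zero.\<close>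

lemma xi_sol_exists:
  assumes \<tau>: "Im \<tau> > 0"
  obtains p where "xi_sol \<tau> l p" "lead_coeff (p (4, 0)) = 1"
    "\<And>k. k \<in> basis_set l \<Longrightarrow> k \<noteq> (4, 0) \<Longrightarrow> p k = 0 \<or> degree (p k) < degree (p (4, 0))"
proof -
  let ?K = "basis_set l" and ?u = "pot \<tau> l" and ?e = "basis_fun \<tau> l"
  let ?h = "lenard ?u"
  have ko: "(4, 0) \<in> ?K" by (simp add: basis_set_def)
  have "\<forall>n. \<exists>a. \<forall>x. x \<notin> poles \<tau> l \<longrightarrow> ?h n x = (\<Sum>k\<in>?K. a k * ?e k x)"
    by (intro allI elliptic_span[OF \<tau> elliptic_lenard[OF \<tau>] order_refl polar_lenard[OF \<tau>]])
  from choice[OF this] obtain a' where a': "\<And>n x. x \<notin> poles \<tau> l \<Longrightarrow> ?h n x = (\<Sum>k\<in>?K. a' n k * ?e k x)" by blast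
  \<comment> \<open>Independence of the basis is not yet available, so the coordinates of h_0 = 1
    are prescribed; this later makes the top coefficient exactly 1 at (4, 0) and 0
    elsewhere.\<close>
  define a where "a = (\<lambda>n. if n = 0 then (\<lambda>k. if k = (4, 0) then 1 else 0) else a' n)"
  have a: "?h n x = (\<Sum>k\<in>?K. a n k * ?e k x)" if "x \<notin> poles \<tau> l" for n x
  proof (cases n)
    case 0
    have "(\<Sum>k\<in>?K. a 0 k * ?e k x) = (\<Sum>k\<in>?K. if k = (4, 0) then ?e k x else 0)" by (rule sum.cong) (auto simp: a_def)
    also have "\<dots> = 1" using ko by (subst sum.delta) (auto simp: basis_fun_def)
    finally show ?thesis by (simp add: 0)
  next
    case (Suc m) then show ?thesis using a'[OF that] by (simp add: a_def)
  qed
  obtain c1 where c1: "\<exists>n\<le>card ?K. c1 n \<noteq> 0" "\<forall>k\<in>?K. (\<Sum>n\<le>card ?K. c1 n * a n k) = 0"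
    using linear_dependence[OF finite_basis_set, of l a] by blast
  \<comment> \<open>The last index occurring in the relation, which is normalized to coefficient 1
    below. It is positive because h_0 is not zero.\<close>
  define N where "N = Max {n. n \<le> card ?K \<and> c1 n \<noteq> 0}"
  have Nin: "N \<in> {n. n \<le> card ?K \<and> c1 n \<noteq> 0}" unfolding N_def by (rule Max_in) (use c1(1) in auto)
  then have N: "N \<le> card ?K" "c1 N \<noteq> 0" by auto
  have above: "c1 n = 0" if "N < n" "n \<le> card ?K" for n
  proof (rule ccontr)
    assume "c1 n \<noteq> 0"
    then have "n \<le> N" unfolding N_def using that by (intro Max_ge) auto
    with that show False by simp
  qed
  define c where "c = (\<lambda>n. c1 n / c1 N)"
  have cN: "c N = 1" using N by (simp add: c_def)
  have rel: "(\<Sum>n\<le>N. c n * a n k) = 0" if "k \<in> ?K" for k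
  proof -
    have "(\<Sum>n\<le>card ?K. c1 n * a n k) = (\<Sum>n\<le>N. c1 n * a n k)"
      by (rule sum.mono_neutral_right) (use N above in auto)
    then have "(\<Sum>n\<le>N. c1 n * a n k) / c1 N = 0" using c1(2) that by simp
    then show ?thesis by (simp add: c_def sum_divide_distrib)
  qed
  have "N \<noteq> 0" using rel[OF ko] cN by (cases N) (auto simp: a_def)
  \<comment> \<open>Coordinates of the coefficient of E^(N-1-m). \<open>A 0\<close> belongs to h_0,
    and \<open>A N\<close> to the full relation, so it vanishes.\<close>
  define A where "A = (\<lambda>m k. \<Sum>j\<le>m. c (N - m + j) * a j k)"
  have AN: "A N k = 0" if "k \<in> ?K" for k using rel[OF that] by (simp add: A_def)
  have A0: "A 0 k = (if k = (4, 0) then 1 else 0)" for k by (simp add: A_def cN a_def)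
  define p where "p = (\<lambda>k. \<Sum>m<N. monom (A m k) (N - 1 - m))"
  have deg: "degree (p k) \<le> N - 1" for k
    unfolding p_def by (rule degree_sum_le) (auto intro: order_trans[OF degree_monom_le])
  have top: "coeff (p k) (N - 1) = A 0 k" for k
  proof -
    have "coeff (p k) (N - 1) = (\<Sum>m<N. if m = 0 then A 0 k else 0)"
      unfolding p_def coeff_sum coeff_monom by (rule sum.cong) auto
    then show ?thesis using \<open>N \<noteq> 0\<close> by simp
  qed
  have deg4: "degree (p (4, 0)) = N - 1" using deg[of "(4,0)"] top[of "(4,0)"] by (intro antisym le_degree) (auto simp: A0)
  show ?thesis
  proof (rule that[of p])
    show "lead_coeff (p (4, 0)) = 1" unfolding deg4 top A0 by simp
    fix k assume k: "k \<in> ?K" "k \<noteq> (4, 0)"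
    show "p k = 0 \<or> degree (p k) < degree (p (4, 0))"
    proof (cases "p k = 0")
      case False
      have "degree (p k) \<noteq> N - 1"
      proof
        assume e: "degree (p k) = N - 1"
        have "lead_coeff (p k) = 0" unfolding e top A0 using k(2) by simp
        with False show False by simp
      qed
      then show ?thesis using deg[of k] deg4 by simp
    qed simp
  next
    show "xi_sol \<tau> l p"
      unfolding xi_sol_def
    proof (intro allI impI)
      fix E x assume x: "x \<notin> poles \<tau> l"
      then have xU: "x \<in> - poles \<tau> l" by simp
      define T where "T = (\<lambda>m. \<Sum>k\<in>?K. A m k * third_op ?u (?e k) x)"
      define D where "D = (\<lambda>m. \<Sum>k\<in>?K. A m k * deriv (?e k) x)"
      have Mh: "third_op ?u (?h j) x = (\<Sum>k\<in>?K. a j k * third_op ?u (?e k) x)" for j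
        using third_op_cong[OF open_not_poles[OF \<tau>], of l "?h j" "\<lambda>x. \<Sum>k\<in>?K. a j k * ?e k x" x] a xU
          third_op_lincomb[OF open_not_poles[OF \<tau>] finite_basis_set holomorphic_basis_fun[OF \<tau>] xU, where c = "a j"] by simp
      have Dh: "deriv (?h j) x = (\<Sum>k\<in>?K. a j k * deriv (?e k) x)" for j
        using deriv_eq_on_open[OF open_not_poles[OF \<tau>], of l "?h j" "\<lambda>x. \<Sum>k\<in>?K. a j k * ?e k x" x] a xU
          deriv_lincomb[OF open_not_poles[OF \<tau>] finite_basis_set holomorphic_basis_fun[OF \<tau>] xU, where c = "a j"] by simp
      have swap: "(\<Sum>k\<in>?K. A m k * f k) = (\<Sum>j\<le>m. c (N - m + j) * (\<Sum>k\<in>?K. a j k * f k))" for m and f :: "nat \<times> nat \<Rightarrow> complex"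
        unfolding A_def sum_distrib_right sum_distrib_left by (subst sum.swap) (simp add: mult.assoc)
      have T: "T m = (\<Sum>j\<le>m. c (N - m + j) * third_op ?u (?h j) x)" for m unfolding T_def swap Mh ..
      have D: "D m = (\<Sum>j\<le>m. c (N - m + j) * deriv (?h j) x)" for m unfolding D_def swap Dh ..
      have h0: "deriv (?h 0) x = 0" by simp
      \<comment> \<open>Summing the Lenard recursion with the weights c; the shifted index loses
        nothing because h_0 has derivative zero.\<close>
      have TD: "T m = - 4 * D (Suc m)" if m: "m < N" for m
      proof -
        have "D (Suc m) = (\<Sum>j\<le>m. c (N - Suc m + Suc j) * deriv (?h (Suc j)) x)"
          unfolding D by (subst sum.atMost_Suc_shift) (simp add: h0)
        also have "\<dots> = (\<Sum>j\<le>m. c (N - m + j) * deriv (?h (Suc j)) x)"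
        proof (rule sum.cong)
          fix j
          have "N - Suc m + Suc j = N - m + j" using m by simp
          then show "c (N - Suc m + Suc j) * deriv (?h (Suc j)) x = c (N - m + j) * deriv (?h (Suc j)) x" by (simp only:)
        qed simp
        finally have "- 4 * D (Suc m) = (\<Sum>j\<le>m. c (N - m + j) * (- (4 * deriv (?h (Suc j)) x)))"
          by (simp add: sum_distrib_left sum_negf mult_ac)
        also have "\<dots> = T m" unfolding T lenard_recursion[OF open_not_poles[OF \<tau>] holomorphic_pot[OF \<tau>] xU] by simp
        finally show ?thesis by simp
      qed
      have "(\<Sum>k\<in>?K. poly (p k) E * (third_op ?u (?e k) x + 4 * E * deriv (?e k) x))
         = (\<Sum>m<N. E ^ (N - 1 - m) * (T m + 4 * E * D m))"
      proof -
        have "poly (p k) E = (\<Sum>m<N. A m k * E ^ (N - 1 - m))" for k by (simp add: p_def poly_sum poly_monom)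
        then have "(\<Sum>k\<in>?K. poly (p k) E * (third_op ?u (?e k) x + 4 * E * deriv (?e k) x))
          = (\<Sum>m<N. \<Sum>k\<in>?K. A m k * E ^ (N - 1 - m) * (third_op ?u (?e k) x + 4 * E * deriv (?e k) x))"
          by (simp add: sum_distrib_right) (rule sum.swap)
        also have "\<dots> = (\<Sum>m<N. E ^ (N - 1 - m) * (T m + 4 * E * D m))"
          unfolding T_def D_def by (simp add: sum_distrib_left sum.distrib[symmetric] algebra_simps)
        finally show ?thesis .
      qed
      also have "\<dots> = (\<Sum>m<N. 4 * (E ^ (N - m) * D m) - 4 * (E ^ (N - Suc m) * D (Suc m)))"
      proof (rule sum.cong)
        fix m assume "m \<in> {..<N}"
        then have m: "m < N" by simp
        have n1: "N - m = Suc (N - Suc m)" by (rule Suc_diff_Suc[OF m, symmetric])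
        have n2: "N - 1 - m = N - Suc m" by simp
        have ring: "y * (- 4 * d' + 4 * E * d) = 4 * (E * y * d) - 4 * (y * d')" for y d d' :: complex
          by (simp add: algebra_simps)
        show "E ^ (N - 1 - m) * (T m + 4 * E * D m) = 4 * (E ^ (N - m) * D m) - 4 * (E ^ (N - Suc m) * D (Suc m))"
          unfolding TD[OF m] n2 n1 power_Suc by (rule ring)
      qed simp
      also have "\<dots> = 4 * (E ^ N * D 0) - 4 * D N"
        using sum_lessThan_telescope'[of "\<lambda>m. 4 * (E ^ (N - m) * D m)" N] by simp
      also have "\<dots> = 0"
      proof -
        have "D 0 = 0" using D[of 0] h0 by simp
        moreover have "D N = 0" by (simp add: D_def AN)
        ultimately show ?thesis by simp
      qed
      finally show "(\<Sum>k\<in>?K. poly (p k) E * (third_op ?u (?e k) x + 4 * E * deriv (?e k) x)) = 0" .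
    qed
  qed
qed

text \<open>Among all monic solutions choose one of least degree. Dividing out a nonconstant common
  divisor would give a solution of smaller degree, so the coefficients are coprime.\<close>

lemma Xi_ok_exists:
  assumes \<tau>: "Im \<tau> > 0" shows "\<exists>c0 b. Xi_ok \<tau> l c0 b"
proof -
  let ?P = "\<lambda>p. xi_sol \<tau> l p \<and> lead_coeff (p (4, 0)) = 1 \<and>
     (\<forall>k\<in>basis_set l. k \<noteq> (4, 0) \<longrightarrow> p k = 0 \<or> degree (p k) < degree (p (4, 0)))"
  obtain p0 where "?P p0" using xi_sol_exists[OF \<tau>, of l] by metis
  then obtain p where p: "?P p" and least: "\<And>p'. ?P p' \<Longrightarrow> degree (p (4, 0)) \<le> degree (p' (4, 0))"
    using ex_has_least_nat[of ?P p0 "\<lambda>p. degree (p (4, 0))"] by blast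
  have ko: "(4, 0) \<in> basis_set l" by (simp add: basis_set_def)
  have kij: "(i, j) \<in> basis_set l \<and> (i, j) \<noteq> (4, 0)" if "i < 4" "j < l i" for i j using that by (simp add: basis_set_def)
  have cop: "degree d = 0" if d: "\<And>k. k \<in> basis_set l \<Longrightarrow> d dvd p k" for d
  proof -
    have p4: "p (4, 0) \<noteq> 0" using p by auto
    have "d \<noteq> 0" using d[OF ko] p4 by auto
    \<comment> \<open>Made monic, so that the quotient keeps leading coefficient 1.\<close>
    define d' where "d' = smult (1 / lead_coeff d) d"
    have lc: "lead_coeff d' = 1" using \<open>d \<noteq> 0\<close> by (simp add: d'_def)
    have d'0: "d' \<noteq> 0" using lc by auto
    have "d' dvd p k" if "k \<in> basis_set l" for k
      unfolding d'_def using d[OF that] \<open>d \<noteq> 0\<close> by (subst smult_dvd_iff) auto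
    then have "\<forall>k. \<exists>r. k \<in> basis_set l \<longrightarrow> p k = d' * r" by (auto simp: dvd_def)
    from choice[OF this] obtain p' where p': "\<And>k. k \<in> basis_set l \<Longrightarrow> p k = d' * p' k" by blast
    have degp: "degree (p k) = degree d' + degree (p' k)" if "k \<in> basis_set l" "p' k \<noteq> 0" for k
      using p'[OF that(1)] d'0 that(2) by (simp add: degree_mult_eq)
    have p'4: "p' (4, 0) \<noteq> 0" using p4 p'[OF ko] by auto
    have "?P p'"
    proof (intro conjI ballI impI)
      show "xi_sol \<tau> l p'" by (rule xi_sol_cancel[OF d'0 _ p']) (use p in auto)
      show "lead_coeff (p' (4, 0)) = 1" using p p'[OF ko] lc lead_coeff_mult[of d' "p' (4, 0)"] by simp
      fix k assume k: "k \<in> basis_set l" "k \<noteq> (4, 0)"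
      show "p' k = 0 \<or> degree (p' k) < degree (p' (4, 0))"
      proof (cases "p' k = 0")
        case False
        then have "p k \<noteq> 0" using p'[OF k(1)] d'0 by simp
        then have "degree (p k) < degree (p (4, 0))" using p k by blast
        then show ?thesis using degp[OF k(1) False] degp[OF ko p'4] by simp
      qed simp
    qed
    from least[OF this] degp[OF ko p'4] have "degree d' = 0" by simp
    then show ?thesis using \<open>d \<noteq> 0\<close> by (simp add: d'_def)
  qed
  have eq: "coeffs_of (p (4, 0)) (\<lambda>i j. p (i, j)) k = p k" if "k \<in> basis_set l" for k
    using that by (auto simp: coeffs_of_def basis_set_def)
  have sol: "xi_sol \<tau> l (coeffs_of (p (4, 0)) (\<lambda>i j. p (i, j)))"
    using p eq unfolding xi_sol_def by (simp cong: sum.cong_simp)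
  have "Xi_ok \<tau> l (p (4, 0)) (\<lambda>i j. p (i, j))"
    unfolding Xi_ok_iff[OF \<tau>]
  proof (intro conjI allI impI)
    show "lead_coeff (p (4, 0)) = 1" using p by simp
    show "p (i, j) = 0 \<or> degree (p (i, j)) < degree (p (4, 0))" if "i < 4" "j < l i" for i j
      using p kij[OF that] by blast
    show "degree d = 0" if d: "d dvd p (4, 0) \<and> (\<forall>i<4. \<forall>j<l i. d dvd p (i, j))" for d
    proof (rule cop)
      fix k assume "k \<in> basis_set l"
      then consider "k = (4, 0)" | i j where "k = (i, j)" "i < 4" "j < l i" by (auto simp: basis_set_def)
      then show "d dvd p k" using d by cases auto
    qed
  qed (rule sol)
  then show ?thesis by blast
qed

subsection \<open>Properties of the function Xi\<close>

text \<open>This strip contains no pole, is convex and is preserved by real translations, so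
  primitives exist on it and translation by 1 acts on its solution spaces.\<close>

definition upper :: "complex \<Rightarrow> complex set" where "upper \<tau> = {x. 0 < Im x \<and> Im x < Im \<tau> / 2}"

lemma upper_facts:
  "open (upper \<tau>)" "convex (upper \<tau>)" "upper \<tau> \<subseteq> strip \<tau> - half_ints" "x + 1 \<in> upper \<tau> \<longleftrightarrow> x \<in> upper \<tau>"
    "x + of_real r \<in> upper \<tau> \<longleftrightarrow> x \<in> upper \<tau>"
proof -
  have eq: "upper \<tau> = {x. Im x > 0} \<inter> {x. Im x < Im \<tau> / 2}" by (auto simp: upper_def)
  show "open (upper \<tau>)" unfolding eq by (intro open_Int open_halfspace_Im_gt open_halfspace_Im_lt)
  show "convex (upper \<tau>)" unfolding eq by (intro convex_Int convex_halfspace_Im_gt convex_halfspace_Im_lt)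
  show "upper \<tau> \<subseteq> strip \<tau> - half_ints"
  proof
    fix x assume x: "x \<in> upper \<tau>"
    have "x \<notin> half_ints"
    proof
      assume "x \<in> half_ints"
      then show False using x by (cases rule: half_ints_cases) (auto simp: upper_def)
    qed
    then show "x \<in> strip \<tau> - half_ints" using x by (auto simp: upper_def strip_def)
  qed
qed (auto simp: upper_def)

lemma upper_not_poles: "Im \<tau> > 0 \<Longrightarrow> upper \<tau> \<subseteq> - poles \<tau> l"
  using upper_facts(3)[of \<tau>] strip_poles[of \<tau>] by blast

lemma strip_half_not_poles: "Im \<tau> > 0 \<Longrightarrow> strip \<tau> - half_ints \<subseteq> - poles \<tau> l"
  using strip_poles[of \<tau>] by blast

text \<open>At a half period only its own powers of \<open>wp\<close> have poles, with distinct
  orders, so the coefficients are read off from the highest power downwards and the constant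
  last.\<close>

lemma basis_independent:
  assumes \<tau>: "Im \<tau> > 0" and z: "\<And>x. x \<notin> poles \<tau> l \<Longrightarrow> (\<Sum>k\<in>basis_set l. a k * basis_fun \<tau> l k x) = 0" and k: "k \<in> basis_set l"
  shows "a k = 0"
proof -
  have aij: "a (i, j) = 0" if ij: "i < 4" "j < l i" for i j
    using ij(2)
  proof (induction j rule: less_induct)
    case (less j)
    let ?c = "- omega \<tau> i" and ?m = "2 * (l i - j)"
    have li: "l i > 0" using less.prems by simp
    have pw: "polar ?c (2 * n) 1 (\<lambda>x. wp \<tau> (x + omega \<tau> i) ^ n)" for n
      using polar_power[OF polar_wp_same[OF \<tau>, of i], of n] by (simp add: mult.commute)
    have "polar ?c ?m (\<Sum>k\<in>basis_set l. if k = (i, j) then a (i, j) else 0) (\<lambda>x. \<Sum>k\<in>basis_set l. a k * basis_fun \<tau> l k x)"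
    proof (rule polar_sum)
      fix k assume k: "k \<in> basis_set l"
      obtain i' j' where kk: "k = (i', j')" by (cases k)
      consider "i' = 4" | "i' = i" "j' < j" | "i' = i" "j' = j" | "i' = i" "j' > j" | "i' < 4" "i' \<noteq> i"
        using k ij(1) unfolding kk by (auto simp: basis_set_def) linarith
      then show "polar ?c ?m (if k = (i, j) then a (i, j) else 0) (\<lambda>x. a k * basis_fun \<tau> l k x)"
      proof cases
        case 1
        have "polar ?c (0 + ?m) (if ?m = 0 then a k else 0) (\<lambda>x. a k)" by (rule polar_raise[OF polar_const])
        then show ?thesis using 1 ij less.prems unfolding kk by (simp add: basis_fun_def)
      next
        case 2
        have "a k = 0" using less.IH[of j'] 2 less.prems unfolding kk by simp
        have "polar ?c (0 + ?m) (if ?m = 0 then 0 else 0) (\<lambda>x. 0)" by (rule polar_raise[OF polar_const])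
        then show ?thesis using 2 \<open>a k = 0\<close> unfolding kk by simp
      next
        case 3
        then show ?thesis using polar_cmult[OF pw[of "l i - j"], of "a (i, j)"] ij unfolding kk by (simp add: basis_fun_def)
      next
        case 4
        have "j' < l i" using k ij 4 unfolding kk by (auto simp: basis_set_def)
        then have e: "2 * (l i - j') + 2 * (j' - j) = ?m" using 4 by simp
        from polar_raise[OF polar_cmult[OF pw[of "l i - j'"], of "a (i, j')"], of "2 * (j' - j)", unfolded e]
        show ?thesis using 4 ij unfolding kk by (simp add: basis_fun_def)
      next
        case 5
        have "polar ?c 0 (wp \<tau> (omega \<tau> i' - omega \<tau> i) ^ (l i' - j')) (\<lambda>x. wp \<tau> (x + omega \<tau> i') ^ (l i' - j'))"
          using polar_power[OF polar_wp_other[OF \<tau> ij(1) 5(1)], of "l i' - j'"] 5 by simp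
        from polar_raise[OF polar_cmult[OF this, of "a k"], of ?m]
        show ?thesis using 5 less.prems unfolding kk by (simp add: basis_fun_def)
      qed
    qed simp
    moreover have "(\<Sum>k\<in>basis_set l. if k = (i, j) then a (i, j) else 0) = a (i, j)"
      using ij less.prems by (simp add: sum.delta basis_set_def)
    ultimately have p1: "polar ?c ?m (a (i, j)) (\<lambda>x. \<Sum>k\<in>basis_set l. a k * basis_fun \<tau> l k x)" by simp
    obtain \<delta> where \<delta>: "\<delta> > 0" "\<And>y. y \<in> ball 0 \<delta> \<Longrightarrow> y \<noteq> 0 \<Longrightarrow> ?c + y \<notin> poles \<tau> l"
      using poles_separated[OF \<tau>, of l] omega_poles[of i l \<tau>, OF ij(1) li] by metis
    have z0: "polar ?c ?m 0 (\<lambda>x. 0)" using polar_cmult[OF p1, of 0] by simp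
    have "polar ?c ?m 0 (\<lambda>x. \<Sum>k\<in>basis_set l. a k * basis_fun \<tau> l k x)"
    proof (rule polar_cong[OF z0 \<delta>(1)])
      fix y :: complex assume "y \<in> ball 0 \<delta>" "y \<noteq> 0"
      from z[OF \<delta>(2)[OF this]] show "0 = (\<Sum>k\<in>basis_set l. a k * basis_fun \<tau> l k (?c + y))" by (rule sym)
    qed
    with p1 show ?case by (rule polar_unique)
  qed
  have "\<exists>x. x \<notin> poles \<tau> l"
    using countable_poles[of \<tau> l] uncountable_UNIV_complex by (metis UNIV_eq_I)
  then obtain x where x: "x \<notin> poles \<tau> l" by blast
  have "(\<Sum>k\<in>basis_set l. a k * basis_fun \<tau> l k x) = a (4, 0)"
    unfolding sum_basis_set by (simp add: aij basis_fun_def)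
  then have "a (4, 0) = 0" using z[OF x] by simp
  then show ?thesis using k aij by (auto simp: basis_set_def)
qed

text \<open>The last property is the use of coprimality: if all coefficients vanished at one energy
  E, the linear polynomial with root E would divide them all. So no energy makes Xi vanish
  identically.\<close>

lemma Xi_structure:
  assumes \<tau>: "Im \<tau> > 0"
  obtains p where "\<And>x E. Xi \<tau> l x E = xi_lin \<tau> l p x E" "xi_sol \<tau> l p" "\<And>E. \<exists>k\<in>basis_set l. poly (p k) E \<noteq> 0"
proof -
  define cb where "cb = (SOME cb. Xi_ok \<tau> l (fst cb) (snd cb))"
  have "\<exists>cb. Xi_ok \<tau> l (fst cb) (snd cb)" using Xi_ok_exists[OF \<tau>, of l] by auto
  then have ok: "Xi_ok \<tau> l (fst cb) (snd cb)" unfolding cb_def by (rule someI_ex)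
  let ?p = "coeffs_of (fst cb) (snd cb)"
  show ?thesis
  proof (rule that[of ?p])
    show "Xi \<tau> l x E = xi_lin \<tau> l ?p x E" for x E
      unfolding Xi_def cb_def[symmetric] Let_def XiF_eq_xi_lin ..
    show "xi_sol \<tau> l ?p" using ok unfolding Xi_ok_iff[OF \<tau>] by blast
    show "\<exists>k\<in>basis_set l. poly (?p k) E \<noteq> 0" for E
    proof (rule ccontr)
      assume "\<not> ?thesis"
      then have z: "poly (?p k) E = 0" if "k \<in> basis_set l" for k using that by blast
      have "[:-E, 1:] dvd fst cb" using z[of "(4, 0)"] by (simp add: basis_set_def coeffs_of_def poly_eq_0_iff_dvd)
      moreover have "[:-E, 1:] dvd snd cb i j" if "i < 4" "j < l i" for i j
        using z[of "(i, j)"] that by (simp add: basis_set_def coeffs_of_def poly_eq_0_iff_dvd)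
      ultimately have "degree [:-E, 1:] = 0" using ok unfolding Xi_ok_iff[OF \<tau>] by blast
      then show False by simp
    qed
  qed
qed

definition Xi_op :: "complex \<Rightarrow> (nat \<Rightarrow> nat) \<Rightarrow> complex \<Rightarrow> (complex \<Rightarrow> complex) \<Rightarrow> complex \<Rightarrow> complex" where
  "Xi_op \<tau> l E y x = Xi \<tau> l x E * deriv y x - 1/2 * deriv (\<lambda>y. Xi \<tau> l y E) x * y x"

text \<open>For a primitive G, the function G(x + 1) - G(x) has derivative f(x + 1) - f(x) = 0, so
  the integral over a period does not depend on where it starts.\<close>

lemma periodic_integral_shift:
  assumes V: "open V" "convex V" "\<And>x. x \<in> V \<Longrightarrow> x + 1 \<in> V" and f: "f holomorphic_on V" "\<And>x. x \<in> V \<Longrightarrow> f (x + 1) = f x"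
  obtains G where "\<And>x. x \<in> V \<Longrightarrow> (G has_field_derivative f x) (at x)"
    "\<And>a b. a \<in> V \<Longrightarrow> b \<in> V \<Longrightarrow> (f has_contour_integral (G b - G a)) (linepath a b)"
    "\<And>a b. a \<in> V \<Longrightarrow> b \<in> V \<Longrightarrow> G (a + 1) - G a = G (b + 1) - G b"
proof -
  obtain G where G: "\<And>x. x \<in> V \<Longrightarrow> (G has_field_derivative f x) (at x)"
  proof (cases "V = {}")
    case False
    then show ?thesis
      using that holomorphic_starlike_primitive[OF holomorphic_on_imp_continuous_on[OF f(1)] convex_imp_starlike[OF V(2)] V(1) finite.emptyI]
        holomorphic_on_imp_differentiable_at[OF f(1) V(1)] by auto
  qed auto
  show ?thesis
  proof (rule that[of G, OF G])
    fix a b assume ab: "a \<in> V" "b \<in> V"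
    have "closed_segment a b \<subseteq> V" using V(2) ab by (simp add: closed_segment_subset)
    then show "(f has_contour_integral (G b - G a)) (linepath a b)"
      using contour_integral_primitive[of V G f "linepath a b"] G by (auto intro: has_field_derivative_at_within)
    show "G (a + 1) - G a = G (b + 1) - G b"
    proof (rule deriv_zero_constant[OF V(1) convex_connected[OF V(2)] _ ab])
      fix x assume x: "x \<in> V"
      have "((\<lambda>x. G (x + 1)) has_field_derivative f (x + 1)) (at x)" using G[OF V(3)[OF x]] by (simp add: DERIV_shift)
      from DERIV_diff[OF this G[OF x]] show "((\<lambda>x. G (x + 1) - G x) has_field_derivative 0) (at x)" using f(2)[OF x] by simp
    qed
  qed
qed

text \<open>For j = 0 and j = 1 these are the solutions with initial data (1, 0) and (0, 1) at a.
  Their Volterra form gives continuity in energy and argument jointly.\<close>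

definition fund :: "complex \<Rightarrow> (nat \<Rightarrow> nat) \<Rightarrow> complex \<Rightarrow> nat \<Rightarrow> complex \<Rightarrow> complex \<Rightarrow> complex" where
  "fund \<tau> l a j E x = frob j (\<lambda>z. pot \<tau> l (a + z) - E) (x - a)"

definition floquet :: "complex \<Rightarrow> (nat \<Rightarrow> nat) \<Rightarrow> complex \<Rightarrow> complex \<Rightarrow> (complex \<Rightarrow> complex) \<Rightarrow> bool" where
  "floquet \<tau> l E s y \<longleftrightarrow> ode_sol (\<lambda>x. pot \<tau> l x - E) (upper \<tau>) y \<and> (\<forall>x\<in>upper \<tau>. Xi_op \<tau> l E y x = s * y x)"

text \<open>The initial value Xi(a) and slope Xi'(a)/2 + s are those imposed by Xi y' = (Xi'/2 + s)
  y, scaled to avoid division by Xi. The formula is therefore continuous in E and s even where Xi(a)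
  vanishes.\<close>

definition floquet_sol :: "complex \<Rightarrow> (nat \<Rightarrow> nat) \<Rightarrow> complex \<Rightarrow> complex \<Rightarrow> complex \<Rightarrow> complex \<Rightarrow> complex" where
  "floquet_sol \<tau> l a E s x = Xi \<tau> l a E * fund \<tau> l a 0 E x + (1/2 * deriv (\<lambda>y. Xi \<tau> l y E) a + s) * fund \<tau> l a 1 E x"

definition multiplier :: "complex \<Rightarrow> (nat \<Rightarrow> nat) \<Rightarrow> complex \<Rightarrow> complex \<Rightarrow> complex" where
  "multiplier \<tau> l E s = (SOME m. \<forall>y. floquet \<tau> l E s y \<longrightarrow> (\<forall>x\<in>upper \<tau>. y (x + 1) = m * y x))"

lemma DERIV_shift_minus:
  fixes f :: "complex \<Rightarrow> complex"
  assumes "(f has_field_derivative d) (at (x - a))"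
  shows "((\<lambda>x. f (x - a)) has_field_derivative d) (at x)"
proof -
  have "((\<lambda>x. f (x - a)) has_field_derivative d * 1) (at x)"
    by (rule DERIV_chain2[where g = "\<lambda>x. x - a", OF assms]) (auto intro!: derivative_eq_intros)
  then show ?thesis by simp
qed

lemma has_vector_derivative_quotient:
  fixes f :: "real \<Rightarrow> complex"
  shows "(f has_vector_derivative D) (at t) \<longleftrightarrow> ((\<lambda>r. (f r - f t) / of_real (r - t)) \<longlongrightarrow> D) (at t)"
proof -
  have eq: "norm ((f r - f t) - (r - t) *\<^sub>R D) / norm (r - t) = norm ((f r - f t) / of_real (r - t) - D)" if "r \<noteq> t" for r
  proof -
    have "(f r - f t) / of_real (r - t) - D = ((f r - f t) - (r - t) *\<^sub>R D) / of_real (r - t)"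
      using that by (simp add: divide_simps scaleR_conv_of_real mult.commute)
    then show ?thesis by (simp only: norm_divide norm_of_real real_norm_def)
  qed
  have "(f has_vector_derivative D) (at t) \<longleftrightarrow> ((\<lambda>r. norm ((f r - f t) - (r - t) *\<^sub>R D) / norm (r - t)) \<longlongrightarrow> 0) (at t)"
    unfolding has_vector_derivative_def has_derivative_iff_norm by (simp add: bounded_linear_scaleR_left)
  also have "\<dots> \<longleftrightarrow> ((\<lambda>r. norm ((f r - f t) / of_real (r - t) - D)) \<longlongrightarrow> 0) (at t)"
    by (rule filterlim_cong[OF refl refl]) (use eq in \<open>simp only: eventually_at_filter, intro always_eventually allI impI, blast\<close>)
  also have "\<dots> \<longleftrightarrow> ((\<lambda>r. (f r - f t) / of_real (r - t)) \<longlongrightarrow> D) (at t)"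
    by (simp only: tendsto_norm_zero_iff LIM_zero_iff)
  finally show ?thesis .
qed

context
  fixes \<tau> :: complex and l :: "nat \<Rightarrow> nat"
  assumes \<tau>: "Im \<tau> > 0"
begin

private abbreviation (input) "U \<equiv> - poles \<tau> l"
private abbreviation (input) "X E \<equiv> (\<lambda>x. Xi \<tau> l x E)"
private abbreviation (input) "u \<equiv> pot \<tau> l"

private lemma opU: "open U" by (rule open_not_poles[OF \<tau>])

lemma elliptic_Xi: "elliptic \<tau> l (X E)"
proof -
  obtain p where p: "\<And>x E. Xi \<tau> l x E = xi_lin \<tau> l p x E" using Xi_structure[OF \<tau>] by metis
  show ?thesis unfolding p xi_lin_def by (intro elliptic_lincomb elliptic_basis_fun \<tau>) auto
qed

lemma holomorphic_Xi: "X E holomorphic_on U"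
  using elliptic_Xi unfolding elliptic_def by blast

lemma Xi_shift: "x \<in> U \<Longrightarrow> w \<in> lattice \<tau> \<Longrightarrow> Xi \<tau> l (x + w) E = Xi \<tau> l x E"
  using elliptic_Xi[of E] unfolding elliptic_def by blast

lemma Xi_uminus: "x \<in> U \<Longrightarrow> Xi \<tau> l (- x) E = Xi \<tau> l x E"
  using elliptic_Xi[of E] unfolding elliptic_def by blast

lemma deriv_Xi_shift: "x \<in> U \<Longrightarrow> w \<in> lattice \<tau> \<Longrightarrow> deriv (X E) (x + w) = deriv (X E) x"
  by (rule deriv_shift[OF holomorphic_Xi opU]) (auto simp: Xi_shift poles_shift)

lemma deriv_Xi_uminus: "x \<in> U \<Longrightarrow> deriv (X E) (- x) = - deriv (X E) x"
  using deriv_parity[OF holomorphic_Xi opU, of E 1 x] by (simp add: Xi_uminus poles_uminus)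

lemma Xi_third_order: "x \<in> U \<Longrightarrow> third_op u (X E) x + 4 * E * deriv (X E) x = 0"
proof -
  assume x: "x \<in> U"
  obtain p where p: "\<And>x E. Xi \<tau> l x E = xi_lin \<tau> l p x E" "xi_sol \<tau> l p" using Xi_structure[OF \<tau>] by metis
  show ?thesis unfolding p(1) using xi_lin_third[OF \<tau>, of x l p E] p(2) x unfolding xi_sol_def by simp
qed

text \<open>The zeros of Xi move with the energy, so base points are chosen anew for each energy,
  from any given open set.\<close>

lemma Xi_nonzero:
  assumes "open S" "S \<noteq> {}" "S \<subseteq> U" obtains x where "x \<in> S" "Xi \<tau> l x E \<noteq> 0"
proof (rule ccontr)
  assume no: "\<not> thesis"
  then have z: "Xi \<tau> l x E = 0" if "x \<in> S" for x using that \<open>\<And>x. x \<in> S \<Longrightarrow> Xi \<tau> l x E \<noteq> 0 \<Longrightarrow> thesis\<close> by blast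
  obtain p where p: "\<And>x E. Xi \<tau> l x E = xi_lin \<tau> l p x E" "\<And>E. \<exists>k\<in>basis_set l. poly (p k) E \<noteq> 0" using Xi_structure[OF \<tau>] by metis
  have "Xi \<tau> l x E = 0" if "x \<in> U" for x
    by (rule identity_open[OF holomorphic_Xi _ opU connected_not_poles assms z that]) auto
  then have "poly (p k) E = 0" if "k \<in> basis_set l" for k
    using basis_independent[OF \<tau>, of l "\<lambda>k. poly (p k) E" k] that p(1) by (simp add: xi_lin_def)
  with p(2)[of E] show False by blast
qed

lemma continuous_Xi:
  "continuous_on (UNIV \<times> U) (\<lambda>(E, x). Xi \<tau> l x E)"
  "continuous_on (UNIV \<times> U) (\<lambda>(E, x). deriv (X E) x)"
  "continuous_on (UNIV \<times> U) (\<lambda>(E, x). deriv (deriv (X E)) x)"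
proof -
  obtain p where p: "\<And>x E. Xi \<tau> l x E = xi_lin \<tau> l p x E" using Xi_structure[OF \<tau>] by metis
  let ?e = "basis_fun \<tau> l"
  have hol: "?e k holomorphic_on U" "deriv (?e k) holomorphic_on U" "deriv (deriv (?e k)) holomorphic_on U" if "k \<in> basis_set l" for k
    using holomorphic_basis_fun[OF \<tau> that] opU by (auto intro!: holomorphic_deriv)
  have d1: "deriv (X E) x = (\<Sum>k\<in>basis_set l. poly (p k) E * deriv (?e k) x)" if "x \<in> U" for E x
    unfolding p xi_lin_def by (rule deriv_lincomb[OF opU finite_basis_set hol(1) that])
  have d2: "deriv (deriv (X E)) x = (\<Sum>k\<in>basis_set l. poly (p k) E * deriv (deriv (?e k)) x)" if "x \<in> U" for E x
    using deriv_eq_on_open[OF opU d1 that] deriv_lincomb[OF opU finite_basis_set hol(2) that, where c = "\<lambda>k. poly (p k) E"] by simp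
  have c: "continuous_on (UNIV \<times> U) (\<lambda>y. \<Sum>k\<in>basis_set l. poly (p k) (fst y) * f k (snd y))"
    if "\<And>k. k \<in> basis_set l \<Longrightarrow> f k holomorphic_on U" for f
    by (intro continuous_intros continuous_on_poly continuous_on_compose2[OF holomorphic_on_imp_continuous_on[OF that]]) auto
  show "continuous_on (UNIV \<times> U) (\<lambda>(E, x). Xi \<tau> l x E)"
    using c[OF hol(1)] by (simp add: p xi_lin_def split_beta)
  show "continuous_on (UNIV \<times> U) (\<lambda>(E, x). deriv (X E) x)"
    by (rule continuous_on_eq[OF c[OF hol(2)]]) (auto simp: d1)
  show "continuous_on (UNIV \<times> U) (\<lambda>(E, x). deriv (deriv (X E)) x)"
    by (rule continuous_on_eq[OF c[OF hol(3)]]) (auto simp: d2)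
qed

lemma base_point: "1/4 + \<tau>/4 \<in> U"
proof -
  have "1/4 + \<tau>/4 \<in> upper \<tau>" using \<tau> by (simp add: upper_def)
  then show ?thesis using upper_not_poles[OF \<tau>] by blast
qed

text \<open>The x-derivative of this expression is Xi/2 times the third-order equation.\<close>

lemma Qf_eq:
  assumes x: "x \<in> U"
  shows "(Xi \<tau> l x E)\<^sup>2 * (E - u x) + 1/2 * Xi \<tau> l x E * deriv (deriv (X E)) x - 1/4 * (deriv (X E) x)\<^sup>2 = Qf \<tau> l E"
proof -
  let ?Q = "\<lambda>x. (Xi \<tau> l x E)\<^sup>2 * (E - u x) + 1/2 * Xi \<tau> l x E * deriv (deriv (X E)) x - 1/4 * (deriv (X E) x)\<^sup>2"
  have "?Q x = ?Q (1/4 + \<tau>/4)"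
  proof (rule deriv_zero_constant[OF opU connected_not_poles _ x base_point])
    fix t assume t: "t \<in> U"
    have d0: "(X E has_field_derivative deriv (X E) t) (at t)" by (rule holomorphic_has_deriv[OF holomorphic_Xi opU t])
    have d1: "(deriv (X E) has_field_derivative deriv (deriv (X E)) t) (at t)"
      by (rule holomorphic_has_deriv[OF holomorphic_deriv[OF holomorphic_Xi opU] opU t])
    have d2: "(deriv (deriv (X E)) has_field_derivative deriv (deriv (deriv (X E))) t) (at t)"
      by (rule holomorphic_has_deriv[OF holomorphic_deriv[OF holomorphic_deriv[OF holomorphic_Xi opU] opU] opU t])
    have du: "(u has_field_derivative deriv u t) (at t)" by (rule holomorphic_has_deriv[OF holomorphic_pot[OF \<tau>] opU t])
    have d: "(?Q has_field_derivative 2 * X E t * deriv (X E) t * (E - u t) - (X E t)\<^sup>2 * deriv u t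
        + 1/2 * (deriv (X E) t * deriv (deriv (X E)) t + X E t * deriv (deriv (deriv (X E))) t)
        - 1/2 * deriv (X E) t * deriv (deriv (X E)) t) (at t)"
      by (rule derivative_eq_intros d0 d1 d2 du refl)+ (simp add: algebra_simps)
    have e: "2 * X E t * deriv (X E) t * (E - u t) - (X E t)\<^sup>2 * deriv u t
        + 1/2 * (deriv (X E) t * deriv (deriv (X E)) t + X E t * deriv (deriv (deriv (X E))) t)
        - 1/2 * deriv (X E) t * deriv (deriv (X E)) t = 1/2 * X E t * (third_op u (X E) t + 4 * E * deriv (X E) t)"
      by (simp add: third_op_def power2_eq_square field_simps)
    show "(?Q has_field_derivative 0) (at t)" using d unfolding e Xi_third_order[OF t] mult_zero_right .
  qed
  also have "\<dots> = Qf \<tau> l E" unfolding Qf_def Let_def by (simp add: numeral_2_eq_2)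
  finally show ?thesis .
qed

lemma continuous_Qf: "continuous_on UNIV (Qf \<tau> l)"
proof -
  let ?x = "1/4 + \<tau>/4"
  have c: "continuous_on UNIV (\<lambda>E. f E ?x)" if "continuous_on (UNIV \<times> U) (\<lambda>(E, x). f E x)" for f :: "complex \<Rightarrow> complex \<Rightarrow> complex"
  proof -
    have "continuous_on UNIV (\<lambda>E. (\<lambda>(E, x). f E x) (E, ?x))"
      by (rule continuous_on_compose2[OF that]) (use base_point in \<open>auto intro!: continuous_intros\<close>)
    then show ?thesis by simp
  qed
  have "Qf \<tau> l = (\<lambda>E. (Xi \<tau> l ?x E)\<^sup>2 * (E - u ?x) + 1/2 * Xi \<tau> l ?x E * deriv (deriv (X E)) ?x - 1/4 * (deriv (X E) ?x)\<^sup>2)"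
    using Qf_eq[OF base_point] by auto
  then show ?thesis
    by (simp only:) (intro continuous_intros c[OF continuous_Xi(1)] c[OF continuous_Xi(2)] c[OF continuous_Xi(3)])
qed

lemma Xi_op_deriv:
  assumes S: "open S" "S \<subseteq> U" and y: "ode_sol (\<lambda>x. u x - E) S y" and x: "x \<in> S"
  shows "(Xi_op \<tau> l E y has_field_derivative
     1/2 * deriv (X E) x * deriv y x + (Xi \<tau> l x E * (u x - E) - 1/2 * deriv (deriv (X E)) x) * y x) (at x)"
proof -
  have t: "x \<in> U" using S x by blast
  have d0: "(X E has_field_derivative deriv (X E) x) (at x)" by (rule holomorphic_has_deriv[OF holomorphic_Xi opU t])
  have d1: "(deriv (X E) has_field_derivative deriv (deriv (X E)) x) (at x)"
    by (rule holomorphic_has_deriv[OF holomorphic_deriv[OF holomorphic_Xi opU] opU t])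
  show ?thesis unfolding Xi_op_def[abs_def]
    by (rule derivative_eq_intros d0 d1 ode_solD[OF y S(1) x] refl)+ (simp add: algebra_simps)
qed

text \<open>The third-order equation for Xi is what makes the first-order operator map solutions to
  solutions: it replaces Xi''' in the second derivative of the image.\<close>

lemma Xi_op_sol:
  assumes S: "open S" "S \<subseteq> U" and y: "ode_sol (\<lambda>x. u x - E) S y"
  shows "ode_sol (\<lambda>x. u x - E) S (Xi_op \<tau> l E y)"
proof (rule ode_solI[OF S(1) Xi_op_deriv[OF S y]])
  fix x assume x: "x \<in> S"
  have t: "x \<in> U" using S x by blast
  have d0: "(X E has_field_derivative deriv (X E) x) (at x)" by (rule holomorphic_has_deriv[OF holomorphic_Xi opU t])
  have d1: "(deriv (X E) has_field_derivative deriv (deriv (X E)) x) (at x)"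
    by (rule holomorphic_has_deriv[OF holomorphic_deriv[OF holomorphic_Xi opU] opU t])
  have d2: "(deriv (deriv (X E)) has_field_derivative deriv (deriv (deriv (X E))) x) (at x)"
    by (rule holomorphic_has_deriv[OF holomorphic_deriv[OF holomorphic_deriv[OF holomorphic_Xi opU] opU] opU t])
  have du: "(u has_field_derivative deriv u x) (at x)" by (rule holomorphic_has_deriv[OF holomorphic_pot[OF \<tau>] opU t])
  have 0: "deriv (deriv (deriv (X E))) x = 4 * (u x - E) * deriv (X E) x + 2 * deriv u x * X E x"
    using Xi_third_order[OF t, of E] by (simp add: third_op_def algebra_simps)
  have d: "((\<lambda>x. 1/2 * deriv (X E) x * deriv y x + (X E x * (u x - E) - 1/2 * deriv (deriv (X E)) x) * y x) has_field_derivative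
    1/2 * (deriv (deriv (X E)) x * deriv y x + deriv (X E) x * ((u x - E) * y x))
      + ((deriv (X E) x * (u x - E) + X E x * deriv u x - 1/2 * deriv (deriv (deriv (X E))) x) * y x
      + (X E x * (u x - E) - 1/2 * deriv (deriv (X E)) x) * deriv y x)) (at x)"
    by (rule derivative_eq_intros d0 d1 d2 du ode_solD[OF y S(1) x] refl)+ (simp add: field_simps)
  have e: "1/2 * (deriv (deriv (X E)) x * deriv y x + deriv (X E) x * ((u x - E) * y x))
      + ((deriv (X E) x * (u x - E) + X E x * deriv u x - 1/2 * deriv (deriv (deriv (X E))) x) * y x
      + (X E x * (u x - E) - 1/2 * deriv (deriv (X E)) x) * deriv y x) = (u x - E) * Xi_op \<tau> l E y x"
  proof -
    have ring: "h * (b * y' + a * (v * z)) + ((a * v + X * w - h * (4 * v * a + 2 * w * X)) * z + (X * v - h * b) * y') = v * (X * y' - h * a * z)"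
      if "2 * h = 1" for h b y' a v z X w :: complex using that by algebra
    show ?thesis unfolding 0 Xi_op_def by (rule ring) simp
  qed
  show "((\<lambda>x. 1/2 * deriv (X E) x * deriv y x + (X E x * (u x - E) - 1/2 * deriv (deriv (X E)) x) * y x)
      has_field_derivative (u x - E) * Xi_op \<tau> l E y x) (at x)" using d unfolding e .
qed

lemma Xi_op_square:
  assumes S: "open S" "S \<subseteq> U" and y: "ode_sol (\<lambda>x. u x - E) S y" and x: "x \<in> S"
  shows "Xi_op \<tau> l E (Xi_op \<tau> l E y) x = - Qf \<tau> l E * y x"
proof -
  have t: "x \<in> U" using S x by blast
  have "Xi_op \<tau> l E (Xi_op \<tau> l E y) x = Xi \<tau> l x E * (1/2 * deriv (X E) x * deriv y x + (Xi \<tau> l x E * (u x - E) - 1/2 * deriv (deriv (X E)) x) * y x)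
      - 1/2 * deriv (X E) x * (Xi \<tau> l x E * deriv y x - 1/2 * deriv (X E) x * y x)"
    unfolding Xi_op_def[of _ _ _ "Xi_op \<tau> l E y"] DERIV_imp_deriv[OF Xi_op_deriv[OF S y x]] by (simp add: Xi_op_def)
  also have "\<dots> = - Qf \<tau> l E * y x"
    unfolding Qf_eq[OF t, symmetric] by (simp add: power2_eq_square algebra_simps)
  finally show ?thesis .
qed

subsection \<open>Floquet multipliers\<close>

private abbreviation (input) "V \<equiv> upper \<tau>"
private abbreviation (input) "fmul \<equiv> multiplier \<tau> l"
private abbreviation (input) "fsol \<equiv> floquet_sol \<tau> l"

private lemma V: "open V" "connected V" "V \<subseteq> - poles \<tau> l" "V \<noteq> {}"
proof -
  have "\<tau>/4 \<in> V" using \<tau> by (simp add: upper_def)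
  then show "V \<noteq> {}" by blast
qed (simp_all add: upper_facts convex_connected[OF upper_facts(2)] upper_not_poles[OF \<tau>])

lemma holomorphic_pot_upper: "u holomorphic_on V"
  by (rule holomorphic_on_subset[OF holomorphic_pot[OF \<tau>] V(3)])

context
  fixes a :: complex
  assumes a: "a \<in> upper \<tau>"
begin

private abbreviation (input) "W \<equiv> {z. a + z \<in> upper \<tau>}"

private lemma star: "star_zero W" "convex W"
proof -
  have "W = {z. Im z > - Im a} \<inter> {z. Im z < Im \<tau> / 2 - Im a}" by (auto simp: upper_def)
  then have "open W" and c: "convex W"
    by (simp_all only: open_Int convex_Int open_halfspace_Im_gt open_halfspace_Im_lt convex_halfspace_Im_gt convex_halfspace_Im_lt)
  moreover have "of_real r * z \<in> W" if "z \<in> W" "r \<in> {0..1}" for z r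
    using convexD_alt[OF c, of 0 z r] that a by (simp add: scaleR_conv_of_real)
  ultimately show "star_zero W" "convex W" using a by (auto simp: star_zero_def)
qed

private lemma pot_translate_holomorphic: "(\<lambda>z. u (a + z) - E) holomorphic_on W"
proof -
  have "(u \<circ> (\<lambda>z. a + z)) holomorphic_on W"
    by (rule holomorphic_on_compose_gen[OF _ holomorphic_pot_upper]) (auto intro!: holomorphic_intros)
  then show ?thesis by (auto simp: o_def intro!: holomorphic_intros)
qed

lemma fund_deriv:
  assumes "x \<in> V" shows "(fund \<tau> l a j E has_field_derivative frob' j (\<lambda>z. u (a + z) - E) (x - a)) (at x)"
proof -
  have "x - a \<in> W" using assms by simp
  from DERIV_shift_minus[OF frob_deriv[OF star(1) pot_translate_holomorphic this, of j E]] show ?thesis by (simp add: fund_def[abs_def])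
qed

lemma fund_sol:
  assumes j: "j \<le> 1" shows "ode_sol (\<lambda>x. u x - E) V (fund \<tau> l a j E)"
proof (rule ode_solI[OF V(1) fund_deriv])
  fix x assume x: "x \<in> V"
  then have "x - a \<in> W" by simp
  have "((\<lambda>x. frob' j (\<lambda>z. u (a + z) - E) (x - a)) has_field_derivative
      (of_nat (j * (j - 1)) / (x - a)\<^sup>2 + (u (a + (x - a)) - E)) * frob j (\<lambda>z. u (a + z) - E) (x - a)) (at x)"
    by (rule DERIV_shift_minus[OF frob'_deriv[OF star(1) pot_translate_holomorphic \<open>x - a \<in> W\<close>]]) (use j in auto)
  moreover have "of_nat (j * (j - 1)) = (0::complex)" using j by (cases j) auto
  ultimately show "((\<lambda>x. frob' j (\<lambda>z. u (a + z) - E) (x - a)) has_field_derivative (u x - E) * fund \<tau> l a j E x) (at x)"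
    by (simp only: fund_def div_0 add_0_left add_diff_cancel_left' add_diff_eq diff_add_cancel)
qed

lemma fund_init:
  "fund \<tau> l a 0 E a = 1" "deriv (fund \<tau> l a 0 E) a = 0" "fund \<tau> l a 1 E a = 0" "deriv (fund \<tau> l a 1 E) a = 1"
  using DERIV_imp_deriv[OF fund_deriv[OF a]]
  by (simp_all add: fund_def frob_def frob'_def volterra_sum_0 ray_integral_def)

lemma continuous_fund: "continuous_on (UNIV \<times> V) (\<lambda>(E, x). fund \<tau> l a j E x)"
proof -
  have D: "ray_closed ((UNIV::complex set) \<times> W)" "open ((UNIV::complex set) \<times> W)"
    using star(1) by (auto simp: star_zero_def ray_closed_def open_Times)
  have q: "continuous_on ((UNIV::complex set) \<times> W) (\<lambda>(E, z). u (a + z) - E)"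
    unfolding split_beta
    by (intro continuous_intros continuous_on_compose2[OF holomorphic_on_imp_continuous_on[OF holomorphic_pot_upper]]) auto
  have "continuous_on (UNIV \<times> V) (\<lambda>y. (\<lambda>(E, z). volterra_sum (2 * j) (\<lambda>z. u (a + z) - E) z) (fst y, snd y - a))"
    by (rule continuous_on_compose2[OF continuous_on_volterra_sum[OF D q]]) (auto intro!: continuous_intros)
  then show ?thesis unfolding fund_def frob_def split_beta by (intro continuous_intros) simp
qed

lemma ode_sol_zero:
  assumes y: "ode_sol (\<lambda>x. u x - E) V y" and 0: "y a = 0" "deriv y a = 0" and x: "x \<in> V"
  shows "y x = 0"
proof -
  let ?T = "fund \<tau> l a 0 E"
  have T: "ode_sol (\<lambda>x. u x - E) V ?T" by (rule fund_sol) simp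
  have W: "wronskian ?T y z = 0" if "z \<in> V" for z
    using wronskian_const[OF T y V(1,2) that a] by (simp add: wronskian_def 0)
  have "?T a \<noteq> 0" by (simp add: fund_init)
  from proportional_if_wronskian_0[OF _ _ V(1,2) W a this] T y
  obtain k where k: "\<And>x. x \<in> V \<Longrightarrow> y x = k * ?T x" by (auto simp: ode_sol_def)
  have "k = 0" using k[OF a] 0 by (simp add: fund_init)
  then show ?thesis using k[OF x] by simp
qed

lemma floquet_sol_init:
  "fsol a E s a = Xi \<tau> l a E" "deriv (fsol a E s) a = 1/2 * deriv (X E) a + s"
proof -
  show "fsol a E s a = Xi \<tau> l a E"
    by (simp only: floquet_sol_def fund_init mult_zero_right mult_1_right add_0_right)
  have "(fsol a E s has_field_derivative
     Xi \<tau> l a E * deriv (fund \<tau> l a 0 E) a + (1/2 * deriv (X E) a + s) * deriv (fund \<tau> l a 1 E) a) (at a)"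
    unfolding floquet_sol_def[abs_def]
    by (intro DERIV_add DERIV_cmult ode_solD(1)[OF fund_sol V(1) a]) simp_all
  from DERIV_imp_deriv[OF this] show "deriv (fsol a E s) a = 1/2 * deriv (X E) a + s"
    by (simp only: fund_init mult_zero_right mult_1_right add_0_left)
qed

lemma floquet_sol_ode: "ode_sol (\<lambda>x. u x - E) V (fsol a E s)"
  unfolding floquet_sol_def[abs_def] by (intro ode_sol_lincomb fund_sol V) simp_all

text \<open>The defect (A - s) Y, with A the operator \<open>Xi_op\<close>, is itself a solution.
  Its value at a is zero by the choice of initial data and its slope is -Q - s^2 = 0, so it vanishes
  identically.\<close>

lemma floquet_sol_floquet:
  assumes s: "s\<^sup>2 = - Qf \<tau> l E" shows "floquet \<tau> l E s (fsol a E s)"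
proof -
  let ?Y = "fsol a E s"
  let ?z = "\<lambda>x. 1 * Xi_op \<tau> l E ?Y x + (- s) * ?Y x"
  have Y: "ode_sol (\<lambda>x. u x - E) V ?Y" by (rule floquet_sol_ode)
  have AY: "ode_sol (\<lambda>x. u x - E) V (Xi_op \<tau> l E ?Y)" by (rule Xi_op_sol[OF V(1,3) Y])
  have z: "ode_sol (\<lambda>x. u x - E) V ?z" by (rule ode_sol_lincomb[OF AY Y V(1)])
  have z0: "?z a = 0" by (simp add: Xi_op_def floquet_sol_init algebra_simps)
  have dz: "(?z has_field_derivative 1 * (1/2 * deriv (X E) a * deriv ?Y a + (Xi \<tau> l a E * (u a - E) - 1/2 * deriv (deriv (X E)) a) * ?Y a) + (- s) * deriv ?Y a) (at a)"
    by (intro DERIV_add DERIV_cmult Xi_op_deriv[OF V(1,3) Y a] ode_solD(1)[OF Y V(1) a])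
  have "1 * (1/2 * deriv (X E) a * deriv ?Y a + (Xi \<tau> l a E * (u a - E) - 1/2 * deriv (deriv (X E)) a) * ?Y a) + (- s) * deriv ?Y a
     = - Qf \<tau> l E - s\<^sup>2"
    using a V(3) unfolding floquet_sol_init by (subst Qf_eq[symmetric, of a]) (auto simp: power2_eq_square algebra_simps)
  then have dz0: "deriv ?z a = 0" using DERIV_imp_deriv[OF dz] s by simp
  have "?z x = 0" if "x \<in> V" for x by (rule ode_sol_zero[OF z z0 dz0 that])
  then show ?thesis using Y by (simp add: floquet_def)
qed

end

lemma floquet_first_order:
  "floquet \<tau> l E s y \<Longrightarrow> x \<in> V \<Longrightarrow> Xi \<tau> l x E * deriv y x = (1/2 * deriv (X E) x + s) * y x"
  by (simp add: floquet_def Xi_op_def algebra_simps)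

text \<open>Both functions satisfy the same first-order equation, so their Wronskian vanishes
  wherever Xi does not; being constant, it vanishes everywhere. This covers s = 0 as well.\<close>

lemma floquet_proportional:
  assumes y: "floquet \<tau> l E s y" and z: "floquet \<tau> l E s z" and a: "a \<in> V" "y a \<noteq> 0"
  shows "\<exists>k. \<forall>x\<in>V. z x = k * y x"
proof -
  have ys: "ode_sol (\<lambda>x. u x - E) V y" and zs: "ode_sol (\<lambda>x. u x - E) V z" using y z by (auto simp: floquet_def)
  obtain b where b: "b \<in> V" "Xi \<tau> l b E \<noteq> 0" using Xi_nonzero[OF V(1) V(4) V(3)] by blast
  have "Xi \<tau> l b E * wronskian y z b = y b * (Xi \<tau> l b E * deriv z b) - (Xi \<tau> l b E * deriv y b) * z b"
    by (simp add: wronskian_def algebra_simps)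
  also have "\<dots> = 0" unfolding floquet_first_order[OF y b(1)] floquet_first_order[OF z b(1)] by (simp add: algebra_simps)
  finally have "wronskian y z b = 0" using b by simp
  then have "wronskian y z x = 0" if "x \<in> V" for x using wronskian_const[OF ys zs V(1,2) that b(1)] by simp
  then show ?thesis using proportional_if_wronskian_0[of y V z a] ys zs V a by (auto simp: ode_sol_def)
qed

lemma floquet_shift:
  assumes y: "floquet \<tau> l E s y" shows "floquet \<tau> l E s (\<lambda>x. y (x + 1))"
proof -
  have ys: "ode_sol (\<lambda>x. u x - E) V y" using y by (simp add: floquet_def)
  have eq: "{x. x + 1 \<in> V} = V" by (simp add: upper_facts)
  have t: "ode_sol (\<lambda>x. u (x + 1) - E) V (\<lambda>x. y (x + 1))" using ode_sol_translate[OF ys V(1), of 1] unfolding eq .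
  have ode: "ode_sol (\<lambda>x. u x - E) V (\<lambda>x. y (x + 1))"
    by (rule ode_sol_cong[OF t V(1)]) (use pot_shift[OF \<tau>] V(3) in auto)
  have "Xi_op \<tau> l E (\<lambda>x. y (x + 1)) x = s * y (x + 1)" if x: "x \<in> V" for x
  proof -
    have x1: "x + 1 \<in> V" using x by (simp add: upper_facts)
    have xU: "x \<in> - poles \<tau> l" using x V(3) by blast
    have d: "deriv (\<lambda>x. y (x + 1)) x = deriv y (x + 1)"
      using ode_solD(1)[OF ys V(1) x1] by (intro DERIV_imp_deriv) (simp add: DERIV_shift)
    have "Xi_op \<tau> l E (\<lambda>x. y (x + 1)) x = Xi_op \<tau> l E y (x + 1)"
      unfolding Xi_op_def d using Xi_shift[OF xU] deriv_Xi_shift[OF xU] by simp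
    then show ?thesis using y x1 by (simp add: floquet_def)
  qed
  then show ?thesis using ode by (simp add: floquet_def)
qed

lemma multiplier_eq:
  assumes s: "s\<^sup>2 = - Qf \<tau> l E" and y: "floquet \<tau> l E s y" and x: "x \<in> V"
  shows "y (x + 1) = fmul E s * y x"
proof -
  obtain a where a: "a \<in> V" "Xi \<tau> l a E \<noteq> 0" using Xi_nonzero[OF V(1) V(4) V(3)] by blast
  let ?Y = "fsol a E s"
  have Y: "floquet \<tau> l E s ?Y" by (rule floquet_sol_floquet[OF a(1) s])
  have Ya: "?Y a \<noteq> 0" using a by (simp add: floquet_sol_init)
  obtain m where m: "\<And>x. x \<in> V \<Longrightarrow> ?Y (x + 1) = m * ?Y x"
    using floquet_proportional[OF Y floquet_shift[OF Y] a(1) Ya] by blast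
  have "\<forall>y. floquet \<tau> l E s y \<longrightarrow> (\<forall>x\<in>V. y (x + 1) = m * y x)"
  proof (intro allI impI ballI)
    fix y x assume "floquet \<tau> l E s y" "x \<in> V"
    then obtain k where k: "\<And>x. x \<in> V \<Longrightarrow> y x = k * ?Y x" using floquet_proportional[OF Y _ a(1) Ya] by blast
    have "x + 1 \<in> V" using \<open>x \<in> V\<close> by (simp add: upper_facts)
    then show "y (x + 1) = m * y x" using k m \<open>x \<in> V\<close> by simp
  qed
  then have "\<forall>y. floquet \<tau> l E s y \<longrightarrow> (\<forall>x\<in>V. y (x + 1) = fmul E s * y x)"
    unfolding multiplier_def by (rule someI)
  then show ?thesis using y x by blast
qed

lemma deriv_multiplier:
  assumes s: "s\<^sup>2 = - Qf \<tau> l E" and y: "floquet \<tau> l E s y" and x: "x \<in> V"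
  shows "deriv y (x + 1) = fmul E s * deriv y x"
proof -
  have ys: "ode_sol (\<lambda>x. u x - E) V y" using y by (simp add: floquet_def)
  have x1: "x + 1 \<in> V" using x by (simp add: upper_facts)
  have "((\<lambda>x. y (x + 1)) has_field_derivative deriv y (x + 1)) (at x)"
    using ode_solD(1)[OF ys V(1) x1] by (simp add: DERIV_shift)
  then have "((\<lambda>x. fmul E s * y x) has_field_derivative deriv y (x + 1)) (at x)"
    by (rule has_field_derivative_transform_within_open[OF _ V(1) x]) (use multiplier_eq[OF s y] in auto)
  moreover have "((\<lambda>x. fmul E s * y x) has_field_derivative fmul E s * deriv y x) (at x)"
    by (intro DERIV_cmult ode_solD(1)[OF ys V(1) x])
  ultimately show ?thesis by (rule DERIV_unique)
qed

lemma multiplier_nonzero: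
  assumes s: "s\<^sup>2 = - Qf \<tau> l E" shows "fmul E s \<noteq> 0"
proof
  assume 0: "fmul E s = 0"
  obtain a where a: "a \<in> V" "Xi \<tau> l a E \<noteq> 0" using Xi_nonzero[OF V(1) V(4) V(3)] by blast
  have "a - 1 \<in> V" using a(1) upper_facts(4)[of "a - 1" \<tau>] by simp
  from multiplier_eq[OF s floquet_sol_floquet[OF a(1) s] this] 0 a show False by (simp add: floquet_sol_init)
qed

lemma wronskian_multiplier:
  assumes "s\<^sup>2 = - Qf \<tau> l E" "floquet \<tau> l E s y" "s'\<^sup>2 = - Qf \<tau> l E'" "floquet \<tau> l E' s' z" "x \<in> V"
  shows "wronskian y z (x + 1) = fmul E s * fmul E' s' * wronskian y z x"
  unfolding wronskian_def multiplier_eq[OF assms(1,2,5)] multiplier_eq[OF assms(3,4,5)]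
    deriv_multiplier[OF assms(1,2,5)] deriv_multiplier[OF assms(3,4,5)] by (simp add: algebra_simps)

text \<open>The Wronskian of the solutions for s and -s is the nonzero constant -2 s Xi(a), and a
  period multiplies it by the product of the two multipliers.\<close>

lemma multiplier_inverse:
  assumes s: "s\<^sup>2 = - Qf \<tau> l E" and s0: "s \<noteq> 0"
  shows "fmul E s * fmul E (- s) = 1"
proof -
  obtain a where a: "a \<in> V" "Xi \<tau> l a E \<noteq> 0" using Xi_nonzero[OF V(1) V(4) V(3)] by blast
  let ?Y = "fsol a E s" and ?Z = "fsol a E (- s)"
  have s': "(- s)\<^sup>2 = - Qf \<tau> l E" using s by simp
  have Y: "floquet \<tau> l E s ?Y" and Z: "floquet \<tau> l E (- s) ?Z"
    using floquet_sol_floquet[OF a(1) s] floquet_sol_floquet[OF a(1) s'] by auto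
  have a1: "a + 1 \<in> V" using a(1) by (simp add: upper_facts)
  have "wronskian ?Y ?Z a = - 2 * s * Xi \<tau> l a E"
    using a(1) by (simp add: wronskian_def floquet_sol_init algebra_simps)
  then have nz: "wronskian ?Y ?Z a \<noteq> 0" using s0 a by simp
  have "wronskian ?Y ?Z (a + 1) = wronskian ?Y ?Z a"
    by (rule wronskian_const[OF floquet_sol_ode[OF a(1)] floquet_sol_ode[OF a(1)] V(1,2) a1 a(1)])
  then show ?thesis using wronskian_multiplier[OF s Y s' Z a(1)] nz by simp
qed

text \<open>The logarithmic derivatives Xi'/(2 Xi) + s/Xi and Xi'/(2 Xi) - s/Xi add up to that of
  Xi; the constant is found at a.\<close>

lemma floquet_product:
  assumes a: "a \<in> V" "Xi \<tau> l a E \<noteq> 0" and s: "s\<^sup>2 = - Qf \<tau> l E" and x: "x \<in> V"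
  shows "fsol a E s x * fsol a E (- s) x = Xi \<tau> l a E * Xi \<tau> l x E"
proof -
  let ?Y = "fsol a E s" and ?Z = "fsol a E (- s)"
  have s': "(- s)\<^sup>2 = - Qf \<tau> l E" using s by simp
  have Y: "floquet \<tau> l E s ?Y" and Z: "floquet \<tau> l E (- s) ?Z"
    using floquet_sol_floquet[OF a(1) s] floquet_sol_floquet[OF a(1) s'] by auto
  have Xh: "X E holomorphic_on V" by (rule holomorphic_on_subset[OF holomorphic_Xi V(3)])
  have Yh: "?Y holomorphic_on V" "?Z holomorphic_on V" using Y Z by (auto simp: floquet_def ode_sol_def)
  have "wronskian (X E) (\<lambda>x. ?Y x * ?Z x) t = 0" if t: "t \<in> V" for t
  proof -
    have "((\<lambda>x. ?Y x * ?Z x) has_field_derivative deriv ?Y t * ?Z t + deriv ?Z t * ?Y t) (at t)"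
      by (intro DERIV_mult holomorphic_has_deriv[OF _ V(1) t] Yh)
    then have d: "deriv (\<lambda>x. ?Y x * ?Z x) t = deriv ?Y t * ?Z t + deriv ?Z t * ?Y t" by (rule DERIV_imp_deriv)
    have "wronskian (X E) (\<lambda>x. ?Y x * ?Z x) t = (Xi \<tau> l t E * deriv ?Y t) * ?Z t + (Xi \<tau> l t E * deriv ?Z t) * ?Y t - deriv (X E) t * (?Y t * ?Z t)"
      unfolding wronskian_def d by (simp add: algebra_simps)
    also have "\<dots> = 0" unfolding floquet_first_order[OF Y t] floquet_first_order[OF Z t] by (simp add: algebra_simps)
    finally show ?thesis .
  qed
  from proportional_if_wronskian_0[OF Xh _ V(1,2) this a]
  obtain k where k: "\<And>x. x \<in> V \<Longrightarrow> ?Y x * ?Z x = k * Xi \<tau> l x E" using Yh by (auto intro: holomorphic_intros)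
  have "Xi \<tau> l a E * Xi \<tau> l a E = k * Xi \<tau> l a E" using k[OF a(1)] a(1) by (simp add: floquet_sol_init)
  then have "k = Xi \<tau> l a E" using a by simp
  then show ?thesis using k[OF x] by simp
qed

text \<open>Comparing the Floquet solutions for two energies: the Wronskian is multiplied by the product of the
  multipliers along a period, and its derivative is \<open>(e - E)\<close> times the product of the solutions.\<close>

lemma multiplier_difference:
  assumes a: "a \<in> V" and s: "s\<^sup>2 = - Qf \<tau> l e" and s1: "s1\<^sup>2 = - Qf \<tau> l E"
  shows "(fmul e s * fmul E s1 - 1) *
      (Xi \<tau> l a e * (1/2 * deriv (X E) a + s1) - (1/2 * deriv (X e) a + s) * Xi \<tau> l a E) =
    (e - E) * contour_integral (linepath a (a + 1)) (\<lambda>x. fsol a e s x * fsol a E s1 x)"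
proof -
  let ?Y = "fsol a e s" and ?Z = "fsol a E s1"
  have Y: "floquet \<tau> l e s ?Y" and Z: "floquet \<tau> l E s1 ?Z"
    using floquet_sol_floquet[OF a s] floquet_sol_floquet[OF a s1] by auto
  have ys: "ode_sol (\<lambda>x. u x - e) V ?Y" and zs: "ode_sol (\<lambda>x. u x - E) V ?Z" using floquet_sol_ode[OF a] by auto
  have a1: "a + 1 \<in> V" using a by (simp add: upper_facts)
  have seg: "closed_segment a (a + 1) \<subseteq> V" using upper_facts(2) a a1 by (simp add: closed_segment_subset)
  have d: "(wronskian ?Y ?Z has_field_derivative (e - E) * (?Y x * ?Z x)) (at x within V)" if "x \<in> V" for x
    using wronskian_deriv[OF ys zs V(1) that] by (auto intro: has_field_derivative_at_within simp: algebra_simps)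
  have "((\<lambda>x. (e - E) * (?Y x * ?Z x)) has_contour_integral (wronskian ?Y ?Z (a + 1) - wronskian ?Y ?Z a)) (linepath a (a + 1))"
    using contour_integral_primitive[of V "wronskian ?Y ?Z" "\<lambda>x. (e - E) * (?Y x * ?Z x)" "linepath a (a+1)"] d seg by simp
  then have "contour_integral (linepath a (a + 1)) (\<lambda>x. (e - E) * (?Y x * ?Z x)) = wronskian ?Y ?Z (a + 1) - wronskian ?Y ?Z a"
    by (rule contour_integral_unique)
  moreover have "(\<lambda>x. ?Y x * ?Z x) contour_integrable_on (linepath a (a + 1))"
    using ys zs seg by (intro contour_integrable_continuous_linepath holomorphic_on_imp_continuous_on holomorphic_on_subset[OF _ seg] holomorphic_on_mult)
      (auto simp: ode_sol_def)
  ultimately have "(e - E) * contour_integral (linepath a (a + 1)) (\<lambda>x. ?Y x * ?Z x) = wronskian ?Y ?Z (a + 1) - wronskian ?Y ?Z a"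
    by (simp add: contour_integral_lmul)
  then have "(e - E) * contour_integral (linepath a (a + 1)) (\<lambda>x. ?Y x * ?Z x) =
      (fmul e s * fmul E s1 - 1) * wronskian ?Y ?Z a"
    unfolding wronskian_multiplier[OF s Y s1 Z a] by (simp only: left_diff_distrib mult_1_left)
  then show ?thesis unfolding wronskian_def floquet_sol_init[OF a] by (rule sym)
qed

lemma Q1_eq: "a \<in> V \<Longrightarrow> contour_integral (linepath a (a + 1)) (X E) = Q1 \<tau> l E"
proof -
  assume a: "a \<in> V"
  have b: "\<tau>/4 \<in> V" using \<tau> by (simp add: upper_def)
  have Xh: "X E holomorphic_on V" by (rule holomorphic_on_subset[OF holomorphic_Xi V(3)])
  obtain G where G: "\<And>a b. a \<in> V \<Longrightarrow> b \<in> V \<Longrightarrow> (X E has_contour_integral (G b - G a)) (linepath a b)"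
    "\<And>a b. a \<in> V \<Longrightarrow> b \<in> V \<Longrightarrow> G (a + 1) - G a = G (b + 1) - G b"
    using periodic_integral_shift[OF upper_facts(1,2) _ Xh] Xi_shift[of _ 1] V(3) upper_facts(4)
    by (metis lattice_basic(2) subsetD)
  have "\<tau>/4 + 1 \<in> V" "a + 1 \<in> V" using a b by (auto simp: upper_facts)
  then have "contour_integral (linepath a (a + 1)) (X E) = contour_integral (linepath (\<tau>/4) (\<tau>/4 + 1)) (X E)"
    using G(1)[OF a] G(1)[OF b] G(2)[OF a b] by (metis contour_integral_unique)
  then show ?thesis by (simp add: Q1_def add.commute)
qed

context
  fixes a E s1 :: complex
  assumes a: "a \<in> upper \<tau>"
begin

private abbreviation (input) "I e s \<equiv> contour_integral (linepath a (a + 1)) (\<lambda>x. fsol a e s x * fsol a E s1 x)"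

lemma tendsto_Xi:
  assumes "(e \<longlongrightarrow> E0) F" "b \<in> V"
  shows "((\<lambda>t. Xi \<tau> l b (e t)) \<longlongrightarrow> Xi \<tau> l b E0) F" "((\<lambda>t. deriv (X (e t)) b) \<longlongrightarrow> deriv (X E0) b) F"
    "((\<lambda>t. fund \<tau> l a j (e t) b) \<longlongrightarrow> fund \<tau> l a j E0 b) F"
proof -
  have c: "((\<lambda>t. f (e t) b) \<longlongrightarrow> f E0 b) F" if f: "continuous_on (UNIV \<times> V) (\<lambda>(E, x). f E x)" for f :: "complex \<Rightarrow> complex \<Rightarrow> complex"
  proof -
    have "continuous_on UNIV (\<lambda>E. (\<lambda>(E, x). f E x) (E, b))"
      by (rule continuous_on_compose2[OF f]) (use assms(2) in \<open>auto intro!: continuous_intros\<close>)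
    then have "isCont (\<lambda>E. f E b) E0" by (simp add: continuous_on_eq_continuous_at)
    then show ?thesis by (rule isCont_tendsto_compose[OF _ assms(1)])
  qed
  have sub: "UNIV \<times> V \<subseteq> UNIV \<times> - poles \<tau> l" using V(3) by auto
  show "((\<lambda>t. Xi \<tau> l b (e t)) \<longlongrightarrow> Xi \<tau> l b E0) F" by (rule c[OF continuous_on_subset[OF continuous_Xi(1) sub]])
  show "((\<lambda>t. deriv (X (e t)) b) \<longlongrightarrow> deriv (X E0) b) F" by (rule c[OF continuous_on_subset[OF continuous_Xi(2) sub]])
  show "((\<lambda>t. fund \<tau> l a j (e t) b) \<longlongrightarrow> fund \<tau> l a j E0 b) F" by (rule c[OF continuous_fund[OF a]])
qed

text \<open>The branch s enters linearly through the initial data, so the limit reduces to the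
  continuity in the energy of two integrals against \<open>fund\<close>.\<close>

lemma tendsto_floquet_integral:
  assumes e: "(e \<longlongrightarrow> E0) F" and s: "(s \<longlongrightarrow> s0) F"
  shows "((\<lambda>t. I (e t) (s t)) \<longlongrightarrow> I E0 s0) F"
proof -
  let ?J = "\<lambda>j e. integral {0..1} (\<lambda>r. fund \<tau> l a j e (a + of_real r) * fsol a E s1 (a + of_real r))"
  have ar: "a + of_real r \<in> V" for r using a by (simp add: upper_facts)
  have zs: "fsol a E s1 holomorphic_on V" using floquet_sol_ode[OF a] by (auto simp: ode_sol_def)
  have cz: "continuous_on {0..1} (\<lambda>r. fsol a E s1 (a + of_real r))"
    by (rule continuous_on_compose2[OF holomorphic_on_imp_continuous_on[OF zs]]) (use ar in \<open>auto intro!: continuous_intros\<close>)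
  have cf: "continuous_on (UNIV \<times> {0..1}) (\<lambda>y. fund \<tau> l a j (fst y) (a + of_real (snd y)))" for j
  proof -
    have "continuous_on (UNIV \<times> {0..1}) (\<lambda>y. (\<lambda>(E, x). fund \<tau> l a j E x) (fst y, a + of_real (snd y)))"
      by (rule continuous_on_compose2[OF continuous_fund[OF a]]) (use ar in \<open>auto intro!: continuous_intros\<close>)
    then show ?thesis by simp
  qed
  have cJ: "continuous_on UNIV (?J j)" for j
  proof -
    have "continuous_on (UNIV \<times> {0..1}) (\<lambda>y. fund \<tau> l a j (fst y) (a + of_real (snd y)) * fsol a E s1 (a + of_real (snd y)))"
      by (intro continuous_on_mult cf continuous_on_compose2[OF cz]) (auto intro!: continuous_intros)
    then have "continuous_on UNIV (\<lambda>e. integral (cbox 0 1) (\<lambda>r. fund \<tau> l a j e (a + of_real r) * fsol a E s1 (a + of_real r)))"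
      by (intro integral_continuous_on_param) (simp add: split_beta)
    then show ?thesis by simp
  qed
  have I: "I e s = Xi \<tau> l a e * ?J 0 e + (1/2 * deriv (X e) a + s) * ?J 1 e" for e s
  proof -
    have cfe: "continuous_on {0..1} (\<lambda>r. fund \<tau> l a j e (a + of_real r))" for j
    proof -
      have "continuous_on {0..1} (\<lambda>r. (\<lambda>y. fund \<tau> l a j (fst y) (a + of_real (snd y))) (e, r))"
        by (rule continuous_on_compose2[OF cf]) (auto intro!: continuous_intros)
      then show ?thesis by simp
    qed
    have int: "(\<lambda>r. fund \<tau> l a j e (a + of_real r) * fsol a E s1 (a + of_real r)) integrable_on {0..1}" for j
      by (intro integrable_continuous_real continuous_on_mult cfe cz)
    have lp: "linepath a (a + 1) r = a + of_real r" for r by (simp add: linepath_def algebra_simps scaleR_conv_of_real)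
    have "I e s = integral {0..1} (\<lambda>r. Xi \<tau> l a e * (fund \<tau> l a 0 e (a + of_real r) * fsol a E s1 (a + of_real r))
       + (1/2 * deriv (X e) a + s) * (fund \<tau> l a 1 e (a + of_real r) * fsol a E s1 (a + of_real r)))"
      unfolding contour_integral_integral lp by (simp add: floquet_sol_def[of _ _ _ e s] algebra_simps)
    also have "\<dots> = Xi \<tau> l a e * ?J 0 e + (1/2 * deriv (X e) a + s) * ?J 1 e"
      using int by (subst integral_add) (auto intro: integrable_on_mult_right simp: integral_mult_right)
    finally show ?thesis .
  qed
  have "((\<lambda>t. ?J j (e t)) \<longlongrightarrow> ?J j E0) F" for j
    using cJ[of j] e by (intro isCont_tendsto_compose[of E0 "?J j"]) (auto simp: continuous_on_eq_continuous_at)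
  then show ?thesis unfolding I by (intro tendsto_intros tendsto_Xi[OF e a] s)
qed

end

text \<open>The multiplier is Y(a + 1) / Xi(a). The value s0 = 0 is allowed, which gives continuity
  at the start of the path, where Q may vanish; the arbitrary filter serves both paths and
  sequences.\<close>

lemma tendsto_multiplier:
  assumes e: "(e \<longlongrightarrow> E) F" and s: "(s \<longlongrightarrow> s0) F" and es: "\<forall>\<^sub>F t in F. (s t)\<^sup>2 = - Qf \<tau> l (e t)" and s0: "s0\<^sup>2 = - Qf \<tau> l E"
  shows "((\<lambda>t. fmul (e t) (s t)) \<longlongrightarrow> fmul E s0) F"
proof -
  obtain a where a: "a \<in> V" "Xi \<tau> l a E \<noteq> 0" using Xi_nonzero[OF V(1) V(4) V(3)] by blast
  have a1: "a + 1 \<in> V" using a(1) by (simp add: upper_facts)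
  have Xa: "((\<lambda>t. Xi \<tau> l a (e t)) \<longlongrightarrow> Xi \<tau> l a E) F" by (rule tendsto_Xi(1)[OF a(1) e a(1)])
  have "((\<lambda>t. fsol a (e t) (s t) (a + 1) / Xi \<tau> l a (e t)) \<longlongrightarrow> fsol a E s0 (a + 1) / Xi \<tau> l a E) F"
    unfolding floquet_sol_def
    by (intro tendsto_intros Xa s a(2) tendsto_Xi(2)[OF a(1) e a(1)] tendsto_Xi(3)[OF a(1) e a1])
  moreover have "fsol a E s0 (a + 1) / Xi \<tau> l a E = fmul E s0"
    using multiplier_eq[OF s0 floquet_sol_floquet[OF a(1) s0] a(1)] a by (simp add: floquet_sol_init)
  moreover have "\<forall>\<^sub>F t in F. fsol a (e t) (s t) (a + 1) / Xi \<tau> l a (e t) = fmul (e t) (s t)"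
    using es tendsto_imp_eventually_ne[OF Xa a(2)]
  proof eventually_elim
    case (elim t)
    then show ?case using multiplier_eq[OF elim(1) floquet_sol_floquet[OF a(1) elim(1)] a(1)] a(1) by (simp add: floquet_sol_init)
  qed
  ultimately show ?thesis by (simp add: filterlim_cong[OF refl refl])
qed

text \<open>The comparison solution is taken for -s0: its multiplier is the reciprocal one, the
  Wronskian of the initial data tends to -2 s0 Xi(a), which is not zero, and by
  \<open>floquet_product\<close> the integral tends to Xi(a) Q1. With d the increment of the path
  parameter or of the energy, this is dm/dE = -m Q1 / (2s).\<close>

lemma multiplier_quotient:
  assumes e: "(e \<longlongrightarrow> E) F" and s: "(s \<longlongrightarrow> s0) F" and es: "\<forall>\<^sub>F t in F. (s t)\<^sup>2 = - Qf \<tau> l (e t)"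
    and s0: "s0\<^sup>2 = - Qf \<tau> l E" "s0 \<noteq> 0" and g: "((\<lambda>t. (e t - E) / d t) \<longlongrightarrow> g) F"
  shows "((\<lambda>t. (fmul (e t) (s t) / fmul E s0 - 1) / d t) \<longlongrightarrow> - g * Q1 \<tau> l E / (2 * s0)) F"
proof -
  obtain a where a: "a \<in> V" "Xi \<tau> l a E \<noteq> 0" using Xi_nonzero[OF V(1) V(4) V(3)] by blast
  let ?V = "\<lambda>t. Xi \<tau> l a (e t) * (1/2 * deriv (X E) a + (- s0)) - (1/2 * deriv (X (e t)) a + s t) * Xi \<tau> l a E"
  let ?I = "\<lambda>e s. contour_integral (linepath a (a + 1)) (\<lambda>x. fsol a e s x * fsol a E (- s0) x)"
  have s0': "(- s0)\<^sup>2 = - Qf \<tau> l E" using s0 by simp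
  have Vt: "(?V \<longlongrightarrow> Xi \<tau> l a E * (1/2 * deriv (X E) a + (- s0)) - (1/2 * deriv (X E) a + s0) * Xi \<tau> l a E) F"
    by (intro tendsto_intros tendsto_Xi(1,2)[OF a(1) e a(1)] s)
  have Vl: "Xi \<tau> l a E * (1/2 * deriv (X E) a + (- s0)) - (1/2 * deriv (X E) a + s0) * Xi \<tau> l a E = - 2 * s0 * Xi \<tau> l a E"
    by (simp add: algebra_simps)
  have Vnz: "- 2 * s0 * Xi \<tau> l a E \<noteq> 0" using s0 a by simp
  have I: "((\<lambda>t. ?I (e t) (s t)) \<longlongrightarrow> ?I E s0) F" by (rule tendsto_floquet_integral[OF a(1) e s])
  have a1: "a + 1 \<in> V" using a(1) by (simp add: upper_facts)
  have seg: "closed_segment a (a + 1) \<subseteq> V" using upper_facts(2) a(1) a1 by (simp add: closed_segment_subset)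
  have "?I E s0 = contour_integral (linepath a (a + 1)) (\<lambda>x. Xi \<tau> l a E * Xi \<tau> l x E)"
    by (rule contour_integral_eq) (use floquet_product[OF a s0(1)] seg in auto)
  also have "\<dots> = Xi \<tau> l a E * Q1 \<tau> l E"
  proof -
    have "X E contour_integrable_on linepath a (a + 1)"
      by (intro contour_integrable_continuous_linepath holomorphic_on_imp_continuous_on holomorphic_on_subset[OF holomorphic_Xi])
        (use seg V(3) in blast)
    then show ?thesis using Q1_eq[OF a(1), of E] by (simp add: contour_integral_lmul)
  qed
  finally have IE: "?I E s0 = Xi \<tau> l a E * Q1 \<tau> l E" .
  have "((\<lambda>t. (e t - E) / d t * (?I (e t) (s t) / ?V t)) \<longlongrightarrow> g * (?I E s0 / (- 2 * s0 * Xi \<tau> l a E))) F"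
    using Vt unfolding Vl by (intro tendsto_mult g tendsto_divide I Vnz)
  moreover have "g * (?I E s0 / (- 2 * s0 * Xi \<tau> l a E)) = - g * Q1 \<tau> l E / (2 * s0)"
    unfolding IE using s0 a by (simp add: field_simps)
  moreover have "\<forall>\<^sub>F t in F. (e t - E) / d t * (?I (e t) (s t) / ?V t) = (fmul (e t) (s t) / fmul E s0 - 1) / d t"
    using es tendsto_imp_eventually_ne[OF Vt[unfolded Vl] Vnz]
  proof eventually_elim
    case (elim t)
    have m: "fmul E (- s0) = 1 / fmul E s0"
      using multiplier_inverse[OF s0] multiplier_nonzero[OF s0(1)] by (simp add: field_simps)
    have eq: "(fmul (e t) (s t) / fmul E s0 - 1) * ?V t = (e t - E) * ?I (e t) (s t)"
      using multiplier_difference[OF a(1) elim(1) s0'] unfolding m by simp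
    then have "fmul (e t) (s t) / fmul E s0 - 1 = (e t - E) * ?I (e t) (s t) / ?V t"
      using elim(2) by (simp add: nonzero_eq_divide_eq)
    then show ?case by simp
  qed
  ultimately show ?thesis by (simp add: filterlim_cong[OF refl refl])
qed

text \<open>At a degenerate multiplier the square of a Floquet solution has mean zero: pass to the limit
  \<open>e \<rightarrow> E\<close> in the previous Wronskian identity with equal roots, where the Wronskian of the initial values tends to zero.\<close>

lemma floquet_square_integral_zero:
  assumes s0: "s0\<^sup>2 = - Qf \<tau> l E" "s0 \<noteq> 0" and m: "(fmul E s0)\<^sup>2 = 1" and a: "a \<in> V"
    and y: "floquet \<tau> l E s0 y"
  shows "contour_integral (linepath a (a + 1)) (\<lambda>x. (y x)\<^sup>2) = 0"
proof -
  have main: "contour_integral (linepath b (b + 1)) (\<lambda>x. fsol b E s0 x * fsol b E s0 x) = 0" if b: "b \<in> V" for b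
  proof -
    define e where "e = (\<lambda>n::nat. E + of_real (1 / Suc n))"
    \<comment> \<open>A root of -Q at e_n close to s0: the quotient under \<open>csqrt\<close> tends
      to 1, away from the branch cut.\<close>
    define s where "s = (\<lambda>n. s0 * csqrt (Qf \<tau> l (e n) / Qf \<tau> l E))"
    have Q0: "Qf \<tau> l E \<noteq> 0" using s0 by auto
    have "(\<lambda>n. complex_of_real (1 / Suc n)) \<longlonglongrightarrow> of_real 0" 
      by (intro tendsto_of_real) (use LIMSEQ_inverse_real_of_nat in \<open>simp only: inverse_eq_divide\<close>)
    from tendsto_add[OF tendsto_const[of E] this] have e: "e \<longlonglongrightarrow> E" by (simp add: e_def)
    have "isCont (Qf \<tau> l) E" using continuous_Qf by (simp add: continuous_on_eq_continuous_at)
    from isCont_tendsto_compose[OF this e] have Qe: "(\<lambda>n. Qf \<tau> l (e n)) \<longlonglongrightarrow> Qf \<tau> l E" .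
    have "isCont csqrt (1::complex)" by (rule continuous_at_csqrt) simp
    moreover have "(\<lambda>n. Qf \<tau> l (e n) / Qf \<tau> l E) \<longlonglongrightarrow> 1" using tendsto_divide[OF Qe tendsto_const Q0] Q0 by simp
    ultimately have "(\<lambda>n. csqrt (Qf \<tau> l (e n) / Qf \<tau> l E)) \<longlonglongrightarrow> csqrt 1" by (rule isCont_tendsto_compose)
    from tendsto_mult[OF tendsto_const[of s0] this] have s: "s \<longlonglongrightarrow> s0" by (simp add: s_def)
    have es: "(s n)\<^sup>2 = - Qf \<tau> l (e n)" for n using Q0 s0(1) by (simp add: s_def power_mult_distrib)
    let ?I = "\<lambda>n. contour_integral (linepath b (b + 1)) (\<lambda>x. fsol b (e n) (s n) x * fsol b E s0 x)"
    let ?d = "\<lambda>n. of_real (1 / Suc n) :: complex"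
    let ?m = "\<lambda>n. fmul (e n) (s n)" and ?mz = "fmul E s0"
    let ?V = "\<lambda>n. Xi \<tau> l b (e n) * (1/2 * deriv (X E) b + s0) - (1/2 * deriv (X (e n)) b + s n) * Xi \<tau> l b E"
    have "(\<lambda>n. (?m n / ?mz - 1) / ?d n) \<longlonglongrightarrow> - 1 * Q1 \<tau> l E / (2 * s0)"
      by (rule multiplier_quotient[OF e s _ s0]) (use es in \<open>auto simp: e_def simp del: of_nat_Suc\<close>)
    moreover have "?V \<longlonglongrightarrow> Xi \<tau> l b E * (1/2 * deriv (X E) b + s0) - (1/2 * deriv (X E) b + s0) * Xi \<tau> l b E"
      by (intro tendsto_intros tendsto_Xi(1,2)[OF b e b] s)
    then have "?V \<longlonglongrightarrow> 0" by simp
    ultimately have "(\<lambda>n. (?m n / ?mz - 1) / ?d n * ?V n) \<longlonglongrightarrow> - 1 * Q1 \<tau> l E / (2 * s0) * 0" by (rule tendsto_mult)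
    moreover have "(?m n / ?mz - 1) / ?d n * ?V n = ?I n" for n
    proof -
      have "?mz * ?mz = 1" using m by (simp add: power2_eq_square)
      then have m0: "?m n / ?mz = ?m n * ?mz" using multiplier_nonzero[OF s0(1)] by (simp add: field_simps)
      have "(?m n * ?mz - 1) * ?V n = ?d n * ?I n"
        using multiplier_difference[OF b es s0(1)] by (simp only: e_def add_diff_cancel_left')
      then show ?thesis unfolding m0 by (simp add: field_simps del: of_nat_Suc)
    qed
    ultimately have "?I \<longlonglongrightarrow> 0" by simp
    moreover have "?I \<longlonglongrightarrow> contour_integral (linepath b (b + 1)) (\<lambda>x. fsol b E s0 x * fsol b E s0 x)"
      by (rule tendsto_floquet_integral[OF b e s])
    ultimately have "0 = contour_integral (linepath b (b + 1)) (\<lambda>x. fsol b E s0 x * fsol b E s0 x)"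
      by (rule LIMSEQ_unique)
    then show ?thesis by (rule sym)
  qed
  have yh: "y holomorphic_on V" using y by (auto simp: floquet_def ode_sol_def)
  obtain b where b: "b \<in> V" "Xi \<tau> l b E \<noteq> 0" using Xi_nonzero[OF V(1) V(4) V(3)] by blast
  have Yb: "fsol b E s0 b \<noteq> 0" using b by (simp add: floquet_sol_init)
  obtain k where k: "\<And>x. x \<in> V \<Longrightarrow> y x = k * fsol b E s0 x"
    using floquet_proportional[OF floquet_sol_floquet[OF b(1) s0(1)] y b(1) Yb] by blast
  have per: "(y (x + 1))\<^sup>2 = (y x)\<^sup>2" if "x \<in> V" for x
    using multiplier_eq[OF s0(1) y that] m by (simp add: power_mult_distrib)
  have yh2: "(\<lambda>x. (y x)\<^sup>2) holomorphic_on V" by (intro holomorphic_intros yh)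
  have Vs: "x + 1 \<in> V" if "x \<in> V" for x using that by (simp add: upper_facts)
  obtain G where G: "\<And>a b. a \<in> V \<Longrightarrow> b \<in> V \<Longrightarrow> ((\<lambda>x. (y x)\<^sup>2) has_contour_integral (G b - G a)) (linepath a b)"
    "\<And>a b. a \<in> V \<Longrightarrow> b \<in> V \<Longrightarrow> G (a + 1) - G a = G (b + 1) - G b"
    using periodic_integral_shift[OF upper_facts(1,2) Vs yh2 per] by metis
  have "contour_integral (linepath a (a + 1)) (\<lambda>x. (y x)\<^sup>2) = contour_integral (linepath b (b + 1)) (\<lambda>x. (y x)\<^sup>2)"
    using G(1)[OF a Vs[OF a]] G(1)[OF b(1) Vs[OF b(1)]] G(2)[OF a b(1)] by (metis contour_integral_unique)
  also have "\<dots> = contour_integral (linepath b (b + 1)) (\<lambda>x. k\<^sup>2 * (fsol b E s0 x * fsol b E s0 x))"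
  proof (rule contour_integral_eq)
    fix x assume "x \<in> path_image (linepath b (b + 1))"
    then have "x \<in> V" using closed_segment_subset[OF b(1) Vs[OF b(1)] upper_facts(2)] by auto
    then show "(y x)\<^sup>2 = k\<^sup>2 * (fsol b E s0 x * fsol b E s0 x)"
      using k by (simp add: power2_eq_square)
  qed
  also have "\<dots> = k\<^sup>2 * 0"
  proof -
    have "(\<lambda>x. fsol b E s0 x * fsol b E s0 x) contour_integrable_on linepath b (b + 1)"
      using floquet_sol_ode[OF b(1)] closed_segment_subset[OF b(1) Vs[OF b(1)] upper_facts(2)]
      by (intro contour_integrable_continuous_linepath holomorphic_on_imp_continuous_on holomorphic_on_mult)
        (auto simp: ode_sol_def intro: holomorphic_on_subset)
    then show ?thesis by (simp only: contour_integral_lmul main[OF b(1)])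
  qed
  finally show ?thesis by simp
qed

subsection \<open>Continuation of the multiplier along a path of energies\<close>

private lemma up: "\<tau>/4 \<in> upper \<tau>" using \<tau> by (simp add: upper_def)

lemma continuous_Q1: "continuous_on UNIV (Q1 \<tau> l)"
proof -
  have lp: "linepath (\<tau>/4) (1 + \<tau>/4) r = \<tau>/4 + of_real r" for r by (simp add: linepath_def algebra_simps scaleR_conv_of_real diff_divide_distrib)
  have "\<tau>/4 + of_real r \<in> U" for r using up upper_facts(5)[of "\<tau>/4" r \<tau>] upper_not_poles[OF \<tau>] by blast
  then have "continuous_on (UNIV \<times> {0..1::real}) (\<lambda>y. (\<lambda>(E, x). Xi \<tau> l x E) (fst y, \<tau>/4 + of_real (snd y)))"
    by (intro continuous_on_compose2[OF continuous_Xi(1)]) (auto intro!: continuous_intros)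
  then have "continuous_on UNIV (\<lambda>E. integral (cbox 0 1) (\<lambda>r::real. Xi \<tau> l (\<tau>/4 + of_real r) E))"
    by (intro integral_continuous_on_param) (simp add: split_beta)
  then show ?thesis unfolding Q1_def contour_integral_integral lp by simp
qed

text \<open>Differentiating the first-order equation and inserting the formula for Q gives Xi^2 (L''
  - (u - E) L) = 0. The bracket is holomorphic and vanishes where Xi does not, hence everywhere,
  since Xi is not identically zero on any open set.\<close>

lemma Lam_spec_ode:
  assumes L: "Lam_spec \<tau> l E s L" and s: "s\<^sup>2 = - Qf \<tau> l E"
  shows "ode_sol (\<lambda>x. u x - E) U L"
proof -
  have Lh: "L holomorphic_on U" using L unfolding Lam_spec_def by blast
  have Xh: "X E holomorphic_on U" by (rule holomorphic_Xi)
  have uh: "u holomorphic_on U" by (rule holomorphic_pot[OF \<tau>])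
  note h = Lh Xh holomorphic_deriv[OF Lh opU] holomorphic_deriv[OF Xh opU]
  have first: "2 * Xi \<tau> l x E * deriv L x = (deriv (X E) x + 2 * s) * L x" if "x \<in> U" for x
    using L that unfolding Lam_spec_def by blast
  define D where "D = (\<lambda>x. deriv (deriv L) x - (u x - E) * L x)"
  have Dh: "D holomorphic_on U" unfolding D_def by (intro holomorphic_intros holomorphic_deriv[OF _ opU] Lh uh)
  have XD: "(Xi \<tau> l x E)\<^sup>2 * D x = 0" if x: "x \<in> U" for x
  proof -
    note d = holomorphic_has_deriv[OF _ opU x]
    have "((\<lambda>x. 2 * Xi \<tau> l x E * deriv L x) has_field_derivative 2 * deriv (X E) x * deriv L x + deriv (deriv L) x * (2 * Xi \<tau> l x E)) (at x)"
      by (intro DERIV_mult DERIV_cmult d h)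
    then have "((\<lambda>x. (deriv (X E) x + 2 * s) * L x) has_field_derivative 2 * deriv (X E) x * deriv L x + deriv (deriv L) x * (2 * Xi \<tau> l x E)) (at x)"
      by (rule has_field_derivative_transform_within_open[OF _ opU x]) (rule first)
    moreover have "((\<lambda>x. (deriv (X E) x + 2 * s) * L x) has_field_derivative (deriv (deriv (X E)) x + 0) * L x + deriv L x * (deriv (X E) x + 2 * s)) (at x)"
      by (intro DERIV_mult DERIV_add DERIV_const d h)
    ultimately have second: "2 * deriv (X E) x * deriv L x + deriv (deriv L) x * (2 * Xi \<tau> l x E) =
        (deriv (deriv (X E)) x + 0) * L x + deriv L x * (deriv (X E) x + 2 * s)" by (rule DERIV_unique)
    have Q: "4 * (Xi \<tau> l x E)\<^sup>2 * (E - u x) + 2 * Xi \<tau> l x E * deriv (deriv (X E)) x - (deriv (X E) x)\<^sup>2 = - 4 * s\<^sup>2"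
      using arg_cong[OF Qf_eq[OF x, of E], of "\<lambda>z. 4 * z"] s by (simp add: algebra_simps)
    define a b c p q r w where "a = Xi \<tau> l x E" "b = deriv (X E) x" "c = deriv (deriv (X E)) x" "p = L x" "q = deriv L x" "r = deriv (deriv L) x" "w = u x - E"
    have 1: "2 * a * q = (b + 2 * s) * p" using first[OF x] by (simp add: a_b_c_p_q_r_w_def)
    have 2: "2 * a * r = c * p + (2 * s - b) * q" using second by (simp add: a_b_c_p_q_r_w_def algebra_simps)
    have 3: "- 4 * a\<^sup>2 * w + 2 * a * c - b\<^sup>2 = - 4 * s\<^sup>2" using Q by (simp add: a_b_c_p_q_r_w_def algebra_simps)
    have "4 * a\<^sup>2 * r = 2 * a * (c * p + (2 * s - b) * q)" unfolding 2[symmetric] by (simp add: power2_eq_square)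
    also have "\<dots> = 2 * a * c * p + (2 * s - b) * (2 * a * q)" by (simp add: algebra_simps)
    also have "\<dots> = (2 * a * c - b\<^sup>2 + 4 * s\<^sup>2) * p" unfolding 1 by (simp add: algebra_simps power2_eq_square)
    also have "2 * a * c - b\<^sup>2 + 4 * s\<^sup>2 = 4 * a\<^sup>2 * w" using 3 by (simp add: algebra_simps)
    finally have "a\<^sup>2 * (r - w * p) = 0" by (simp add: algebra_simps)
    then show ?thesis by (simp add: D_def a_b_c_p_q_r_w_def)
  qed
  have "D x = 0" if x: "x \<in> U" for x
  proof (rule ccontr)
    assume "D x \<noteq> 0"
    have "open (U \<inter> D -` (- {0}))"
      using holomorphic_on_imp_continuous_on[OF Dh] opU by (intro continuous_open_preimage) auto
    moreover have "x \<in> U \<inter> D -` (- {0})" using x \<open>D x \<noteq> 0\<close> by simp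
    ultimately obtain t where "t \<in> U \<inter> D -` (- {0})" "Xi \<tau> l t E \<noteq> 0"
      using Xi_nonzero[of "U \<inter> D -` (- {0})" E] by blast
    then show False using XD[of t] by simp
  qed
  then show ?thesis using Lh by (simp add: ode_sol_def D_def)
qed

lemma Lam_spec_floquet:
  assumes L: "Lam_spec \<tau> l E s L" and s: "s\<^sup>2 = - Qf \<tau> l E"
  shows "floquet \<tau> l E s L" "\<exists>x\<in>upper \<tau>. L x \<noteq> 0"
proof -
  have sub: "upper \<tau> \<subseteq> U" by (rule upper_not_poles[OF \<tau>])
  have Lh: "L holomorphic_on U" and L0: "\<exists>x\<in>U. L x \<noteq> 0" using L unfolding Lam_spec_def by blast+
  have op: "Xi_op \<tau> l E L x = s * L x" if "x \<in> upper \<tau>" for x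
  proof -
    have "2 * Xi \<tau> l x E * deriv L x = (deriv (X E) x + 2 * s) * L x" using L sub that unfolding Lam_spec_def by blast
    then have "2 * Xi_op \<tau> l E L x = 2 * (s * L x)" by (simp add: Xi_op_def algebra_simps)
    then show ?thesis by simp
  qed
  have sol: "ode_sol (\<lambda>x. u x - E) (upper \<tau>) L" by (rule ode_sol_subset[OF Lam_spec_ode[OF L s] sub])
  show "floquet \<tau> l E s L" unfolding floquet_def by (intro conjI ballI sol op)
  show "\<exists>x\<in>upper \<tau>. L x \<noteq> 0"
  proof (rule ccontr)
    assume "\<not> (\<exists>x\<in>upper \<tau>. L x \<noteq> 0)"
    then have z: "L x = 0" if "x \<in> upper \<tau>" for x using that by blast
    have "L x = 0" if "x \<in> U" for x
      by (rule identity_open[where f = L and S = U and g = "\<lambda>_. 0" and T = "upper \<tau>", OF Lh _ opU connected_not_poles upper_facts(1) _ sub z that])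
        (use up in auto)
    then show False using L0 by blast
  qed
qed

text \<open>With J the indefinite integral of h, one has m' = -m h / 2 and J' = h, so m exp(J/2) has
  derivative zero off a finite set; being continuous on the whole interval, it is constant.\<close>

lemma multiplier_along_path:
  assumes \<gamma>: "valid_path \<gamma>" and s: "continuous_on {0..1} s" and sq: "\<And>t. t \<in> {0..1} \<Longrightarrow> (s t)\<^sup>2 = - Qf \<tau> l (\<gamma> t)"
    and nz: "\<And>t. t \<in> {0<..1} \<Longrightarrow> Qf \<tau> l (\<gamma> t) \<noteq> 0"
    and I: "((\<lambda>t. Q1 \<tau> l (\<gamma> t) / s t * vector_derivative \<gamma> (at t)) has_integral I) {0..1}"
  shows "fmul (\<gamma> 1) (s 1) * exp (I / 2) = fmul (\<gamma> 0) (s 0)"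
proof -
  define m where "m = (\<lambda>t. fmul (\<gamma> t) (s t))"
  define h where "h = (\<lambda>t. Q1 \<tau> l (\<gamma> t) / s t * vector_derivative \<gamma> (at t))"
  define J where "J = (\<lambda>t. integral {0..t} h)"
  define P where "P = (\<lambda>t. m t * exp (J t / 2))"
  have \<gamma>c: "continuous_on {0..1} \<gamma>" using valid_path_imp_path[OF \<gamma>] by (simp add: path_def)
  obtain S D where S: "finite S" and D: "\<And>t. t \<in> {0..1} - S \<Longrightarrow> (\<gamma> has_vector_derivative D t) (at t)" "continuous_on ({0..1} - S) D"
    using \<gamma> unfolding valid_path_def piecewise_C1_differentiable_on_def C1_differentiable_on_def by blast
  \<comment> \<open>Excluded are the corners of the path and both ends. At t = 0 the root s may
    vanish, so there the argument rests on continuity of the multiplier and of the indefinite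
    integral.\<close>
  define T where "T = insert 0 (insert 1 S)"
  have T: "finite T" and opT: "open ({0..1} - T)"
  proof -
    show "finite T" using S by (simp add: T_def)
    have "{0..1} - T = {0<..<1} - S" by (auto simp: T_def)
    then show "open ({0..1} - T)" using S by (simp add: open_Diff finite_imp_closed)
  qed
  have mc: "continuous_on {0..1} m"
    unfolding continuous_on_def
  proof
    fix t :: real assume t: "t \<in> {0..1}"
    show "(m \<longlongrightarrow> m t) (at t within {0..1})"
      unfolding m_def
      by (rule tendsto_multiplier) (use \<gamma>c s sq t in \<open>auto simp: continuous_on_def eventually_at_filter\<close>)
  qed
  have hint: "h integrable_on {0..1}" using I by (auto simp: h_def)
  have Jc: "continuous_on {0..1} J" unfolding J_def by (rule indefinite_integral_continuous_1[OF hint])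
  have Pc: "continuous_on {0..1} P" unfolding P_def by (intro continuous_intros mc Jc) simp
  have snz: "s t \<noteq> 0" if "t \<in> {0..1} - T" for t using sq[of t] nz[of t] that by (auto simp: T_def)
  have vd: "vector_derivative \<gamma> (at t) = D t" if "t \<in> {0..1} - T" for t
    using D(1)[of t] that by (auto simp: T_def intro: vector_derivative_at)
  have "continuous_on ({0..1} - T) (\<lambda>t. Q1 \<tau> l (\<gamma> t) / s t * D t)"
    by (intro continuous_intros continuous_on_compose2[OF continuous_Q1] continuous_on_subset[OF \<gamma>c] continuous_on_subset[OF s]
      continuous_on_subset[OF D(2)]) (use snz in \<open>auto simp: T_def\<close>)
  then have hc: "continuous_on ({0..1} - T) h" by (rule continuous_on_eq) (simp add: h_def vd)
  have Pd: "(P has_vector_derivative 0) (at t)" if t: "t \<in> {0..1} - T" for t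
  proof -
    have t01: "t \<in> {0..1}" using t by simp
    have at: "at t within ({0..1} - T) = at t" by (rule at_within_open[OF t opT])
    have "(J has_vector_derivative h t) (at t within ({0..1} - T))"
      unfolding J_def using hc t by (intro integral_has_vector_derivative_continuous_at[OF hint t T]) (simp add: continuous_on_eq_continuous_within)
    then have Jd: "(J has_vector_derivative h t) (at t)" unfolding at .
    have "((\<lambda>z. exp (z / 2)) has_field_derivative exp (J t / 2) / 2) (at (J t))" by (auto intro!: derivative_eq_intros)
    from field_vector_diff_chain_at[OF Jd this]
    have ed: "((\<lambda>t. exp (J t / 2)) has_vector_derivative h t * (exp (J t / 2) / 2)) (at t)" by (simp add: o_def)
    have ti: "(f \<longlongrightarrow> f t) (at t)" if "continuous_on {0..1} f" for f :: "real \<Rightarrow> complex"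
    proof -
      have "continuous_on ({0..1} - T) f" by (rule continuous_on_subset[OF that]) auto
      then have "(f \<longlongrightarrow> f t) (at t within ({0..1} - T))" using t by (auto simp: continuous_on_def)
      then show ?thesis unfolding at .
    qed
    have "\<forall>\<^sub>F r in at t. r \<in> {0..1} - T" using eventually_at_in_open'[OF opT t] .
    then have ev: "\<forall>\<^sub>F r in at t. (s r)\<^sup>2 = - Qf \<tau> l (\<gamma> r)" by eventually_elim (use sq in auto)
    have g: "((\<lambda>r. (\<gamma> r - \<gamma> t) / of_real (r - t)) \<longlongrightarrow> D t) (at t)"
      using D(1)[of t] t unfolding has_vector_derivative_quotient by (auto simp: T_def)
    have mz: "m t \<noteq> 0" unfolding m_def by (rule multiplier_nonzero[OF sq[OF t01]])
    have "((\<lambda>r. (m r / m t - 1) / of_real (r - t)) \<longlongrightarrow> - D t * Q1 \<tau> l (\<gamma> t) / (2 * s t)) (at t)"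
      unfolding m_def by (rule multiplier_quotient[OF ti[OF \<gamma>c] ti[OF s] ev sq[OF t01] snz[OF t] g])
    note lim = tendsto_mult[OF tendsto_const[of "m t"] this]
    have "m t * ((m r / m t - 1) / of_real (r - t)) = (m r - m t) / of_real (r - t)" for r
      using mz by (simp add: right_diff_distrib)
    from lim[unfolded this] have lim': "((\<lambda>r. (m r - m t) / of_real (r - t)) \<longlongrightarrow> m t * (- D t * Q1 \<tau> l (\<gamma> t) / (2 * s t))) (at t)" .
    have eq2: "m t * (- D t * Q1 \<tau> l (\<gamma> t) / (2 * s t)) = - m t * h t / 2" using vd[OF t] snz[OF t] by (simp add: h_def field_simps)
    have md: "(m has_vector_derivative - m t * h t / 2) (at t)" using lim' unfolding eq2 has_vector_derivative_quotient .
    have "(P has_vector_derivative m t * (h t * (exp (J t / 2) / 2)) + - m t * h t / 2 * exp (J t / 2)) (at t)"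
      unfolding P_def by (rule has_vector_derivative_mult[OF md ed])
    then show ?thesis by simp
  qed
  have "P 1 = P 0"
    by (rule has_derivative_zero_unique_strong_interval[OF T Pc refl])
      (use Pd in \<open>auto simp: has_vector_derivative_def intro: has_derivative_at_withinI\<close>)
  moreover have "J 1 = I" using I by (simp add: J_def h_def integral_unique)
  moreover have "J 0 = 0" by (simp add: J_def)
  ultimately show ?thesis by (simp add: P_def m_def)
qed

text \<open>The hypothesis on the multiplier gives the quasi-period on \<open>upper\<close>, hence
  on all of the pole-free set by continuation. Since the quasi-period sign is its own inverse, the
  reflected function shares it, and symmetrization produces the required parity.\<close>

lemma symmetrized_Lam_eigenfunction:
  assumes l: "l 0 \<ge> 1" "l 1 \<ge> 1" and L: "Lam_spec \<tau> l E s L" and s: "s\<^sup>2 = - Qf \<tau> l E" "s \<noteq> 0"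
    and m: "fmul E s = (-1) ^ (l 0 + l 1)"
  shows "\<exists>f\<in>Dsp l. f \<noteq> (\<lambda>_. 0) \<and> (\<forall>x::real. complex_of_real x \<notin> poles \<tau> l \<longrightarrow>
      f x = L (complex_of_real x) - (-1) ^ l 0 * L (- complex_of_real x))"
proof -
  let ?R = "strip \<tau> - half_ints"
  define F where "F = (\<lambda>x. 1 * L x + (- ((-1) ^ l 0)) * L (- x))"
  have Ls: "ode_sol (\<lambda>x. u x - E) U L" by (rule Lam_spec_ode[OF L s(1)])
  have Lh: "L holomorphic_on U" using L unfolding Lam_spec_def by blast
  have Lnz: "\<exists>x\<in>U. L x \<noteq> 0" using L unfolding Lam_spec_def by blast
  have RU: "?R \<subseteq> U" by (rule strip_half_not_poles[OF \<tau>])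
  have Um: "- x \<in> U \<longleftrightarrow> x \<in> U" for x by (simp add: poles_uminus)
  have U1: "x + 1 \<in> U \<longleftrightarrow> x \<in> U" for x using poles_shift[of 1 \<tau> x l] by simp
  have per: "L (x + 1) = (-1) ^ (l 0 + l 1) * L x" if "x \<in> U" for x
  proof (rule identity_open[where S = U and T = "upper \<tau>" and f = "\<lambda>x. L (x + 1)" and g = "\<lambda>x. (-1) ^ (l 0 + l 1) * L x"])
    show "(\<lambda>x. L (x + 1)) holomorphic_on U"
      by (rule holomorphic_on_compose_gen[OF _ Lh, unfolded o_def]) (use U1 in \<open>auto intro!: holomorphic_intros\<close>)
    show "L (z + 1) = (-1) ^ (l 0 + l 1) * L z" if "z \<in> upper \<tau>" for z
      using multiplier_eq[OF s(1) Lam_spec_floquet(1)[OF L s(1)] that] m by simp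
  qed (use that up opU connected_not_poles upper_facts(1) upper_not_poles[OF \<tau>] Lh in \<open>auto intro!: holomorphic_intros\<close>)
  have Lm: "ode_sol (\<lambda>x. u x - E) U (\<lambda>x. L (- x))"
  proof (rule ode_solI[OF opU])
    fix x assume x: "x \<in> U"
    then have mx: "- x \<in> U" using Um by simp
    show "((\<lambda>x. L (- x)) has_field_derivative - deriv L (- x)) (at x)"
      using DERIV_chain2[OF ode_solD(1)[OF Ls opU mx] DERIV_minus[OF DERIV_ident]] by simp
    have "((\<lambda>x. deriv L (- x)) has_field_derivative (u (- x) - E) * L (- x) * (- 1)) (at x)"
      by (rule DERIV_chain2[where f = "deriv L", OF ode_solD(2)[OF Ls opU mx] DERIV_minus[OF DERIV_ident]])
    from DERIV_minus[OF this] show "((\<lambda>x. - deriv L (- x)) has_field_derivative (u x - E) * L (- x)) (at x)"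
      using pot_uminus[OF \<tau>, of x l] x by simp
  qed
  have FU: "ode_sol (\<lambda>x. u x - E) U F" unfolding F_def by (rule ode_sol_lincomb[OF Ls Lm opU])
  have Fper: "F (x + 1) = (-1) ^ (l 0 + l 1) * F x" if x: "x \<in> U" for x
  proof -
    have mx: "- x - 1 \<in> U" using x U1[of "- x - 1"] Um by simp
    have "L (- x) = (-1) ^ (l 0 + l 1) * L (- x - 1)" using per[OF mx] by simp
    then have "(-1) ^ (l 0 + l 1) * L (- x) = (-1) ^ (l 0 + l 1) * (-1) ^ (l 0 + l 1) * L (- x - 1)" by (simp only: mult.assoc)
    also have "(-1) ^ (l 0 + l 1) * (-1) ^ (l 0 + l 1) = (1::complex)" by (simp only: power_mult_distrib[symmetric]) simp
    finally have "L (- x - 1) = (-1) ^ (l 0 + l 1) * L (- x)" by simp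
    moreover have "- (x + 1) = - x - 1" by simp
    ultimately have L1: "L (- (x + 1)) = (-1) ^ (l 0 + l 1) * L (- x)" by (simp only:)
    show ?thesis unfolding F_def per[OF x] L1 by (simp only: algebra_simps mult_1_left)
  qed
  have sq0: "(-1) ^ l 0 * (-1) ^ l 0 = (1::complex)" by (simp only: power_mult_distrib[symmetric]) simp
  have Fpar: "F (- x) = (-1) ^ (l 0 + 1) * F x" for x
  proof -
    have "(-1) ^ l 0 * ((-1) ^ l 0 * L (- x)) = L (- x)" by (simp only: mult.assoc[symmetric] sq0) simp
    then show ?thesis by (simp add: F_def algebra_simps)
  qed
  have "\<exists>z\<in>?R. F z \<noteq> 0"
  proof (rule ccontr)
    assume "\<not> (\<exists>z\<in>?R. F z \<noteq> 0)"
    then have z: "F z = 0" if "z \<in> ?R" for z using that by blast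
    have Fh: "F holomorphic_on U" using FU by (simp add: ode_sol_def)
    have F0: "F z = 0" if "z \<in> U" for z
      by (rule identity_open[where f = F and S = U and g = "\<lambda>_. 0" and T = ?R, OF Fh _ opU connected_not_poles open_strip_half _ RU z that])
        (use up upper_facts(3)[of \<tau>] in auto)
    define c where "c = (-1::complex) ^ l 0"
    have cc: "c * c = 1" using sq0 by (simp add: c_def)
    then have c0: "c \<noteq> 0" by auto
    \<comment> \<open>If the symmetrization vanished, L and its reflection would be proportional.
      Reflection reverses the sign of s in the first-order equation, so L would satisfy it for both
      s and -s, which gives 4 s L = 0.\<close>
    have sym: "L (- x) = c * L x" if "x \<in> U" for x
      using F0[OF that] cc by (simp add: F_def c_def[symmetric])
    have Lz: "L x = 0" if x: "x \<in> U" for x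
    proof -
      have mx: "- x \<in> U" using x Um by simp
      have d: "deriv L (- x) = - c * deriv L x" by (rule deriv_parity[OF Lh opU _ sym x]) (use Um in auto)
      have 1: "2 * Xi \<tau> l x E * deriv L x = (deriv (X E) x + 2 * s) * L x" using L x unfolding Lam_spec_def by blast
      have "2 * Xi \<tau> l (- x) E * deriv L (- x) = (deriv (X E) (- x) + 2 * s) * L (- x)" using L mx unfolding Lam_spec_def by blast
      then have "2 * Xi \<tau> l x E * (- c * deriv L x) = (- deriv (X E) x + 2 * s) * (c * L x)"
        unfolding d sym[OF x] Xi_uminus[OF x] deriv_Xi_uminus[OF x] .
      then have "c * (- (2 * Xi \<tau> l x E * deriv L x)) = c * ((- deriv (X E) x + 2 * s) * L x)" by (simp add: algebra_simps)
      then have "- (2 * Xi \<tau> l x E * deriv L x) = (- deriv (X E) x + 2 * s) * L x"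
        unfolding mult_left_cancel[OF c0] .
      then have "4 * s * L x = 0" unfolding 1 by (simp add: algebra_simps)
      then show ?thesis using s by simp
    qed
    obtain x1 where "x1 \<in> U" "L x1 \<noteq> 0" using Lnz by blast
    with Lz[of x1] show False by simp
  qed
  then obtain z0 where z0: "z0 \<in> ?R" "F z0 \<noteq> 0" by blast
  obtain H where "H holomorphic_on strip \<tau>" and H: "\<And>z. z \<in> ?R \<Longrightarrow> H z = F z" "(\<lambda>x. H (complex_of_real x)) \<in> Dsp l" "(\<lambda>x. H (complex_of_real x)) \<noteq> (\<lambda>_. 0)"
    and "eigen \<tau> l E (\<lambda>x. H (complex_of_real x))"
    by (rule strip_solution_eigenfunction[OF \<tau> l ode_sol_subset[OF FU RU] Fper[OF subsetD[OF RU]] Fpar z0]) (assumption, rule that, assumption, simp, assumption+)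
  have "H (complex_of_real x) = L (complex_of_real x) - (-1) ^ l 0 * L (- complex_of_real x)" if x: "complex_of_real x \<notin> poles \<tau> l" for x
  proof -
    have "complex_of_real x \<in> ?R" using x \<tau> half_ints_poles[OF l] by (auto simp: strip_def)
    then show ?thesis using H(1) by (simp add: F_def)
  qed
  then show ?thesis using H(2,3) by blast
qed

end

lemma exp_quantization:
  fixes k :: int and n :: nat
  assumes I: "I = 2 * of_nat n * pi * \<i> + 4 * pi * \<i> * of_int k"
  shows "exp (I / 2) = (-1) ^ n"
proof -
  have "I / 2 = of_nat n * (of_real pi * \<i>) + of_int (2 * k) * (of_real pi * \<i>)" by (simp add: I field_simps)
  then have "exp (I / 2) = exp (of_real pi * \<i>) ^ n * exp (of_int (2 * k) * (of_real pi * \<i>))" 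
    by (simp only: exp_add exp_of_nat_mult)
  also have "exp (of_int (2 * k) * (of_real pi * \<i>)) = 1" by (subst exp_eq_1) (auto intro!: exI[of _ k])
  finally show ?thesis by simp
qed

text \<open>Periodicity at E0 means multiplier 1 there. The quantization condition makes exp(I/2)
  equal to (-1)^(l0 + l1), which is its own inverse, so this is the multiplier at the end of the
  path.\<close>

theorem symmetrized_Lam_in_Dsp:
  assumes \<tau>: "Im \<tau> > 0" and l: "l 0 \<ge> 1" "l 1 \<ge> 1"
    and \<gamma>: "valid_path \<gamma>" "pathstart \<gamma> = E0" "pathfinish \<gamma> = Es"
    and s: "continuous_on {0..1} s" "\<forall>t\<in>{0..1}. (s t)\<^sup>2 = - Qf \<tau> l (\<gamma> t)" "\<forall>t\<in>{0<..1}. Qf \<tau> l (\<gamma> t) \<noteq> 0"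
    and L0: "Lam_spec \<tau> l E0 (s 0) Lam0" "\<forall>x\<in>- poles \<tau> l. Lam0 (x + 1) = Lam0 x" and LS: "Lam_spec \<tau> l Es (s 1) LamS"
    and I: "((\<lambda>t. Q1 \<tau> l (\<gamma> t) / s t * vector_derivative \<gamma> (at t)) has_integral I) {0..1}"
      "I = 2 * of_nat (l 0 + l 1) * pi * \<i> + 4 * pi * \<i> * of_int k"
  shows "\<exists>f\<in>Dsp l. f \<noteq> (\<lambda>_. 0) \<and> (\<forall>x::real. complex_of_real x \<notin> poles \<tau> l \<longrightarrow>
      f x = LamS (complex_of_real x) - (-1) ^ l 0 * LamS (- complex_of_real x))"
proof -
  have g: "\<gamma> 0 = E0" "\<gamma> 1 = Es" using \<gamma> by (auto simp: pathstart_def pathfinish_def)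
  have sq: "(s 0)\<^sup>2 = - Qf \<tau> l E0" "(s 1)\<^sup>2 = - Qf \<tau> l Es" using bspec[OF s(2), of 0] bspec[OF s(2), of 1] g by simp_all
  have s1: "s 1 \<noteq> 0" using bspec[OF s(3), of 1] sq(2) g by auto
  obtain x where x: "x \<in> upper \<tau>" "Lam0 x \<noteq> 0" using Lam_spec_floquet(2)[OF \<tau> L0(1) sq(1)] by blast
  have "multiplier \<tau> l E0 (s 0) = 1"
    using multiplier_eq[OF \<tau> sq(1) Lam_spec_floquet(1)[OF \<tau> L0(1) sq(1)] x(1)] L0(2) x upper_not_poles[OF \<tau>, of l] by auto
  moreover have "multiplier \<tau> l (\<gamma> 1) (s 1) * exp (I / 2) = multiplier \<tau> l (\<gamma> 0) (s 0)"
    using s by (intro multiplier_along_path[OF \<tau> \<gamma>(1) s(1) _ _ I(1)]) auto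
  ultimately have "multiplier \<tau> l Es (s 1) * (-1) ^ (l 0 + l 1) = 1"
    unfolding exp_quantization[OF I(2)] g by simp
  moreover have "(-1) ^ (l 0 + l 1) * (-1) ^ (l 0 + l 1) = (1::complex)" by (simp only: power_mult_distrib[symmetric]) simp
  ultimately have "multiplier \<tau> l Es (s 1) = (-1) ^ (l 0 + l 1)" by (metis mult.assoc mult_1_left mult_1_right)
  then show ?thesis by (rule symmetrized_Lam_eigenfunction[OF \<tau> l LS sq(2) s1])
qed

subsection \<open>Regular solutions as functions of the energy and the modulus\<close>

context
  fixes l :: "nat \<Rightarrow> nat"
begin

private abbreviation (input) "D \<equiv> {(p, x). Im (snd p) > 0 \<and> x \<in> cell (snd p)} :: ((complex \<times> complex) \<times> complex) set"
private abbreviation (input) "q \<equiv> (\<lambda>p x. pot_reg (snd p) l x - fst p)"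
private abbreviation (input) "j \<equiv> l 0 + 1"

private lemma D_facts: "ray_closed D" "open D"
proof -
  show "ray_closed D"
    unfolding ray_closed_def
  proof (intro allI impI)
    fix p :: "complex \<times> complex" and x :: complex and r :: real
    assume a: "(p, x) \<in> D \<and> r \<in> {0..1}"
    then have "star_zero (cell (snd p))" by (auto intro: star_zero_cell)
    then show "(p, of_real r * x) \<in> D" using a by (auto simp: star_zero_def)
  qed
  have eq: "D = {y. 0 < Im (snd (fst y))} \<inter> {y. \<bar>Re (snd y)\<bar> < 1/2} \<inter> {y. \<bar>Im (snd y)\<bar> < Im (snd (fst y)) / 2}"
    by (auto simp: cell_def)
  show "open D" unfolding eq by (intro open_Int open_Collect_less continuous_intros) simp_all
qed

private lemma cont_q: "continuous_on D (\<lambda>(p, x). q p x)"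
proof -
  have "continuous_on D (\<lambda>y. (\<lambda>(\<tau>, x). pot_reg \<tau> l x) (snd (fst y), snd y))"
    by (rule continuous_on_compose2[OF continuous_on_pot_reg]) (auto intro!: continuous_intros)
  then show ?thesis unfolding split_beta by (intro continuous_intros) simp
qed

private lemma contV: "continuous_on D (\<lambda>(p, x). volterra_sum (2 * j) (q p) x)"
  by (rule continuous_on_volterra_sum[OF D_facts cont_q])

private lemma contG: "continuous_on D (\<lambda>(p, x). q p x * volterra_sum (2 * j) (q p) x)"
  using continuous_on_mult[OF cont_q contV] unfolding split_beta .

lemma continuous_regsol: "continuous_on D (\<lambda>(p, x). regsol (snd p) l (fst p) x)"
  using contV unfolding regsol_def frob_def split_beta by (intro continuous_intros) simp_all

lemma continuous_regsol': "continuous_on D (\<lambda>(p, x). regsol' (snd p) l (fst p) x)"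
  using contV continuous_on_ray_integral[OF D_facts(1) contG, of "2 * j"]
  unfolding regsol'_def frob'_def split_beta by (intro continuous_intros) simp_all

context
  fixes S :: "complex set" and t e :: "complex \<Rightarrow> complex" and c :: complex
  assumes S: "open S" and t: "t holomorphic_on S" and e: "e holomorphic_on S" and tS: "\<And>z. z \<in> S \<Longrightarrow> Im (t z) > 0"
    and c: "\<And>z. z \<in> S \<Longrightarrow> c \<in> cell (t z)"
begin

private lemma PX: "z \<in> S \<Longrightarrow> ((e z, t z), c) \<in> D"
  using tS c by auto

private lemma ray_cell: "z \<in> S \<Longrightarrow> r \<in> {0..1} \<Longrightarrow> of_real r * c \<in> cell (t z)"
  using star_zero_cell[OF tS] c by (auto simp: star_zero_def)

private lemma P: "continuous_on S (\<lambda>z. (e z, t z))"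
  by (intro continuous_on_Pair holomorphic_on_imp_continuous_on t e)

private lemma hq: "r \<in> {0..1} \<Longrightarrow> (\<lambda>z. q (e z, t z) (of_real r * c)) holomorphic_on S"
  unfolding fst_conv snd_conv
  by (intro holomorphic_on_diff e holomorphic_pot_reg_curve[OF S t holomorphic_on_const]) (use tS ray_cell in auto)

private lemma hV:
  assumes r: "r \<in> {0..1}" shows "(\<lambda>z. volterra_sum (2 * j) (q (e z, t z)) (of_real r * c)) holomorphic_on S"
proof (rule holomorphic_volterra_sum[OF S D_facts cont_q P holomorphic_on_const])
  show "((e z, t z), of_real r * c) \<in> D" if "z \<in> S" for z using tS ray_cell that r by auto
  show "(\<lambda>z. q (e z, t z) (of_real r' * (of_real r * c))) holomorphic_on S" if r': "r' \<in> {0..1}" for r'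
  proof -
    have "r' * r \<in> {0..1}" using r r' by (auto simp: mult_le_one)
    from hq[OF this] show ?thesis by (simp add: mult.assoc)
  qed
qed

lemma holomorphic_regsol_curve: "(\<lambda>z. regsol (t z) l (e z) c) holomorphic_on S"
  using hV[of 1] unfolding regsol_def frob_def by (intro holomorphic_intros) simp

lemma holomorphic_regsol'_curve: "(\<lambda>z. regsol' (t z) l (e z) c) holomorphic_on S"
proof -
  have G: "(\<lambda>z. q (e z, t z) (of_real r * c) * volterra_sum (2 * j) (q (e z, t z)) (of_real r * c)) holomorphic_on S"
    if "r \<in> {0..1}" for r
    by (rule holomorphic_on_mult[OF hq[OF that] hV[OF that]])
  have "(\<lambda>z. ray_integral (2 * j) (\<lambda>y. q (e z, t z) y * volterra_sum (2 * j) (q (e z, t z)) y) c) holomorphic_on S"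
    by (rule holomorphic_ray_integral[OF S D_facts(1) contG P holomorphic_on_const PX]) (assumption, rule G)
  then show ?thesis using hV[of 1] unfolding regsol'_def frob'_def by (intro holomorphic_intros) simp_all
qed

end

end

lemma quarter_cell: "Im \<tau> > 0 \<Longrightarrow> 1/4 \<in> cell \<tau>" "Im \<tau> > 0 \<Longrightarrow> - 1/4 \<in> cell \<tau>"
  by (auto simp: cell_def)

lemma continuous_evans: "continuous_on {p. Im (snd p) > 0} (\<lambda>p. evans (snd p) l (fst p))"
proof -
  have r: "continuous_on {p. Im (snd p) > 0} (\<lambda>p. regsol (snd p) m (fst p) c)"
    and r': "continuous_on {p. Im (snd p) > 0} (\<lambda>p. regsol' (snd p) m (fst p) c)"
    if c: "\<And>\<tau>. Im \<tau> > 0 \<Longrightarrow> c \<in> cell \<tau>" for c m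
  proof -
    have "continuous_on {p. Im (snd p) > 0} (\<lambda>p. (\<lambda>(p, x). regsol (snd p) m (fst p) x) (p, c))"
      by (rule continuous_on_compose2[OF continuous_regsol]) (use c in \<open>auto intro!: continuous_intros\<close>)
    then show "continuous_on {p. Im (snd p) > 0} (\<lambda>p. regsol (snd p) m (fst p) c)" by simp
    have "continuous_on {p. Im (snd p) > 0} (\<lambda>p. (\<lambda>(p, x). regsol' (snd p) m (fst p) x) (p, c))"
      by (rule continuous_on_compose2[OF continuous_regsol']) (use c in \<open>auto intro!: continuous_intros\<close>)
    then show "continuous_on {p. Im (snd p) > 0} (\<lambda>p. regsol' (snd p) m (fst p) c)" by simp
  qed
  show ?thesis unfolding evans_def by (intro continuous_intros r r' quarter_cell)
qed

lemma holomorphic_evans_curve: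
  assumes "open S" "t holomorphic_on S" "e holomorphic_on S" "\<And>z. z \<in> S \<Longrightarrow> Im (t z) > 0"
  shows "(\<lambda>z. evans (t z) l (e z)) holomorphic_on S"
  unfolding evans_def
  by (intro holomorphic_on_diff holomorphic_on_mult holomorphic_regsol_curve holomorphic_regsol'_curve quarter_cell assms)

subsection \<open>Eigenvalues are zeros of the Wronskian\<close>

text \<open>Parity about 1/2 is obtained by combining parity about 0 with the quasi-period; sine and
  cosine in \<open>Phi\<close> exchange their roles.\<close>

lemma Dsp_half_shift:
  assumes f: "f \<in> Dsp l" shows "(\<lambda>x. f (x + 1/2)) \<in> Dsp (l \<circ> swap_half)"
proof -
  obtain S g where S: "open S" "range complex_of_real \<subseteq> S" and g: "g holomorphic_on S" "\<And>x. f x = g (complex_of_real x) * Phi l x"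
    using f unfolding Dsp_def by blast
  have per: "f x = (-1) ^ (l 0 + l 1) * f (x + 1)" and par: "f x = (-1) ^ (l 0 + 1) * f (- x)" for x
    using f unfolding Dsp_def by blast+
  have sw: "(l \<circ> swap_half) 0 = l 1" "(l \<circ> swap_half) 1 = l 0" by (simp_all add: swap_half_def)
  have "\<exists>S h. open S \<and> range complex_of_real \<subseteq> S \<and> h holomorphic_on S \<and>
      (\<forall>x. f (x + 1/2) = h (complex_of_real x) * Phi (l \<circ> swap_half) x)"
  proof (rule exI[of _ "(\<lambda>z. z + 1/2) -` S"], rule exI[of _ "\<lambda>z. (-1) ^ (l 1 + 1) * g (z + 1/2)"], intro conjI allI)
    show "open ((\<lambda>z. z + 1/2) -` S)" by (intro continuous_open_vimage S) (auto intro!: continuous_intros)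
    show "range complex_of_real \<subseteq> (\<lambda>z. z + 1/2) -` S"
    proof
      fix z assume "z \<in> range complex_of_real"
      then obtain x where "z = of_real x" by blast
      then have "z + 1/2 = of_real (x + 1/2)" by simp
      then show "z \<in> (\<lambda>z. z + 1/2) -` S" using S(2) by (metis rangeI subsetD vimageI2)
    qed
    have "(\<lambda>z. g (z + 1/2)) holomorphic_on ((\<lambda>z. z + 1/2) -` S)"
      by (rule holomorphic_on_compose_gen[OF _ g(1), unfolded o_def]) (auto intro!: holomorphic_intros)
    then show "(\<lambda>z. (-1) ^ (l 1 + 1) * g (z + 1/2)) holomorphic_on ((\<lambda>z. z + 1/2) -` S)" by (intro holomorphic_intros)
    fix x :: real
    have "Phi l (x + 1/2) = (-1) ^ (l 1 + 1) * Phi (l \<circ> swap_half) x"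
    proof -
      have s: "sin (pi * (x + 1/2)) = cos (pi * x)" and c: "cos (pi * (x + 1/2)) = - sin (pi * x)"
        using sin_cos_eq[of "- pi * x"] by (simp_all add: distrib_left sin_add cos_add)
      show ?thesis unfolding Phi_def s c sw by (simp add: power_minus[of "sin _"] power_minus[of "complex_of_real (sin _)"])
    qed
    moreover have "complex_of_real (x + 1/2) = of_real x + 1/2" by simp
    ultimately show "f (x + 1/2) = (-1) ^ (l 1 + 1) * g (of_real x + 1/2) * Phi (l \<circ> swap_half) x"
      unfolding g(2) by (simp only: mult_ac)
  qed
  moreover have "f (x + 1/2) = (-1) ^ (l 1 + l 0) * f (x + 1 + 1/2)" for x using per[of "x + 1/2"] by (simp add: add_ac)
  moreover have "f (x + 1/2) = (-1) ^ (l 1 + 1) * f (- x + 1/2)" for x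
  proof -
    have "f (x + 1/2) = (-1) ^ (l 0 + 1) * f (- x - 1/2)" using par[of "x + 1/2"] by (simp add: algebra_simps)
    also have "f (- x - 1/2) = (-1) ^ (l 0 + l 1) * f (- x + 1/2)" using per[of "- x - 1/2"] by (simp add: algebra_simps)
    also have "(-1) ^ (l 0 + 1) * ((-1) ^ (l 0 + l 1) * f (- x + 1/2)) = ((-1) ^ l 0 * (-1) ^ l 0) * ((-1) ^ (l 1 + 1) * f (- x + 1/2))"
      by (simp add: power_add mult_ac)
    also have "(-1) ^ l 0 * (-1) ^ l 0 = (1::complex)" by (simp add: power_mult_distrib[symmetric])
    finally show ?thesis by simp
  qed
  ultimately show ?thesis unfolding Dsp_def sw by blast
qed

lemma eigen_half_shift:
  assumes \<tau>: "Im \<tau> > 0" and f: "eigen \<tau> l E f" shows "eigen \<tau> (l \<circ> swap_half) E (\<lambda>x. f (x + 1/2))"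
proof -
  obtain f1 f2 where d: "\<And>x. (f has_vector_derivative f1 x) (at x)" "\<And>x. (f1 has_vector_derivative f2 x) (at x)"
    and eq: "\<And>x. complex_of_real x \<notin> poles \<tau> l \<Longrightarrow> - f2 x + pot \<tau> l (complex_of_real x) * f x - E * f x = 0"
    using f unfolding eigen_def by blast
  have sh: "((\<lambda>x. h (x + 1/2)) has_vector_derivative h' (x + 1/2)) (at x)"
    if "\<And>x. (h has_vector_derivative h' x) (at x)" for h h' :: "real \<Rightarrow> complex" and x
  proof -
    have "((\<lambda>x::real. x + 1/2) has_vector_derivative 1) (at x)" by (auto intro!: derivative_eq_intros)
    from vector_diff_chain_at[OF this that[of "x + 1/2"]] show ?thesis by (simp add: o_def)
  qed
  show ?thesis
    unfolding eigen_def
  proof (rule exI[of _ "\<lambda>x. f1 (x + 1/2)"], rule exI[of _ "\<lambda>x. f2 (x + 1/2)"], intro conjI allI impI)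
    fix x :: real
    show "((\<lambda>x. f (x + 1/2)) has_vector_derivative f1 (x + 1/2)) (at x)" by (rule sh[OF d(1)])
    show "((\<lambda>x. f1 (x + 1/2)) has_vector_derivative f2 (x + 1/2)) (at x)" by (rule sh[OF d(2)])
    assume x: "complex_of_real x \<notin> poles \<tau> (l \<circ> swap_half)"
    have e: "complex_of_real (x + 1/2) = of_real x + 1/2" by simp
    have x': "of_real x + 1/2 \<notin> poles \<tau> l" using x by (simp only: poles_swap_half) simp
    from eq[of "x + 1/2"] x'
    show "- f2 (x + 1/2) + pot \<tau> (l \<circ> swap_half) (complex_of_real x) * f (x + 1/2) - E * f (x + 1/2) = 0"
      unfolding e using pot_swap_half[OF \<tau> x'] by simp
  qed
qed

text \<open>On the overlap f is a multiple of both regular solutions, with constants k and k'. They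
  cannot both be zero, or f would vanish on [0, 1) and then everywhere by the quasi-period; either
  one being nonzero forces the Wronskian to vanish.\<close>

lemma eigen_imp_evans_zero:
  assumes \<tau>: "Im \<tau> > 0" and f: "f \<in> Dsp l" "f \<noteq> (\<lambda>_. 0)" "eigen \<tau> l E f"
  shows "evans \<tau> l E = 0"
proof -
  obtain k where k: "\<And>x. \<bar>x\<bar> < 1/2 \<Longrightarrow> f x = k * regsol \<tau> l E (of_real x)"
    using Dsp_eigen_regsol[OF \<tau> f(1,3)] by blast
  obtain k' where k': "\<And>x. \<bar>x\<bar> < 1/2 \<Longrightarrow> f (x + 1/2) = k' * regsol \<tau> (l \<circ> swap_half) E (of_real x)"
    using Dsp_eigen_regsol[OF \<tau> Dsp_half_shift[OF f(1)] eigen_half_shift[OF \<tau> f(3)]] by blast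
  let ?O = "overlap \<tau>" and ?y = "regsol \<tau> l E" and ?z = "half_shift \<tau> l E"
  have y: "ode_sol (\<lambda>x. pot \<tau> l x - E) ?O ?y" by (rule ode_sol_subset[OF regsol_ode[OF \<tau>]]) (use overlap_facts[OF \<tau>] in auto)
  have z: "ode_sol (\<lambda>x. pot \<tau> l x - E) ?O ?z" by (rule ode_sol_subset[OF half_shift_ode[OF \<tau>]]) (use overlap_facts[OF \<tau>] in auto)
  have hol: "?y holomorphic_on ?O" "?z holomorphic_on ?O" using y z by (auto simp: ode_sol_def)
  have eq: "k * ?y w = k' * ?z w" if "w \<in> ?O" for w
  proof (rule real_identity[where f = "\<lambda>w. k * ?y w" and g = "\<lambda>w. k' * ?z w" and S = ?O and a = "1/4"])
    fix x assume "complex_of_real x \<in> ?O"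
    then have x: "0 < x" "x < 1/2" by (auto simp: overlap_def)
    have "k * ?y (of_real x) = f (x - 1/2 + 1/2)" using k[of x] x by simp
    also have "\<dots> = k' * ?z (of_real x)" using k'[of "x - 1/2"] x by (simp add: half_shift_def)
    finally show "k * ?y (of_real x) = k' * ?z (of_real x)" .
  qed (use that overlap_facts[OF \<tau>] hol in \<open>auto intro!: holomorphic_intros\<close>)
  have k0: "k \<noteq> 0 \<or> k' \<noteq> 0"
  proof (rule ccontr)
    assume "\<not> ?thesis"
    then have z0: "f x = 0" if "0 \<le> x" "x < 1" for x
      using k[of x] k'[of "x - 1/2"] that by (cases "x < 1/2") (auto simp: abs_less_iff)
    have per: "f x = (-1) ^ (l 0 + l 1) * f (x + 1)" for x using f(1) unfolding Dsp_def by blast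
    have per0: "f (x + 1) = 0 \<longleftrightarrow> f x = 0" for x using per[of x] by auto
    have "f (x + of_int n) = 0 \<longleftrightarrow> f x = 0" for x n
    proof (induction n rule: int_induct[of _ 0])
      case (step1 i) then show ?case using per0[of "x + of_int i"] by (simp add: add_ac)
    next
      case (step2 i) then show ?case using per0[of "x + of_int (i - 1)"] by (simp add: add_ac)
    qed simp
    from this[of "frac x" "\<lfloor>x\<rfloor>" for x] have "f x = 0" for x
      using z0[of "frac x"] frac_ge_0[of x] frac_lt_1[of x] by (simp add: frac_def)
    then show False using f(2) by blast
  qed
  have e: "evans \<tau> l E = wronskian ?y ?z (1/4)" by (rule evans_eq_wronskian[OF \<tau>])
  note q = overlap_facts(5)[OF \<tau>]
  note h = holomorphic_has_deriv[OF hol(1) overlap_facts(1)[OF \<tau>] q] holomorphic_has_deriv[OF hol(2) overlap_facts(1)[OF \<tau>] q]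
  have d: "k * deriv ?y (1/4) = k' * deriv ?z (1/4)"
  proof -
    have "((\<lambda>w. k' * ?z w) has_field_derivative k * deriv ?y (1/4)) (at (1/4))"
      by (rule has_field_derivative_transform_within_open[OF DERIV_cmult[OF h(1)] overlap_facts(1)[OF \<tau>] q eq])
    then show ?thesis using DERIV_unique[OF _ DERIV_cmult[OF h(2)]] by blast
  qed
  have "k * wronskian ?y ?z (1/4) = (k * ?y (1/4)) * deriv ?z (1/4) - (k * deriv ?y (1/4)) * ?z (1/4)"
    by (simp add: wronskian_def algebra_simps)
  also have "\<dots> = 0" unfolding eq[OF q] d by simp
  finally have 1: "k * wronskian ?y ?z (1/4) = 0" .
  have "k' * wronskian ?y ?z (1/4) = ?y (1/4) * (k' * deriv ?z (1/4)) - deriv ?y (1/4) * (k' * ?z (1/4))"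
    by (simp add: wronskian_def algebra_simps)
  also have "\<dots> = 0" unfolding eq[OF q, symmetric] d[symmetric] by simp
  finally show ?thesis using 1 k0 e by auto
qed

subsection \<open>Simplicity of the zeros of the Wronskian\<close>

lemma ode_sol_upper_nonzero:
  assumes \<tau>: "Im \<tau> > 0" and F: "F holomorphic_on strip \<tau> - half_ints" and nz: "z0 \<in> strip \<tau> - half_ints" "F z0 \<noteq> 0"
  shows "\<exists>x\<in>upper \<tau>. F x \<noteq> 0"
proof (rule ccontr)
  assume "\<not> ?thesis"
  then have 0: "F x = 0" if "x \<in> upper \<tau>" for x using that by blast
  have "\<tau>/4 \<in> upper \<tau>" using \<tau> by (simp add: upper_def)
  then have "upper \<tau> \<noteq> {}" by blast
  from identity_open[OF F holomorphic_on_const open_strip_half connected_strip_half upper_facts(1) this upper_facts(3) 0 nz(1)] nz(2)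
  show False by simp
qed

context
  fixes \<tau> :: complex and l :: "nat \<Rightarrow> nat" and E :: complex and F :: "complex \<Rightarrow> complex"
  assumes \<tau>: "Im \<tau> > 0" and Q: "Qf \<tau> l E \<noteq> 0"
    and F: "ode_sol (\<lambda>x. pot \<tau> l x - E) (strip \<tau> - half_ints) F"
    and per: "\<And>x. x \<in> strip \<tau> - half_ints \<Longrightarrow> F (x + 1) = (-1) ^ (l 0 + l 1) * F x"
    and par: "\<And>x. x \<in> strip \<tau> - half_ints \<Longrightarrow> F (- x) = (-1) ^ (l 0 + 1) * F x"
    and nz: "\<exists>x\<in>upper \<tau>. F x \<noteq> 0"
begin

private abbreviation (input) "R \<equiv> strip \<tau> - half_ints"
private abbreviation (input) "A \<equiv> Xi_op \<tau> l E F"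

private lemma R: "open R" "R \<subseteq> - poles \<tau> l" "upper \<tau> \<subseteq> R"
  using open_strip_half strip_half_not_poles[OF \<tau>] upper_facts(3) by auto

private lemma A: "ode_sol (\<lambda>x. pot \<tau> l x - E) R A"
  by (rule Xi_op_sol[OF \<tau> R(1,2) F])

private lemma FV: "ode_sol (\<lambda>x. pot \<tau> l x - E) (upper \<tau>) F" and AV: "ode_sol (\<lambda>x. pot \<tau> l x - E) (upper \<tau>) A"
  using ode_sol_subset[OF _ R(3)] F A by auto

private lemma R_uminus: "x \<in> R \<Longrightarrow> - x \<in> R"
  by (auto simp: strip_def half_ints_def)

private lemma A_uminus:
  assumes x: "x \<in> R" shows "A (- x) = (-1) ^ l 0 * A x"
proof -
  have Fh: "F holomorphic_on R" using F by (simp add: ode_sol_def)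
  have xU: "x \<in> - poles \<tau> l" using x R(2) by blast
  have "deriv F (- x) = - ((-1) ^ (l 0 + 1)) * deriv F x" by (rule deriv_parity[OF Fh R(1) R_uminus par x])
  then show ?thesis
    unfolding Xi_op_def par[OF x] Xi_uminus[OF \<tau> xU] deriv_Xi_uminus[OF \<tau> xU] by (simp add: algebra_simps)
qed

private lemma A_shift:
  assumes x: "x \<in> upper \<tau>" shows "A (x + 1) = (-1) ^ (l 0 + l 1) * A x"
proof -
  have x1: "x + 1 \<in> upper \<tau>" using x by (simp add: upper_facts)
  have xU: "x \<in> - poles \<tau> l" using x R(2,3) by blast
  have "((\<lambda>x. F (x + 1)) has_field_derivative deriv F (x + 1)) (at x)"
    using ode_solD(1)[OF FV upper_facts(1) x1] by (simp add: DERIV_shift)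
  then have "((\<lambda>x. (-1) ^ (l 0 + l 1) * F x) has_field_derivative deriv F (x + 1)) (at x)"
    by (rule has_field_derivative_transform_within_open[OF _ upper_facts(1) x]) (use per R(3) in blast)
  then have d: "deriv F (x + 1) = (-1) ^ (l 0 + l 1) * deriv F x"
    using DERIV_unique[OF _ DERIV_cmult[OF ode_solD(1)[OF FV upper_facts(1) x]]] by blast
  have F1: "F (x + 1) = (-1) ^ (l 0 + l 1) * F x" using per x R(3) by blast
  show ?thesis
    unfolding Xi_op_def d F1 Xi_shift[OF \<tau> xU lattice_basic(2)] deriv_Xi_shift[OF \<tau> xU lattice_basic(2)] by (simp add: algebra_simps)
qed

private abbreviation (input) "L s \<equiv> (\<lambda>x. 1 * A x + s * F x)"

text \<open>Since A F solves the equation too and the operator squares to -Q = s^2, applying it to A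
  F + s F gives s^2 F + s A F, which is s times the same function.\<close>

private lemma L_floquet:
  assumes s: "s\<^sup>2 = - Qf \<tau> l E" shows "floquet \<tau> l E s (L s)"
proof -
  have sol: "ode_sol (\<lambda>x. pot \<tau> l x - E) (upper \<tau>) (L s)" by (rule ode_sol_lincomb[OF AV FV upper_facts(1)])
  have "Xi_op \<tau> l E (L s) x = s * L s x" if x: "x \<in> upper \<tau>" for x
  proof -
    have "(L s has_field_derivative 1 * deriv A x + s * deriv F x) (at x)"
      by (intro DERIV_add DERIV_cmult ode_solD(1)[OF AV upper_facts(1) x] ode_solD(1)[OF FV upper_facts(1) x])
    then have d: "deriv (L s) x = deriv A x + s * deriv F x" by (simp add: DERIV_imp_deriv)
    have "Xi_op \<tau> l E (L s) x = Xi_op \<tau> l E A x + s * A x"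
      unfolding Xi_op_def[of \<tau> l E "L s"] d unfolding Xi_op_def[of \<tau> l E A] by (simp add: Xi_op_def algebra_simps)
    also have "Xi_op \<tau> l E A x = s * s * F x"
      using Xi_op_square[OF \<tau> R(1,2) F, of x] x R(3) s by (auto simp: power2_eq_square)
    finally show ?thesis by (simp add: algebra_simps)
  qed
  then show ?thesis using sol by (simp add: floquet_def)
qed

text \<open>F and its image under \<open>Xi_op\<close> have opposite parity, because Xi is even and
  each term of the operator contains one derivative. A relation A F = -s F would reflect to A F = s
  F, forcing F = 0.\<close>

private lemma L_nonzero:
  assumes s: "s \<noteq> 0" obtains x where "x \<in> upper \<tau>" "L s x \<noteq> 0"
proof -
  have "\<exists>x\<in>upper \<tau>. L s x \<noteq> 0"
  proof (rule ccontr)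
    assume "\<not> ?thesis"
    then have 0: "L s x = 0" if "x \<in> upper \<tau>" for x using that by blast
    have h: "L s holomorphic_on R" using ode_sol_lincomb[OF A F R(1), of 1 s] by (simp add: ode_sol_def)
    obtain a where a: "a \<in> upper \<tau>" "F a \<noteq> 0" using nz by blast
    then have ne: "upper \<tau> \<noteq> {}" by blast
    have L0: "L s x = 0" if "x \<in> R" for x
      using identity_open[OF h holomorphic_on_const R(1) connected_strip_half upper_facts(1) ne R(3) 0 that] by simp
    have aR: "a \<in> R" using a(1) R(3) by blast
    have 1: "A a = - s * F a" using L0[OF aR] by (simp add: eq_neg_iff_add_eq_0)
    have "L s (- a) = 0" using L0[OF R_uminus[OF aR]] .
    then have "(-1) ^ l 0 * A a + s * ((-1) ^ (l 0 + 1) * F a) = 0" by (simp only: A_uminus[OF aR] par[OF aR] mult_1_left)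
    then have "(-1) ^ l 0 * (A a - s * F a) = 0" by (simp add: algebra_simps)
    then have "A a = s * F a" by simp
    with 1 have "2 * s * F a = 0" by simp
    then show False using s a(2) by simp
  qed
  then show ?thesis using that by blast
qed

lemma square_integral_nonzero:
  assumes Q1: "Q1 \<tau> l E \<noteq> 0" and a: "a \<in> upper \<tau>"
  shows "contour_integral (linepath a (a + 1)) (\<lambda>x. (F x)\<^sup>2) \<noteq> 0"
proof -
  define s where "s = csqrt (- Qf \<tau> l E)"
  have s: "s\<^sup>2 = - Qf \<tau> l E" "(- s)\<^sup>2 = - Qf \<tau> l E" by (simp_all add: s_def)
  have s0: "s \<noteq> 0" "- s \<noteq> 0" using s Q by auto
  \<comment> \<open>The eigenvectors inherit the quasi-period of F for either sign of the root, so
    both multipliers are 1 or -1, the degenerate case.\<close>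
  have m: "(multiplier \<tau> l E t)\<^sup>2 = 1" if t: "t\<^sup>2 = - Qf \<tau> l E" "t \<noteq> 0" for t
  proof -
    obtain x where x: "x \<in> upper \<tau>" "L t x \<noteq> 0" using L_nonzero[OF t(2)] by blast
    have "L t (x + 1) = multiplier \<tau> l E t * L t x" by (rule multiplier_eq[OF \<tau> t(1) L_floquet[OF t(1)] x(1)])
    moreover have "L t (x + 1) = (-1) ^ (l 0 + l 1) * L t x"
      using A_shift[OF x(1)] per[of x] x(1) R(3) by (simp add: subset_iff algebra_simps)
    ultimately have "multiplier \<tau> l E t = (-1) ^ (l 0 + l 1)" using x(2) by simp
    then show ?thesis by (simp add: power_mult[symmetric] mult.commute[of _ 2] power_mult)
  qed
  note zero = floquet_square_integral_zero[OF \<tau> _ _ m a L_floquet]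
  have seg: "closed_segment a (a + 1) \<subseteq> upper \<tau>" using upper_facts(2) a by (simp add: closed_segment_subset upper_facts(4))
  obtain b where b: "b \<in> upper \<tau>" "Xi \<tau> l b E \<noteq> 0"
    using Xi_nonzero[OF \<tau> upper_facts(1) _ upper_not_poles[OF \<tau>]] a by blast
  have prp: "\<exists>k. k \<noteq> 0 \<and> (\<forall>x\<in>upper \<tau>. L t x = k * floquet_sol \<tau> l b E t x)" if t: "t\<^sup>2 = - Qf \<tau> l E" "t \<noteq> 0" for t
  proof -
    have "floquet_sol \<tau> l b E t b \<noteq> 0" using b by (simp add: floquet_sol_init[OF \<tau> b(1)])
    then obtain k where k: "\<forall>x\<in>upper \<tau>. L t x = k * floquet_sol \<tau> l b E t x"
      using floquet_proportional[OF \<tau> floquet_sol_floquet[OF \<tau> b(1) t(1)] L_floquet[OF t(1)] b(1)] by blast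
    obtain x where "x \<in> upper \<tau>" "L t x \<noteq> 0" using L_nonzero[OF t(2)] by blast
    then have "k \<noteq> 0" using k by auto
    then show ?thesis using k by blast
  qed
  obtain k where k: "k \<noteq> 0" "\<And>x. x \<in> upper \<tau> \<Longrightarrow> L s x = k * floquet_sol \<tau> l b E s x" using prp[OF s(1) s0(1)] by blast
  obtain k' where k': "k' \<noteq> 0" "\<And>x. x \<in> upper \<tau> \<Longrightarrow> L (- s) x = k' * floquet_sol \<tau> l b E (- s) x" using prp[OF s(2) s0(2)] by blast
  define \<kappa> where "\<kappa> = k * k' * Xi \<tau> l b E"
  have \<kappa>: "\<kappa> \<noteq> 0" using k k' b by (simp add: \<kappa>_def)
  have LL: "L s x * L (- s) x = \<kappa> * Xi \<tau> l x E" if x: "x \<in> upper \<tau>" for x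
  proof -
    have "L s x * L (- s) x = k * k' * (floquet_sol \<tau> l b E s x * floquet_sol \<tau> l b E (- s) x)"
      unfolding k(2)[OF x] k'(2)[OF x] by (simp only: mult_ac)
    then show ?thesis unfolding floquet_product[OF \<tau> b s(1) x] by (simp add: \<kappa>_def)
  qed
  have int: "f contour_integrable_on linepath a (a + 1)" if "f holomorphic_on upper \<tau>" for f
    by (intro contour_integrable_continuous_linepath holomorphic_on_imp_continuous_on holomorphic_on_subset[OF that seg])
  have Fh: "F holomorphic_on upper \<tau>" and Ah: "A holomorphic_on upper \<tau>" using FV AV by (auto simp: ode_sol_def)
  have Xh: "(\<lambda>x. Xi \<tau> l x E) holomorphic_on upper \<tau>" by (rule holomorphic_on_subset[OF holomorphic_Xi[OF \<tau>] upper_not_poles[OF \<tau>]])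
  have hs: "(\<lambda>x. (L t x)\<^sup>2) holomorphic_on upper \<tau>" for t by (intro holomorphic_intros Fh Ah)
  note i = int[OF hs[of s]] int[OF hs[of "- s"]]
  have "(4 * s\<^sup>2) * contour_integral (linepath a (a + 1)) (\<lambda>x. (F x)\<^sup>2) = contour_integral (linepath a (a + 1)) (\<lambda>x. (4 * s\<^sup>2) * (F x)\<^sup>2)"
    by (rule contour_integral_lmul[symmetric]) (intro int holomorphic_intros Fh)
  also have "\<dots> = contour_integral (linepath a (a + 1)) (\<lambda>x. ((L s x)\<^sup>2 + (L (- s) x)\<^sup>2) - 2 * \<kappa> * Xi \<tau> l x E)"
  proof (rule contour_integral_eq)
    fix x assume "x \<in> path_image (linepath a (a + 1))"
    then have x: "x \<in> upper \<tau>" using seg by auto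
    have "4 * s\<^sup>2 * (F x)\<^sup>2 = (L s x)\<^sup>2 + (L (- s) x)\<^sup>2 - 2 * (L s x * L (- s) x)"
      by (simp add: power2_eq_square algebra_simps)
    then show "4 * s\<^sup>2 * (F x)\<^sup>2 = ((L s x)\<^sup>2 + (L (- s) x)\<^sup>2) - 2 * \<kappa> * Xi \<tau> l x E" unfolding LL[OF x] by (simp only: mult.assoc)
  qed
  also have "\<dots> = contour_integral (linepath a (a + 1)) (\<lambda>x. (L s x)\<^sup>2) + contour_integral (linepath a (a + 1)) (\<lambda>x. (L (- s) x)\<^sup>2)
      - 2 * \<kappa> * contour_integral (linepath a (a + 1)) (\<lambda>x. Xi \<tau> l x E)"
    using i int[OF Xh] by (simp only: contour_integral_diff contour_integral_add contour_integrable_add contour_integrable_lmul contour_integral_lmul)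
  also have "\<dots> = - 2 * \<kappa> * Q1 \<tau> l E"
    using zero[OF s(1) s0(1) s(1) s0(1) s(1)] zero[OF s(2) s0(2) s(2) s0(2) s(2)] Q1_eq[OF \<tau> a] by simp
  finally show ?thesis using \<kappa> Q1 by auto
qed

end

lemma continuous_regsol_energy:
  assumes \<tau>: "Im \<tau> > 0" shows "continuous_on (UNIV \<times> cell \<tau>) (\<lambda>(E, x). regsol \<tau> l E x)"
proof -
  have "continuous_on (UNIV \<times> cell \<tau>) (\<lambda>y. (\<lambda>(p, x). regsol (snd p) l (fst p) x) ((fst y, \<tau>), snd y))"
    by (rule continuous_on_compose2[OF continuous_regsol]) (use \<tau> in \<open>auto intro!: continuous_intros\<close>)
  then show ?thesis by (simp add: split_beta)
qed

text \<open>The Wronskian of regular solutions for two energies vanishes at 0, where both solutions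
  do, so it equals (E - e) times the integral of their product from 0. Letting E tend to e leaves
  the integral of the square, expressed by a primitive.\<close>

lemma regsol_wronskian_quotient:
  assumes \<tau>: "Im \<tau> > 0" and p: "p \<in> cell \<tau>" and G: "\<And>x. x \<in> cell \<tau> \<Longrightarrow> (G has_field_derivative (regsol \<tau> l e x)\<^sup>2) (at x)"
  shows "((\<lambda>E. wronskian (regsol \<tau> l E) (regsol \<tau> l e) p / (E - e)) \<longlongrightarrow> G p - G 0) (at e)"
proof -
  let ?C = "cell \<tau>" and ?y = "regsol \<tau> l"
  have C0: "0 \<in> ?C" using \<tau> by (simp add: cell_def)
  have seg: "closed_segment 0 p \<subseteq> ?C" by (rule closed_segment_subset[OF C0 p convex_cell])
  have h: "?y E holomorphic_on ?C" for E by (rule regsol_holomorphic[OF \<tau>])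
  have opC: "open ?C" and opC0: "open (?C - {0})" using open_cell[OF \<tau>] by (auto simp: open_delete)
  have neC0: "?C - {0} \<noteq> {}" using quarter_cell(1)[OF \<tau>] by force
  have W: "wronskian (?y E) (?y e) p = (E - e) * contour_integral (linepath 0 p) (\<lambda>x. ?y E x * ?y e x)" for E
  proof -
    let ?w = "wronskian (?y E) (?y e)"
    have wh: "?w holomorphic_on ?C" unfolding wronskian_def[abs_def] by (intro holomorphic_intros holomorphic_deriv[OF _ opC] h)
    \<comment> \<open>The equation holds off the origin only, but both sides are holomorphic on the
      whole cell.\<close>
    have "deriv ?w x = (E - e) * (?y E x * ?y e x)" if "x \<in> ?C" for x
    proof (rule identity_open[where f = "deriv ?w" and S = ?C and g = "\<lambda>x. (E - e) * (?y E x * ?y e x)" and T = "?C - {0}"])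
      show "deriv ?w z = (E - e) * (?y E z * ?y e z)" if "z \<in> ?C - {0}" for z
        using DERIV_imp_deriv[OF wronskian_deriv[OF regsol_ode[OF \<tau>] regsol_ode[OF \<tau>] opC0 that]] by (simp add: mult.assoc)
    qed (use that opC opC0 neC0 convex_connected[OF convex_cell] in \<open>auto intro!: holomorphic_intros holomorphic_deriv[OF wh] h\<close>)
    then have "(?w has_field_derivative (E - e) * (?y E x * ?y e x)) (at x within ?C)" if "x \<in> ?C" for x
      using holomorphic_has_deriv[OF wh opC that] that by (auto intro: has_field_derivative_at_within)
    then have "((\<lambda>x. (E - e) * (?y E x * ?y e x)) has_contour_integral (?w p - ?w 0)) (linepath 0 p)"
      using contour_integral_primitive[of ?C ?w "\<lambda>x. (E - e) * (?y E x * ?y e x)" "linepath 0 p"] seg by simp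
    moreover have "?w 0 = 0" by (simp add: wronskian_def regsol_0[OF \<tau>])
    ultimately have "contour_integral (linepath 0 p) (\<lambda>x. (E - e) * (?y E x * ?y e x)) = ?w p" by (simp add: contour_integral_unique)
    moreover have "(\<lambda>x. ?y E x * ?y e x) contour_integrable_on linepath 0 p"
      by (intro contour_integrable_continuous_linepath holomorphic_on_imp_continuous_on holomorphic_on_mult holomorphic_on_subset[OF _ seg] h)
    ultimately show ?thesis by (simp add: contour_integral_lmul)
  qed
  let ?I = "\<lambda>E. contour_integral (linepath 0 p) (\<lambda>x. ?y E x * ?y e x)"
  have rp: "of_real r * p \<in> ?C" if "r \<in> {0..1}" for r using star_zero_cell[OF \<tau>] p that by (auto simp: star_zero_def)
  have lp: "linepath 0 p r = of_real r * p" for r by (simp add: linepath_def scaleR_conv_of_real)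
  have "continuous_on (UNIV \<times> {0..1}) (\<lambda>y. (\<lambda>(E, x). ?y E x) (fst y, of_real (snd y) * p))"
    by (rule continuous_on_compose2[OF continuous_regsol_energy[OF \<tau>]]) (use rp in \<open>auto intro!: continuous_intros\<close>)
  moreover have "continuous_on (UNIV \<times> {0..1}) (\<lambda>y. ?y e (of_real (snd y) * p))"
    by (rule continuous_on_compose2[OF holomorphic_on_imp_continuous_on[OF h]]) (use rp in \<open>auto intro!: continuous_intros\<close>)
  ultimately have "continuous_on (UNIV \<times> {0..1}) (\<lambda>y. ?y (fst y) (of_real (snd y) * p) * ?y e (of_real (snd y) * p) * p)"
    by (intro continuous_on_mult continuous_on_const) simp_all
  then have "continuous_on UNIV (\<lambda>E. integral (cbox 0 1) (\<lambda>r. ?y E (of_real r * p) * ?y e (of_real r * p) * p))"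
    by (intro integral_continuous_on_param) (simp add: split_beta)
  then have "continuous_on UNIV ?I" unfolding contour_integral_integral lp by simp
  then have "isCont ?I e" by (simp add: continuous_on_eq_continuous_at)
  then have lim: "(?I \<longlongrightarrow> ?I e) (at e)" by (simp add: isCont_def)
  have "((\<lambda>x. (?y e x)\<^sup>2) has_contour_integral (G p - G 0)) (linepath 0 p)"
    using contour_integral_primitive[of ?C G "\<lambda>x. (?y e x)\<^sup>2" "linepath 0 p"] seg G by (auto intro: has_field_derivative_at_within)
  then have "?I e = G p - G 0" by (simp add: contour_integral_unique power2_eq_square)
  with lim have "(?I \<longlongrightarrow> G p - G 0) (at e)" by simp
  then show ?thesis
    by (rule tendsto_cong[THEN iffD1, rotated]) (simp add: eventually_at_filter W)
qed

text \<open>The derivative equals (G(1/2) - G(0)) / k with G a primitive of the square of the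
  eigenfunction. That square is even and 1-periodic, so twice this difference is its integral over a
  period, and the latter is not zero by \<open>square_integral_nonzero\<close>.\<close>

lemma evans_derivative_nonzero:
  assumes \<tau>: "Im \<tau> > 0" and l: "l 0 \<ge> 1" "l 1 \<ge> 1" and e: "evans \<tau> l e = 0" and Q: "Qf \<tau> l e \<noteq> 0" "Q1 \<tau> l e \<noteq> 0"
  shows "deriv (evans \<tau> l) e \<noteq> 0"
proof -
  let ?R = "strip \<tau> - half_ints" and ?m = "l \<circ> swap_half" and ?O = "overlap \<tau>" and ?C = "cell \<tau>"
  obtain F k where F: "ode_sol (\<lambda>x. pot \<tau> l x - e) ?R F"
    and per: "\<And>x. x \<in> ?R \<Longrightarrow> F (x + 1) = (-1) ^ (l 0 + l 1) * F x" and par: "\<And>x. x \<in> ?R \<Longrightarrow> F (- x) = (-1) ^ (l 0 + 1) * F x"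
    and F0: "\<And>x. x \<in> ?C - {0} \<Longrightarrow> F x = regsol \<tau> l e x" and F1: "\<And>x. x \<in> ?C - {0} \<Longrightarrow> F (x + 1/2) = k * regsol \<tau> ?m e x" and k: "k \<noteq> 0"
    using evans_zero_strip_solution[OF \<tau> e] by blast
  have Fh: "F holomorphic_on ?R" using F by (simp add: ode_sol_def)
  note q = overlap_facts[OF \<tau>]
  have CR: "?C - {0} \<subseteq> ?R"
  proof
    fix x assume x: "x \<in> ?C - {0}"
    have "x \<notin> half_ints"
    proof
      assume "x \<in> half_ints"
      then obtain n where n: "2 * x = of_int n" by (auto simp: half_ints_def elim: Ints_cases)
      then have "Re (2 * x) = of_int n" "Im (2 * x) = 0" by simp_all
      then have "\<bar>of_int n\<bar> < (1::real)" "Im x = 0" using x by (auto simp: cell_def)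
      then have "n = 0" by linarith
      then show False using n x by simp
    qed
    then show "x \<in> ?R" using x by (auto simp: strip_def cell_def)
  qed
  have "?O \<noteq> {}" using q(5) by blast
  \<comment> \<open>The Wronskian is constant on the overlap, so it may be evaluated at a point
    where F does not vanish; F p is divided out at the end.\<close>
  then obtain p where p: "p \<in> ?O" "regsol \<tau> l e p \<noteq> 0"
    using regsol_nonzero_open[OF \<tau> q(1)] q(3) by (metis DiffD1 subsetI)
  have pC: "p \<in> ?C - {0}" "p - 1/2 \<in> ?C - {0}" using q p by auto
  have Fp: "F p = regsol \<tau> l e p" "F p = k * half_shift \<tau> l e p"
    using F0[OF pC(1)] F1[OF pC(2)] by (simp_all add: half_shift_def)
  have pR: "p \<in> ?R" using CR pC by blast
  have Fnz: "F p \<noteq> 0" using p Fp by simp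
  obtain H where H: "H holomorphic_on strip \<tau>" and HF: "\<And>z. z \<in> ?R \<Longrightarrow> H z = F z"
    and "(\<lambda>x. H (complex_of_real x)) \<in> Dsp l" "(\<lambda>x. H (complex_of_real x)) \<noteq> (\<lambda>_. 0)" "eigen \<tau> l e (\<lambda>x. H (complex_of_real x))"
    by (rule strip_solution_eigenfunction[OF \<tau> l F per par pR Fnz]) (assumption, assumption, rule that, assumption, simp, assumption+)
  have strip: "open (strip \<tau>)" "convex (strip \<tau>)" "\<And>x. x \<in> strip \<tau> \<Longrightarrow> x + 1 \<in> strip \<tau>" "\<And>x. x \<in> strip \<tau> \<Longrightarrow> - x \<in> strip \<tau>"
    using open_strip convex_strip by (auto simp: strip_def)
  have R: "open ?R" "?R \<noteq> {}" "?R \<subseteq> strip \<tau>" using open_strip_half pR by auto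
  have cs: "connected (strip \<tau>)" by (rule convex_connected[OF strip(2)])
  have ident: "f x = g x" if "f holomorphic_on strip \<tau>" "g holomorphic_on strip \<tau>" "\<And>z. z \<in> ?R \<Longrightarrow> f z = g z" "x \<in> strip \<tau>" for f g :: "complex \<Rightarrow> complex" and x
    by (rule identity_open[where f = f and g = g and S = "strip \<tau>", OF that(1,2) strip(1) cs R that(3,4)])
  define N where "N = (\<lambda>x. (H x)\<^sup>2)"
  have N: "N holomorphic_on strip \<tau>" unfolding N_def by (intro holomorphic_intros H)
  have sq: "((-1) ^ n * z)\<^sup>2 = z\<^sup>2" for n and z :: complex by (simp add: power_mult_distrib power_mult[symmetric] mult.commute[of n 2] power_mult)
  have Nper: "N (x + 1) = N x" if "x \<in> strip \<tau>" for x
  proof (rule ident[where f = "\<lambda>x. N (x + 1)" and g = N, OF _ N _ that])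
    show "(\<lambda>x. N (x + 1)) holomorphic_on strip \<tau>"
      by (rule holomorphic_on_compose_gen[OF _ N, unfolded o_def]) (use strip in \<open>auto intro!: holomorphic_intros\<close>)
    fix z assume z: "z \<in> ?R"
    have "z + 1 \<in> ?R"
    proof -
      have "2 * z \<in> \<int>" if "2 * (z + 1) \<in> \<int>"
        using Ints_diff[OF that, of 2] by (simp add: algebra_simps)
      then show ?thesis using z by (auto simp: strip_def half_ints_def)
    qed
    then show "N (z + 1) = N z" using HF z per[OF z] by (simp add: N_def sq)
  qed
  have Npar: "N (- x) = N x" if "x \<in> strip \<tau>" for x
  proof (rule ident[where f = "\<lambda>x. N (- x)" and g = N, OF _ N _ that])
    show "(\<lambda>x. N (- x)) holomorphic_on strip \<tau>"
      by (rule holomorphic_on_compose_gen[OF _ N, unfolded o_def]) (use strip in \<open>auto intro!: holomorphic_intros\<close>)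
    fix z assume z: "z \<in> ?R"
    then have "- z \<in> ?R" by (auto simp: strip_def half_ints_def)
    then show "N (- z) = N z" using HF z unfolding N_def by (simp only: par[OF z] sq)
  qed
  obtain G where G: "\<And>x. x \<in> strip \<tau> \<Longrightarrow> (G has_field_derivative N x) (at x)"
    "\<And>a b. a \<in> strip \<tau> \<Longrightarrow> b \<in> strip \<tau> \<Longrightarrow> (N has_contour_integral (G b - G a)) (linepath a b)"
    "\<And>a b. a \<in> strip \<tau> \<Longrightarrow> b \<in> strip \<tau> \<Longrightarrow> G (a + 1) - G a = G (b + 1) - G b"
    using periodic_integral_shift[OF strip(1,2,3) N Nper] by metis
  have Cs: "?C \<subseteq> strip \<tau>" "\<And>x. x \<in> ?C \<Longrightarrow> x + 1/2 \<in> strip \<tau>" by (auto simp: cell_def strip_def)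
  have opC: "open ?C" "open (?C - {0})" "connected ?C" "?C - {0} \<noteq> {}"
    using open_cell[OF \<tau>] convex_connected[OF convex_cell] pC by (auto simp: open_delete)
  have H0: "H x = regsol \<tau> l e x" if "x \<in> ?C" for x
    by (rule identity_open[where f = H and g = "regsol \<tau> l e" and S = ?C and T = "?C - {0}",
        OF holomorphic_on_subset[OF H Cs(1)] regsol_holomorphic[OF \<tau>] opC(1,3,2,4) _ _ that]) (use HF F0 CR in auto)
  have CR2: "x + 1/2 \<in> ?R" if "x \<in> ?C - {0}" for x
  proof -
    have "2 * x \<in> \<int>" if "2 * (x + 1/2) \<in> \<int>" using Ints_diff[OF that, of 1] by (simp add: algebra_simps)
    moreover have "x \<notin> half_ints" using CR that by blast
    ultimately show ?thesis using Cs(2) that by (auto simp: half_ints_def)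
  qed
  have H1: "H (x + 1/2) = k * regsol \<tau> ?m e x" if "x \<in> ?C" for x
  proof (rule identity_open[where f = "\<lambda>x. H (x + 1/2)" and g = "\<lambda>x. k * regsol \<tau> ?m e x" and S = ?C and T = "?C - {0}"])
    show "(\<lambda>x. H (x + 1/2)) holomorphic_on ?C"
      by (rule holomorphic_on_compose_gen[OF _ H, unfolded o_def]) (use Cs in \<open>auto intro!: holomorphic_intros\<close>)
    show "H (z + 1/2) = k * regsol \<tau> ?m e z" if "z \<in> ?C - {0}" for z using HF[OF CR2[OF that]] F1[OF that] by simp
  qed (use opC that in \<open>auto intro!: holomorphic_intros regsol_holomorphic[OF \<tau>]\<close>)
  have lim0: "((\<lambda>E. wronskian (regsol \<tau> l E) (regsol \<tau> l e) p / (E - e)) \<longlongrightarrow> G p - G 0) (at e)"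
  proof (rule regsol_wronskian_quotient[OF \<tau>])
    show "(G has_field_derivative (regsol \<tau> l e x)\<^sup>2) (at x)" if "x \<in> ?C" for x
      using G(1)[OF subsetD[OF Cs(1) that]] H0[OF that] by (simp add: N_def)
  qed (use pC in auto)
  have lim1: "((\<lambda>E. wronskian (regsol \<tau> ?m E) (regsol \<tau> ?m e) (p - 1/2) / (E - e)) \<longlongrightarrow> G (p - 1/2 + 1/2) / k\<^sup>2 - G (0 + 1/2) / k\<^sup>2) (at e)"
  proof (rule regsol_wronskian_quotient[OF \<tau>, where G = "\<lambda>x. G (x + 1/2) / k\<^sup>2"])
    fix x assume x: "x \<in> ?C"
    have "((\<lambda>x. G (x + 1/2)) has_field_derivative N (x + 1/2)) (at x)" using G(1)[OF Cs(2)[OF x]] by (simp only: DERIV_shift)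
    from DERIV_cdivide[OF this, of "k\<^sup>2"] show "((\<lambda>x. G (x + 1/2) / k\<^sup>2) has_field_derivative (regsol \<tau> ?m e x)\<^sup>2) (at x)"
      using k by (simp add: N_def H1[OF x] power_mult_distrib)
  qed (use pC in auto)
  have half: "wronskian (half_shift \<tau> l E) (half_shift \<tau> l e) p = wronskian (regsol \<tau> ?m E) (regsol \<tau> ?m e) (p - 1/2)"
    "deriv (half_shift \<tau> l E) p = deriv (regsol \<tau> ?m E) (p - 1/2)" for E
  proof -
    have d: "deriv (half_shift \<tau> l E) p = deriv (regsol \<tau> ?m E) (p - 1/2)" for E
    proof -
      have "(regsol \<tau> ?m E has_field_derivative deriv (regsol \<tau> ?m E) (p - 1/2)) (at (p - 1/2))"
        by (rule holomorphic_has_deriv[OF regsol_holomorphic[OF \<tau>] opC(1)]) (use pC in auto)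
      from DERIV_shift_minus[OF this] show ?thesis unfolding half_shift_def[abs_def] by (rule DERIV_imp_deriv)
    qed
    then show "deriv (half_shift \<tau> l E) p = deriv (regsol \<tau> ?m E) (p - 1/2)" .
    show "wronskian (half_shift \<tau> l E) (half_shift \<tau> l e) p = wronskian (regsol \<tau> ?m E) (regsol \<tau> ?m e) (p - 1/2)"
      unfolding wronskian_def d by (simp add: half_shift_def)
  qed
  have dF: "deriv F p = deriv (regsol \<tau> l e) p" "deriv F p = k * deriv (half_shift \<tau> l e) p"
  proof -
    have Fd: "(F has_field_derivative deriv F p) (at p)" by (rule holomorphic_has_deriv[OF Fh R(1) pR])
    have "(regsol \<tau> l e has_field_derivative deriv F p) (at p)"
      by (rule has_field_derivative_transform_within_open[OF Fd opC(2) pC(1)]) (use F0 in auto)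
    then show "deriv F p = deriv (regsol \<tau> l e) p" by (simp add: DERIV_imp_deriv)
    have "((\<lambda>x. k * half_shift \<tau> l e x) has_field_derivative deriv F p) (at p)"
      by (rule has_field_derivative_transform_within_open[OF Fd q(1) p(1)]) (use F1 q(4) in \<open>force simp: half_shift_def\<close>)
    moreover have "(half_shift \<tau> l e has_field_derivative deriv (half_shift \<tau> l e) p) (at p)"
    proof (rule holomorphic_has_deriv[OF _ q(1) p(1)])
      have "half_shift \<tau> l e holomorphic_on {z. z - 1/2 \<in> ?C - {0}}" using half_shift_ode[OF \<tau>] by (simp add: ode_sol_def)
      then show "half_shift \<tau> l e holomorphic_on ?O" by (rule holomorphic_on_subset) (use q(4) in auto)
    qed
    ultimately show "deriv F p = k * deriv (half_shift \<tau> l e) p" using DERIV_unique DERIV_cmult by blast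
  qed
  text \<open>Expanding the Wronskian at two energies along \<open>F\<close>, which is proportional to both regular solutions at \<open>e\<close>.\<close>
  have expand: "evans \<tau> l E * F p = half_shift \<tau> l E p * wronskian (regsol \<tau> l E) (regsol \<tau> l e) p
      - k * regsol \<tau> l E p * wronskian (regsol \<tau> ?m E) (regsol \<tau> ?m e) (p - 1/2)" for E
  proof -
    have y: "ode_sol (\<lambda>x. pot \<tau> l x - E) ?O (regsol \<tau> l E)" by (rule ode_sol_subset[OF regsol_ode[OF \<tau>]]) (use q in auto)
    have z: "ode_sol (\<lambda>x. pot \<tau> l x - E) ?O (half_shift \<tau> l E)" by (rule ode_sol_subset[OF half_shift_ode[OF \<tau>]]) (use q in auto)
    have ev: "evans \<tau> l E = wronskian (regsol \<tau> l E) (half_shift \<tau> l E) p"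
      unfolding evans_eq_wronskian[OF \<tau>] by (rule wronskian_const[OF y z q(1,2,5) p(1)])
    have "evans \<tau> l E * F p = half_shift \<tau> l E p * (regsol \<tau> l E p * deriv F p - deriv (regsol \<tau> l E) p * F p)
        - regsol \<tau> l E p * (half_shift \<tau> l E p * deriv F p - deriv (half_shift \<tau> l E) p * F p)"
      unfolding ev wronskian_def by (simp add: algebra_simps)
    also have "regsol \<tau> l E p * deriv F p - deriv (regsol \<tau> l E) p * F p = wronskian (regsol \<tau> l E) (regsol \<tau> l e) p"
      unfolding wronskian_def Fp(1) dF(1) ..
    also have "half_shift \<tau> l E p * deriv F p - deriv (half_shift \<tau> l E) p * F p = k * wronskian (half_shift \<tau> l E) (half_shift \<tau> l e) p"
      unfolding wronskian_def Fp(2) dF(2) by (simp add: algebra_simps)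
    also have "wronskian (half_shift \<tau> l E) (half_shift \<tau> l e) p = wronskian (regsol \<tau> ?m E) (regsol \<tau> ?m e) (p - 1/2)"
      by (rule half(1))
    finally show ?thesis by (simp add: mult_ac)
  qed
  have cont: "((\<lambda>E. regsol \<tau> m E c) \<longlongrightarrow> regsol \<tau> m e c) (at e)" if c: "c \<in> ?C" for m c
  proof -
    have "continuous_on UNIV (\<lambda>E. (\<lambda>(E, x). regsol \<tau> m E x) (E, c))"
      by (rule continuous_on_compose2[OF continuous_regsol_energy[OF \<tau>]]) (use c in \<open>auto intro!: continuous_intros\<close>)
    then have "isCont (\<lambda>E. regsol \<tau> m E c) e" by (simp add: continuous_on_eq_continuous_at)
    then show ?thesis by (simp add: isCont_def)
  qed
  have "((\<lambda>E. half_shift \<tau> l E p * (wronskian (regsol \<tau> l E) (regsol \<tau> l e) p / (E - e))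
      - k * regsol \<tau> l E p * (wronskian (regsol \<tau> ?m E) (regsol \<tau> ?m e) (p - 1/2) / (E - e))) \<longlongrightarrow>
      half_shift \<tau> l e p * (G p - G 0) - k * regsol \<tau> l e p * (G (p - 1/2 + 1/2) / k\<^sup>2 - G (0 + 1/2) / k\<^sup>2)) (at e)"
    unfolding half_shift_def by (intro tendsto_intros lim0 lim1 cont) (use pC in auto)
  moreover have "half_shift \<tau> l E p * (wronskian (regsol \<tau> l E) (regsol \<tau> l e) p / (E - e))
      - k * regsol \<tau> l E p * (wronskian (regsol \<tau> ?m E) (regsol \<tau> ?m e) (p - 1/2) / (E - e)) = (evans \<tau> l E * F p) / (E - e)" for E
    unfolding expand by (simp add: diff_divide_distrib)
  \<comment> \<open>By proportionality both terms carry the factor F p / k, so G p cancels and only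
    the values at 0 and 1/2 remain.\<close>
  moreover have "half_shift \<tau> l e p * (G p - G 0) - k * regsol \<tau> l e p * (G (p - 1/2 + 1/2) / k\<^sup>2 - G (0 + 1/2) / k\<^sup>2) = F p / k * (G (1/2) - G 0)"
    using k Fp by (simp add: field_simps power2_eq_square)
  ultimately have "((\<lambda>E. evans \<tau> l E * F p / (E - e)) \<longlongrightarrow> F p / k * (G (1/2) - G 0)) (at e)" by simp
  from tendsto_divide[OF this tendsto_const[of "F p"] Fnz]
  have "((\<lambda>E. (evans \<tau> l E - evans \<tau> l e) / (E - e)) \<longlongrightarrow> (G (1/2) - G 0) / k) (at e)" using Fnz e by simp
  then have d: "deriv (evans \<tau> l) e = (G (1/2) - G 0) / k"
    by (intro DERIV_imp_deriv) (simp add: has_field_derivative_iff)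
  \<comment> \<open>The primitive of an even function is odd up to a constant, so the integrals over
    (-1/2, 0) and (0, 1/2) agree.\<close>
  have G0: "G (1/2) + G (- (1/2)) = G 0 + G (- 0)"
  proof (rule deriv_zero_constant[OF strip(1) cs, where f = "\<lambda>x. G x + G (- x)"])
    fix x assume x: "x \<in> strip \<tau>"
    have "((\<lambda>x. G (- x)) has_field_derivative N (- x) * (- 1)) (at x)"
      by (rule DERIV_chain2[where f = G, OF G(1)[OF strip(4)[OF x]] DERIV_minus[OF DERIV_ident]])
    from DERIV_add[OF G(1)[OF x] this] show "((\<lambda>x. G x + G (- x)) has_field_derivative 0) (at x)" using Npar[OF x] by simp
  qed (use \<tau> in \<open>auto simp: strip_def\<close>)
  have a: "\<tau>/4 \<in> upper \<tau>" using \<tau> by (simp add: upper_def)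
  have a': "\<tau>/4 \<in> strip \<tau>" "- (1/2) \<in> strip \<tau>" using \<tau> by (auto simp: strip_def)
  have "contour_integral (linepath (\<tau>/4) (\<tau>/4 + 1)) (\<lambda>x. (F x)\<^sup>2) = contour_integral (linepath (\<tau>/4) (\<tau>/4 + 1)) N"
  proof (rule contour_integral_eq)
    fix x assume "x \<in> path_image (linepath (\<tau>/4) (\<tau>/4 + 1))"
    then have "x \<in> upper \<tau>" using closed_segment_subset[OF a _ upper_facts(2)] a upper_facts(4) by (metis path_image_linepath subsetD)
    then have "x \<in> ?R" using upper_facts(3) by blast
    from HF[OF this] show "(F x)\<^sup>2 = N x" by (simp add: N_def)
  qed
  also have "\<dots> = G (\<tau>/4 + 1) - G (\<tau>/4)" by (rule contour_integral_unique[OF G(2)[OF a'(1) strip(3)[OF a'(1)]]])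
  also have "\<dots> = G (- (1/2) + 1) - G (- (1/2))" by (rule G(3)[OF a'])
  also have "\<dots> = 2 * (G (1/2) - G 0)" using G0 by (simp add: algebra_simps)
  finally have "2 * (G (1/2) - G 0) \<noteq> 0"
    using square_integral_nonzero[OF \<tau> Q(1) F per par ode_sol_upper_nonzero[OF \<tau> Fh pR Fnz] Q(2) a] by simp
  then show ?thesis using k unfolding d by simp
qed

subsection \<open>An implicit function theorem\<close>

lemma holomorphic_lipschitz:
  fixes f :: "complex \<Rightarrow> complex"
  assumes f: "f holomorphic_on UNIV" and S: "convex S" and B: "\<And>z. z \<in> S \<Longrightarrow> norm (deriv f z) \<le> B" and xy: "x \<in> S" "y \<in> S"
  shows "norm (f x - f y) \<le> B * norm (x - y)"
  by (rule field_differentiable_bound[OF S _ B xy])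
    (auto intro: has_field_derivative_at_within holomorphic_has_deriv[OF f])

text \<open>Newton's iteration with the fixed slope \<open>c = \<partial>W/\<partial>E (e0, t0)\<close> is a contraction, uniformly in \<open>t\<close>
  near \<open>t0\<close>; the iterates are holomorphic in \<open>t\<close>, hence so is their uniform limit.\<close>

lemma holomorphic_implicit_function:
  fixes W :: "complex \<Rightarrow> complex \<Rightarrow> complex"
  assumes T: "open T" "t0 \<in> T" and cont: "continuous_on (UNIV \<times> T) (\<lambda>p. W (fst p) (snd p))"
    and hol: "\<And>A e t. open A \<Longrightarrow> e holomorphic_on A \<Longrightarrow> t holomorphic_on A \<Longrightarrow> (\<And>z. z \<in> A \<Longrightarrow> t z \<in> T) \<Longrightarrow> (\<lambda>z. W (e z) (t z)) holomorphic_on A"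
    and W0: "W e0 t0 = 0" and c: "deriv (\<lambda>E. W E t0) e0 \<noteq> 0"
  obtains r e where "r > 0" "ball t0 r \<subseteq> T" "e holomorphic_on ball t0 r" "e t0 = e0" "\<And>t. t \<in> ball t0 r \<Longrightarrow> W (e t) t = 0"
proof -
  define c where "c = deriv (\<lambda>E. W E t0) e0"
  have c0: "c \<noteq> 0" using c by (simp add: c_def)
  have WE: "(\<lambda>E. W E t) holomorphic_on UNIV" if "t \<in> T" for t
    using hol[OF open_UNIV holomorphic_on_ident holomorphic_on_const] that by simp
  have "continuous_on UNIV (deriv (\<lambda>E. W E t0))"
    by (intro holomorphic_on_imp_continuous_on holomorphic_deriv WE T open_UNIV)
  then have "isCont (deriv (\<lambda>E. W E t0)) e0" by (simp add: continuous_on_eq_continuous_at)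
  then obtain \<rho>' where \<rho>': "\<rho>' > 0" "\<And>E. dist E e0 < \<rho>' \<Longrightarrow> dist (deriv (\<lambda>E. W E t0) E) c < norm c / 4"
    unfolding continuous_at_eps_delta c_def[symmetric] using c0 by (metis divide_pos_pos zero_less_norm_iff zero_less_numeral)
  define \<rho> where "\<rho> = \<rho>' / 2"
  have \<rho>: "\<rho> > 0" using \<rho>' by (simp add: \<rho>_def)
  have dW0: "norm (deriv (\<lambda>E. W E t0) E - c) \<le> norm c / 4" if "E \<in> cball e0 \<rho>" for E
    using \<rho>'(2)[of E] that \<rho> by (simp add: dist_norm \<rho>_def norm_minus_commute)
  obtain r0 where r0: "r0 > 0" "cball t0 r0 \<subseteq> T" using T open_contains_cball by blast
  \<comment> \<open>This size of perturbation serves twice: Cauchy's inequality on radius \<rho>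
    bounds the change of the slope by \<eta> / \<rho> = |c| / 4, and the first Newton step moves e0
    by at most \<eta> / |c| = \<rho> / 4.\<close>
  define \<eta> where "\<eta> = norm c * \<rho> / 4"
  have \<eta>: "\<eta> > 0" using c0 \<rho> by (simp add: \<eta>_def)
  \<comment> \<open>The radius is doubled because Cauchy's inequality is applied on circles of
    radius \<rho> centred anywhere in \<open>cball e0 \<rho>\<close>.\<close>
  have "compact (cball e0 (2 * \<rho>) \<times> cball t0 r0)" by (intro compact_Times compact_cball)
  moreover have "continuous_on (cball e0 (2 * \<rho>) \<times> cball t0 r0) (\<lambda>p. W (fst p) (snd p))"
    by (rule continuous_on_subset[OF cont]) (use r0 in auto)
  ultimately have "uniformly_continuous_on (cball e0 (2 * \<rho>) \<times> cball t0 r0) (\<lambda>p. W (fst p) (snd p))"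
    by (intro compact_uniformly_continuous)
  then obtain d where d: "d > 0" "\<And>p p'. p \<in> cball e0 (2 * \<rho>) \<times> cball t0 r0 \<Longrightarrow> p' \<in> cball e0 (2 * \<rho>) \<times> cball t0 r0 \<Longrightarrow>
      dist p' p < d \<Longrightarrow> dist (W (fst p') (snd p')) (W (fst p) (snd p)) < \<eta>"
    using \<eta> unfolding uniformly_continuous_on_def by metis
  define r where "r = min r0 d"
  have r: "r > 0" "ball t0 r \<subseteq> T" "ball t0 r \<subseteq> cball t0 r0" using r0 d by (auto simp: r_def)
  have close: "norm (W E t - W E t0) \<le> \<eta>" if "E \<in> cball e0 (2 * \<rho>)" "t \<in> ball t0 r" for E t
  proof -
    have "dist (E, t) (E, t0) < d" using that by (simp add: dist_Pair_Pair r_def dist_commute)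
    from d(2)[OF _ _ this] that r r0 show ?thesis by (force simp: dist_norm)
  qed
  have dW: "norm (deriv (\<lambda>E. W E t) E - c) \<le> norm c / 2" if E: "E \<in> cball e0 \<rho>" and t: "t \<in> ball t0 r" for E t
  proof -
    have tT: "t \<in> T" using t r by blast
    have h: "(\<lambda>E. W E t - W E t0) holomorphic_on A" for A
      by (rule holomorphic_on_subset[of _ UNIV]) (auto intro!: holomorphic_on_diff WE tT T)
    have "norm ((deriv ^^ 1) (\<lambda>E. W E t - W E t0) E) \<le> fact 1 * \<eta> / \<rho> ^ 1"
    proof (rule Cauchy_inequality[OF h holomorphic_on_imp_continuous_on[OF h] \<rho>])
      fix x assume "norm (E - x) = \<rho>"
      then have "dist e0 x \<le> 2 * \<rho>" using E dist_triangle[of e0 x E] by (simp add: dist_norm)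
      then show "norm (W x t - W x t0) \<le> \<eta>" using close t by simp
    qed
    moreover have "deriv (\<lambda>E. W E t - W E t0) E = deriv (\<lambda>E. W E t) E - deriv (\<lambda>E. W E t0) E"
      by (intro DERIV_imp_deriv DERIV_diff holomorphic_has_deriv[OF WE open_UNIV] tT T UNIV_I)
    moreover have "\<eta> / \<rho> = norm c / 4" using \<rho> by (simp add: \<eta>_def)
    ultimately have "norm (deriv (\<lambda>E. W E t) E - deriv (\<lambda>E. W E t0) E) \<le> norm c / 4" by simp
    then show ?thesis using dW0[OF E] norm_triangle_ineq[of "deriv (\<lambda>E. W E t) E - deriv (\<lambda>E. W E t0) E" "deriv (\<lambda>E. W E t0) E - c"] by simp
  qed
  define N where "N = (\<lambda>t E. E - W E t / c)"
  have Nlip: "norm (N t E - N t E') \<le> 1/2 * norm (E - E')" if "E \<in> cball e0 \<rho>" "E' \<in> cball e0 \<rho>" "t \<in> ball t0 r" for E E' t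
  proof (rule holomorphic_lipschitz[of "N t" "cball e0 \<rho>"])
    have tT: "t \<in> T" using that r by blast
    show "N t holomorphic_on UNIV" unfolding N_def by (intro holomorphic_intros WE tT c0)
    fix z assume z: "z \<in> cball e0 \<rho>"
    have "((N t) has_field_derivative 1 - deriv (\<lambda>E. W E t) z / c) (at z)"
      unfolding N_def by (intro DERIV_diff DERIV_ident DERIV_cdivide holomorphic_has_deriv[OF WE open_UNIV] tT UNIV_I)
    then have "deriv (N t) z = (c - deriv (\<lambda>E. W E t) z) / c" using c0 by (simp add: DERIV_imp_deriv diff_divide_distrib)
    then have "norm (deriv (N t) z) = norm (deriv (\<lambda>E. W E t) z - c) / norm c" by (simp add: norm_divide norm_minus_commute)
    also have "\<dots> \<le> norm c / 2 / norm c" by (intro divide_right_mono dW z that norm_ge_zero)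
    finally show "norm (deriv (N t) z) \<le> 1/2" using c0 by simp
  qed (use that in auto)
  have N0: "norm (N t e0 - e0) \<le> \<rho> / 4" if "t \<in> ball t0 r" for t
  proof -
    have "norm (W e0 t) \<le> \<eta>" using close[of e0 t] that \<rho> W0 by simp
    then have "norm (W e0 t) / norm c \<le> \<eta> / norm c" by (intro divide_right_mono) auto
    then show ?thesis using c0 by (simp add: N_def norm_divide \<eta>_def)
  qed
  have Nin: "N t E \<in> cball e0 \<rho>" if "E \<in> cball e0 \<rho>" "t \<in> ball t0 r" for E t
  proof -
    have "norm (N t E - N t e0) \<le> 1/2 * norm (E - e0)" by (rule Nlip) (use that \<rho> in auto)
    moreover have "norm (E - e0) \<le> \<rho>" using that by (simp add: dist_norm norm_minus_commute)
    ultimately have "norm (N t E - e0) \<le> \<rho>"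
      using N0[OF that(2)] norm_triangle_ineq[of "N t E - N t e0" "N t e0 - e0"] \<rho> by simp
    then show ?thesis by (simp add: dist_norm norm_minus_commute)
  qed
  define e where "e = (\<lambda>n t. (N t ^^ n) e0)"
  have e0: "e 0 t = e0" and eS: "e (Suc n) t = N t (e n t)" for n t by (simp_all add: e_def)
  have ein: "e n t \<in> cball e0 \<rho>" if "t \<in> ball t0 r" for n t
    using Nin that \<rho> by (induction n) (auto simp: e0 eS)
  have ehol: "e n holomorphic_on ball t0 r" for n
  proof (induction n)
    case 0 then show ?case using e0 by simp
  next
    case (Suc n)
    have "(\<lambda>t. e n t - W (e n t) t / c) holomorphic_on ball t0 r"
      by (intro holomorphic_intros Suc hol open_ball c0) (use r in auto)
    then show ?case by (simp add: eS[abs_def] N_def)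
  qed
  have step: "norm (e (Suc n) t - e n t) \<le> \<rho> * (1/2) ^ n" if t: "t \<in> ball t0 r" for n t
  proof (induction n)
    case 0 show ?case using N0[OF t] \<rho> by (simp add: e0 eS)
  next
    case (Suc n)
    have "norm (e (Suc (Suc n)) t - e (Suc n) t) \<le> 1/2 * norm (e (Suc n) t - e n t)"
      unfolding eS[of "Suc n"] eS[of n] by (intro Nlip Nin ein t)
    then show ?case using Suc by simp
  qed
  \<comment> \<open>The Newton steps shrink geometrically at a rate independent of t, so the
    telescoping series of steps converges uniformly.\<close>
  have "uniform_limit (ball t0 r) (\<lambda>n t. \<Sum>k<n. e (Suc k) t - e k t) (\<lambda>t. \<Sum>k. e (Suc k) t - e k t) sequentially"
    by (rule Weierstrass_m_test[of _ _ "\<lambda>n. \<rho> * (1/2) ^ n"]) (auto intro!: step summable_mult summable_geometric)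
  moreover have "(\<Sum>k<n. e (Suc k) t - e k t) = e n t - e0" for n t
    using sum_lessThan_telescope[of "\<lambda>k. e k t" n] by (simp add: e0)
  ultimately have ul0: "uniform_limit (ball t0 r) (\<lambda>n t. e n t - e0) (\<lambda>t. \<Sum>k. e (Suc k) t - e k t) sequentially" by simp
  define ee where "ee = (\<lambda>t. (\<Sum>k. e (Suc k) t - e k t) + e0)"
  have "uniform_limit (ball t0 r) (\<lambda>n t. (e n t - e0) + e0) (\<lambda>t. (\<Sum>k. e (Suc k) t - e k t) + e0) sequentially"
    by (intro uniform_limit_add ul0 uniform_limit_const)
  then have ul: "uniform_limit (ball t0 r) e ee sequentially" by (simp add: ee_def)
  have lim: "(\<lambda>n. e n t) \<longlonglongrightarrow> ee t" if "t \<in> ball t0 r" for t by (rule tendsto_uniform_limitI[OF ul that])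
  have "ee holomorphic_on ball t0 r"
  proof (rule holomorphic_uniform_sequence[OF open_ball ehol])
    fix x assume "x \<in> ball t0 r"
    then obtain d where "d > 0" "cball x d \<subseteq> ball t0 r" using open_ball[of t0 r, unfolded open_contains_cball] by blast
    then show "\<exists>d>0. cball x d \<subseteq> ball t0 r \<and> uniform_limit (cball x d) e ee sequentially"
      using uniform_limit_on_subset[OF ul] by blast
  qed
  moreover have "W (ee t) t = 0" if t: "t \<in> ball t0 r" for t
  proof -
    have tT: "t \<in> T" using t r by blast
    have "isCont (\<lambda>E. W E t) (ee t)"
      using holomorphic_on_imp_continuous_on[OF WE[OF tT]] by (simp add: continuous_on_eq_continuous_at)
    from isCont_tendsto_compose[OF this lim[OF t]] have "(\<lambda>n. W (e n t) t) \<longlonglongrightarrow> W (ee t) t" .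
    from tendsto_diff[OF lim[OF t] tendsto_divide[OF this tendsto_const c0]]
    have "(\<lambda>n. e (Suc n) t) \<longlonglongrightarrow> ee t - W (ee t) t / c" by (simp add: eS N_def)
    moreover have "(\<lambda>n. e (Suc n) t) \<longlonglongrightarrow> ee t" by (rule LIMSEQ_Suc[OF lim[OF t]])
    ultimately have "ee t - W (ee t) t / c = ee t" by (rule LIMSEQ_unique)
    then show ?thesis using c0 by simp
  qed
  moreover have "ee t0 = e0"
  proof -
    have "e n t0 = e0" for n by (induction n) (auto simp: e0 eS N_def W0)
    then show ?thesis by (simp add: ee_def)
  qed
  ultimately show ?thesis using that[of r ee] r by blast
qed

subsection \<open>Continuation of eigenvalues\<close>

lemma eigen_shift_tau:
  assumes \<tau>: "Im \<tau> > 0" and f: "eigen \<tau> l E f" shows "eigen (\<tau> + of_int (2 * k)) l E f"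
  using f unfolding eigen_def poles_shift_tau using pot_shift_tau[OF \<tau>, of _ l k] by metis

lemma evans_zero_imp_eigen:
  assumes \<tau>: "Im \<tau> > 0" and l: "l 0 \<ge> 1" "l 1 \<ge> 1" and e: "evans \<tau> l E = 0"
  shows "\<exists>g\<in>Dsp l. g \<noteq> (\<lambda>_. 0) \<and> eigen \<tau> l E g"
proof -
  obtain F k where F: "ode_sol (\<lambda>x. pot \<tau> l x - E) (strip \<tau> - half_ints) F"
    and per: "\<And>x. x \<in> strip \<tau> - half_ints \<Longrightarrow> F (x + 1) = (-1) ^ (l 0 + l 1) * F x"
    and par: "\<And>x. x \<in> strip \<tau> - half_ints \<Longrightarrow> F (- x) = (-1) ^ (l 0 + 1) * F x"
    and F0: "\<And>x. x \<in> cell \<tau> - {0} \<Longrightarrow> F x = regsol \<tau> l E x"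
    and "\<And>x. x \<in> cell \<tau> - {0} \<Longrightarrow> F (x + 1/2) = k * regsol \<tau> (l \<circ> swap_half) E x" and "k \<noteq> 0"
    using evans_zero_strip_solution[OF \<tau> e] by blast
  have "overlap \<tau> \<noteq> {}" using overlap_facts(5)[OF \<tau>] by blast
  then obtain a where a: "a \<in> overlap \<tau>" "regsol \<tau> l E a \<noteq> 0"
    using regsol_nonzero_open[OF \<tau> overlap_facts(1)[OF \<tau>]] overlap_facts(3)[OF \<tau>] by (metis DiffD1 subsetI)
  have "a \<notin> half_ints"
  proof
    assume "a \<in> half_ints"
    then obtain n where "2 * a = of_int n" by (auto simp: half_ints_def elim: Ints_cases)
    then have "Re (2 * a) = of_int n" by simp
    then have "0 < real_of_int n" "real_of_int n < 1" using a(1) by (auto simp: overlap_def)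
    then show False by simp
  qed
  then have aR: "a \<in> strip \<tau> - half_ints" using a(1) by (auto simp: overlap_def strip_def)
  have Fa: "F a \<noteq> 0" using F0[OF overlap_facts(3)[OF \<tau> a(1)]] a(2) by simp
  obtain H where "H holomorphic_on strip \<tau>" "\<And>z. z \<in> strip \<tau> - half_ints \<Longrightarrow> H z = F z"
    and H: "(\<lambda>x. H (complex_of_real x)) \<in> Dsp l" "(\<lambda>x. H (complex_of_real x)) \<noteq> (\<lambda>_. 0)" "eigen \<tau> l E (\<lambda>x. H (complex_of_real x))"
    by (rule strip_solution_eigenfunction[OF \<tau> l F per par aR Fa]) (assumption, assumption, rule that, assumption, simp, assumption+)
  then show ?thesis by blast
qed

text \<open>The implicit function theorem gives the eigenvalue as a function of tau near the given
  modulus. A local inverse of tau -> exp(pi i tau) makes it a function of p, and all other moduli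
  with the same p are covered by the invariance under even shifts.\<close>

theorem eigenvalue_continuation:
  assumes \<tau>: "Im \<tau>s > 0" and l: "l 0 \<ge> 1" "l 1 \<ge> 1" and Q: "Q1 \<tau>s l Es \<noteq> 0" "Qf \<tau>s l Es \<noteq> 0"
    and f: "f \<in> Dsp l" "f \<noteq> (\<lambda>_. 0)" "eigen \<tau>s l Es f"
  shows "\<exists>r>0. \<exists>Ef. Ef holomorphic_on ball (exp (pi * \<i> * \<tau>s)) r \<and> Ef (exp (pi * \<i> * \<tau>s)) = Es \<and>
    (\<forall>\<tau>. Im \<tau> > 0 \<and> exp (pi * \<i> * \<tau>) \<in> ball (exp (pi * \<i> * \<tau>s)) r \<longrightarrow>
      (\<exists>g\<in>Dsp l. g \<noteq> (\<lambda>_. 0) \<and> eigen \<tau> l (Ef (exp (pi * \<i> * \<tau>))) g))"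
proof -
  let ?T = "{t::complex. Im t > 0}"
  have ev: "evans \<tau>s l Es = 0" by (rule eigen_imp_evans_zero[OF \<tau> f])
  have opT: "open ?T" by (rule open_halfspace_Im_gt)
  have cont: "continuous_on (UNIV \<times> ?T) (\<lambda>p. evans (snd p) l (fst p))"
    by (rule continuous_on_subset[OF continuous_evans]) auto
  obtain r1 e where r1: "r1 > 0" "ball \<tau>s r1 \<subseteq> ?T" and e: "e holomorphic_on ball \<tau>s r1" "e \<tau>s = Es"
    and W: "\<And>t. t \<in> ball \<tau>s r1 \<Longrightarrow> evans t l (e t) = 0"
  proof (rule holomorphic_implicit_function[OF opT _ cont, of \<tau>s Es])
    show "\<tau>s \<in> ?T" using \<tau> by simp
    show "(\<lambda>z. evans (t z) l (e z)) holomorphic_on A"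
      if "open A" "e holomorphic_on A" "t holomorphic_on A" "\<And>z. z \<in> A \<Longrightarrow> t z \<in> ?T" for A e t
      by (rule holomorphic_evans_curve) (use that in auto)
    show "deriv (evans \<tau>s l) Es \<noteq> 0" by (rule evans_derivative_nonzero[OF \<tau> l ev Q(2,1)])
  qed (use ev that in auto)
  define p where "p = exp (pi * \<i> * \<tau>s)"
  have p: "p \<noteq> 0" by (simp add: p_def)
  \<comment> \<open>The local inverse through the given modulus. Dividing by p first puts the
    argument of \<open>Ln\<close> into the right half plane on the ball of radius |p|, clear of the
    branch cut.\<close>
  define \<theta> where "\<theta> = (\<lambda>z. \<tau>s + Ln (z / p) / (pi * \<i>))"
  have re: "Re (z / p) > 0" if "z \<in> ball p (norm p)" for z
  proof -
    have "norm (z / p - 1) = norm (z - p) / norm p" using p by (simp add: norm_divide[symmetric] diff_divide_distrib)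
    also have "\<dots> < 1" using that p by (simp add: dist_norm norm_minus_commute)
    finally show ?thesis using abs_Re_le_cmod[of "z / p - 1"] by simp
  qed
  have \<theta>h: "\<theta> holomorphic_on ball p (norm p)"
    unfolding \<theta>_def by (intro holomorphic_intros) (use p re in \<open>force simp: complex_nonpos_Reals_iff\<close>)+
  have \<theta>exp: "exp (pi * \<i> * \<theta> z) = z" if "z \<in> ball p (norm p)" for z
  proof -
    have "z / p \<noteq> 0" using re[OF that] by auto
    then have "exp (pi * \<i> * \<tau>s + Ln (z / p)) = z" using p by (simp add: exp_add exp_Ln p_def[symmetric])
    moreover have "pi * \<i> * \<theta> z = pi * \<i> * \<tau>s + Ln (z / p)" by (simp add: \<theta>_def distrib_left)
    ultimately show ?thesis by simp
  qed
  have \<theta>p: "\<theta> p = \<tau>s" using p by (simp add: \<theta>_def)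
  have "open (ball p (norm p) \<inter> \<theta> -` ball \<tau>s r1)"
    using holomorphic_on_imp_continuous_on[OF \<theta>h] by (intro continuous_open_preimage) auto
  moreover have "p \<in> ball p (norm p) \<inter> \<theta> -` ball \<tau>s r1" using p r1 \<theta>p by simp
  ultimately obtain r where r: "r > 0" "ball p r \<subseteq> ball p (norm p) \<inter> \<theta> -` ball \<tau>s r1" using open_contains_ball by blast
  have "(\<lambda>z. e (\<theta> z)) holomorphic_on ball p r"
    by (rule holomorphic_on_compose_gen[OF holomorphic_on_subset[OF \<theta>h] e(1), unfolded o_def]) (use r(2) in auto)
  moreover have "e (\<theta> p) = Es" by (simp add: \<theta>p e)
  moreover have "\<exists>g\<in>Dsp l. g \<noteq> (\<lambda>_. 0) \<and> eigen \<tau> l (e (\<theta> (exp (pi * \<i> * \<tau>)))) g"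
    if "Im \<tau> > 0" "exp (pi * \<i> * \<tau>) \<in> ball p r" for \<tau>
  proof -
    define z where "z = exp (pi * \<i> * \<tau>)"
    have z: "z \<in> ball p (norm p)" "\<theta> z \<in> ball \<tau>s r1" using that(2) r(2) by (auto simp: z_def)
    have Im: "Im (\<theta> z) > 0" using z(2) r1(2) by blast
    have "exp (pi * \<i> * \<tau>) = exp (pi * \<i> * \<theta> z)" using \<theta>exp[OF z(1)] by (simp add: z_def)
    \<comment> \<open>Equal exponentials differ by a multiple of 2 pi i in the exponent, so the two
      moduli differ by an even integer, which leaves the potential unchanged off its poles.\<close>
    then obtain n :: int where "pi * \<i> * \<tau> = pi * \<i> * \<theta> z + of_int (2 * n) * pi * \<i>" by (auto simp: exp_eq)
    then have "pi * \<i> * \<tau> = pi * \<i> * (\<theta> z + of_int (2 * n))" by (simp add: algebra_simps)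
    then have \<tau>: "\<tau> = \<theta> z + of_int (2 * n)" by simp
    obtain g where g: "g \<in> Dsp l" "g \<noteq> (\<lambda>_. 0)" "eigen (\<theta> z) l (e (\<theta> z)) g"
      using evans_zero_imp_eigen[OF Im l W[OF z(2)]] by blast
    have "eigen \<tau> l (e (\<theta> z)) g" unfolding \<tau> by (rule eigen_shift_tau[OF Im g(3)])
    then show ?thesis using g by (auto simp: z_def)
  qed
  ultimately show ?thesis unfolding p_def[symmetric] using r(1)
    by (intro exI[of _ r] conjI exI[of _ "\<lambda>z. e (\<theta> z)"]) auto
qed

theorem theorem4p7:
  fixes l :: "nat \<Rightarrow> nat"
  assumes l0: "l 0 \<ge> 1" and l1: "l 1 \<ge> 1"
  shows
   "(\<forall>\<tau> E0 Es \<gamma> s Lam0 LamS I.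
       Im \<tau> > 0 \<and> valid_path \<gamma> \<and> pathstart \<gamma> = E0 \<and> pathfinish \<gamma> = Es \<and>
       continuous_on {0..1} s \<and> (\<forall>t\<in>{0..1}. (s t)^2 = - Qf \<tau> l (\<gamma> t)) \<and>
       (\<forall>t\<in>{0<..1}. Qf \<tau> l (\<gamma> t) \<noteq> 0) \<and>
       Lam_spec \<tau> l E0 (s 0) Lam0 \<and> (\<forall>x\<in>- poles \<tau> l. Lam0 (x + 1) = Lam0 x) \<and>
       Lam_spec \<tau> l Es (s 1) LamS \<and>
       ((\<lambda>t. Q1 \<tau> l (\<gamma> t) / s t * vector_derivative \<gamma> (at t)) has_integral I) {0..1} \<and>
       (\<exists>k::int. I = 2 * of_nat (l 0 + l 1) * pi * \<i> + 4 * pi * \<i> * of_int k)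
     \<longrightarrow> (\<exists>f\<in>Dsp l. f \<noteq> (\<lambda>_. 0) \<and>
            (\<forall>x::real. complex_of_real x \<notin> poles \<tau> l \<longrightarrow>
               f x = LamS (complex_of_real x) - (-1) ^ l 0 * LamS (- complex_of_real x))))
  \<and>
   (\<forall>\<tau>s Es f.
       Im \<tau>s > 0 \<and> Q1 \<tau>s l Es \<noteq> 0 \<and> Qf \<tau>s l Es \<noteq> 0 \<and>
       f \<in> Dsp l \<and> f \<noteq> (\<lambda>_. 0) \<and> eigen \<tau>s l Es f
     \<longrightarrow> (\<exists>r>0. \<exists>Ef. Ef holomorphic_on ball (exp (pi * \<i> * \<tau>s)) r \<and>
            Ef (exp (pi * \<i> * \<tau>s)) = Es \<and>
            (\<forall>\<tau>. Im \<tau> > 0 \<and> exp (pi * \<i> * \<tau>) \<in> ball (exp (pi * \<i> * \<tau>s)) r \<longrightarrow>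
               (\<exists>g\<in>Dsp l. g \<noteq> (\<lambda>_. 0) \<and> eigen \<tau> l (Ef (exp (pi * \<i> * \<tau>))) g))))"
proof (intro conjI allI impI, goal_cases)
  case (1 \<tau> E0 Es \<gamma> s Lam0 LamS I)
  then obtain k :: int where "I = 2 * of_nat (l 0 + l 1) * pi * \<i> + 4 * pi * \<i> * of_int k" by blast
  with 1 show ?case by (elim conjE) (rule symmetrized_Lam_in_Dsp[OF _ l0 l1])
next
  case (2 \<tau>s Es f)
  then show ?case by (elim conjE) (rule eigenvalue_continuation[OF _ l0 l1])
qed

end
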